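(* Let $w$ satisfy Assumption A, let $\rho\in\mathcal D_{\rm per}$, and for each $\varepsilon>0$ let $v_\varepsilon(\rho)\in\mathrm H^{-1}_{\rm per}(I)$ be any potential such that $\min\{F^\varepsilon_{\rm per}(\zeta)-n\langle v_\varepsilon(\rho),\zeta\rangle:\sqrt\zeta\in\mathrm H^1_{\rm per}(I),\ \int_I\zeta=1\}=F^\varepsilon_{\rm per}(\rho)-n\langle v_\varepsilon(\rho),\rho\rangle.$ Then there exist constants $C_\varepsilon\in\mathbb R$ and a sequence $\varepsilon_k\downarrow0$ such that $v_{\varepsilon_k}(\rho)+C_{\varepsilon_k}\rightharpoonup v_{\rm OT}(\rho)$ weakly in $\mathrm H^{-1}_{\rm per}(I)$, where $v_{\rm OT}(\rho)$ is a regular Kantorovich potential for $F_{\rm OT}(\rho)$. Moreover, if $w$ is $C^1$ on $\{(x,y)\in I\times I:|x-y|_{\mathbb T}>0\}$, then the regular Kantorovich potential $v_{\rm OT}(\rho)$ is unique and $v_\varepsilon(\rho)+C_\varepsilon\rightharpoonup v_{\rm OT}(\rho)$ as $\varepsilon\downarrow0$ without passing to a subsequence.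
   Context: $I=[0,2\pi]$, $I_n=I^n$, $|t|_{\mathbb T}=\min\{|t-k|:k\in2\pi\mathbb Z\}$. Assumption A: $w:I\times I\to[0,+\infty]$ symmetric, continuous (for the topology of $[0,+\infty]$), with $\{w=\infty\}=\{(x,y):|x-y|_{\mathbb T}=0\}$. $c_n(x)=\sum_{i\ne j}w(x_i,x_j)$; $F_{\rm OT}(\rho)=\min\{\int_{I_n}c_n\,d\gamma:\gamma\in\mathcal P(I_n),\text{ all marginals }=\rho\}$. $\mathrm H^1_{\rm per}(I)$: restrictions to $I$ of $2\pi$-periodic $\mathrm H^1_{\rm loc}(\mathbb R)$ functions; $\mathrm H^{-1}_{\rm per}(I)$ its dual, $\langle\cdot,\cdot\rangle$ the duality pairing. $\mathcal D_{\rm per}=\{\rho\in\mathrm H^1_{\rm per}(I):\rho(x)>0\ \forall x\in I,\ \int_I\rho=1\}$. $F^\varepsilon_{\rm per}(\rho)=\inf\{\sum_k\lambda_k\int_{I_n}(\varepsilon|\nabla\Psi_k|^2+c_n|\Psi_k|^2)\}$ over orthonormal $\Psi_k\in\wedge^n\mathrm L^2(I)\cap\mathrm H^1_{\rm per}(I_n)$, $\lambda_k\ge0$, $\sum\lambda_k=1$, $\sum_k\lambda_k\rho_{\Psi_k}=n\rho$, where $\rho_\Psi(x)=n\int|\Psi(x,x_2,\dots,x_n)|^2dx_2\cdots dx_n$ and $\mathrm H^1_{\rm per}(I_n)$ is periodic $\mathrm H^1$ on $I_n$. Kantorovich potential: a $\rho$-integrable $v:I\to\mathbb R$ with $F_{\rm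 OT}(\rho)=n\int_I\rho v$ and $c_n(x_1,\dots,x_n)-\sum_{j=1}^nv(x_j)\ge0$ for every $(x_1,\dots,x_n)\in I_n$; it is regular if continuous (a continuous function is viewed as an element of $\mathrm H^{-1}_{\rm per}(I)$). *)

theory Defs
  imports "HOL-Probability.Probability" "HOL-Combinatorics.Permutations"
begin

definition Iper :: "real set" where
  "Iper = {0 .. 2 * pi}"

definition distT :: "real \<Rightarrow> real" where
  "distT t = Inf {\<bar>t - 2 * pi * real_of_int k\<bar> | k. True}"

definition assumptionA :: "(real \<times> real \<Rightarrow> ennreal) \<Rightarrow> bool" where
  "assumptionA w \<longleftrightarrow>
     (\<forall>x\<in>Iper. \<forall>y\<in>Iper. w (x, y) = w (y, x)) \<and>
     continuous_on (Iper \<times> Iper) w \<and>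
     {p \<in> Iper \<times> Iper. w p = \<infinity>} = {(x, y) \<in> Iper \<times> Iper. distT (x - y) = 0}"

definition offdiag :: "(real \<times> real) set" where
  "offdiag = {(x, y) \<in> Iper \<times> Iper. distT (x - y) > 0}"

definition C1_offdiag :: "(real \<times> real \<Rightarrow> ennreal) \<Rightarrow> bool" where
  "C1_offdiag w \<longleftrightarrow>
     (\<exists>D :: real \<times> real \<Rightarrow> ((real \<times> real) \<Rightarrow>\<^sub>L real).
        continuous_on offdiag D \<and>
        (\<forall>p\<in>offdiag. ((\<lambda>q. enn2real (w q)) has_derivative blinfun_apply (D p)) (at p within offdiag)))"

definition trig1 :: "int \<Rightarrow> real \<Rightarrow> complex" where
  "trig1 m t = cis (real_of_int m * t)"

text \<open>g is the periodic weak derivative of f on I (test functions: trigonometric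
  polynomials, i.e. smooth 2 pi-periodic functions up to density).\<close>
definition wderiv1 :: "(real \<Rightarrow> complex) \<Rightarrow> (real \<Rightarrow> complex) \<Rightarrow> bool" where
  "wderiv1 f g \<longleftrightarrow>
     f \<in> borel_measurable (lebesgue_on Iper) \<and> g \<in> borel_measurable (lebesgue_on Iper) \<and>
     integrable (lebesgue_on Iper) (\<lambda>t. (cmod (f t))\<^sup>2) \<and>
     integrable (lebesgue_on Iper) (\<lambda>t. (cmod (g t))\<^sup>2) \<and>
     (\<forall>m::int. (\<integral>t. f t * (\<i> * of_int m * trig1 m t) \<partial>lebesgue_on Iper)
                = - (\<integral>t. g t * trig1 m t \<partial>lebesgue_on Iper))"

definition H1per :: "(real \<Rightarrow> real) \<Rightarrow> bool" where
  "H1per f \<longleftrightarrow> (\<exists>g. wderiv1 (\<lambda>t. complex_of_real (f t)) g)"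

definition Hminus :: "((real \<Rightarrow> real) \<Rightarrow> real) \<Rightarrow> bool" where
  "Hminus v \<longleftrightarrow>
     (\<forall>f h a b. H1per f \<longrightarrow> H1per h \<longrightarrow> v (\<lambda>t. a * f t + b * h t) = a * v f + b * v h) \<and>
     (\<exists>B. \<forall>f g. wderiv1 (\<lambda>t. complex_of_real (f t)) g \<longrightarrow>
          \<bar>v f\<bar> \<le> B * sqrt ((\<integral>t. (f t)\<^sup>2 \<partial>lebesgue_on Iper) + (\<integral>t. (cmod (g t))\<^sup>2 \<partial>lebesgue_on Iper)))"

text \<open>The set D_per (continuous representative of rho).\<close>
definition Dper :: "(real \<Rightarrow> real) \<Rightarrow> bool" where
  "Dper \<rho> \<longleftrightarrow> H1per \<rho> \<and> continuous_on Iper \<rho> \<and> (\<forall>x\<in>Iper. \<rho> x > 0) \<and>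
     (\<integral>t. \<rho> t \<partial>lebesgue_on Iper) = 1"

definition adm :: "(real \<Rightarrow> real) \<Rightarrow> bool" where
  "adm \<zeta> \<longleftrightarrow> (\<forall>x\<in>Iper. 0 \<le> \<zeta> x) \<and> H1per (\<lambda>t. sqrt (\<zeta> t)) \<and>
     (\<integral>t. \<zeta> t \<partial>lebesgue_on Iper) = 1"

definition muN :: "nat \<Rightarrow> (nat \<Rightarrow> real) measure" where
  "muN n = PiM {..<n} (\<lambda>_. lebesgue_on Iper)"

definition cN :: "nat \<Rightarrow> (real \<times> real \<Rightarrow> ennreal) \<Rightarrow> (nat \<Rightarrow> real) \<Rightarrow> ennreal" where
  "cN n w x = (\<Sum>i\<in>{..<n}. \<Sum>j\<in>{..<n} - {i}. w (x i, x j))"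

definition trigN :: "nat \<Rightarrow> (nat \<Rightarrow> int) \<Rightarrow> (nat \<Rightarrow> real) \<Rightarrow> complex" where
  "trigN n m x = cis (\<Sum>j<n. real_of_int (m j) * x j)"

definition wgradN :: "nat \<Rightarrow> ((nat \<Rightarrow> real) \<Rightarrow> complex) \<Rightarrow> (nat \<Rightarrow> (nat \<Rightarrow> real) \<Rightarrow> complex) \<Rightarrow> bool" where
  "wgradN n \<Psi> G \<longleftrightarrow>
     \<Psi> \<in> borel_measurable (muN n) \<and> integrable (muN n) (\<lambda>x. (cmod (\<Psi> x))\<^sup>2) \<and>
     (\<forall>j<n. G j \<in> borel_measurable (muN n) \<and> integrable (muN n) (\<lambda>x. (cmod (G j x))\<^sup>2) \<and>
        (\<forall>m::nat \<Rightarrow> int. (\<integral>x. \<Psi> x * (\<i> * of_int (m j) * trigN n m x) \<partial>muN n)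
                = - (\<integral>x. G j x * trigN n m x \<partial>muN n)))"

definition antisymN :: "nat \<Rightarrow> ((nat \<Rightarrow> real) \<Rightarrow> complex) \<Rightarrow> bool" where
  "antisymN n \<Psi> \<longleftrightarrow>
     (\<forall>\<sigma>. \<sigma> permutes {..<n} \<longrightarrow>
        (AE x in muN n. \<Psi> (x \<circ> \<sigma>) = of_int (sign \<sigma>) * \<Psi> x))"

definition innerN :: "nat \<Rightarrow> ((nat \<Rightarrow> real) \<Rightarrow> complex) \<Rightarrow> ((nat \<Rightarrow> real) \<Rightarrow> complex) \<Rightarrow> complex" where
  "innerN n \<Psi> \<Phi> = (\<integral>x. cnj (\<Psi> x) * \<Phi> x \<partial>muN n)"

text \<open>rho_Psi(t) = n * integral of |Psi(t, x_2, ..., x_n)|^2 (first variable is index 0).\<close>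
definition densN :: "nat \<Rightarrow> ((nat \<Rightarrow> real) \<Rightarrow> complex) \<Rightarrow> real \<Rightarrow> ennreal" where
  "densN n \<Psi> t = ennreal (real n) *
     (\<integral>\<^sup>+ y. ennreal ((cmod (\<Psi> (y(0 := t))))\<^sup>2) \<partial>PiM {1..<n} (\<lambda>_. lebesgue_on Iper))"

definition energyN :: "nat \<Rightarrow> (real \<times> real \<Rightarrow> ennreal) \<Rightarrow> real \<Rightarrow> ((nat \<Rightarrow> real) \<Rightarrow> complex)
    \<Rightarrow> (nat \<Rightarrow> (nat \<Rightarrow> real) \<Rightarrow> complex) \<Rightarrow> ennreal" where
  "energyN n w \<epsilon> \<Psi> G =
     (\<integral>\<^sup>+ x. ennreal (\<epsilon> * (\<Sum>j<n. (cmod (G j x))\<^sup>2)) + cN n w x * ennreal ((cmod (\<Psi> x))\<^sup>2) \<partial>muN n)"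

definition mixed :: "nat \<Rightarrow> (real \<Rightarrow> real) \<Rightarrow> (nat \<Rightarrow> real) \<Rightarrow> (nat \<Rightarrow> (nat \<Rightarrow> real) \<Rightarrow> complex)
    \<Rightarrow> (nat \<Rightarrow> nat \<Rightarrow> (nat \<Rightarrow> real) \<Rightarrow> complex) \<Rightarrow> bool" where
  "mixed n \<rho> lam \<Psi> G \<longleftrightarrow>
     (\<forall>k. 0 \<le> lam k) \<and> lam sums 1 \<and>
     (\<forall>k. antisymN n (\<Psi> k) \<and> wgradN n (\<Psi> k) (G k)) \<and>
     (\<forall>k l. innerN n (\<Psi> k) (\<Psi> l) = (if k = l then 1 else 0)) \<and>
     (AE t in lebesgue_on Iper. (\<Sum>k. ennreal (lam k) * densN n (\<Psi> k) t) = ennreal (real n * \<rho> t))"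

definition Feps :: "nat \<Rightarrow> (real \<times> real \<Rightarrow> ennreal) \<Rightarrow> real \<Rightarrow> (real \<Rightarrow> real) \<Rightarrow> ennreal" where
  "Feps n w \<epsilon> \<rho> =
     (INF s \<in> {(lam, \<Psi>, G). mixed n \<rho> lam \<Psi> G}.
        (case s of (lam, \<Psi>, G) \<Rightarrow> (\<Sum>k. ennreal (lam k) * energyN n w \<epsilon> (\<Psi> k) (G k))))"

definition coupling :: "nat \<Rightarrow> (real \<Rightarrow> real) \<Rightarrow> (nat \<Rightarrow> real) measure \<Rightarrow> bool" where
  "coupling n \<rho> \<gamma> \<longleftrightarrow>
     sets \<gamma> = sets (PiM {..<n} (\<lambda>_. restrict_space lborel Iper)) \<and> prob_space \<gamma> \<and>
     (\<forall>j<n. distr \<gamma> (restrict_space lborel Iper) (\<lambda>x. x j)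
             = density (restrict_space lborel Iper) (\<lambda>t. ennreal (\<rho> t)))"

definition FOT :: "nat \<Rightarrow> (real \<times> real \<Rightarrow> ennreal) \<Rightarrow> (real \<Rightarrow> real) \<Rightarrow> ennreal" where
  "FOT n w \<rho> = (INF \<gamma> \<in> {\<gamma>. coupling n \<rho> \<gamma>}. \<integral>\<^sup>+ x. cN n w x \<partial>\<gamma>)"

definition kantorovich_pot :: "nat \<Rightarrow> (real \<times> real \<Rightarrow> ennreal) \<Rightarrow> (real \<Rightarrow> real) \<Rightarrow> (real \<Rightarrow> real) \<Rightarrow> bool" where
  "kantorovich_pot n w \<rho> v \<longleftrightarrow>
     integrable (lebesgue_on Iper) (\<lambda>t. \<rho> t * v t) \<and>
     enn2ereal (FOT n w \<rho>) = ereal (real n * (\<integral>t. \<rho> t * v t \<partial>lebesgue_on Iper)) \<and>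
     (\<forall>x\<in>PiE {..<n} (\<lambda>_. Iper). 0 \<le> enn2ereal (cN n w x) - ereal (\<Sum>j<n. v (x j)))"

definition regular_kantorovich_pot :: "nat \<Rightarrow> (real \<times> real \<Rightarrow> ennreal) \<Rightarrow> (real \<Rightarrow> real) \<Rightarrow> (real \<Rightarrow> real) \<Rightarrow> bool" where
  "regular_kantorovich_pot n w \<rho> v \<longleftrightarrow> kantorovich_pot n w \<rho> v \<and> continuous_on Iper v"

end

theory Submission
  imports Defs "HOL-Complex_Analysis.Great_Picard"
begin

text \<open>
Normalise the potential by a constant so that n V(rho) is the quantum energy of rho. For disjointly supported
orbitals with squares f_1, ..., f_n, multiplying each orbital by phases running through its mass coordinate gives
infinitely many orthonormal Slater determinants with the same density, so mixed states realise the density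
(f_1 + ... + f_n) / n with energy at most epsilon times a kinetic term plus the maximal cost on the product of the
supports. Minimality therefore bounds V(f_1) + ... + V(f_n) from above. A density comparable to rho can be cut into
windows of equal mass that are grouped into such families, and since V(rho) is nonnegative this yields a bound on
the normalised potentials in the dual norm that is uniform in epsilon, and hence a weak limit V.

For the limit the kinetic term disappears, and testing with narrow bumps shows that the upper envelope of V is
feasible in the dual transport problem. Averaging a feasible potential repeatedly with its c-transform increases it
to a feasible u that is its own c-transform; u inherits continuity from the cost away from the diagonal, and V is
dominated by integration against u. The quantum energy dominates the transport cost, so n V(rho) is at least the
transport cost, which by weak duality is at least n times the integral of rho u. Since rho is strictly positive,
equality at rho forces V to be integration against u, and u is a Kantorovich potential.

If the cost is differentiable off the diagonal, any two potentials are touched from above by the same smooth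
functions, so their difference is constant, and the constant is zero because the values agree. Convergence of the
whole family then follows from uniqueness of the limit along subsequences.
\<close>

section \<open>Smooth periodic functions and their weak derivatives\<close>

abbreviation Lper :: "real measure" where "Lper \<equiv> lebesgue_on Iper"

lemma Iper_sets [simp, measurable]: "Iper \<in> sets lebesgue" "Iper \<in> sets borel" "Iper \<in> sets lborel"
  by (auto simp: Iper_def)

lemma compact_Iper: "compact Iper" by (simp add: Iper_def)

lemma Iper_nonempty: "Iper \<noteq> {}" by (simp add: Iper_def)

lemma finite_measure_Lper: "finite_measure Lper"
  by (rule finite_measure_lebesgue_on) (simp add: Iper_def)

lemma measure_Lper: "measure Lper Iper = 2 * pi"
  by (simp add: measure_def Iper_def emeasure_restrict_space)

lemma integral_Lper_const: "(\<integral>t. c \<partial>Lper) = (2 * pi) * (c::real)"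
  by (simp add: measure_Lper)

lemma integrable_Lper_const: "integrable Lper (\<lambda>t. c :: 'b :: {banach, second_countable_topology})"
  by (rule finite_measure.integrable_const[OF finite_measure_Lper])

lemma integrable_Lper_cont:
  fixes f :: "real \<Rightarrow> 'b::euclidean_space"
  assumes "continuous_on Iper f" shows "integrable Lper f"
  using assms unfolding Iper_def by (rule continuous_imp_integrable_real)

lemma integral_Lper_HK:
  fixes f :: "real \<Rightarrow> 'b::euclidean_space"
  assumes "continuous_on Iper f" shows "integral\<^sup>L Lper f = integral Iper f"
  by (rule lebesgue_integral_eq_integral[OF integrable_Lper_cont[OF assms]]) simp

lemma measurable_Lper_cont:
  fixes f :: "real \<Rightarrow> 'b::euclidean_space"
  assumes "continuous_on Iper f" shows "f \<in> borel_measurable Lper"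
  using integrable_Lper_cont[OF assms] by auto

lemma continuous_on_Iper_bounded:
  assumes "continuous_on Iper (u :: real \<Rightarrow> real)"
  obtains B where "0 \<le> B" "\<And>t. t \<in> Iper \<Longrightarrow> \<bar>u t\<bar> \<le> B"
proof -
  have "bounded (u ` Iper)" using compact_imp_bounded[OF compact_continuous_image[OF assms compact_Iper]] .
  then obtain B where "\<And>t. t \<in> Iper \<Longrightarrow> \<bar>u t\<bar> \<le> B" by (auto simp: bounded_iff)
  then show ?thesis using that[of "max B 0"] by (auto simp: le_max_iff_disj)
qed

lemma integral_Lper_eq_0_iff:
  fixes f :: "real \<Rightarrow> real"
  assumes "continuous_on Iper f" "\<And>t. t \<in> Iper \<Longrightarrow> 0 \<le> f t"
  shows "(\<integral>t. f t \<partial>Lper) = 0 \<longleftrightarrow> (\<forall>t\<in>Iper. f t = 0)"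
  using integralL_eq_0_iff[of 0 "2 * pi" f] assms by (simp add: Iper_def)

lemma integral_Lper_pos:
  fixes f :: "real \<Rightarrow> real"
  assumes "continuous_on Iper f" "\<And>t. t \<in> Iper \<Longrightarrow> 0 \<le> f t" "s \<in> Iper" "0 < f s"
  shows "0 < (\<integral>t. f t \<partial>Lper)"
proof -
  have "0 \<le> (\<integral>t. f t \<partial>Lper)" using assms(2) by (intro integral_nonneg_AE AE_I2) simp
  moreover have "(\<integral>t. f t \<partial>Lper) \<noteq> 0" using integral_Lper_eq_0_iff[OF assms(1,2)] assms(3,4) by auto
  ultimately show ?thesis by simp
qed

lemma integral_Lper_FTC:
  fixes f :: "real \<Rightarrow> 'b::euclidean_space"
  assumes "\<And>t. (f has_vector_derivative f' t) (at t)" "continuous_on UNIV f'"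
  shows "integral\<^sup>L Lper f' = f (2 * pi) - f 0"
proof -
  have "(f' has_integral (f (2 * pi) - f 0)) {0..2*pi}"
    by (rule fundamental_theorem_of_calculus)
      (auto intro: has_vector_derivative_at_within assms)
  then have "integral Iper f' = f (2*pi) - f 0" unfolding Iper_def by (rule integral_unique)
  then show ?thesis
    using integral_Lper_HK[of f'] assms(2) continuous_on_subset by (metis subset_UNIV)
qed

definition C1per :: "(real \<Rightarrow> real) \<Rightarrow> (real \<Rightarrow> real) \<Rightarrow> bool" where
  "C1per f f' \<longleftrightarrow> (\<forall>t. (f has_real_derivative f' t) (at t)) \<and> continuous_on UNIV f' \<and>
     (\<forall>t. f (t + 2 * pi) = f t)"

lemma C1per_periodic: "C1per f f' \<Longrightarrow> f (t + 2 * pi) = f t"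
  unfolding C1per_def by blast

lemma C1per_cont: assumes "C1per f f'" shows "continuous_on A f" "continuous_on A f'"
proof -
  have "continuous_on UNIV f" using assms unfolding C1per_def
    by (meson DERIV_isCont continuous_at_imp_continuous_on)
  then show "continuous_on A f" using continuous_on_subset by blast
  show "continuous_on A f'" using assms unfolding C1per_def using continuous_on_subset by blast
qed

lemma C1per_lin: assumes "C1per f f'" "C1per h h'"
  shows "C1per (\<lambda>t. a * f t + b * h t) (\<lambda>t. a * f' t + b * h' t)"
  using assms unfolding C1per_def
  by (auto intro!: derivative_eq_intros continuous_intros)

lemma C1per_cmult: "C1per f f' \<Longrightarrow> C1per (\<lambda>t. c * f t) (\<lambda>t. c * f' t)"
  using C1per_lin[of f f' f f' c 0] by simp

lemma C1per_add: "C1per f f' \<Longrightarrow> C1per h h' \<Longrightarrow> C1per (\<lambda>t. f t + h t) (\<lambda>t. f' t + h' t)"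
  using C1per_lin[of f f' h h' 1 1] by simp

lemma C1per_diff: "C1per f f' \<Longrightarrow> C1per h h' \<Longrightarrow> C1per (\<lambda>t. f t - h t) (\<lambda>t. f' t - h' t)"
  using C1per_lin[of f f' h h' 1 "-1"] by simp

lemma C1per_mult: assumes "C1per f f'" "C1per h h'"
  shows "C1per (\<lambda>t. f t * h t) (\<lambda>t. f' t * h t + f t * h' t)"
proof -
  have "continuous_on UNIV f" "continuous_on UNIV h" using assms C1per_cont by blast+
  then show ?thesis
    using assms unfolding C1per_def
    by (auto intro!: derivative_eq_intros continuous_intros)
qed

lemma C1per_sq: "C1per f f' \<Longrightarrow> C1per (\<lambda>t. (f t)\<^sup>2) (\<lambda>t. 2 * f t * f' t)"
  using C1per_mult[of f f' f f'] by (simp add: power2_eq_square algebra_simps)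

lemma C1per_compose:
  assumes "C1per f f'" "\<And>t. (\<phi> has_real_derivative \<phi>' (f t)) (at (f t))"
    "continuous_on (range f) \<phi>'"
  shows "C1per (\<lambda>t. \<phi> (f t)) (\<lambda>t. \<phi>' (f t) * f' t)"
  unfolding C1per_def
proof (intro conjI allI)
  fix t show "((\<lambda>t. \<phi> (f t)) has_real_derivative \<phi>' (f t) * f' t) (at t)"
    by (rule DERIV_chain2[where g=f]) (use assms in \<open>auto simp: C1per_def\<close>)
  show "\<phi> (f (t + 2 * pi)) = \<phi> (f t)" using assms(1) by (simp add: C1per_def)
next
  show "continuous_on UNIV (\<lambda>t. \<phi>' (f t) * f' t)"
    using C1per_cont[OF assms(1)] assms(3)
    by (intro continuous_on_mult continuous_on_compose2[OF assms(3)]) auto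
qed

lemma C1per_sqrt:
  assumes "C1per f f'" "\<And>t. 0 < f t" shows "C1per (\<lambda>t. sqrt (f t)) (\<lambda>t. (inverse (sqrt (f t)) / 2) * f' t)"
proof (rule C1per_compose[OF assms(1), of sqrt "\<lambda>y. inverse (sqrt y) / 2"])
  show "(sqrt has_real_derivative inverse (sqrt (f t)) / 2) (at (f t))" for t
    by (rule DERIV_real_sqrt[OF assms(2)])
  show "continuous_on (range f) (\<lambda>y. inverse (sqrt y) / 2)"
    using assms(2) by (intro continuous_intros) (auto simp: less_imp_neq[symmetric])
qed

lemma C1per_inverse:
  assumes "C1per f f'" "\<And>t. f t \<noteq> 0"
  shows "C1per (\<lambda>t. inverse (f t)) (\<lambda>t. - (inverse (f t) ^ Suc (Suc 0)) * f' t)"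
proof (rule C1per_compose[OF assms(1), of inverse "\<lambda>y. - (inverse y ^ Suc (Suc 0))"])
  show "(inverse has_real_derivative - (inverse (f t) ^ Suc (Suc 0))) (at (f t))" for t
    by (rule DERIV_inverse[OF assms(2)])
  show "continuous_on (range f) (\<lambda>y. - (inverse y ^ Suc (Suc 0)))"
    using assms(2) by (intro continuous_intros) auto
qed

lemma C1per_const: "C1per (\<lambda>t. c) (\<lambda>t. 0)"
  by (auto simp: C1per_def)

lemma C1per_sum:
  assumes "finite A" "\<And>i. i \<in> A \<Longrightarrow> C1per (f i) (f' i)"
  shows "C1per (\<lambda>t. \<Sum>i\<in>A. f i t) (\<lambda>t. \<Sum>i\<in>A. f' i t)"
  using assms by (induction rule: finite_induct) (auto intro!: C1per_const C1per_add)

lemma C1per_shift: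
  assumes "C1per f f'" shows "C1per (\<lambda>t. f (t - a)) (\<lambda>t. f' (t - a))"
  unfolding C1per_def
proof (intro conjI allI)
  fix t
  have "((\<lambda>t. f (t - a)) has_real_derivative f' (t - a) * 1) (at t)"
    by (rule DERIV_chain2[where f=f]) (use assms in \<open>auto simp: C1per_def intro!: derivative_eq_intros\<close>)
  then show "((\<lambda>t. f (t - a)) has_real_derivative f' (t - a)) (at t)" by simp
  show "continuous_on UNIV (\<lambda>t. f' (t - a))"
    by (rule continuous_on_compose2[OF C1per_cont(2)[OF assms, of UNIV]]) (auto intro!: continuous_intros)
  show "f (t + 2 * pi - a) = f (t - a)"
    using C1per_periodic[OF assms, of "t - a"] by (simp add: algebra_simps)
qed

lemma C1per_deriv_periodic:
  assumes "C1per f f'" shows "f' (t + 2 * pi) = f' t"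
proof -
  have "((\<lambda>t. f (t + 2 * pi)) has_real_derivative f' (t + 2 * pi) * 1) (at t)"
    by (rule DERIV_chain2[where f=f]) (use assms in \<open>auto simp: C1per_def intro!: derivative_eq_intros\<close>)
  then have "(f has_real_derivative f' (t + 2 * pi)) (at t)" using assms by (simp add: C1per_def)
  moreover have "(f has_real_derivative f' t) (at t)" using assms by (simp add: C1per_def)
  ultimately show ?thesis by (rule DERIV_unique)
qed

lemma periodic_int:
  fixes f :: "real \<Rightarrow> 'a"
  assumes "\<And>t. f (t + 2 * pi) = f t"
  shows "f (t + 2 * pi * of_int k) = f t"
proof -
  have nat: "f (t + 2 * pi * real m) = f t" for m :: nat and t
  proof (induction m)
    case (Suc m)
    have "t + 2 * pi * real (Suc m) = (t + 2 * pi * real m) + 2 * pi" by (simp add: algebra_simps)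
    then show ?case using assms[of "t + 2 * pi * real m"] Suc by metis
  qed simp
  show ?thesis
  proof (cases "k \<ge> 0")
    case True then show ?thesis using nat[of t "nat k"] by simp
  next
    case False
    then show ?thesis using nat[of "t + 2 * pi * of_int k" "nat (- k)"] by simp
  qed
qed

lemma translate_into_Iper: "\<exists>k::int. t + 2 * pi * of_int k \<in> Iper"
proof -
  define k where "k = \<lfloor>t / (2 * pi)\<rfloor>"
  have "of_int k \<le> t / (2 * pi)" "t / (2 * pi) < of_int k + 1" unfolding k_def by linarith+
  then have "of_int k * (2 * pi) \<le> t" "t < (of_int k + 1) * (2 * pi)"
    by (simp_all only: pos_le_divide_eq pos_divide_less_eq pi_gt_zero zero_less_mult_iff zero_less_numeral simp_thms)
  then have "t + 2 * pi * of_int (- k) \<in> Iper" by (auto simp: Iper_def algebra_simps)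
  then show ?thesis by blast
qed

lemma periodic_all_of_Iper:
  assumes "\<And>t. f (t + 2 * pi) = f t" "\<And>t. t \<in> Iper \<Longrightarrow> P (f t)" shows "P (f t)"
proof -
  obtain k :: int where k: "t + 2 * pi * of_int k \<in> Iper" using translate_into_Iper by blast
  have "f (t + 2 * pi * of_int k) = f t" using periodic_int[of f t k] assms(1) by blast
  then show ?thesis using assms(2)[OF k] by simp
qed

lemma periodic_bounded:
  assumes "continuous_on UNIV f" "\<And>t. f (t + 2 * pi) = (f t :: real)"
  obtains B where "0 \<le> B" "\<And>t. \<bar>f t\<bar> \<le> B"
proof -
  obtain B where B: "0 \<le> B" "\<And>t. t \<in> Iper \<Longrightarrow> \<bar>f t\<bar> \<le> B"
    using continuous_on_Iper_bounded[OF continuous_on_subset[OF assms(1)]] by blast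
  show ?thesis using that[OF B(1) periodic_all_of_Iper[of f "\<lambda>y. \<bar>y\<bar> \<le> B", OF assms(2) B(2)]] .
qed

lemma C1per_bounded:
  assumes "C1per f f'"
  obtains B where "0 \<le> B" "\<And>t. \<bar>f t\<bar> \<le> B" "\<And>t. \<bar>f' t\<bar> \<le> B"
proof -
  obtain B1 where B1: "0 \<le> B1" "\<And>t. \<bar>f t\<bar> \<le> B1"
    using periodic_bounded[OF C1per_cont(1)[OF assms] C1per_periodic[OF assms]] by blast
  obtain B2 where B2: "0 \<le> B2" "\<And>t. \<bar>f' t\<bar> \<le> B2"
    using periodic_bounded[OF C1per_cont(2)[OF assms] C1per_deriv_periodic[OF assms]] by blast
  show ?thesis by (rule that[of "max B1 B2"]) (use B1 B2 in \<open>auto simp: le_max_iff_disj\<close>)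
qed

lemma trig1_has_vector_derivative: "((\<lambda>t. trig1 m t) has_vector_derivative \<i> * of_int m * trig1 m t) (at t)"
proof -
  have "((\<lambda>t. exp (\<i> * of_int m * of_real t)) has_vector_derivative
     (1 * (\<i> * of_int m)) * exp (\<i> * of_int m * of_real t)) (at t)"
    by (rule has_vector_derivative_real_field)
       (auto intro!: derivative_eq_intros)
  then show ?thesis
    by (simp add: trig1_def cis_conv_exp mult_ac)
qed

lemma trig1_cont: "continuous_on A (trig1 m)"
  unfolding trig1_def by (intro continuous_intros)

lemma trig1_periodic: "trig1 m (t + 2 * pi) = trig1 m t"
  using cis_multiple_2pi[of "real_of_int m"]
  by (simp add: trig1_def distrib_left cis_mult[symmetric] mult_ac)

lemma trig1_mult: "trig1 m t * trig1 k t = trig1 (m + k) t"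
  by (simp add: trig1_def cis_mult algebra_simps)

lemma trig1_cnj: "cnj (trig1 m t) = trig1 (- m) t"
  by (simp add: trig1_def cis_cnj)

lemma trig1_orthogonal: "(\<integral>t. trig1 m t \<partial>Lper) = (if m = 0 then 2 * pi else 0)"
proof (cases "m = 0")
  case True then show ?thesis by (simp add: trig1_def measure_Lper scaleR_conv_of_real)
next
  case False
  have "integral\<^sup>L Lper (\<lambda>t. \<i> * of_int m * trig1 m t) = trig1 m (2*pi) - trig1 m 0"
    by (rule integral_Lper_FTC) (auto intro!: trig1_has_vector_derivative continuous_intros trig1_cont)
  also have "\<dots> = 0" using trig1_periodic[of m 0] by simp
  finally show ?thesis using False by simp
qed

lemma wderiv1_of_C1:
  fixes f f' :: "real \<Rightarrow> complex"
  assumes "\<And>t. (f has_vector_derivative f' t) (at t)" "continuous_on UNIV f'"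
    "f (2 * pi) = f 0"
  shows "wderiv1 f f'"
proof -
  have cf: "continuous_on UNIV f"
    using assms(1) by (meson continuous_at_imp_continuous_on has_vector_derivative_continuous)
  have cfI: "continuous_on Iper f" "continuous_on Iper f'"
    using cf assms(2) continuous_on_subset by blast+
  show ?thesis unfolding wderiv1_def
  proof (intro conjI allI)
    show "f \<in> borel_measurable Lper" "f' \<in> borel_measurable Lper"
      using cfI by (auto intro: measurable_Lper_cont)
    show "integrable Lper (\<lambda>t. (cmod (f t))\<^sup>2)" "integrable Lper (\<lambda>t. (cmod (f' t))\<^sup>2)"
      using cfI by (auto intro!: integrable_Lper_cont continuous_intros)
    fix m
    have "integral\<^sup>L Lper (\<lambda>t. f t * (\<i> * of_int m * trig1 m t) + f' t * trig1 m t)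
       = f (2*pi) * trig1 m (2*pi) - f 0 * trig1 m 0"
      by (rule integral_Lper_FTC)
        (auto intro!: derivative_eq_intros assms trig1_has_vector_derivative continuous_intros trig1_cont cf)
    also have "\<dots> = 0" using trig1_periodic[of m 0] assms(3) by simp
    also have "integral\<^sup>L Lper (\<lambda>t. f t * (\<i> * of_int m * trig1 m t) + f' t * trig1 m t)
      = integral\<^sup>L Lper (\<lambda>t. f t * (\<i> * of_int m * trig1 m t)) + integral\<^sup>L Lper (\<lambda>t. f' t * trig1 m t)"
      by (intro Bochner_Integration.integral_add integrable_Lper_cont continuous_intros cfI trig1_cont)
    finally show "(\<integral>t. f t * (\<i> * of_int m * trig1 m t) \<partial>Lper) = - (\<integral>t. f' t * trig1 m t \<partial>Lper)"
      by (simp add: eq_neg_iff_add_eq_0)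
  qed
qed

lemma C1per_has_complex_derivative:
  assumes "C1per f f'"
  shows "((\<lambda>t. complex_of_real (f t)) has_vector_derivative complex_of_real (f' t)) (at t)"
  using assms unfolding C1per_def
  by (intro has_vector_derivative_of_real) (auto simp: has_real_derivative_iff_has_vector_derivative)

lemma C1per_wderiv1:
  assumes "C1per f f'"
  shows "wderiv1 (\<lambda>t. complex_of_real (f t)) (\<lambda>t. complex_of_real (f' t))"
  by (rule wderiv1_of_C1[OF C1per_has_complex_derivative[OF assms]])
    (use C1per_cont(2)[OF assms] C1per_periodic[OF assms, of 0] in \<open>auto intro: continuous_intros\<close>)

lemma C1per_H1per: "C1per f f' \<Longrightarrow> H1per f"
  using C1per_wderiv1 unfolding H1per_def by blast

lemma H1per_const: "H1per (\<lambda>t. c)"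
  by (rule C1per_H1per[OF C1per_const])

lemma wderiv1_cong:
  assumes "wderiv1 f g" "\<And>t. t \<in> Iper \<Longrightarrow> f t = f2 t" "\<And>t. t \<in> Iper \<Longrightarrow> g t = g2 t"
  shows "wderiv1 f2 g2"
proof -
  have "f \<in> borel_measurable Lper \<longleftrightarrow> f2 \<in> borel_measurable Lper" "g \<in> borel_measurable Lper \<longleftrightarrow> g2 \<in> borel_measurable Lper"
    using assms(2,3) by (auto intro!: measurable_cong)
  moreover have "integrable Lper (\<lambda>t. (cmod (f t))\<^sup>2) \<longleftrightarrow> integrable Lper (\<lambda>t. (cmod (f2 t))\<^sup>2)"
    "integrable Lper (\<lambda>t. (cmod (g t))\<^sup>2) \<longleftrightarrow> integrable Lper (\<lambda>t. (cmod (g2 t))\<^sup>2)"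
    using assms(2,3) by (auto intro!: Bochner_Integration.integrable_cong)
  moreover have "(\<integral>t. f t * c t \<partial>Lper) = (\<integral>t. f2 t * c t \<partial>Lper)" "(\<integral>t. g t * c t \<partial>Lper) = (\<integral>t. g2 t * c t \<partial>Lper)" for c
    using assms(2,3) by (auto intro!: Bochner_Integration.integral_cong)
  ultimately show ?thesis using assms(1) unfolding wderiv1_def by simp
qed

definition h1_sqnorm :: "(real \<Rightarrow> real) \<Rightarrow> (real \<Rightarrow> real) \<Rightarrow> real" where
  "h1_sqnorm f g = (\<integral>t. (f t)\<^sup>2 \<partial>Lper) + (\<integral>t. (g t)\<^sup>2 \<partial>Lper)"

lemma h1_sqnorm_nonneg: "0 \<le> h1_sqnorm f g"
  by (simp add: h1_sqnorm_def)

lemma h1_sqnorm_cmult: "h1_sqnorm (\<lambda>t. c * f t) (\<lambda>t. c * g t) = c\<^sup>2 * h1_sqnorm f g"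
  by (simp add: h1_sqnorm_def power_mult_distrib distrib_left)

lemma L2_le_h1_sqnorm: "(\<integral>t. (f t)\<^sup>2 \<partial>Lper) \<le> h1_sqnorm f g" "(\<integral>t. (g t)\<^sup>2 \<partial>Lper) \<le> h1_sqnorm f g"
  by (simp_all add: h1_sqnorm_def)

lemma C1per_sq_diff_le_h1_sqnorm:
  assumes h: "C1per h h'" and "a \<le> b" "a \<in> Iper" "b \<in> Iper"
  shows "\<bar>(h b)\<^sup>2 - (h a)\<^sup>2\<bar> \<le> h1_sqnorm h h'"
proof -
  have c: "continuous_on A h" "continuous_on A h'" for A using C1per_cont[OF h] by auto
  have "((\<lambda>t. 2 * h t * h' t) has_integral ((h b)\<^sup>2 - (h a)\<^sup>2)) {a..b}"
    using h unfolding C1per_def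
    by (intro fundamental_theorem_of_calculus \<open>a \<le> b\<close>)
      (auto intro!: derivative_eq_intros simp: has_real_derivative_iff_has_vector_derivative[symmetric] intro: DERIV_subset)
  then have "\<bar>(h b)\<^sup>2 - (h a)\<^sup>2\<bar> = norm (integral {a..b} (\<lambda>t. 2 * h t * h' t))"
    by (simp add: integral_unique)
  also have "\<dots> \<le> integral {a..b} (\<lambda>t. (h t)\<^sup>2 + (h' t)\<^sup>2)"
  proof (rule integral_norm_bound_integral)
    show "(\<lambda>t. 2 * h t * h' t) integrable_on {a..b}" "(\<lambda>t. (h t)\<^sup>2 + (h' t)\<^sup>2) integrable_on {a..b}"
      by (auto intro!: integrable_continuous_real continuous_intros c)
    show "norm (2 * h x * h' x) \<le> (h x)\<^sup>2 + (h' x)\<^sup>2" for x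
      using sum_squares_bound[of "h x" "h' x"] sum_squares_bound[of "h x" "- h' x"]
      by (auto simp: abs_le_iff)
  qed
  also have "\<dots> \<le> integral Iper (\<lambda>t. (h t)\<^sup>2 + (h' t)\<^sup>2)"
    using assms(3,4) by (intro integral_subset_le) (auto intro!: integrable_continuous_real continuous_intros c simp: Iper_def)
  also have "\<dots> = (\<integral>t. (h t)\<^sup>2 + (h' t)\<^sup>2 \<partial>Lper)"
    by (intro integral_Lper_HK[symmetric] continuous_intros c)
  also have "\<dots> = h1_sqnorm h h'"
    unfolding h1_sqnorm_def by (intro Bochner_Integration.integral_add integrable_Lper_cont continuous_intros c)
  finally show ?thesis .
qed

lemma C1per_sq_le_h1_sqnorm:
  assumes h: "C1per h h'" and t: "t \<in> Iper"
  shows "(h t)\<^sup>2 \<le> 2 * h1_sqnorm h h'"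
proof -
  have c: "continuous_on Iper (\<lambda>t. (h t)\<^sup>2)" by (intro continuous_intros C1per_cont[OF h])
  obtain s where s: "s \<in> Iper" "\<And>y. y \<in> Iper \<Longrightarrow> (h s)\<^sup>2 \<le> (h y)\<^sup>2"
    using continuous_attains_inf[OF compact_Iper Iper_nonempty c] by blast
  have "1 * (h s)\<^sup>2 \<le> (2 * pi) * (h s)\<^sup>2" using pi_gt3 by (intro mult_right_mono) auto
  also have "\<dots> = (\<integral>t. (h s)\<^sup>2 \<partial>Lper)" by (simp only: integral_Lper_const)
  also have "\<dots> \<le> (\<integral>t. (h t)\<^sup>2 \<partial>Lper)"
    by (intro integral_mono integrable_Lper_const integrable_Lper_cont c) (use s in auto)
  also have "\<dots> \<le> h1_sqnorm h h'" by (rule L2_le_h1_sqnorm)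
  finally have "(h s)\<^sup>2 \<le> h1_sqnorm h h'" by simp
  moreover have "\<bar>(h t)\<^sup>2 - (h s)\<^sup>2\<bar> \<le> h1_sqnorm h h'"
    using C1per_sq_diff_le_h1_sqnorm[OF h, of s t] C1per_sq_diff_le_h1_sqnorm[OF h, of t s] s(1) t
    by (cases "s \<le> t") (auto simp: abs_minus_commute)
  ultimately show ?thesis by linarith
qed

lemma continuous_antiderivative:
  assumes g: "continuous_on UNIV g"
  obtains G where "\<And>t. (G has_real_derivative g t) (at t)" "G 0 = (0::real)"
proof -
  have "\<exists>F. \<forall>x :: real. - \<infinity> < ereal x \<longrightarrow> ereal x < \<infinity> \<longrightarrow> (F has_vector_derivative g x) (at x)"
    using g by (intro einterval_antiderivative) (auto simp: continuous_on_eq_continuous_at)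
  then obtain F where F: "\<And>x. (F has_vector_derivative g x) (at x)" by auto
  show ?thesis
    by (rule that[of "\<lambda>t. F t - F 0"])
      (use F in \<open>auto intro!: derivative_eq_intros simp: has_real_derivative_iff_has_vector_derivative[symmetric]\<close>)
qed

lemma antiderivative_periodic:
  assumes G: "\<And>t. (G has_real_derivative g t) (at t)" and g: "\<And>t. g (t + 2 * pi) = g t"
    and c: "continuous_on UNIV g"
  shows "G (t + 2 * pi) = G t + (\<integral>t. g t \<partial>Lper)"
proof -
  have "((\<lambda>t. G (t + 2*pi) - G t) has_real_derivative 0) (at x)" for x
  proof -
    have "((\<lambda>t. G (t + 2*pi)) has_real_derivative g (x + 2*pi) * 1) (at x)"
      by (rule DERIV_chain2[OF G]) (auto intro!: derivative_eq_intros)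
    from DERIV_diff[OF this G[of x]] show ?thesis by (simp add: g)
  qed
  then have "G (t + 2*pi) - G t = G (0 + 2*pi) - G 0"
    by (intro DERIV_isconst_all) blast
  also have "\<dots> = (\<integral>t. g t \<partial>Lper)"
    using integral_Lper_FTC[of G g] G c by (simp add: has_real_derivative_iff_has_vector_derivative)
  finally show ?thesis by simp
qed

section \<open>Square integrable functions\<close>

definition square_integrable :: "'a measure \<Rightarrow> ('a \<Rightarrow> complex) \<Rightarrow> bool" where
  "square_integrable M f \<longleftrightarrow> f \<in> borel_measurable M \<and> integrable M (\<lambda>x. (cmod (f x))\<^sup>2)"

abbreviation L2per :: "(real \<Rightarrow> complex) \<Rightarrow> bool" where "L2per \<equiv> square_integrable Lper"

lemma square_integrableD:
  assumes "square_integrable M f"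
  shows "f \<in> borel_measurable M" "integrable M (\<lambda>x. (cmod (f x))\<^sup>2)"
  using assms by (auto simp: square_integrable_def)

lemma square_integrable_mult:
  assumes "square_integrable M f" "square_integrable M g"
  shows "integrable M (\<lambda>x. f x * g x)"
proof (rule Bochner_Integration.integrable_bound)
  note [measurable] = assms[THEN square_integrableD(1)]
  show "integrable M (\<lambda>x. (cmod (f x))\<^sup>2 + (cmod (g x))\<^sup>2)" using assms[THEN square_integrableD(2)] by auto
  show "(\<lambda>x. f x * g x) \<in> borel_measurable M" by measurable
  show "AE x in M. norm (f x * g x) \<le> norm ((cmod (f x))\<^sup>2 + (cmod (g x))\<^sup>2)"
  proof (rule AE_I2)
    fix x
    have "cmod (f x) * cmod (g x) \<le> 2 * cmod (f x) * cmod (g x)" by (simp add: mult_le_cancel_right1)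
    also have "\<dots> \<le> (cmod (f x))\<^sup>2 + (cmod (g x))\<^sup>2" by (rule sum_squares_bound)
    finally show "norm (f x * g x) \<le> norm ((cmod (f x))\<^sup>2 + (cmod (g x))\<^sup>2)"
      by (simp add: norm_mult)
  qed
qed

lemma cmod_lin_sq_le: "(cmod (a * x + b * y))\<^sup>2 \<le> 2 * (cmod a)\<^sup>2 * (cmod x)\<^sup>2 + 2 * (cmod b)\<^sup>2 * (cmod y)\<^sup>2"
proof -
  have "(cmod (a * x + b * y))\<^sup>2 \<le> (cmod (a * x) + cmod (b * y))\<^sup>2"
    by (intro power_mono norm_triangle_ineq) auto
  also have "\<dots> \<le> 2 * (cmod (a * x))\<^sup>2 + 2 * (cmod (b * y))\<^sup>2"
    using sum_squares_bound[of "cmod (a * x)" "cmod (b * y)"] by (simp add: power2_sum)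
  finally show ?thesis by (simp add: norm_mult power_mult_distrib)
qed

lemma square_integrable_lin:
  assumes "square_integrable M f" "square_integrable M g"
  shows "square_integrable M (\<lambda>x. a * f x + b * g x)"
  unfolding square_integrable_def
proof
  note [measurable] = assms[THEN square_integrableD(1)]
  show "(\<lambda>x. a * f x + b * g x) \<in> borel_measurable M" by measurable
  show "integrable M (\<lambda>x. (cmod (a * f x + b * g x))\<^sup>2)"
  proof (rule Bochner_Integration.integrable_bound)
    show "integrable M (\<lambda>x. 2 * (cmod a)\<^sup>2 * (cmod (f x))\<^sup>2 + 2 * (cmod b)\<^sup>2 * (cmod (g x))\<^sup>2)"
      using assms[THEN square_integrableD(2)] by auto
    show "(\<lambda>x. (cmod (a * f x + b * g x))\<^sup>2) \<in> borel_measurable M" by measurable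
    show "AE x in M. norm ((cmod (a * f x + b * g x))\<^sup>2) \<le> norm (2 * (cmod a)\<^sup>2 * (cmod (f x))\<^sup>2 + 2 * (cmod b)\<^sup>2 * (cmod (g x))\<^sup>2)"
      using cmod_lin_sq_le by simp
  qed
qed

lemma square_integrable_diff:
  "square_integrable M f \<Longrightarrow> square_integrable M g \<Longrightarrow> square_integrable M (\<lambda>x. f x - g x)"
  using square_integrable_lin[of M f g 1 "-1"] by simp

lemma square_integrable_cnj: "square_integrable M f \<Longrightarrow> square_integrable M (\<lambda>x. cnj (f x))"
  unfolding square_integrable_def
  by (auto intro!: measurable_compose[of f M borel cnj borel] borel_measurable_continuous_onI continuous_intros)

lemma square_integrable_bounded:
  assumes "finite_measure M" "f \<in> borel_measurable M" "\<And>x. x \<in> space M \<Longrightarrow> cmod (f x) \<le> B"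
  shows "square_integrable M f"
  unfolding square_integrable_def
proof
  note [measurable] = assms(2)
  show "f \<in> borel_measurable M" by measurable
  show "integrable M (\<lambda>x. (cmod (f x))\<^sup>2)"
    by (rule finite_measure.integrable_const_bound[OF assms(1), where B = "B\<^sup>2"])
      (use assms(3) in \<open>auto intro!: AE_I2 power_mono\<close>)
qed

lemma square_integrable_of_real:
  assumes "square_integrable M (\<lambda>x. complex_of_real (f x))"
  shows "integrable M (\<lambda>x. (f x)\<^sup>2)" "f \<in> borel_measurable M"
  using assms by (auto simp: square_integrable_def borel_measurable_complex_iff)

lemma integral_cmod_sq_lin_le:
  assumes "square_integrable M f" "square_integrable M g"
  shows "(\<integral>x. (cmod (a * f x + b * g x))\<^sup>2 \<partial>M) \<le> 2 * (cmod a)\<^sup>2 * (\<integral>x. (cmod (f x))\<^sup>2 \<partial>M) + 2 * (cmod b)\<^sup>2 * (\<integral>x. (cmod (g x))\<^sup>2 \<partial>M)"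
proof -
  note i = assms[THEN square_integrableD(2)] square_integrableD(2)[OF square_integrable_lin[OF assms]]
  have "(\<integral>x. (cmod (a * f x + b * g x))\<^sup>2 \<partial>M) \<le> (\<integral>x. 2 * (cmod a)\<^sup>2 * (cmod (f x))\<^sup>2 + 2 * (cmod b)\<^sup>2 * (cmod (g x))\<^sup>2 \<partial>M)"
    by (rule integral_mono) (use i cmod_lin_sq_le in auto)
  then show ?thesis using i by simp
qed

lemma integral_cmod_sq_triangle:
  assumes "square_integrable M u" "square_integrable M v" "square_integrable M h"
  shows "(\<integral>x. (cmod (u x - h x))\<^sup>2 \<partial>M) \<le> 2 * (\<integral>x. (cmod (u x - v x))\<^sup>2 \<partial>M) + 2 * (\<integral>x. (cmod (v x - h x))\<^sup>2 \<partial>M)"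
  using integral_cmod_sq_lin_le[OF square_integrable_diff[OF assms(1,2)] square_integrable_diff[OF assms(2,3)], of 1 1]
  by simp

lemma integral_sq_triangle:
  assumes "square_integrable M (\<lambda>x. complex_of_real (u x))" "square_integrable M (\<lambda>x. complex_of_real (v x))"
    "square_integrable M (\<lambda>x. complex_of_real (h x))"
  shows "(\<integral>x. (u x - h x)\<^sup>2 \<partial>M) \<le> 2 * (\<integral>x. (u x - v x)\<^sup>2 \<partial>M) + 2 * (\<integral>x. (v x - h x)\<^sup>2 \<partial>M)"
  using integral_cmod_sq_triangle[OF assms] by (simp only: of_real_diff[symmetric] norm_of_real power2_abs)

lemma integral_cmod_sq_add_orthogonal:
  assumes f: "square_integrable M f" and g: "square_integrable M g" and orth: "(\<integral>x. f x * cnj (g x) \<partial>M) = 0"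
  shows "(\<integral>x. (cmod (f x + g x))\<^sup>2 \<partial>M) = (\<integral>x. (cmod (f x))\<^sup>2 \<partial>M) + (\<integral>x. (cmod (g x))\<^sup>2 \<partial>M)"
proof -
  note i = f[THEN square_integrableD(2)] g[THEN square_integrableD(2)] square_integrable_mult[OF f square_integrable_cnj[OF g]]
  have "(cmod (f x + g x))\<^sup>2 = (cmod (f x))\<^sup>2 + (cmod (g x))\<^sup>2 + 2 * Re (f x * cnj (g x))" for x
    unfolding cmod_power2 by (simp add: power2_eq_square algebra_simps)
  then have "(\<integral>x. (cmod (f x + g x))\<^sup>2 \<partial>M) = (\<integral>x. (cmod (f x))\<^sup>2 \<partial>M) + (\<integral>x. (cmod (g x))\<^sup>2 \<partial>M) + 2 * Re (\<integral>x. f x * cnj (g x) \<partial>M)"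
    using i by (simp del: times_complex.sel complex_cnj cnj.sel)
  then show ?thesis using orth by simp
qed

lemma L2_dominated_convergence:
  assumes m: "\<And>n. h n \<in> borel_measurable M" "u \<in> borel_measurable M"
    and b: "integrable M b" "\<And>n x. x \<in> space M \<Longrightarrow> (cmod (u x - h n x))\<^sup>2 \<le> b x"
    and l: "AE x in M. (\<lambda>n. h n x) \<longlonglongrightarrow> u x"
  shows "(\<lambda>n. \<integral>x. (cmod (u x - h n x))\<^sup>2 \<partial>M) \<longlonglongrightarrow> 0"
proof -
  have "(\<lambda>n. \<integral>x. (cmod (u x - h n x))\<^sup>2 \<partial>M) \<longlonglongrightarrow> (\<integral>x. 0 \<partial>M)"
  proof (rule integral_dominated_convergence[where w=b])
    show "AE x in M. (\<lambda>i. (cmod (u x - h i x))\<^sup>2) \<longlonglongrightarrow> 0"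
      using l
    proof (rule AE_mp, intro AE_I2 impI)
      fix x assume "(\<lambda>n. h n x) \<longlonglongrightarrow> u x"
      then have "(\<lambda>i. (cmod (u x - h i x))\<^sup>2) \<longlonglongrightarrow> (cmod (u x - u x))\<^sup>2" by (intro tendsto_intros)
      then show "(\<lambda>i. (cmod (u x - h i x))\<^sup>2) \<longlonglongrightarrow> 0" by simp
    qed
  qed (use m b in auto)
  then show ?thesis by simp
qed

lemma (in finite_measure) abs_integral_le_sqrt_integral_sq:
  assumes i: "integrable M f" "integrable M (\<lambda>x. (f x)\<^sup>2)"
  shows "\<bar>\<integral>x. f x \<partial>M\<bar> \<le> sqrt (measure M (space M) * (\<integral>x. (f x)\<^sup>2 \<partial>M))"
proof -
  let ?I = "\<integral>x. f x \<partial>M" and ?m = "measure M (space M)"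
  have "0 \<le> (\<integral>x. (?m * f x - ?I)\<^sup>2 \<partial>M)" by simp
  also have "\<dots> = (\<integral>x. ?m\<^sup>2 * (f x)\<^sup>2 - (2 * ?m * ?I) * f x + ?I\<^sup>2 \<partial>M)"
    by (rule Bochner_Integration.integral_cong) (auto simp: power2_eq_square algebra_simps)
  also have "\<dots> = ?m\<^sup>2 * (\<integral>x. (f x)\<^sup>2 \<partial>M) - (2 * ?m * ?I) * ?I + ?m * ?I\<^sup>2" using i by simp
  also have "\<dots> = ?m * (?m * (\<integral>x. (f x)\<^sup>2 \<partial>M) - ?I\<^sup>2)" by (simp add: power2_eq_square algebra_simps)
  finally have nonneg: "0 \<le> ?m * (?m * (\<integral>x. (f x)\<^sup>2 \<partial>M) - ?I\<^sup>2)" .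
  show ?thesis
  proof (cases "?m = 0")
    case True
    then have "AE x in M. f x = 0" by (intro AE_I'[of "space M"]) (auto simp: emeasure_eq_measure)
    then have "?I = 0" by (rule integral_eq_zero_AE)
    then show ?thesis by simp
  next
    case False
    then have "?I\<^sup>2 \<le> ?m * (\<integral>x. (f x)\<^sup>2 \<partial>M)"
      using nonneg measure_nonneg[of M "space M"] by (simp add: zero_le_mult_iff)
    then show ?thesis by (metis real_sqrt_abs real_sqrt_le_mono)
  qed
qed

lemma L2per_cont: "continuous_on Iper f \<Longrightarrow> L2per f"
  by (auto simp: square_integrable_def intro!: measurable_Lper_cont integrable_Lper_cont continuous_intros)

lemma L2per_integrable: "L2per f \<Longrightarrow> integrable Lper f"
  using square_integrable_mult[of Lper f "\<lambda>_. 1"] L2per_cont[of "\<lambda>_. 1"] by simp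

lemma L2per_of_real_integrable: "L2per (\<lambda>t. complex_of_real (f t)) \<Longrightarrow> integrable Lper f"
  using integrable_Re[OF L2per_integrable] by fastforce

lemma L2per_C1per:
  assumes "C1per f f'" shows "L2per (\<lambda>t. complex_of_real (f t))" "L2per (\<lambda>t. complex_of_real (f' t))"
  by (intro L2per_cont continuous_intros C1per_cont[OF assms])+

lemma L2per_trig1: "L2per (\<lambda>t. c * trig1 m t)"
  by (intro L2per_cont continuous_intros trig1_cont)

lemma wderiv1_L2: "wderiv1 f g \<Longrightarrow> L2per f" "wderiv1 f g \<Longrightarrow> L2per g"
  by (auto simp: wderiv1_def square_integrable_def)

lemma H1per_integrable: "H1per f \<Longrightarrow> integrable Lper f"
  unfolding H1per_def using wderiv1_L2(1) L2per_of_real_integrable by blast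

lemma wderiv1_lin:
  assumes "wderiv1 f g" "wderiv1 h k"
  shows "wderiv1 (\<lambda>t. a * f t + b * h t) (\<lambda>t. a * g t + b * k t)"
  unfolding wderiv1_def
proof (intro conjI allI)
  note L = wderiv1_L2[OF assms(1)] wderiv1_L2[OF assms(2)]
  have "L2per (\<lambda>t. a * f t + b * h t)" "L2per (\<lambda>t. a * g t + b * k t)"
    by (intro square_integrable_lin L)+
  then show "(\<lambda>t. a * f t + b * h t) \<in> borel_measurable Lper" "(\<lambda>t. a * g t + b * k t) \<in> borel_measurable Lper"
    "integrable Lper (\<lambda>t. (cmod (a * f t + b * h t))\<^sup>2)" "integrable Lper (\<lambda>t. (cmod (a * g t + b * k t))\<^sup>2)"
    by (auto simp: square_integrable_def)
  fix m
  have i: "integrable Lper (\<lambda>t. f t * (\<i> * of_int m * trig1 m t))" "integrable Lper (\<lambda>t. h t * (\<i> * of_int m * trig1 m t))"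
    "integrable Lper (\<lambda>t. g t * trig1 m t)" "integrable Lper (\<lambda>t. k t * trig1 m t)"
    using L2per_trig1[of 1 m] L by (auto intro!: square_integrable_mult L2per_trig1)
  have "(\<integral>t. (a * f t + b * h t) * (\<i> * of_int m * trig1 m t) \<partial>Lper) =
    a * (\<integral>t. f t * (\<i> * of_int m * trig1 m t) \<partial>Lper) + b * (\<integral>t. h t * (\<i> * of_int m * trig1 m t) \<partial>Lper)"
    using i by (simp add: distrib_right mult.assoc)
  also have "\<dots> = - (a * (\<integral>t. g t * trig1 m t \<partial>Lper) + b * (\<integral>t. k t * trig1 m t \<partial>Lper))"
    using assms by (simp add: wderiv1_def)
  also have "\<dots> = - (\<integral>t. (a * g t + b * k t) * trig1 m t \<partial>Lper)"
    using i by (simp add: distrib_right mult.assoc)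
  finally show "(\<integral>t. (a * f t + b * h t) * (\<i> * of_int m * trig1 m t) \<partial>Lper) = - (\<integral>t. (a * g t + b * k t) * trig1 m t \<partial>Lper)" .
qed

lemma H1per_lin:
  assumes "H1per f" "H1per h" shows "H1per (\<lambda>t. a * f t + b * h t)"
proof -
  obtain g k where "wderiv1 (\<lambda>t. complex_of_real (f t)) g" "wderiv1 (\<lambda>t. complex_of_real (h t)) k"
    using assms by (auto simp: H1per_def)
  from wderiv1_lin[OF this, of a b] show ?thesis by (auto simp: H1per_def)
qed

lemma wderiv1_cnj:
  assumes w: "wderiv1 f g"
  shows "wderiv1 (\<lambda>t. cnj (f t)) (\<lambda>t. cnj (g t))"
  unfolding wderiv1_def
proof (intro conjI allI)
  show "(\<lambda>t. cnj (f t)) \<in> borel_measurable Lper" "integrable Lper (\<lambda>t. (cmod (cnj (f t)))\<^sup>2)"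
    "(\<lambda>t. cnj (g t)) \<in> borel_measurable Lper" "integrable Lper (\<lambda>t. (cmod (cnj (g t)))\<^sup>2)"
    using square_integrable_cnj[OF wderiv1_L2(1)[OF w]] square_integrable_cnj[OF wderiv1_L2(2)[OF w]]
    by (auto simp: square_integrable_def)
  fix m
  have "(\<integral>t. cnj (f t) * (\<i> * of_int m * trig1 m t) \<partial>Lper) = (\<integral>t. cnj (f t * (\<i> * of_int (-m) * trig1 (-m) t)) \<partial>Lper)"
    by (rule Bochner_Integration.integral_cong) (auto simp: trig1_cnj)
  also have "\<dots> = cnj (\<integral>t. f t * (\<i> * of_int (-m) * trig1 (-m) t) \<partial>Lper)" by (rule Bochner_Integration.integral_cnj)
  also have "\<dots> = cnj (- (\<integral>t. g t * trig1 (-m) t \<partial>Lper))" using w by (simp only: wderiv1_def)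
  also have "\<dots> = - (\<integral>t. cnj (g t * trig1 (-m) t) \<partial>Lper)" by (simp only: complex_cnj_minus Bochner_Integration.integral_cnj)
  also have "\<dots> = - (\<integral>t. cnj (g t) * trig1 m t \<partial>Lper)" by (simp add: trig1_cnj)
  finally show "(\<integral>t. cnj (f t) * (\<i> * of_int m * trig1 m t) \<partial>Lper) = - (\<integral>t. cnj (g t) * trig1 m t \<partial>Lper)" .
qed

lemma wderiv1_of_real_Re:
  assumes w: "wderiv1 (\<lambda>t. complex_of_real (f t)) g"
  shows "wderiv1 (\<lambda>t. complex_of_real (f t)) (\<lambda>t. complex_of_real (Re (g t)))"
proof -
  have "1/2 * complex_of_real x + 1/2 * cnj (complex_of_real x) = complex_of_real x"
    "1/2 * z + 1/2 * cnj z = complex_of_real (Re z)" for x z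
    by (auto simp: complex_eq_iff)
  then show ?thesis using wderiv1_lin[OF w wderiv1_cnj[OF w], of "1/2" "1/2"] by simp
qed

section \<open>Fourier approximation in the periodic Sobolev space\<close>

definition fourier_coeff :: "(real \<Rightarrow> complex) \<Rightarrow> int \<Rightarrow> complex" where
  "fourier_coeff u m = complex_of_real (1 / (2 * pi)) * (\<integral>t. u t * trig1 (- m) t \<partial>Lper)"

definition trig_sum :: "nat \<Rightarrow> (int \<Rightarrow> complex) \<Rightarrow> real \<Rightarrow> complex" where
  "trig_sum k a t = (\<Sum>m\<in>{-int k..int k}. a m * trig1 m t)"

lemma trig_sum_cont: "continuous_on A (trig_sum k a)"
  unfolding trig_sum_def by (intro continuous_intros trig1_cont)

lemma L2per_trig_sum: "L2per (trig_sum k a)"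
  by (rule L2per_cont[OF trig_sum_cont])

lemma trig_sum_extend: "k \<le> l \<Longrightarrow> trig_sum k a = trig_sum l (\<lambda>m. if \<bar>m\<bar> \<le> int k then a m else 0)"
  unfolding trig_sum_def fun_eq_iff
  by (intro allI sum.mono_neutral_cong_left) auto

lemma trig_sum_add: "\<exists>c. (\<lambda>t. trig_sum k a t + trig_sum l b t) = trig_sum (max k l) c"
proof -
  have "(\<lambda>t. trig_sum (max k l) a' t + trig_sum (max k l) b' t) = trig_sum (max k l) (\<lambda>m. a' m + b' m)" for a' b'
    by (auto simp: trig_sum_def fun_eq_iff sum.distrib algebra_simps)
  then show ?thesis
    using trig_sum_extend[of k "max k l" a] trig_sum_extend[of l "max k l" b] by auto
qed

lemma integral_trig_sum_trig1:
  assumes "m \<in> {-int k..int k}"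
  shows "(\<integral>t. trig_sum k a t * trig1 (- m) t \<partial>Lper) = complex_of_real (2 * pi) * a m"
proof -
  have "(\<integral>t. trig_sum k a t * trig1 (- m) t \<partial>Lper) = (\<integral>t. (\<Sum>j\<in>{-int k..int k}. a j * trig1 (j - m) t) \<partial>Lper)"
    by (simp add: trig_sum_def sum_distrib_right mult.assoc trig1_mult)
  also have "\<dots> = (\<Sum>j\<in>{-int k..int k}. a j * (\<integral>t. trig1 (j - m) t \<partial>Lper))"
    by (subst Bochner_Integration.integral_sum) (auto intro!: integrable_Lper_cont continuous_intros trig1_cont)
  also have "\<dots> = (\<Sum>j\<in>{-int k..int k}. if j = m then complex_of_real (2 * pi) * a j else 0)"
    by (rule sum.cong) (auto simp: trig1_orthogonal)
  also have "\<dots> = complex_of_real (2 * pi) * a m" using assms by simp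
  finally show ?thesis .
qed

lemma fourier_remainder_orthogonal:
  assumes u: "L2per u"
  shows "(\<integral>t. (u t - trig_sum k (fourier_coeff u) t) * cnj (trig_sum k b t) \<partial>Lper) = 0"
proof -
  let ?R = "\<lambda>t. u t - trig_sum k (fourier_coeff u) t"
  have R: "L2per ?R" by (intro square_integrable_diff u L2per_trig_sum)
  have mode: "(\<integral>t. ?R t * trig1 (- m) t \<partial>Lper) = 0" if "m \<in> {-int k..int k}" for m
  proof -
    have "(\<integral>t. ?R t * trig1 (- m) t \<partial>Lper) = (\<integral>t. u t * trig1 (- m) t \<partial>Lper) - (\<integral>t. trig_sum k (fourier_coeff u) t * trig1 (- m) t \<partial>Lper)"
      unfolding left_diff_distrib
      by (intro Bochner_Integration.integral_diff square_integrable_mult u L2per_trig_sum L2per_cont trig1_cont)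
    then show ?thesis using integral_trig_sum_trig1[OF that, of "fourier_coeff u"] by (simp add: fourier_coeff_def)
  qed
  have "cnj (trig_sum k b t) = (\<Sum>m\<in>{-int k..int k}. cnj (b m) * trig1 (- m) t)" for t
    by (simp add: trig_sum_def trig1_cnj)
  then have "(\<integral>t. ?R t * cnj (trig_sum k b t) \<partial>Lper) = (\<integral>t. (\<Sum>m\<in>{-int k..int k}. cnj (b m) * (?R t * trig1 (- m) t)) \<partial>Lper)"
    by (simp add: sum_distrib_left mult_ac)
  also have "\<dots> = (\<Sum>m\<in>{-int k..int k}. cnj (b m) * (\<integral>t. ?R t * trig1 (- m) t \<partial>Lper))"
    by (subst Bochner_Integration.integral_sum)
      (auto intro!: integrable_mult_right square_integrable_mult[OF R] L2per_cont trig1_cont)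
  also have "\<dots> = 0" by (intro sum.neutral) (simp add: mode)
  finally show ?thesis .
qed

lemma fourier_best_approximation:
  assumes u: "L2per u"
  shows "(\<integral>t. (cmod (u t - trig_sum k (fourier_coeff u) t))\<^sup>2 \<partial>Lper) \<le> (\<integral>t. (cmod (u t - trig_sum k a t))\<^sup>2 \<partial>Lper)"
proof -
  let ?R = "\<lambda>t. u t - trig_sum k (fourier_coeff u) t" and ?D = "trig_sum k (\<lambda>m. fourier_coeff u m - a m)"
  have "u t - trig_sum k a t = ?R t + ?D t" for t
    by (simp add: trig_sum_def sum_subtractf left_diff_distrib)
  then have "(\<integral>t. (cmod (u t - trig_sum k a t))\<^sup>2 \<partial>Lper) = (\<integral>t. (cmod (?R t))\<^sup>2 \<partial>Lper) + (\<integral>t. (cmod (?D t))\<^sup>2 \<partial>Lper)"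
    using integral_cmod_sq_add_orthogonal[OF square_integrable_diff[OF u L2per_trig_sum] L2per_trig_sum fourier_remainder_orthogonal[OF u]]
    by (simp only:)
  also have "\<dots> \<ge> (\<integral>t. (cmod (?R t))\<^sup>2 \<partial>Lper)" by simp
  finally show ?thesis .
qed

inductive trig_polynomial :: "(real \<Rightarrow> complex) \<Rightarrow> bool" where
  monomial: "trig_polynomial (\<lambda>t. c * trig1 m t)"
| add: "trig_polynomial p \<Longrightarrow> trig_polynomial q \<Longrightarrow> trig_polynomial (\<lambda>t. p t + q t)"

lemma trig_polynomial_mult:
  assumes "trig_polynomial p" "trig_polynomial q"
  shows "trig_polynomial (\<lambda>t. p t * q t)"
  using assms(1)
proof induction
  case (monomial c m)
  show ?case using assms(2)
  proof induction
    case (monomial d l)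
    have "(\<lambda>t. c * trig1 m t * (d * trig1 l t)) = (\<lambda>t. (c * d) * trig1 (m + l) t)"
      by (simp add: trig1_mult[symmetric] mult_ac)
    then show ?case using trig_polynomial.monomial by metis
  qed (auto simp: distrib_left intro: trig_polynomial.add)
qed (auto simp: distrib_right intro: trig_polynomial.add)

lemma trig_polynomial_const: "trig_polynomial (\<lambda>t. c)"
  using trig_polynomial.monomial[of c 0] by (simp add: trig1_def)

lemma trig_polynomial_eq_trig_sum: "trig_polynomial p \<Longrightarrow> \<exists>k a. p = trig_sum k a"
proof (induction rule: trig_polynomial.induct)
  case (monomial c m)
  have "(\<lambda>t. c * trig1 m t) = trig_sum (nat \<bar>m\<bar>) (\<lambda>j. if j = m then c else 0)"
    by (auto simp: trig_sum_def fun_eq_iff mult_delta_left)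
  then show ?case by blast
next
  case (add p q)
  then show ?case using trig_sum_add by metis
qed

lemma trig_polynomial_cont: "trig_polynomial p \<Longrightarrow> continuous_on A p"
  using trig_polynomial_eq_trig_sum trig_sum_cont by metis

lemma L2per_trig_polynomial: "trig_polynomial p \<Longrightarrow> L2per p"
  by (intro L2per_cont trig_polynomial_cont)

lemma real_polynomial_function_cis:
  assumes "real_polynomial_function (p :: complex \<Rightarrow> real)"
  shows "trig_polynomial (\<lambda>t. complex_of_real (p (cis t)))"
  using assms
proof (induction rule: real_polynomial_function.induct)
  case (linear f)
  interpret bounded_linear f by fact
  have "complex_of_real (f (cis t)) = (f 1 / 2 - \<i> * f \<i> / 2) * trig1 1 t + (f 1 / 2 + \<i> * f \<i> / 2) * trig1 (-1) t" for t
  proof -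
    have "cis t = cos t *\<^sub>R 1 + sin t *\<^sub>R \<i>" by (simp add: complex_eq_iff)
    then have "f (cis t) = cos t * f 1 + sin t * f \<i>" by (simp only: add scaleR) simp
    then show ?thesis by (simp add: trig1_def complex_eq_iff algebra_simps)
  qed
  then show ?case by (simp only:) (intro trig_polynomial.intros)
qed (auto intro: trig_polynomial_const trig_polynomial.add trig_polynomial_mult)

definition trig_approximable :: "(real \<Rightarrow> complex) \<Rightarrow> bool" where
  "trig_approximable u \<longleftrightarrow> L2per u \<and> (\<forall>e>0. \<exists>p. trig_polynomial p \<and> (\<integral>t. (cmod (u t - p t))\<^sup>2 \<partial>Lper) < e)"

lemma trig_approximableE:
  assumes "trig_approximable u" "0 < e"
  obtains p where "trig_polynomial p" "(\<integral>t. (cmod (u t - p t))\<^sup>2 \<partial>Lper) < e"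
  using assms unfolding trig_approximable_def by blast

lemma trig_approximable_limit:
  assumes u: "L2per u" and h: "\<And>n. trig_approximable (h n)"
    and lim: "(\<lambda>n. \<integral>t. (cmod (u t - h n t))\<^sup>2 \<partial>Lper) \<longlonglongrightarrow> 0"
  shows "trig_approximable u"
  unfolding trig_approximable_def
proof (intro conjI allI impI u)
  fix e :: real assume "e > 0"
  then have "\<forall>\<^sub>F n in sequentially. (\<integral>t. (cmod (u t - h n t))\<^sup>2 \<partial>Lper) < e / 4"
    using lim by (intro order_tendstoD) auto
  then obtain n where n: "(\<integral>t. (cmod (u t - h n t))\<^sup>2 \<partial>Lper) < e / 4"
    by (auto simp: eventually_sequentially)
  obtain p where p: "trig_polynomial p" "(\<integral>t. (cmod (h n t - p t))\<^sup>2 \<partial>Lper) < e / 4"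
    using trig_approximableE[OF h[of n], of "e / 4"] \<open>e > 0\<close> by auto
  have "L2per (h n)" using h[of n] by (simp add: trig_approximable_def)
  then have "(\<integral>t. (cmod (u t - p t))\<^sup>2 \<partial>Lper) < e"
    using integral_cmod_sq_triangle[OF u _ L2per_trig_polynomial[OF p(1)], of "h n"] n p(2) by simp
  then show "\<exists>p. trig_polynomial p \<and> (\<integral>t. (cmod (u t - p t))\<^sup>2 \<partial>Lper) < e" using p(1) by blast
qed

lemma trig_approximable_lin:
  assumes u: "trig_approximable u" and v: "trig_approximable v"
  shows "trig_approximable (\<lambda>t. a * u t + b * v t)"
  unfolding trig_approximable_def
proof (intro conjI allI impI)
  have L: "L2per u" "L2per v" using u v by (simp_all add: trig_approximable_def)
  then show "L2per (\<lambda>t. a * u t + b * v t)" by (rule square_integrable_lin)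
  fix e :: real assume e: "e > 0"
  define K where "K = 2 * (cmod a)\<^sup>2 + 2 * (cmod b)\<^sup>2 + 1"
  have K: "0 < K" by (simp add: K_def add_nonneg_pos)
  obtain p where p: "trig_polynomial p" "(\<integral>t. (cmod (u t - p t))\<^sup>2 \<partial>Lper) < e / K"
    using trig_approximableE[OF u divide_pos_pos[OF e K]] by blast
  obtain q where q: "trig_polynomial q" "(\<integral>t. (cmod (v t - q t))\<^sup>2 \<partial>Lper) < e / K"
    using trig_approximableE[OF v divide_pos_pos[OF e K]] by blast
  have "trig_polynomial (\<lambda>t. a * p t + b * q t)"
    by (intro trig_polynomial.add trig_polynomial_mult trig_polynomial_const p q)
  moreover have "(\<integral>t. (cmod (a * u t + b * v t - (a * p t + b * q t)))\<^sup>2 \<partial>Lper) < e"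
  proof -
    have "(\<integral>t. (cmod (a * u t + b * v t - (a * p t + b * q t)))\<^sup>2 \<partial>Lper) = (\<integral>t. (cmod (a * (u t - p t) + b * (v t - q t)))\<^sup>2 \<partial>Lper)"
      by (simp add: algebra_simps)
    also have "\<dots> \<le> 2 * (cmod a)\<^sup>2 * (\<integral>t. (cmod (u t - p t))\<^sup>2 \<partial>Lper) + 2 * (cmod b)\<^sup>2 * (\<integral>t. (cmod (v t - q t))\<^sup>2 \<partial>Lper)"
      by (intro integral_cmod_sq_lin_le square_integrable_diff L L2per_trig_polynomial p q)
    also have "\<dots> \<le> 2 * (cmod a)\<^sup>2 * (e / K) + 2 * (cmod b)\<^sup>2 * (e / K)"
      using p(2) q(2) by (intro add_mono mult_left_mono) auto
    also have "\<dots> = (K - 1) * (e / K)" by (simp only: K_def distrib_right[symmetric]) simp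
    also have "\<dots> < K * (e / K)" using e K by (intro mult_strict_right_mono) auto
    finally show ?thesis using K by simp
  qed
  ultimately show "\<exists>p. trig_polynomial p \<and> (\<integral>t. (cmod (a * u t + b * v t - p t))\<^sup>2 \<partial>Lper) < e" by blast
qed

lemma trig_approximable_bounded_limit:
  assumes h: "\<And>n. trig_approximable (\<lambda>t. complex_of_real (h n t))" and u: "u \<in> borel_measurable Lper"
    and B: "\<And>n t. t \<in> Iper \<Longrightarrow> \<bar>h n t\<bar> \<le> B" "\<And>t. t \<in> Iper \<Longrightarrow> \<bar>u t\<bar> \<le> B"
    and lim: "AE t in Lper. (\<lambda>n. h n t) \<longlonglongrightarrow> u t"
  shows "trig_approximable (\<lambda>t. complex_of_real (u t))"
proof (rule trig_approximable_limit[OF _ h])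
  have um: "(\<lambda>t. complex_of_real (u t)) \<in> borel_measurable Lper" using u by measurable
  show "L2per (\<lambda>t. complex_of_real (u t))"
    by (rule square_integrable_bounded[OF finite_measure_Lper um, of B]) (use B(2) in simp)
  show "(\<lambda>n. \<integral>t. (cmod (complex_of_real (u t) - complex_of_real (h n t)))\<^sup>2 \<partial>Lper) \<longlonglongrightarrow> 0"
  proof (rule L2_dominated_convergence[where b = "\<lambda>_. (2 * B)\<^sup>2"])
    show "(\<lambda>t. complex_of_real (h n t)) \<in> borel_measurable Lper" for n
      using h[of n] by (simp add: trig_approximable_def square_integrable_def)
    show "integrable Lper (\<lambda>_. (2 * B)\<^sup>2)" by (rule integrable_Lper_const)
    show "(cmod (complex_of_real (u t) - complex_of_real (h n t)))\<^sup>2 \<le> (2 * B)\<^sup>2" if "t \<in> space Lper" for n t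
    proof -
      have "\<bar>u t - h n t\<bar> \<le> 2 * B" using B(1)[of t n] B(2)[of t] that by auto
      then have "\<bar>u t - h n t\<bar>\<^sup>2 \<le> (2 * B)\<^sup>2" by (rule power_mono) simp
      then show ?thesis by (simp only: of_real_diff[symmetric] norm_of_real)
    qed
    show "AE t in Lper. (\<lambda>n. complex_of_real (h n t)) \<longlonglongrightarrow> complex_of_real (u t)"
      using lim by (auto intro: tendsto_of_real)
  qed (rule um)
qed

lemma trig_approximable_circle:
  assumes F: "continuous_on (sphere 0 1) (F :: complex \<Rightarrow> real)"
  shows "trig_approximable (\<lambda>t. complex_of_real (F (cis t)))"
  unfolding trig_approximable_def
proof (intro conjI allI impI)
  have cF: "continuous_on A (\<lambda>t. complex_of_real (F (cis t)))" for A
    by (intro continuous_intros continuous_on_compose2[OF F]) auto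
  show "L2per (\<lambda>t. complex_of_real (F (cis t)))" by (rule L2per_cont[OF cF])
  fix e :: real assume e: "e > 0"
  define d where "d = sqrt (e / 8)"
  have d: "d > 0" using e by (simp add: d_def)
  obtain p where p: "real_polynomial_function p" "\<And>x. x \<in> sphere 0 1 \<Longrightarrow> \<bar>F x - p x\<bar> < d"
    using Stone_Weierstrass_real_polynomial_function[OF _ F d] by auto
  note P = real_polynomial_function_cis[OF p(1)]
  have "(\<integral>t. (cmod (complex_of_real (F (cis t)) - complex_of_real (p (cis t))))\<^sup>2 \<partial>Lper) \<le> (\<integral>t. d\<^sup>2 \<partial>Lper)"
  proof (rule integral_mono)
    fix t
    have "\<bar>F (cis t) - p (cis t)\<bar> \<le> d" using p(2)[of "cis t"] by simp
    then have "\<bar>F (cis t) - p (cis t)\<bar>\<^sup>2 \<le> d\<^sup>2" by (rule power_mono) simp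
    then show "(cmod (complex_of_real (F (cis t)) - complex_of_real (p (cis t))))\<^sup>2 \<le> d\<^sup>2"
      by (simp only: of_real_diff[symmetric] norm_of_real)
  qed (intro integrable_Lper_cont continuous_intros cF trig_polynomial_cont[OF P])+
  also have "\<dots> = 2 * pi * (e / 8)" using e by (simp add: measure_Lper d_def)
  also have "\<dots> < e" using e pi_less_4 by (simp add: field_simps)
  finally show "\<exists>p. trig_polynomial p \<and> (\<integral>t. (cmod (complex_of_real (F (cis t)) - p t))\<^sup>2 \<partial>Lper) < e"
    using P by blast
qed

text \<open>A function on the interval need not agree at its ends; the factor removes the jump it would cause at 1.\<close>

definition circle_cutoff :: "(real \<Rightarrow> real) \<Rightarrow> nat \<Rightarrow> complex \<Rightarrow> real" where
  "circle_cutoff g n z = g (Arg2pi z) * min 1 (real n * cmod (z - 1))"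

lemma abs_circle_cutoff_le:
  assumes "\<And>t. t \<in> Iper \<Longrightarrow> \<bar>g t\<bar> \<le> B"
  shows "\<bar>circle_cutoff g n z\<bar> \<le> B" "\<bar>circle_cutoff g n z\<bar> \<le> B * (real n * cmod (z - 1))"
proof -
  have g: "\<bar>g (Arg2pi z)\<bar> \<le> B" using Arg2pi[of z] by (intro assms) (auto simp: Iper_def)
  then have "\<bar>circle_cutoff g n z\<bar> \<le> B * min 1 (real n * cmod (z - 1))"
    unfolding circle_cutoff_def abs_mult by (intro mult_mono) auto
  moreover have "0 \<le> B" using g by linarith
  ultimately show "\<bar>circle_cutoff g n z\<bar> \<le> B" "\<bar>circle_cutoff g n z\<bar> \<le> B * (real n * cmod (z - 1))"
    using mult_left_mono[of "min 1 (real n * cmod (z - 1))" 1 B]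
      mult_left_mono[of "min 1 (real n * cmod (z - 1))" "real n * cmod (z - 1)" B] by auto
qed

lemma continuous_on_circle_cutoff:
  assumes g: "continuous_on UNIV g"
  shows "continuous_on (sphere 0 1) (circle_cutoff g n)"
  unfolding continuous_on_eq_continuous_within
proof
  fix z :: complex assume z: "z \<in> sphere 0 1"
  show "continuous (at z within sphere 0 1) (circle_cutoff g n)"
  proof (cases "z = 1")
    case True
    obtain B where B: "\<And>t. t \<in> Iper \<Longrightarrow> \<bar>g t\<bar> \<le> B"
      using continuous_on_Iper_bounded[OF continuous_on_subset[OF g]] by blast
    have "((\<lambda>y. B * (real n * cmod (y - 1))) \<longlongrightarrow> B * (real n * cmod (1 - 1))) (at z within sphere 0 1)"
      unfolding True by (intro tendsto_intros)
    then have bound_lim: "((\<lambda>y. B * (real n * cmod (y - 1))) \<longlongrightarrow> 0) (at z within sphere 0 1)" by simp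
    have "(circle_cutoff g n \<longlongrightarrow> 0) (at z within sphere 0 1)"
      by (rule Lim_null_comparison[OF always_eventually bound_lim]) (simp add: abs_circle_cutoff_le(2)[OF B])
    then show ?thesis by (simp add: continuous_within True circle_cutoff_def)
  next
    case False
    have "z \<notin> \<real>\<^sub>\<ge>\<^sub>0" using z False by (auto simp: nonneg_Reals_def)
    then have "isCont (\<lambda>z. g (Arg2pi z)) z"
      using isCont_o2[OF continuous_at_Arg2pi, of z g] g by (simp add: continuous_on_eq_continuous_at)
    then have "isCont (circle_cutoff g n) z" unfolding circle_cutoff_def by (intro continuous_intros)
    then show ?thesis by (rule continuous_at_imp_continuous_at_within)
  qed
qed

lemma circle_cutoff_tendsto:
  assumes t: "0 < t" "t < 2 * pi"
  shows "(\<lambda>n. circle_cutoff g n (cis t)) \<longlonglongrightarrow> g t"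
proof -
  have Arg: "Arg2pi (cis t) = t" using t by (intro Arg2pi_unique[of 1]) (auto simp: cis_conv_exp)
  then have "cis t \<noteq> 1" using t Arg2pi_eq_0[of 1] by auto
  then obtain N where N: "real N * cmod (cis t - 1) > 1" using ex_less_of_nat_mult[of "cmod (cis t - 1)"] by auto
  have "circle_cutoff g n (cis t) = g t" if "n \<ge> N" for n
  proof -
    have "real N * cmod (cis t - 1) \<le> real n * cmod (cis t - 1)" using that by (intro mult_right_mono) auto
    then show ?thesis using N by (simp add: circle_cutoff_def Arg)
  qed
  then show ?thesis by (intro tendsto_eventually eventually_sequentiallyI[of N])
qed

lemma trig_approximable_continuous:
  assumes g: "continuous_on UNIV (g :: real \<Rightarrow> real)"
  shows "trig_approximable (\<lambda>t. complex_of_real (g t))"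
proof -
  obtain B where B: "\<And>t. t \<in> Iper \<Longrightarrow> \<bar>g t\<bar> \<le> B"
    using continuous_on_Iper_bounded[OF continuous_on_subset[OF g]] by blast
  show ?thesis
  proof (rule trig_approximable_bounded_limit)
    show "trig_approximable (\<lambda>t. complex_of_real (circle_cutoff g n (cis t)))" for n
      by (rule trig_approximable_circle[OF continuous_on_circle_cutoff[OF g]])
    show "\<bar>circle_cutoff g n (cis t)\<bar> \<le> B" for n t by (rule abs_circle_cutoff_le(1)[OF B])
    show "g \<in> borel_measurable Lper" using g continuous_on_subset by (intro measurable_Lper_cont) blast
    have "AE t in Lper. t \<noteq> 0 \<and> t \<noteq> 2 * pi"
    proof (rule AE_I')
      show "{0, 2*pi} \<in> null_sets Lper"
        by (auto simp: null_sets_restrict_space Iper_def negligible_iff_null_sets[symmetric])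
    qed auto
    then show "AE t in Lper. (\<lambda>n. circle_cutoff g n (cis t)) \<longlonglongrightarrow> g t"
      by (rule AE_mp, intro AE_I2 impI circle_cutoff_tendsto) (auto simp: Iper_def)
  qed (rule B)
qed

lemma Lper_measurable_AE_limit_continuous:
  fixes u :: "real \<Rightarrow> real"
  assumes u: "u \<in> borel_measurable Lper"
  obtains g where "\<And>n. continuous_on UNIV (g n)" "AE t in Lper. (\<lambda>n. g n t) \<longlonglongrightarrow> u t"
proof -
  have "(\<lambda>x. if x \<in> Iper then u x else 0) \<in> borel_measurable lebesgue"
    using u by (simp only: borel_measurable_if[OF Iper_sets(1)])
  then have "(\<lambda>x. if x \<in> Iper then u x else 0) measurable_on UNIV"
    by (intro lebesgue_measurable_imp_measurable_on) auto
  then obtain N g where N: "negligible N" and g: "\<And>n. continuous_on UNIV (g n)"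
    and l: "\<And>x. x \<notin> N \<Longrightarrow> (\<lambda>n. g n x) \<longlonglongrightarrow> (if x \<in> Iper then u x else 0)"
    unfolding measurable_on_def by auto
  have "N \<inter> Iper \<in> null_sets Lper"
    using N by (auto simp: null_sets_restrict_space negligible_iff_null_sets[symmetric] intro: negligible_subset)
  then have "AE x in Lper. x \<notin> N" by (rule AE_I') auto
  then have "AE t in Lper. (\<lambda>n. g n t) \<longlonglongrightarrow> u t"
    by (rule AE_mp) (use l in \<open>force intro!: AE_I2\<close>)
  with g show ?thesis by (rule that)
qed

lemma trig_approximable_bounded:
  assumes u: "u \<in> borel_measurable Lper" and B: "\<And>t. \<bar>u t\<bar> \<le> B"
  shows "trig_approximable (\<lambda>t. complex_of_real (u t))"
proof -
  obtain g where g: "\<And>n. continuous_on UNIV (g n)" and l: "AE t in Lper. (\<lambda>n. g n t) \<longlonglongrightarrow> u t"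
    using Lper_measurable_AE_limit_continuous[OF u] by blast
  let ?clamp = "\<lambda>y. max (- B) (min B y)"
  have B0: "0 \<le> B" using B[of 0] by linarith
  show ?thesis
  proof (rule trig_approximable_bounded_limit[OF _ u _ B])
    show "trig_approximable (\<lambda>t. complex_of_real (?clamp (g n t)))" for n
      by (intro trig_approximable_continuous continuous_intros g)
    show "\<bar>?clamp (g n t)\<bar> \<le> B" for n t using B0 by linarith
    have "?clamp (u t) = u t" for t using B[of t] by linarith
    then have clamp_lim: "(\<lambda>n. ?clamp (g n t)) \<longlonglongrightarrow> u t" if "(\<lambda>n. g n t) \<longlonglongrightarrow> u t" for t
      using that tendsto_max[OF tendsto_const tendsto_min[OF tendsto_const that], of "- B" B] by simp
    show "AE t in Lper. (\<lambda>n. ?clamp (g n t)) \<longlonglongrightarrow> u t"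
      using l by (rule AE_mp) (simp add: clamp_lim)
  qed
qed

lemma trig_approximable_of_real:
  assumes u: "L2per (\<lambda>t. complex_of_real (u t))"
  shows "trig_approximable (\<lambda>t. complex_of_real (u t))"
proof (rule trig_approximable_limit[OF u])
  let ?clamp = "\<lambda>(k::nat) y. max (- real k) (min (real k) y)"
  have [measurable]: "u \<in> borel_measurable Lper" by (rule square_integrable_of_real(2)[OF u])
  show "trig_approximable (\<lambda>t. complex_of_real (?clamp k (u t)))" for k
    by (rule trig_approximable_bounded[of _ "real k"]) auto
  show "(\<lambda>k. \<integral>t. (cmod (complex_of_real (u t) - complex_of_real (?clamp k (u t))))\<^sup>2 \<partial>Lper) \<longlonglongrightarrow> 0"
  proof (rule L2_dominated_convergence[where b = "\<lambda>t. (u t)\<^sup>2"])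
    show "(cmod (complex_of_real (u t) - complex_of_real (?clamp n (u t))))\<^sup>2 \<le> (u t)\<^sup>2" for n t
    proof -
      have "\<bar>u t - ?clamp n (u t)\<bar> \<le> \<bar>u t\<bar>" by linarith
      then have "\<bar>u t - ?clamp n (u t)\<bar>\<^sup>2 \<le> \<bar>u t\<bar>\<^sup>2" by (rule power_mono) simp
      then show ?thesis by (simp only: of_real_diff[symmetric] norm_of_real power2_abs)
    qed
    show "AE t in Lper. (\<lambda>n. complex_of_real (?clamp n (u t))) \<longlonglongrightarrow> complex_of_real (u t)"
    proof (rule AE_I2)
      fix t
      obtain K :: nat where "\<bar>u t\<bar> \<le> real K" using real_arch_simple by blast
      then show "(\<lambda>n. complex_of_real (?clamp n (u t))) \<longlonglongrightarrow> complex_of_real (u t)"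
        by (intro tendsto_eventually eventually_sequentiallyI[of K]) auto
    qed
  qed (use square_integrable_of_real[OF u] in measurable)
qed

lemma trig_approximable_L2per:
  assumes u: "L2per u" shows "trig_approximable u"
proof -
  note [measurable] = square_integrableD(1)[OF u]
  have "L2per (\<lambda>t. 1/2 * u t + 1/2 * cnj (u t))" "L2per (\<lambda>t. (- \<i>/2) * u t + (\<i>/2) * cnj (u t))"
    by (intro square_integrable_lin u square_integrable_cnj)+
  moreover have "(\<lambda>t. 1/2 * u t + 1/2 * cnj (u t)) = (\<lambda>t. complex_of_real (Re (u t)))"
    "(\<lambda>t. (- \<i>/2) * u t + (\<i>/2) * cnj (u t)) = (\<lambda>t. complex_of_real (Im (u t)))"
    by (auto simp: complex_eq_iff)
  ultimately have "trig_approximable (\<lambda>t. complex_of_real (Re (u t)))" "trig_approximable (\<lambda>t. complex_of_real (Im (u t)))"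
    by (auto intro: trig_approximable_of_real)
  from trig_approximable_lin[OF this, of 1 \<i>] show ?thesis by (simp add: complex_eq[symmetric])
qed

lemma fourier_series_tendsto_L2:
  assumes u: "L2per u"
  shows "(\<lambda>k. \<integral>t. (cmod (u t - trig_sum k (fourier_coeff u) t))\<^sup>2 \<partial>Lper) \<longlonglongrightarrow> 0"
proof (rule LIMSEQ_I)
  fix r :: real assume "0 < r"
  obtain p where p: "trig_polynomial p" "(\<integral>t. (cmod (u t - p t))\<^sup>2 \<partial>Lper) < r"
    using trig_approximableE[OF trig_approximable_L2per[OF u] \<open>0 < r\<close>] .
  obtain k a where ka: "p = trig_sum k a" using trig_polynomial_eq_trig_sum[OF p(1)] by blast
  show "\<exists>no. \<forall>n\<ge>no. norm ((\<integral>t. (cmod (u t - trig_sum n (fourier_coeff u) t))\<^sup>2 \<partial>Lper) - 0) < r"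
  proof (intro exI[of _ k] allI impI)
    fix n assume "k \<le> n"
    then have "(\<integral>t. (cmod (u t - trig_sum n (fourier_coeff u) t))\<^sup>2 \<partial>Lper) \<le> (\<integral>t. (cmod (u t - p t))\<^sup>2 \<partial>Lper)"
      unfolding ka trig_sum_extend[OF \<open>k \<le> n\<close>, of a] by (intro fourier_best_approximation u)
    then show "norm ((\<integral>t. (cmod (u t - trig_sum n (fourier_coeff u) t))\<^sup>2 \<partial>Lper) - 0) < r" using p(2) by simp
  qed
qed

lemma fourier_coeff_wderiv1:
  assumes "wderiv1 f g" shows "fourier_coeff g m = \<i> * of_int m * fourier_coeff f m"
proof -
  have "(\<integral>t. f t * (\<i> * of_int (-m) * trig1 (-m) t) \<partial>Lper) = - (\<integral>t. g t * trig1 (-m) t \<partial>Lper)"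
    using assms unfolding wderiv1_def by blast
  moreover have "(\<integral>t. f t * (\<i> * of_int (-m) * trig1 (-m) t) \<partial>Lper) = - (\<i> * of_int m * (\<integral>t. f t * trig1 (-m) t \<partial>Lper))"
    by (simp add: mult_ac)
  ultimately show ?thesis by (simp add: fourier_coeff_def)
qed

inductive real_trig_polynomial :: "(real \<Rightarrow> real) \<Rightarrow> bool" where
  cos: "real_trig_polynomial (\<lambda>t. cos (real_of_int m * t))"
| sin: "real_trig_polynomial (\<lambda>t. sin (real_of_int m * t))"
| lin: "real_trig_polynomial f \<Longrightarrow> real_trig_polynomial h \<Longrightarrow> real_trig_polynomial (\<lambda>t. a * f t + b * h t)"

lemma real_trig_polynomial_sum:
  assumes "finite A" "\<And>i. i \<in> A \<Longrightarrow> real_trig_polynomial (f i)"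
  shows "real_trig_polynomial (\<lambda>t. \<Sum>i\<in>A. f i t)"
  using assms
proof (induction rule: finite_induct)
  case empty then show ?case using real_trig_polynomial.lin[OF cos cos, of 0 0 0 0] by simp
next
  case (insert x F)
  then have "real_trig_polynomial (\<lambda>t. 1 * f x t + 1 * (\<Sum>i\<in>F. f i t))"
    by (intro real_trig_polynomial.lin) auto
  then show ?case using insert by simp
qed

lemma real_trig_polynomial_C1per: "real_trig_polynomial f \<Longrightarrow> \<exists>f'. C1per f f'"
proof (induction rule: real_trig_polynomial.induct)
  case (cos m)
  have "cos (real_of_int m * (t + 2 * pi)) = cos (real_of_int m * t)" for t
    using trig1_periodic[of m t] by (simp add: trig1_def complex_eq_iff)
  then have "C1per (\<lambda>t. cos (real_of_int m * t)) (\<lambda>t. - real_of_int m * sin (real_of_int m * t))"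
    by (auto simp: C1per_def intro!: derivative_eq_intros continuous_intros)
  then show ?case by blast
next
  case (sin m)
  have "sin (real_of_int m * (t + 2 * pi)) = sin (real_of_int m * t)" for t
    using trig1_periodic[of m t] by (simp add: trig1_def complex_eq_iff)
  then have "C1per (\<lambda>t. sin (real_of_int m * t)) (\<lambda>t. real_of_int m * cos (real_of_int m * t))"
    by (auto simp: C1per_def intro!: derivative_eq_intros continuous_intros)
  then show ?case by blast
next
  case (lin f h a b)
  then show ?case using C1per_lin by blast
qed

lemma real_trig_polynomial_Re_trig_sum: "real_trig_polynomial (\<lambda>t. Re (trig_sum k a t))"
proof -
  have "(\<lambda>t. Re (trig_sum k a t)) = (\<lambda>t. \<Sum>m\<in>{-int k..int k}. Re (a m) * cos (real_of_int m * t) + (- Im (a m)) * sin (real_of_int m * t))"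
    by (auto simp: trig_sum_def trig1_def fun_eq_iff intro!: sum.cong)
  then show ?thesis
    by (simp only:) (intro real_trig_polynomial_sum real_trig_polynomial.intros, simp)
qed

lemma C1per_Re_trig_sum: "C1per (\<lambda>t. Re (trig_sum k a t)) (\<lambda>t. Re (trig_sum k (\<lambda>m. \<i> * of_int m * a m) t))"
  unfolding C1per_def
proof (intro conjI allI)
  fix t
  have "(trig_sum k a has_vector_derivative trig_sum k (\<lambda>m. \<i> * of_int m * a m) t) (at t)"
    unfolding trig_sum_def
    by (rule has_vector_derivative_sum) (auto intro!: derivative_eq_intros trig1_has_vector_derivative)
  then show "((\<lambda>t. Re (trig_sum k a t)) has_real_derivative Re (trig_sum k (\<lambda>m. \<i> * of_int m * a m) t)) (at t)"
    unfolding has_real_derivative_iff_has_vector_derivative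
    by (rule bounded_linear.has_vector_derivative[OF bounded_linear_Re])
  show "continuous_on UNIV (\<lambda>t. Re (trig_sum k (\<lambda>m. \<i> * of_int m * a m) t))" by (intro continuous_intros trig_sum_cont)
  show "Re (trig_sum k a (t + 2 * pi)) = Re (trig_sum k a t)" by (simp add: trig_sum_def trig1_periodic)
qed

lemma Re_fourier_series_tendsto_L2:
  assumes q: "L2per (\<lambda>t. complex_of_real (q t))"
  shows "(\<lambda>k. \<integral>t. (q t - Re (trig_sum k (fourier_coeff (\<lambda>t. complex_of_real (q t))) t))\<^sup>2 \<partial>Lper) \<longlonglongrightarrow> 0"
proof (rule tendsto_sandwich[OF _ _ tendsto_const fourier_series_tendsto_L2[OF q]])
  have "(\<integral>t. (q t - Re (trig_sum k a t))\<^sup>2 \<partial>Lper) \<le> (\<integral>t. (cmod (complex_of_real (q t) - trig_sum k a t))\<^sup>2 \<partial>Lper)" for k a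
  proof (rule integral_mono')
    show "integrable Lper (\<lambda>t. (cmod (complex_of_real (q t) - trig_sum k a t))\<^sup>2)"
      by (intro square_integrableD square_integrable_diff q L2per_trig_sum)
    show "(q t - Re (trig_sum k a t))\<^sup>2 \<le> (cmod (complex_of_real (q t) - trig_sum k a t))\<^sup>2" for t
      using power_mono[OF abs_Re_le_cmod, of "complex_of_real (q t) - trig_sum k a t" 2] by simp
  qed simp
  then show "\<forall>\<^sub>F k in sequentially. (\<integral>t. (q t - Re (trig_sum k (fourier_coeff (\<lambda>t. complex_of_real (q t))) t))\<^sup>2 \<partial>Lper)
      \<le> (\<integral>t. (cmod (complex_of_real (q t) - trig_sum k (fourier_coeff (\<lambda>t. complex_of_real (q t))) t))\<^sup>2 \<partial>Lper)"
    by (simp add: always_eventually)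
qed simp

definition H1_approximation ::
    "(real \<Rightarrow> real) \<Rightarrow> (real \<Rightarrow> real) \<Rightarrow> (nat \<Rightarrow> real \<Rightarrow> real) \<Rightarrow> (nat \<Rightarrow> real \<Rightarrow> real) \<Rightarrow> bool" where
  "H1_approximation f g T T' \<longleftrightarrow>
     wderiv1 (\<lambda>t. complex_of_real (f t)) (\<lambda>t. complex_of_real (g t)) \<and> (\<forall>k. C1per (T k) (T' k)) \<and>
     (\<lambda>k. h1_sqnorm (\<lambda>t. f t - T k t) (\<lambda>t. g t - T' k t)) \<longlonglongrightarrow> 0"

lemma H1_approximationD:
  assumes "H1_approximation f g T T'"
  shows "wderiv1 (\<lambda>t. complex_of_real (f t)) (\<lambda>t. complex_of_real (g t))" "C1per (T k) (T' k)"
    "(\<lambda>k. h1_sqnorm (\<lambda>t. f t - T k t) (\<lambda>t. g t - T' k t)) \<longlonglongrightarrow> 0"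
  using assms unfolding H1_approximation_def by auto

lemma H1_approximation_H1per: "H1_approximation f g T T' \<Longrightarrow> H1per f"
  using H1_approximationD(1) unfolding H1per_def by blast

lemma H1_approximation_L2per:
  assumes "H1_approximation f g T T'"
  shows "L2per (\<lambda>t. complex_of_real (f t))" "L2per (\<lambda>t. complex_of_real (g t))"
    "L2per (\<lambda>t. complex_of_real (T k t))" "L2per (\<lambda>t. complex_of_real (T' k t))"
  using wderiv1_L2[OF H1_approximationD(1)[OF assms]] L2per_C1per[OF H1_approximationD(2)[OF assms]] by auto

lemma exists_trig_H1_approximation:
  assumes "H1per f"
  obtains g T T' where "H1_approximation f g T T'" "\<And>k. real_trig_polynomial (T k)"
proof -
  obtain g0 where "wderiv1 (\<lambda>t. complex_of_real (f t)) g0" using assms by (auto simp: H1per_def)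
  then have w: "wderiv1 (\<lambda>t. complex_of_real (f t)) (\<lambda>t. complex_of_real (Re (g0 t)))" by (rule wderiv1_of_real_Re)
  let ?a = "fourier_coeff (\<lambda>t. complex_of_real (f t))" and ?b = "fourier_coeff (\<lambda>t. complex_of_real (Re (g0 t)))"
  let ?T = "\<lambda>k t. Re (trig_sum k ?a t)" and ?T' = "\<lambda>k t. Re (trig_sum k ?b t)"
  have "?b = (\<lambda>m. \<i> * of_int m * ?a m)" by (rule ext) (rule fourier_coeff_wderiv1[OF w])
  then have "C1per (?T k) (?T' k)" for k by (simp only:) (rule C1per_Re_trig_sum)
  moreover have "(\<lambda>k. h1_sqnorm (\<lambda>t. f t - ?T k t) (\<lambda>t. Re (g0 t) - ?T' k t)) \<longlonglongrightarrow> 0"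
    unfolding h1_sqnorm_def
    using tendsto_add[OF Re_fourier_series_tendsto_L2[OF wderiv1_L2(1)[OF w]] Re_fourier_series_tendsto_L2[OF wderiv1_L2(2)[OF w]]] by simp
  ultimately have "H1_approximation f (\<lambda>t. Re (g0 t)) ?T ?T'" using w by (simp add: H1_approximation_def)
  then show ?thesis using that real_trig_polynomial_Re_trig_sum by blast
qed

lemma h1_sqnorm_diff_le:
  assumes "H1_approximation f g T T'"
  shows "h1_sqnorm (\<lambda>t. T k t - T j t) (\<lambda>t. T' k t - T' j t)
    \<le> 2 * h1_sqnorm (\<lambda>t. f t - T k t) (\<lambda>t. g t - T' k t) + 2 * h1_sqnorm (\<lambda>t. f t - T j t) (\<lambda>t. g t - T' j t)"
proof -
  note L = H1_approximation_L2per[OF assms]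
  have "(\<integral>t. (T k t - T j t)\<^sup>2 \<partial>Lper) \<le> 2 * (\<integral>t. (T k t - f t)\<^sup>2 \<partial>Lper) + 2 * (\<integral>t. (f t - T j t)\<^sup>2 \<partial>Lper)"
    by (intro integral_sq_triangle L)
  moreover have "(\<integral>t. (T' k t - T' j t)\<^sup>2 \<partial>Lper) \<le> 2 * (\<integral>t. (T' k t - g t)\<^sup>2 \<partial>Lper) + 2 * (\<integral>t. (g t - T' j t)\<^sup>2 \<partial>Lper)"
    by (intro integral_sq_triangle L)
  ultimately show ?thesis
    unfolding h1_sqnorm_def by (simp add: power2_commute[of "T k _" "f _"] power2_commute[of "T' k _" "g _"])
qed

lemma H1_approximation_uniformly_Cauchy:
  assumes approx: "H1_approximation f g T T'"
  shows "uniformly_Cauchy_on Iper T"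
  unfolding uniformly_Cauchy_on_def
proof (intro allI impI)
  let ?d = "\<lambda>k. h1_sqnorm (\<lambda>t. f t - T k t) (\<lambda>t. g t - T' k t)"
  fix e :: real assume e: "e > 0"
  then have "\<forall>\<^sub>F k in sequentially. ?d k < e\<^sup>2 / 8" using H1_approximationD(3)[OF approx] by (intro order_tendstoD) auto
  then obtain M where M: "\<And>k. k \<ge> M \<Longrightarrow> ?d k < e\<^sup>2 / 8" by (auto simp: eventually_sequentially)
  show "\<exists>M. \<forall>x\<in>Iper. \<forall>m\<ge>M. \<forall>n\<ge>M. dist (T m x) (T n x) < e"
  proof (intro exI[of _ M] ballI allI impI)
    fix x m n assume x: "x \<in> Iper" "M \<le> m" "M \<le> n"
    have "(T m x - T n x)\<^sup>2 \<le> 2 * h1_sqnorm (\<lambda>t. T m t - T n t) (\<lambda>t. T' m t - T' n t)"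
      by (intro C1per_sq_le_h1_sqnorm C1per_diff H1_approximationD(2)[OF approx] x)
    also have "\<dots> \<le> 4 * ?d m + 4 * ?d n" using h1_sqnorm_diff_le[OF approx, of m n] by simp
    finally have "(T m x - T n x)\<^sup>2 < e\<^sup>2" using M[of m] M[of n] x by simp
    then show "dist (T m x) (T n x) < e" using e by (metis abs_le_square_iff abs_of_pos not_le dist_real_def)
  qed
qed

lemma uniform_limit_eq_L2_limit:
  fixes T :: "nat \<Rightarrow> real \<Rightarrow> real"
  assumes cont: "continuous_on Iper f" "\<And>k. continuous_on Iper (T k)" and unif: "uniform_limit Iper T F sequentially"
    and L2: "(\<lambda>k. \<integral>t. (f t - T k t)\<^sup>2 \<partial>Lper) \<longlonglongrightarrow> 0" and x: "x \<in> Iper"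
  shows "F x = f x"
proof -
  have cF: "continuous_on Iper F"
    by (rule uniform_limit_theorem[OF _ unif]) (auto intro!: always_eventually cont)
  have "(\<lambda>k. (\<integral>t. (T k t - F t)\<^sup>2 \<partial>Lper)) \<longlonglongrightarrow> 0"
  proof (rule LIMSEQ_I)
    fix e :: real assume e: "0 < e"
    then have "0 < sqrt (e / (4 * pi))" by simp
    then obtain N where N: "\<And>k t. k \<ge> N \<Longrightarrow> t \<in> Iper \<Longrightarrow> \<bar>T k t - F t\<bar> < sqrt (e / (4 * pi))"
      using unif unfolding uniform_limit_sequentially_iff dist_real_def by blast
    have "(\<integral>t. (T k t - F t)\<^sup>2 \<partial>Lper) < e" if "k \<ge> N" for k
    proof -
      have "(\<integral>t. (T k t - F t)\<^sup>2 \<partial>Lper) \<le> (\<integral>t. e / (4 * pi) \<partial>Lper)"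
      proof (rule integral_mono[OF _ integrable_Lper_const])
        show "integrable Lper (\<lambda>t. (T k t - F t)\<^sup>2)" by (intro integrable_Lper_cont continuous_intros cont cF)
        fix t assume "t \<in> space Lper"
        then show "(T k t - F t)\<^sup>2 \<le> e / (4 * pi)"
          using power_mono[OF less_imp_le[OF N[OF that, of t]], of 2] e by simp
      qed
      then show ?thesis using e by (simp add: measure_Lper)
    qed
    then show "\<exists>N. \<forall>k\<ge>N. norm ((\<integral>t. (T k t - F t)\<^sup>2 \<partial>Lper) - 0) < e" by (auto intro!: exI[of _ N])
  qed
  then have "(\<lambda>k. 2 * (\<integral>t. (f t - T k t)\<^sup>2 \<partial>Lper) + 2 * (\<integral>t. (T k t - F t)\<^sup>2 \<partial>Lper)) \<longlonglongrightarrow> 2 * 0 + 2 * 0"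
    by (intro tendsto_intros L2)
  moreover have "(\<integral>t. (f t - F t)\<^sup>2 \<partial>Lper) \<le> 2 * (\<integral>t. (f t - T k t)\<^sup>2 \<partial>Lper) + 2 * (\<integral>t. (T k t - F t)\<^sup>2 \<partial>Lper)" for k
    by (intro integral_sq_triangle L2per_cont continuous_intros cont cF)
  ultimately have "(\<integral>t. (f t - F t)\<^sup>2 \<partial>Lper) \<le> 0" by (intro LIMSEQ_le_const) auto
  then have "(\<integral>t. (f t - F t)\<^sup>2 \<partial>Lper) = 0" by (simp add: antisym)
  moreover have "continuous_on Iper (\<lambda>t. (f t - F t)\<^sup>2)" by (intro continuous_intros cont(1) cF)
  ultimately show ?thesis using integral_Lper_eq_0_iff[of "\<lambda>t. (f t - F t)\<^sup>2"] x by auto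
qed

lemma H1_approximation_uniform_limit:
  assumes approx: "H1_approximation f g T T'" and f: "continuous_on Iper f"
  shows "uniform_limit Iper T f sequentially"
proof -
  obtain F where F: "uniform_limit Iper T F sequentially"
    using Cauchy_uniformly_convergent[OF H1_approximation_uniformly_Cauchy[OF approx]] by (auto simp: uniformly_convergent_on_def)
  have "(\<lambda>k. \<integral>t. (f t - T k t)\<^sup>2 \<partial>Lper) \<longlonglongrightarrow> 0"
    by (rule tendsto_sandwich[OF _ _ tendsto_const H1_approximationD(3)[OF approx]])
      (auto intro!: always_eventually L2_le_h1_sqnorm)
  then have "F x = f x" if "x \<in> Iper" for x
    using uniform_limit_eq_L2_limit[OF f C1per_cont(1)[OF H1_approximationD(2)[OF approx]] F _ that] by blast
  then show ?thesis using F uniform_limit_cong'[of Iper T T F f sequentially] by auto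
qed

section \<open>Slater determinants of disjointly supported orbitals\<close>

interpretation Lprod: product_sigma_finite "\<lambda>_::nat. Lper"
  by (simp add: product_sigma_finite_def finite_measure.sigma_finite_measure[OF finite_measure_Lper])

lemma space_muN: "space (muN n) = PiE {..<n} (\<lambda>_. Iper)"
  by (simp add: muN_def space_PiM)

lemma finite_permutes_lessThan: "finite {p. p permutes {..<n::nat}}"
  by (rule finite_permutations) simp

lemma permutes_less: "p permutes {..<n::nat} \<Longrightarrow> i < n \<Longrightarrow> p i < n"
  using permutes_in_image[of p "{..<n}" i] by auto

lemma trigN_eq_prod: "trigN n m x = (\<Prod>i<n. trig1 (m i) (x i))"
  unfolding trigN_def by (induction n) (auto simp: trig1_def cis_mult[symmetric])

definition slater_term :: "nat \<Rightarrow> (nat \<Rightarrow> nat \<Rightarrow> real \<Rightarrow> complex) \<Rightarrow> (nat \<Rightarrow> nat) \<Rightarrow> (nat \<Rightarrow> real) \<Rightarrow> complex" where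
  "slater_term n f p x = (\<Prod>i<n. f i (p i) (x i))"

text \<open>The orbitals carry a slot index i as well, so that the same sum also yields the partial derivatives.\<close>

definition slater :: "nat \<Rightarrow> (nat \<Rightarrow> nat \<Rightarrow> real \<Rightarrow> complex) \<Rightarrow> (nat \<Rightarrow> real) \<Rightarrow> complex" where
  "slater n f x = complex_of_real (1 / sqrt (fact n)) * (\<Sum>p | p permutes {..<n}. of_int (sign p) * slater_term n f p x)"

definition slater_grad :: "nat \<Rightarrow> (nat \<Rightarrow> real \<Rightarrow> complex) \<Rightarrow> (nat \<Rightarrow> real \<Rightarrow> complex) \<Rightarrow> nat \<Rightarrow> (nat \<Rightarrow> real) \<Rightarrow> complex" where
  "slater_grad n f f' j = slater n (\<lambda>i. if i = j then f' else f)"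

lemma slater_term_measurable:
  assumes "\<And>i k. i < n \<Longrightarrow> k < n \<Longrightarrow> f i k \<in> borel_measurable Lper" "p permutes {..<n}"
  shows "slater_term n f p \<in> borel_measurable (muN n)"
  unfolding slater_term_def muN_def
proof (rule borel_measurable_prod)
  fix i assume i: "i \<in> {..<n}"
  have "(\<lambda>x. x i) \<in> measurable (Pi\<^sub>M {..<n} (\<lambda>_. Lper)) Lper" using i by (rule measurable_component_singleton)
  moreover have "f i (p i) \<in> borel_measurable Lper" using assms i permutes_less by auto
  ultimately show "(\<lambda>x. f i (p i) (x i)) \<in> borel_measurable (Pi\<^sub>M {..<n} (\<lambda>_. Lper))"
    by (rule measurable_compose)
qed

lemma slater_term_square_integrable:
  assumes "\<And>i k. i < n \<Longrightarrow> k < n \<Longrightarrow> L2per (f i k)" "p permutes {..<n}"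
  shows "square_integrable (muN n) (slater_term n f p)"
    "(\<integral>x. (cmod (slater_term n f p x))\<^sup>2 \<partial>muN n) = (\<Prod>i<n. \<integral>t. (cmod (f i (p i) t))\<^sup>2 \<partial>Lper)"
proof -
  have e: "(cmod (slater_term n f p x))\<^sup>2 = (\<Prod>i<n. (cmod (f i (p i) (x i)))\<^sup>2)" for x
    by (simp add: slater_term_def prod_norm[symmetric] prod_power_distrib)
  have i: "integrable Lper (\<lambda>t. (cmod (f i (p i) t))\<^sup>2)" if "i \<in> {..<n}" for i
    using assms(1)[of i "p i"] permutes_less[OF assms(2)] that by (auto simp: square_integrable_def)
  have "integrable (muN n) (\<lambda>x. (cmod (slater_term n f p x))\<^sup>2)"
    unfolding e muN_def by (rule Lprod.product_integrable_prod) (use i in auto)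
  moreover have "slater_term n f p \<in> borel_measurable (muN n)"
    by (rule slater_term_measurable[OF square_integrableD(1)[OF assms(1)] assms(2)])
  ultimately show "square_integrable (muN n) (slater_term n f p)" by (simp add: square_integrable_def)
  show "(\<integral>x. (cmod (slater_term n f p x))\<^sup>2 \<partial>muN n) = (\<Prod>i<n. \<integral>t. (cmod (f i (p i) t))\<^sup>2 \<partial>Lper)"
    unfolding e muN_def by (rule Lprod.product_integral_prod) (use i in auto)
qed

lemma slater_sq_le: "(cmod (slater n f x))\<^sup>2 \<le> (\<Sum>p | p permutes {..<n}. (cmod (slater_term n f p x))\<^sup>2)"
proof -
  let ?P = "{p. p permutes {..<n}}"
  have "cmod (slater n f x) \<le> (1 / sqrt (fact n)) * (\<Sum>p\<in>?P. cmod (slater_term n f p x))"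
    unfolding slater_def norm_mult norm_of_real
    using norm_sum[of "\<lambda>p. of_int (sign p) * slater_term n f p x" ?P]
    by (auto simp: norm_mult sign_def if_distrib[of abs] if_distrib[of real_of_int] cong: if_cong intro!: divide_right_mono)
  then have "(cmod (slater n f x))\<^sup>2 \<le> ((1 / sqrt (fact n)) * (\<Sum>p\<in>?P. cmod (slater_term n f p x)))\<^sup>2"
    by (intro power_mono) auto
  also have "\<dots> = (1 / fact n) * (\<Sum>p\<in>?P. cmod (slater_term n f p x))\<^sup>2"
    by (simp add: power_mult_distrib power_divide)
  also have "\<dots> \<le> (1 / fact n) * ((\<Sum>p\<in>?P. (cmod (slater_term n f p x))\<^sup>2) * real (card ?P))"
    by (intro mult_left_mono sum_squared_le_sum_of_squares finite_permutes_lessThan) auto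
  also have "\<dots> = (\<Sum>p\<in>?P. (cmod (slater_term n f p x))\<^sup>2)"
    by (subst card_permutations[of "{..<n}" n]) auto
  finally show ?thesis .
qed

lemma slater_square_integrable:
  assumes "\<And>i k. i < n \<Longrightarrow> k < n \<Longrightarrow> L2per (f i k)"
  shows "square_integrable (muN n) (slater n f)"
    "(\<integral>x. (cmod (slater n f x))\<^sup>2 \<partial>muN n) \<le> (\<Sum>p | p permutes {..<n}. \<Prod>i<n. \<integral>t. (cmod (f i (p i) t))\<^sup>2 \<partial>Lper)"
proof -
  let ?P = "{p. p permutes {..<n}}"
  note T = slater_term_square_integrable[OF assms]
  have i: "integrable (muN n) (\<lambda>x. \<Sum>p\<in>?P. (cmod (slater_term n f p x))\<^sup>2)"
    using square_integrableD(2)[OF T(1)] by (intro Bochner_Integration.integrable_sum) auto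
  have m: "slater n f \<in> borel_measurable (muN n)"
    unfolding slater_def using square_integrableD(1)[OF T(1)]
    by (intro borel_measurable_times borel_measurable_const borel_measurable_sum) auto
  have "integrable (muN n) (\<lambda>x. (cmod (slater n f x))\<^sup>2)"
    by (rule Bochner_Integration.integrable_bound[OF i])
      (use m in \<open>auto intro!: AE_I2 order_trans[OF slater_sq_le] abs_ge_self\<close>)
  with m show S: "square_integrable (muN n) (slater n f)" by (simp add: square_integrable_def)
  have "(\<integral>x. (cmod (slater n f x))\<^sup>2 \<partial>muN n) \<le> (\<integral>x. (\<Sum>p\<in>?P. (cmod (slater_term n f p x))\<^sup>2) \<partial>muN n)"
    by (intro integral_mono square_integrableD(2)[OF S] i slater_sq_le)
  also have "\<dots> = (\<Sum>p\<in>?P. \<integral>x. (cmod (slater_term n f p x))\<^sup>2 \<partial>muN n)"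
    using square_integrableD(2)[OF T(1)] by (intro Bochner_Integration.integral_sum) auto
  also have "\<dots> = (\<Sum>p\<in>?P. \<Prod>i<n. \<integral>t. (cmod (f i (p i) t))\<^sup>2 \<partial>Lper)"
    using T(2) by (intro sum.cong) auto
  finally show "(\<integral>x. (cmod (slater n f x))\<^sup>2 \<partial>muN n) \<le> (\<Sum>p\<in>?P. \<Prod>i<n. \<integral>t. (cmod (f i (p i) t))\<^sup>2 \<partial>Lper)" .
qed

lemma integral_slater_product:
  assumes "\<And>i k. i < n \<Longrightarrow> k < n \<Longrightarrow> L2per (f i k)" "\<And>i. i < n \<Longrightarrow> L2per (h i)"
  shows "(\<integral>x. slater n f x * (\<Prod>i<n. h i (x i)) \<partial>muN n) =
    complex_of_real (1 / sqrt (fact n)) * (\<Sum>p | p permutes {..<n}. of_int (sign p) * (\<Prod>i<n. \<integral>t. f i (p i) t * h i t \<partial>Lper))"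
proof -
  let ?P = "{p. p permutes {..<n}}"
  have e: "slater_term n f p x * (\<Prod>i<n. h i (x i)) = (\<Prod>i<n. f i (p i) (x i) * h i (x i))" for p x
    by (simp add: slater_term_def prod.distrib)
  have i: "integrable Lper (\<lambda>t. f i (p i) t * h i t)" if "p permutes {..<n}" "i < n" for p i
    using assms that permutes_less by (intro square_integrable_mult) auto
  have term_integrable: "integrable (muN n) (\<lambda>x. slater_term n f p x * (\<Prod>i<n. h i (x i)))"
    and term_integral: "(\<integral>x. slater_term n f p x * (\<Prod>i<n. h i (x i)) \<partial>muN n) = (\<Prod>i<n. \<integral>t. f i (p i) t * h i t \<partial>Lper)"
    if "p permutes {..<n}" for p
    unfolding e muN_def using i[OF that] by (intro Lprod.product_integrable_prod Lprod.product_integral_prod; simp)+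
  have "(\<integral>x. slater n f x * (\<Prod>i<n. h i (x i)) \<partial>muN n) =
    (\<integral>x. complex_of_real (1 / sqrt (fact n)) * (\<Sum>p\<in>?P. of_int (sign p) * (slater_term n f p x * (\<Prod>i<n. h i (x i)))) \<partial>muN n)"
    unfolding slater_def by (simp add: sum_distrib_right mult.assoc)
  also have "\<dots> = complex_of_real (1 / sqrt (fact n)) * (\<Sum>p\<in>?P. of_int (sign p) * (\<integral>x. slater_term n f p x * (\<Prod>i<n. h i (x i)) \<partial>muN n))"
    using term_integrable by (simp add: Bochner_Integration.integral_sum)
  also have "(\<Sum>p\<in>?P. of_int (sign p) * (\<integral>x. slater_term n f p x * (\<Prod>i<n. h i (x i)) \<partial>muN n))
    = (\<Sum>p\<in>?P. of_int (sign p) * (\<Prod>i<n. \<integral>t. f i (p i) t * h i t \<partial>Lper))"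
    using term_integral by (intro sum.cong) auto
  finally show ?thesis .
qed

lemma prod_integral_trig1_by_parts:
  fixes n :: nat
  assumes w: "\<And>i. i < n \<Longrightarrow> wderiv1 (f i) (f' i)" and j: "j < n"
  shows "(\<Prod>i<n. \<integral>t. f i t * ((if i = j then \<i> * of_int (m j) else 1) * trig1 (m i) t) \<partial>Lper)
    = - (\<Prod>i<n. \<integral>t. (if i = j then f' i t else f i t) * trig1 (m i) t \<partial>Lper)"
proof -
  have slot: "(\<integral>t. f j t * (\<i> * of_int (m j) * trig1 (m j) t) \<partial>Lper) = - (\<integral>t. f' j t * trig1 (m j) t \<partial>Lper)"
    using w[OF j] unfolding wderiv1_def by simp
  have "(\<Prod>i<n. \<integral>t. f i t * ((if i = j then \<i> * of_int (m j) else 1) * trig1 (m i) t) \<partial>Lper)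
    = (\<integral>t. f j t * (\<i> * of_int (m j) * trig1 (m j) t) \<partial>Lper) * (\<Prod>i\<in>{..<n} - {j}. \<integral>t. f i t * trig1 (m i) t \<partial>Lper)"
    using j by (subst prod.remove[of _ j]) (auto intro!: prod.cong)
  also have "\<dots> = - (\<Prod>i<n. \<integral>t. (if i = j then f' i t else f i t) * trig1 (m i) t \<partial>Lper)"
    unfolding slot using j by (subst prod.remove[of "{..<n}" j]) (auto intro!: prod.cong)
  finally show ?thesis .
qed

lemma slater_wgradN:
  assumes w: "\<And>k. k < n \<Longrightarrow> wderiv1 (f k) (f' k)"
  shows "wgradN n (slater n (\<lambda>i. f)) (slater_grad n f f')"
  unfolding wgradN_def
proof (intro conjI allI impI)
  have L: "L2per (f k)" "L2per (f' k)" if "k < n" for k using w[OF that] wderiv1_L2 by auto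
  have "square_integrable (muN n) (slater n (\<lambda>i. f))" by (intro slater_square_integrable L)
  then show "slater n (\<lambda>i. f) \<in> borel_measurable (muN n)" "integrable (muN n) (\<lambda>x. (cmod (slater n (\<lambda>i. f) x))\<^sup>2)"
    by (auto dest: square_integrableD)
  fix j assume j: "j < n"
  have "square_integrable (muN n) (slater_grad n f f' j)" unfolding slater_grad_def
    by (intro slater_square_integrable) (use L in auto)
  then show "slater_grad n f f' j \<in> borel_measurable (muN n)" "integrable (muN n) (\<lambda>x. (cmod (slater_grad n f f' j x))\<^sup>2)"
    by (auto dest: square_integrableD)
  fix m :: "nat \<Rightarrow> int"
  let ?h = "\<lambda>i t. (if i = j then \<i> * of_int (m j) else 1) * trig1 (m i) t"
  let ?c = "complex_of_real (1 / sqrt (fact n))" and ?P = "{p. p permutes {..<n}}"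
  have h: "\<i> * of_int (m j) * trigN n m x = (\<Prod>i<n. ?h i (x i))" for x
    using j by (simp add: trigN_eq_prod prod.distrib prod.delta)
  have "(\<integral>x. slater n (\<lambda>i. f) x * (\<i> * of_int (m j) * trigN n m x) \<partial>muN n) =
    ?c * (\<Sum>p\<in>?P. of_int (sign p) * (\<Prod>i<n. \<integral>t. f (p i) t * ?h i t \<partial>Lper))"
    unfolding h by (intro integral_slater_product L L2per_trig1)
  also have "\<dots> = ?c * (\<Sum>p\<in>?P. of_int (sign p) * - (\<Prod>i<n. \<integral>t. (if i = j then f' else f) (p i) t * trig1 (m i) t \<partial>Lper))"
  proof (intro arg_cong2[where f="(*)"] refl sum.cong)
    fix p assume p: "p \<in> ?P"
    show "(\<Prod>i<n. \<integral>t. f (p i) t * ?h i t \<partial>Lper) = - (\<Prod>i<n. \<integral>t. (if i = j then f' else f) (p i) t * trig1 (m i) t \<partial>Lper)"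
      using prod_integral_trig1_by_parts[of n "\<lambda>i. f (p i)" "\<lambda>i. f' (p i)" j m] w permutes_less[of p n] j p
      by (simp add: if_distribR cong: if_cong)
  qed
  also have "\<dots> = - (\<integral>x. slater_grad n f f' j x * (\<Prod>i<n. trig1 (m i) (x i)) \<partial>muN n)"
    unfolding slater_grad_def
    by (subst integral_slater_product) (use L in \<open>auto intro: L2per_trig1[of 1, simplified] simp: sum_negf\<close>)
  finally show "(\<integral>x. slater n (\<lambda>i. f) x * (\<i> * of_int (m j) * trigN n m x) \<partial>muN n) = - (\<integral>x. slater_grad n f f' j x * trigN n m x \<partial>muN n)"
    by (simp add: trigN_eq_prod)
qed

lemma slater_antisym: "antisymN n (slater n (\<lambda>i. f))"
  unfolding antisymN_def
proof (intro allI impI AE_I2)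
  fix \<tau> x assume t: "\<tau> permutes {..<n}"
  let ?P = "{p. p permutes {..<n}}"
  have "(\<Sum>p\<in>?P. of_int (sign p) * slater_term n (\<lambda>i. f) p (x \<circ> \<tau>)) =
    (\<Sum>p\<in>?P. of_int (sign (p \<circ> \<tau>)) * slater_term n (\<lambda>i. f) (p \<circ> \<tau>) (x \<circ> \<tau>))"
    by (rule sum_permutations_compose_right[OF t])
  also have "\<dots> = (\<Sum>p\<in>?P. of_int (sign \<tau>) * (of_int (sign p) * slater_term n (\<lambda>i. f) p x))"
  proof (rule sum.cong[OF refl])
    fix p assume p: "p \<in> ?P"
    have "slater_term n (\<lambda>i. f) (p \<circ> \<tau>) (x \<circ> \<tau>) = slater_term n (\<lambda>i. f) p x" unfolding slater_term_def
      using prod.permute[OF t, of "\<lambda>k. f (p k) (x k)"] by (simp add: o_def)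
    moreover have "sign (p \<circ> \<tau>) = sign p * sign \<tau>"
      using p t by (intro sign_compose) (auto simp: permutation_permutes)
    ultimately show "of_int (sign (p \<circ> \<tau>)) * slater_term n (\<lambda>i. f) (p \<circ> \<tau>) (x \<circ> \<tau>)
        = of_int (sign \<tau>) * (of_int (sign p) * slater_term n (\<lambda>i. f) p x)"
      by simp
  qed
  finally show "slater n (\<lambda>i. f) (x \<circ> \<tau>) = of_int (sign \<tau>) * slater n (\<lambda>i. f) x"
    unfolding slater_def by (simp add: sum_distrib_left mult_ac)
qed

lemma slater_nonzero_imp_permutes:
  assumes "slater n (\<lambda>i. f) x \<noteq> 0"
  obtains p where "p permutes {..<n}" "\<And>i. i < n \<Longrightarrow> f (p i) (x i) \<noteq> 0"
proof -
  have "\<exists>p. p permutes {..<n} \<and> slater_term n (\<lambda>i. f) p x \<noteq> 0"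
    using assms unfolding slater_def by (metis (mono_tags, lifting) mem_Collect_eq mult_eq_0_iff sum.neutral)
  then show ?thesis using that by (auto simp: slater_term_def)
qed

definition disjoint_supports :: "nat \<Rightarrow> (nat \<Rightarrow> real \<Rightarrow> 'a :: mult_zero) \<Rightarrow> (nat \<Rightarrow> real \<Rightarrow> 'a) \<Rightarrow> bool" where
  "disjoint_supports n f h \<longleftrightarrow> (\<forall>k<n. \<forall>l<n. k \<noteq> l \<longrightarrow> (\<forall>t\<in>Iper. f k t * h l t = 0))"

lemma disjoint_supportsD:
  "disjoint_supports n f h \<Longrightarrow> k < n \<Longrightarrow> l < n \<Longrightarrow> k \<noteq> l \<Longrightarrow> t \<in> Iper \<Longrightarrow> f k t * h l t = 0"
  unfolding disjoint_supports_def by blast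

lemma slater_term_disjoint_eq_0:
  assumes d: "disjoint_supports n f h" and x: "\<And>i. i < n \<Longrightarrow> x i \<in> Iper"
    and pq: "p permutes {..<n}" "q permutes {..<n}" "p \<noteq> q"
  shows "cnj (slater_term n (\<lambda>i. f) p x) * slater_term n (\<lambda>i. h) q x = 0"
proof -
  obtain i where i: "p i \<noteq> q i" using pq(3) by blast
  have "i < n" using i permutes_not_in[OF pq(1), of i] permutes_not_in[OF pq(2), of i] by (cases "i < n") auto
  then have "f (p i) (x i) * h (q i) (x i) = 0" using disjoint_supportsD[OF d _ _ i] x pq permutes_less by auto
  then have "\<exists>i\<in>{..<n}. cnj (f (p i) (x i)) * h (q i) (x i) = 0" using \<open>i < n\<close> by auto
  then show ?thesis by (simp add: slater_term_def prod.distrib[symmetric])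
qed

lemma cnj_slater_mult_slater:
  "cnj (slater n f x) * slater n h x = complex_of_real (1 / fact n) *
     (\<Sum>p | p permutes {..<n}. \<Sum>q | q permutes {..<n}.
        of_int (sign p) * of_int (sign q) * (cnj (slater_term n f p x) * slater_term n h q x))"
proof -
  let ?P = "{p. p permutes {..<n}}" and ?c = "complex_of_real (1 / sqrt (fact n))"
  have "?c * ?c = complex_of_real (1 / fact n)"
    unfolding of_real_mult[symmetric] by (simp add: real_sqrt_mult_self)
  moreover have "cnj (slater n f x) * slater n h x = (?c * ?c) *
    ((\<Sum>p\<in>?P. of_int (sign p) * cnj (slater_term n f p x)) * (\<Sum>q\<in>?P. of_int (sign q) * slater_term n h q x))"
    by (simp add: slater_def)
  ultimately show ?thesis unfolding sum_product by (simp add: mult_ac)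
qed

lemma slater_disjoint_product:
  assumes d: "disjoint_supports n f h" and x: "\<And>i. i < n \<Longrightarrow> x i \<in> Iper"
  shows "cnj (slater n (\<lambda>i. f) x) * slater n (\<lambda>i. h) x =
    complex_of_real (1 / fact n) * (\<Sum>p | p permutes {..<n}. \<Prod>i<n. cnj (f (p i) (x i)) * h (p i) (x i))"
proof -
  let ?P = "{p. p permutes {..<n}}"
  have "of_int (sign p) * of_int (sign q) * (cnj (slater_term n (\<lambda>i. f) p x) * slater_term n (\<lambda>i. h) q x) =
      (if q = p then (\<Prod>i<n. cnj (f (p i) (x i)) * h (p i) (x i)) else 0)" if "p \<in> ?P" "q \<in> ?P" for p q
  proof (cases "p = q")
    case True
    have "of_int (sign p) * of_int (sign p) = (1::complex)"
      by (metis (no_types) of_int_1 of_int_mult sign_idempotent)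
    then show ?thesis using True by (simp add: slater_term_def prod.distrib)
  next
    case False
    then show ?thesis using slater_term_disjoint_eq_0[OF d, of x p q] x that by simp
  qed
  then have "cnj (slater n (\<lambda>i. f) x) * slater n (\<lambda>i. h) x = complex_of_real (1 / fact n) *
     (\<Sum>p\<in>?P. \<Sum>q\<in>?P. if q = p then (\<Prod>i<n. cnj (f (p i) (x i)) * h (p i) (x i)) else 0)"
    unfolding cnj_slater_mult_slater by simp
  also have "(\<Sum>p\<in>?P. \<Sum>q\<in>?P. if q = p then (\<Prod>i<n. cnj (f (p i) (x i)) * h (p i) (x i)) else 0)
    = (\<Sum>p\<in>?P. \<Prod>i<n. cnj (f (p i) (x i)) * h (p i) (x i))"
    using finite_permutes_lessThan by (intro sum.cong refl) (simp add: sum.delta')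
  finally show ?thesis .
qed

lemma slater_disjoint_sq_norm:
  assumes d: "disjoint_supports n f f" and x: "\<And>i. i < n \<Longrightarrow> x i \<in> Iper"
  shows "(cmod (slater n (\<lambda>i. f) x))\<^sup>2 = 1 / fact n * (\<Sum>p | p permutes {..<n}. \<Prod>i<n. (cmod (f (p i) (x i)))\<^sup>2)"
proof -
  have "complex_of_real ((cmod (slater n (\<lambda>i. f) x))\<^sup>2) = cnj (slater n (\<lambda>i. f) x) * slater n (\<lambda>i. f) x"
    by (simp add: complex_norm_square mult.commute del: of_real_power)
  also have "\<dots> = complex_of_real (1 / fact n * (\<Sum>p | p permutes {..<n}. \<Prod>i<n. (cmod (f (p i) (x i)))\<^sup>2))"
    by (subst slater_disjoint_product[OF d x]) (simp_all add: complex_norm_square mult.commute del: of_real_power)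
  finally show ?thesis by (simp only: of_real_eq_iff)
qed

lemma slater_inner:
  assumes Lf: "\<And>k. k < n \<Longrightarrow> L2per (f k)" and Lh: "\<And>k. k < n \<Longrightarrow> L2per (h k)" and d: "disjoint_supports n f h"
  shows "innerN n (slater n (\<lambda>i. f)) (slater n (\<lambda>i. h)) = (\<Prod>k<n. \<integral>t. cnj (f k t) * h k t \<partial>Lper)"
proof -
  let ?P = "{p. p permutes {..<n}}"
  have i: "integrable Lper (\<lambda>t. cnj (f (p i) t) * h (p i) t)" if "p \<in> ?P" "i < n" for p i
    using Lf Lh that permutes_less by (intro square_integrable_mult square_integrable_cnj) auto
  have term_integrable: "integrable (muN n) (\<lambda>x. \<Prod>i<n. cnj (f (p i) (x i)) * h (p i) (x i))"
    and term_integral: "(\<integral>x. (\<Prod>i<n. cnj (f (p i) (x i)) * h (p i) (x i)) \<partial>muN n) = (\<Prod>i<n. \<integral>t. cnj (f (p i) t) * h (p i) t \<partial>Lper)"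
    if "p \<in> ?P" for p
    unfolding muN_def using i[OF that] by (intro Lprod.product_integrable_prod Lprod.product_integral_prod; simp)+
  have "innerN n (slater n (\<lambda>i. f)) (slater n (\<lambda>i. h)) =
    (\<integral>x. complex_of_real (1 / fact n) * (\<Sum>p\<in>?P. \<Prod>i<n. cnj (f (p i) (x i)) * h (p i) (x i)) \<partial>muN n)"
    unfolding innerN_def
    by (intro Bochner_Integration.integral_cong refl slater_disjoint_product d) (auto simp: space_muN)
  also have "\<dots> = complex_of_real (1 / fact n) * (\<Sum>p\<in>?P. \<Prod>i<n. \<integral>t. cnj (f (p i) t) * h (p i) t \<partial>Lper)"
    using term_integrable term_integral by (simp add: Bochner_Integration.integral_sum)
  also have "(\<Sum>p\<in>?P. \<Prod>i<n. \<integral>t. cnj (f (p i) t) * h (p i) t \<partial>Lper) = (\<Sum>p\<in>?P. \<Prod>k<n. \<integral>t. cnj (f k t) * h k t \<partial>Lper)"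
    by (rule sum.cong[OF refl], drule CollectD, drule prod.permute[of _ _ "\<lambda>k. \<integral>t. cnj (f k t) * h k t \<partial>Lper"]) (simp add: o_def)
  also have "complex_of_real (1 / fact n) * (\<Sum>p\<in>?P. \<Prod>k<n. \<integral>t. cnj (f k t) * h k t \<partial>Lper) = (\<Prod>k<n. \<integral>t. cnj (f k t) * h k t \<partial>Lper)"
    by (simp add: card_permutations[of "{..<n}" n])
  finally show ?thesis .
qed

lemma sum_permutes_slot:
  fixes \<eta> :: "nat \<Rightarrow> real"
  assumes "j < n"
  shows "real n * (\<Sum>p | p permutes {..<n}. \<eta> (p j)) = fact n * (\<Sum>k<n. \<eta> k)"
proof -
  let ?P = "{p. p permutes {..<n}}"
  have "(\<Sum>p\<in>?P. \<eta> (p i)) = (\<Sum>p\<in>?P. \<eta> (p j))" if "i < n" for i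
  proof -
    have t: "Transposition.transpose i j permutes {..<n}" using that assms by (intro permutes_swap_id) auto
    show ?thesis using sum_permutations_compose_right[OF t, of "\<lambda>p. \<eta> (p i)"] by simp
  qed
  then have "real n * (\<Sum>p\<in>?P. \<eta> (p j)) = (\<Sum>i<n. \<Sum>p\<in>?P. \<eta> (p i))" by simp
  also have "\<dots> = (\<Sum>p\<in>?P. \<Sum>i<n. \<eta> (p i))" by (rule sum.swap)
  also have "\<dots> = (\<Sum>p\<in>?P. \<Sum>k<n. \<eta> k)"
    by (rule sum.cong[OF refl], drule CollectD, drule sum.permute[of _ _ \<eta>]) (simp add: o_def)
  also have "\<dots> = fact n * (\<Sum>k<n. \<eta> k)" by (simp add: card_permutations[of "{..<n}" n])
  finally show ?thesis .
qed

lemma nn_integral_prod_unit: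
  assumes I: "finite I" and L: "\<And>i. i \<in> I \<Longrightarrow> L2per (g i)" and unit: "\<And>i. i \<in> I \<Longrightarrow> (\<integral>t. (cmod (g i t))\<^sup>2 \<partial>Lper) = 1"
  shows "(\<lambda>y. \<Prod>i\<in>I. ennreal ((cmod (g i (y i)))\<^sup>2)) \<in> borel_measurable (Pi\<^sub>M I (\<lambda>_::nat. Lper))"
    "(\<integral>\<^sup>+y. (\<Prod>i\<in>I. ennreal ((cmod (g i (y i)))\<^sup>2)) \<partial>Pi\<^sub>M I (\<lambda>_::nat. Lper)) = 1"
proof -
  have m: "(\<lambda>s. ennreal ((cmod (g i s))\<^sup>2)) \<in> borel_measurable Lper" if "i \<in> I" for i
    using square_integrableD(1)[OF L[OF that]] by measurable
  then show "(\<lambda>y. \<Prod>i\<in>I. ennreal ((cmod (g i (y i)))\<^sup>2)) \<in> borel_measurable (Pi\<^sub>M I (\<lambda>_. Lper))"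
    by (intro borel_measurable_prod_ennreal measurable_compose[OF measurable_component_singleton])
  have "(\<integral>\<^sup>+y. (\<Prod>i\<in>I. ennreal ((cmod (g i (y i)))\<^sup>2)) \<partial>Pi\<^sub>M I (\<lambda>_. Lper)) = (\<Prod>i\<in>I. \<integral>\<^sup>+s. ennreal ((cmod (g i s))\<^sup>2) \<partial>Lper)"
    using m I by (intro Lprod.product_nn_integral_prod) auto
  also have "\<dots> = 1"
    using unit square_integrableD(2)[OF L] by (intro prod.neutral ballI) (subst nn_integral_eq_integral, auto)
  finally show "(\<integral>\<^sup>+y. (\<Prod>i\<in>I. ennreal ((cmod (g i (y i)))\<^sup>2)) \<partial>Pi\<^sub>M I (\<lambda>_. Lper)) = 1" .
qed

lemma slater_densN:
  assumes n: "1 \<le> n" and L: "\<And>k. k < n \<Longrightarrow> L2per (f k)" and d: "disjoint_supports n f f"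
    and unit: "\<And>k. k < n \<Longrightarrow> (\<integral>t. (cmod (f k t))\<^sup>2 \<partial>Lper) = 1" and t: "t \<in> Iper"
  shows "densN n (slater n (\<lambda>i. f)) t = ennreal (\<Sum>k<n. (cmod (f k t))\<^sup>2)"
proof -
  let ?P = "{p. p permutes {..<n}}" and ?M = "Pi\<^sub>M {1..<n} (\<lambda>_. Lper)"
  let ?c = "\<lambda>p. 1 / fact n * (cmod (f (p 0) t))\<^sup>2" and ?R = "\<lambda>p y. \<Prod>i\<in>{1..<n}. ennreal ((cmod (f (p i) (y i)))\<^sup>2)"
  have split: "{..<n} = insert 0 {1..<n}" using n by auto
  have sq: "ennreal ((cmod (slater n (\<lambda>i. f) (y(0 := t))))\<^sup>2) = (\<Sum>p\<in>?P. ennreal (?c p) * ?R p y)" if y: "y \<in> space ?M" for y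
  proof -
    have "(y(0 := t)) i \<in> Iper" if "i < n" for i using y t that by (auto simp: space_PiM PiE_def Pi_def)
    then have "(cmod (slater n (\<lambda>i. f) (y(0 := t))))\<^sup>2 = 1 / fact n * (\<Sum>p\<in>?P. \<Prod>i<n. (cmod (f (p i) ((y(0 := t)) i)))\<^sup>2)"
      by (rule slater_disjoint_sq_norm[OF d])
    also have "\<dots> = (\<Sum>p\<in>?P. ?c p * (\<Prod>i\<in>{1..<n}. (cmod (f (p i) (y i)))\<^sup>2))"
      unfolding split by (subst sum_distrib_left, intro sum.cong refl) (auto intro!: prod.cong)
    finally have "ennreal ((cmod (slater n (\<lambda>i. f) (y(0 := t))))\<^sup>2) = (\<Sum>p\<in>?P. ennreal (?c p * (\<Prod>i\<in>{1..<n}. (cmod (f (p i) (y i)))\<^sup>2)))"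
      by (simp only:) (intro sum_ennreal[symmetric] mult_nonneg_nonneg prod_nonneg, auto)
    also have "\<dots> = (\<Sum>p\<in>?P. ennreal (?c p) * ?R p y)"
      by (rule sum.cong[OF refl], subst ennreal_mult) (auto simp: prod_nonneg prod_ennreal)
    finally show ?thesis .
  qed
  have R: "?R p \<in> borel_measurable ?M" "(\<integral>\<^sup>+y. ?R p y \<partial>?M) = 1" if "p \<in> ?P" for p
    using permutes_less[of p n] that by (intro nn_integral_prod_unit L unit; auto)+
  have "(\<integral>\<^sup>+ y. ennreal ((cmod (slater n (\<lambda>i. f) (y(0 := t))))\<^sup>2) \<partial>?M) = (\<integral>\<^sup>+ y. (\<Sum>p\<in>?P. ennreal (?c p) * ?R p y) \<partial>?M)"
    by (rule nn_integral_cong[OF sq])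
  also have "\<dots> = (\<Sum>p\<in>?P. ennreal (?c p) * 1)"
    using R by (subst nn_integral_sum) (auto simp: nn_integral_cmult)
  also have "\<dots> = ennreal (1 / fact n * (\<Sum>p\<in>?P. (cmod (f (p 0) t))\<^sup>2))"
    by (simp add: sum_ennreal sum_distrib_left)
  finally have "densN n (slater n (\<lambda>i. f)) t = ennreal (real n * (1 / fact n * (\<Sum>p\<in>?P. (cmod (f (p 0) t))\<^sup>2)))"
    unfolding densN_def by (simp only:) (rule ennreal_mult[symmetric], auto intro!: divide_nonneg_nonneg sum_nonneg)
  also have "real n * (1 / fact n * (\<Sum>p\<in>?P. (cmod (f (p 0) t))\<^sup>2)) = (\<Sum>k<n. (cmod (f k t))\<^sup>2)"
    using sum_permutes_slot[of 0 n "\<lambda>k. (cmod (f k t))\<^sup>2"] n by (simp add: mult.left_commute)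
  finally show ?thesis .
qed

lemma slater_grad_sq_le:
  assumes L: "\<And>k. k < n \<Longrightarrow> L2per (f k)" "\<And>k. k < n \<Longrightarrow> L2per (f' k)"
    and unit: "\<And>k. k < n \<Longrightarrow> (\<integral>t. (cmod (f k t))\<^sup>2 \<partial>Lper) = 1"
  shows "(\<Sum>j<n. \<integral>x. (cmod (slater_grad n f f' j x))\<^sup>2 \<partial>muN n) \<le> fact n * (\<Sum>k<n. \<integral>t. (cmod (f' k t))\<^sup>2 \<partial>Lper)"
proof -
  let ?P = "{p. p permutes {..<n}}" and ?K = "\<lambda>k. \<integral>t. (cmod (f' k t))\<^sup>2 \<partial>Lper"
  have "(\<integral>x. (cmod (slater_grad n f f' j x))\<^sup>2 \<partial>muN n) \<le> 1 / real n * (fact n * (\<Sum>k<n. ?K k))" if j: "j < n" for j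
  proof -
    have "(\<integral>x. (cmod (slater_grad n f f' j x))\<^sup>2 \<partial>muN n)
      \<le> (\<Sum>p\<in>?P. \<Prod>i<n. \<integral>t. (cmod ((if i = j then f' else f) (p i) t))\<^sup>2 \<partial>Lper)"
      unfolding slater_grad_def by (rule slater_square_integrable(2)) (use L in auto)
    also have "\<dots> = (\<Sum>p\<in>?P. \<Prod>i<n. if i = j then ?K (p j) else 1)"
      using permutes_less unit by (intro sum.cong prod.cong refl) auto
    also have "\<dots> = (\<Sum>p\<in>?P. ?K (p j))" using j by (simp add: prod.delta)
    also have "\<dots> = 1 / real n * (real n * (\<Sum>p\<in>?P. ?K (p j)))" using j by simp
    finally show ?thesis unfolding sum_permutes_slot[OF j, of ?K] .
  qed
  then have "(\<Sum>j<n. \<integral>x. (cmod (slater_grad n f f' j x))\<^sup>2 \<partial>muN n) \<le> (\<Sum>j<n. 1 / real n * (fact n * (\<Sum>k<n. ?K k)))"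
    by (intro sum_mono) auto
  also have "\<dots> \<le> fact n * (\<Sum>k<n. ?K k)" by (cases "n = 0") auto
  finally show ?thesis .
qed

section \<open>Mixed states with a prescribed density\<close>

lemma cN_permute:
  assumes s: "\<sigma> permutes {..<n}"
  shows "cN n w (x \<circ> \<sigma>) = cN n w x"
proof -
  let ?g = "\<lambda>k. \<Sum>j\<in>{..<n} - {k}. w (x k, x j)"
  have "cN n w (x \<circ> \<sigma>) = (\<Sum>i<n. ?g (\<sigma> i))"
    unfolding cN_def
  proof (rule sum.cong[OF refl])
    fix i assume i: "i \<in> {..<n}"
    have "bij_betw \<sigma> ({..<n} - {i}) ({..<n} - {\<sigma> i})"
      using permutes_imp_bij[OF s] i by (intro bij_betw_DiffI) (auto simp: bij_betw_def inj_on_def)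
    from sum.reindex_bij_betw[OF this, of "\<lambda>l. w (x (\<sigma> i), x l)"]
    show "(\<Sum>j\<in>{..<n} - {i}. w ((x \<circ> \<sigma>) i, (x \<circ> \<sigma>) j)) = ?g (\<sigma> i)" by simp
  qed
  also have "\<dots> = (\<Sum>i<n. ?g i)" using sum.permute[OF s, of ?g] by (simp add: o_def)
  finally show ?thesis by (simp add: cN_def)
qed

lemma innerN_self: "innerN n \<Psi> \<Psi> = complex_of_real (\<integral>x. (cmod (\<Psi> x))\<^sup>2 \<partial>muN n)"
proof -
  have "innerN n \<Psi> \<Psi> = (\<integral>x. complex_of_real ((cmod (\<Psi> x))\<^sup>2) \<partial>muN n)"
    unfolding innerN_def complex_norm_square by (simp add: mult.commute)
  then show ?thesis by (simp only: integral_complex_of_real)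
qed

lemma energyN_le:
  assumes G: "wgradN n \<Psi> G" and unit: "innerN n \<Psi> \<Psi> = 1" and nonneg: "0 \<le> \<epsilon>" "0 \<le> S"
    and cost: "\<And>x. x \<in> space (muN n) \<Longrightarrow> \<Psi> x \<noteq> 0 \<Longrightarrow> cN n w x \<le> ennreal S"
  shows "energyN n w \<epsilon> \<Psi> G \<le> ennreal (\<epsilon> * (\<Sum>j<n. \<integral>x. (cmod (G j x))\<^sup>2 \<partial>muN n) + S)"
proof -
  let ?T = "\<lambda>x. \<epsilon> * (\<Sum>j<n. (cmod (G j x))\<^sup>2)"
  have i: "integrable (muN n) (\<lambda>x. (cmod (\<Psi> x))\<^sup>2)" "\<And>j. j < n \<Longrightarrow> integrable (muN n) (\<lambda>x. (cmod (G j x))\<^sup>2)"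
    using G unfolding wgradN_def by auto
  then have iT: "integrable (muN n) ?T" by (intro integrable_mult_right Bochner_Integration.integrable_sum) auto
  have one: "(\<integral>x. (cmod (\<Psi> x))\<^sup>2 \<partial>muN n) = 1" using unit unfolding innerN_self by (metis of_real_eq_1_iff)
  have "energyN n w \<epsilon> \<Psi> G \<le> (\<integral>\<^sup>+ x. ennreal (?T x + S * (cmod (\<Psi> x))\<^sup>2) \<partial>muN n)"
    unfolding energyN_def
  proof (rule nn_integral_mono)
    fix x assume x: "x \<in> space (muN n)"
    have "cN n w x * ennreal ((cmod (\<Psi> x))\<^sup>2) \<le> ennreal S * ennreal ((cmod (\<Psi> x))\<^sup>2)"
      using cost[OF x] by (cases "\<Psi> x = 0") (auto intro: mult_right_mono)
    then show "ennreal (?T x) + cN n w x * ennreal ((cmod (\<Psi> x))\<^sup>2) \<le> ennreal (?T x + S * (cmod (\<Psi> x))\<^sup>2)"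
      using nonneg by (simp add: ennreal_plus ennreal_mult sum_nonneg)
  qed
  also have "\<dots> = ennreal (\<integral>x. ?T x + S * (cmod (\<Psi> x))\<^sup>2 \<partial>muN n)"
    by (rule nn_integral_eq_integral) (use iT i(1) nonneg in \<open>auto intro!: AE_I2 add_nonneg_nonneg mult_nonneg_nonneg sum_nonneg\<close>)
  also have "(\<integral>x. ?T x + S * (cmod (\<Psi> x))\<^sup>2 \<partial>muN n) = (\<integral>x. ?T x \<partial>muN n) + S * (\<integral>x. (cmod (\<Psi> x))\<^sup>2 \<partial>muN n)"
    using iT i(1) by simp
  also have "(\<integral>x. ?T x \<partial>muN n) = \<epsilon> * (\<Sum>j<n. \<integral>x. (cmod (G j x))\<^sup>2 \<partial>muN n)"
    using i(2) by (subst integral_mult_right_zero, subst Bochner_Integration.integral_sum) auto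
  finally show ?thesis by (simp add: one)
qed

lemma cis_has_vector_derivative:
  assumes "(\<theta> has_real_derivative d) (at t)"
  shows "((\<lambda>t. cis (\<theta> t)) has_vector_derivative \<i> * complex_of_real d * cis (\<theta> t)) (at t)"
  unfolding has_vector_derivative_def
  by (rule has_derivative_eq_rhs[OF has_derivative_cis[OF assms[unfolded has_field_derivative_def]]])
    (auto simp: fun_eq_iff scaleR_conv_of_real)

definition unit_orbital :: "(real \<Rightarrow> real) \<Rightarrow> (real \<Rightarrow> real) \<Rightarrow> bool" where
  "unit_orbital \<phi> \<phi>' \<longleftrightarrow> C1per \<phi> \<phi>' \<and> (\<forall>t. 0 \<le> \<phi> t) \<and> (\<integral>t. (\<phi> t)\<^sup>2 \<partial>Lper) = 1"

lemma unit_orbitalD: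
  assumes "unit_orbital \<phi> \<phi>'"
  shows "C1per \<phi> \<phi>'" "0 \<le> \<phi> t" "(\<integral>t. (\<phi> t)\<^sup>2 \<partial>Lper) = 1"
  using assms unfolding unit_orbital_def by auto

text \<open>Multiplying the orbital by a phase running through its mass coordinate s produces infinitely many
  orthonormal orbitals with the same density.\<close>

definition phase_orbital :: "(real \<Rightarrow> real) \<Rightarrow> (real \<Rightarrow> real) \<Rightarrow> nat \<Rightarrow> real \<Rightarrow> complex" where
  "phase_orbital \<phi> s k t = complex_of_real (\<phi> t) * cis (2 * pi * real k * s t)"

definition phase_orbital_deriv :: "(real \<Rightarrow> real) \<Rightarrow> (real \<Rightarrow> real) \<Rightarrow> (real \<Rightarrow> real) \<Rightarrow> nat \<Rightarrow> real \<Rightarrow> complex" where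
  "phase_orbital_deriv \<phi> \<phi>' s k t = complex_of_real (\<phi>' t) * cis (2 * pi * real k * s t)
     + complex_of_real (\<phi> t) * (\<i> * complex_of_real (2 * pi * real k * (\<phi> t)\<^sup>2) * cis (2 * pi * real k * s t))"

locale mass_coordinate =
  fixes \<phi> \<phi>' s :: "real \<Rightarrow> real"
  assumes orbital: "unit_orbital \<phi> \<phi>'" and s: "\<And>t. (s has_real_derivative (\<phi> t)\<^sup>2) (at t)" and s0: "s 0 = 0"
begin

lemmas C1 = unit_orbitalD(1)[OF orbital]

lemma s_2pi: "s (2 * pi) = 1"
  using antiderivative_periodic[OF s, of 0] C1per_periodic[OF C1] C1per_cont(1)[OF C1] unit_orbitalD(3)[OF orbital]
  by (auto simp: s0 intro!: continuous_intros)

lemma s_cont: "continuous_on A s"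
  using s by (meson DERIV_isCont continuous_at_imp_continuous_on)

lemma phase_has_vector_derivative: "((\<lambda>t. cis (2 * pi * a * s t)) has_vector_derivative
    \<i> * complex_of_real (2 * pi * a * (\<phi> t)\<^sup>2) * cis (2 * pi * a * s t)) (at t)"
  by (rule cis_has_vector_derivative) (auto intro!: derivative_eq_intros s)

lemma phase_orbital_wderiv1: "wderiv1 (phase_orbital \<phi> s k) (phase_orbital_deriv \<phi> \<phi>' s k)"
proof (rule wderiv1_of_C1)
  show "(phase_orbital \<phi> s k has_vector_derivative phase_orbital_deriv \<phi> \<phi>' s k t) (at t)" for t
    using has_vector_derivative_mult[OF C1per_has_complex_derivative[OF C1] phase_has_vector_derivative[of "real k"]]
    unfolding phase_orbital_def phase_orbital_deriv_def by (simp add: add.commute)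
  show "continuous_on UNIV (phase_orbital_deriv \<phi> \<phi>' s k)" unfolding phase_orbital_deriv_def
    by (intro continuous_intros C1per_cont[OF C1] s_cont)
  show "phase_orbital \<phi> s k (2 * pi) = phase_orbital \<phi> s k 0"
    using cis_multiple_2pi[of "real k"] C1per_periodic[OF C1, of 0] by (simp add: phase_orbital_def s_2pi s0)
qed

lemma integral_phase_eq_0:
  assumes "a \<in> \<int>" "a \<noteq> 0"
  shows "(\<integral>t. complex_of_real ((\<phi> t)\<^sup>2) * cis (2 * pi * a * s t) \<partial>Lper) = 0"
proof -
  have "(\<integral>t. \<i> * complex_of_real (2 * pi * a * (\<phi> t)\<^sup>2) * cis (2 * pi * a * s t) \<partial>Lper) = cis (2 * pi * a * s (2*pi)) - cis (2 * pi * a * s 0)"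
    by (rule integral_Lper_FTC[OF phase_has_vector_derivative]) (intro continuous_intros C1per_cont[OF C1] s_cont)
  also have "\<dots> = 0" using cis_multiple_2pi[of a] assms by (simp add: s_2pi s0)
  finally have "(\<integral>t. (\<i> * complex_of_real (2 * pi * a)) * (complex_of_real ((\<phi> t)\<^sup>2) * cis (2 * pi * a * s t)) \<partial>Lper) = 0"
    by (simp add: mult_ac)
  then show ?thesis using assms(2) by (simp only: integral_mult_right_zero) simp
qed

lemma phase_orbital_inner: "(\<integral>t. cnj (phase_orbital \<phi> s k t) * phase_orbital \<phi> s l t \<partial>Lper) = (if k = l then 1 else 0)"
proof -
  let ?a = "real l - real k"
  have e: "cnj (phase_orbital \<phi> s k t) * phase_orbital \<phi> s l t = complex_of_real ((\<phi> t)\<^sup>2) * cis (2 * pi * ?a * s t)" for t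
  proof -
    have "cis (- (2 * pi * real k * s t)) * cis (2 * pi * real l * s t) = cis (2 * pi * ?a * s t)"
      by (simp add: cis_mult algebra_simps)
    then show ?thesis by (simp add: phase_orbital_def cis_cnj power2_eq_square mult_ac)
  qed
  show ?thesis
  proof (cases "k = l")
    case True
    have "(\<integral>t. complex_of_real ((\<phi> t)\<^sup>2) \<partial>Lper) = complex_of_real (\<integral>t. (\<phi> t)\<^sup>2 \<partial>Lper)" by (rule integral_complex_of_real)
    then show ?thesis unfolding e using True unit_orbitalD(3)[OF orbital] by (simp del: of_real_power)
  next
    case False
    then show ?thesis unfolding e using integral_phase_eq_0[of ?a] by simp
  qed
qed

end

lemma exists_mass_coordinate:
  assumes "unit_orbital \<phi> \<phi>'" shows "\<exists>s. mass_coordinate \<phi> \<phi>' s"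
proof -
  have "continuous_on UNIV (\<lambda>t. (\<phi> t)\<^sup>2)" by (intro continuous_intros C1per_cont[OF unit_orbitalD(1)[OF assms]])
  then obtain s where "\<And>t. (s has_real_derivative (\<phi> t)\<^sup>2) (at t)" "s 0 = 0" using continuous_antiderivative by blast
  then show ?thesis using assms by (auto simp: mass_coordinate_def)
qed

definition orbital_density :: "nat \<Rightarrow> (nat \<Rightarrow> real \<Rightarrow> real) \<Rightarrow> real \<Rightarrow> real" where
  "orbital_density n \<phi> t = (1 / real n) * (\<Sum>j<n. (\<phi> j t)\<^sup>2)"

definition slater_kinetic :: "nat \<Rightarrow> (nat \<Rightarrow> real \<Rightarrow> real) \<Rightarrow> real" where
  "slater_kinetic n \<phi>' = fact n * (\<Sum>j<n. \<integral>t. (\<phi>' j t)\<^sup>2 \<partial>Lper)"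

lemma slater_kinetic_nonneg: "0 \<le> slater_kinetic n \<phi>'"
  by (simp add: slater_kinetic_def sum_nonneg)

definition support_cost_le :: "nat \<Rightarrow> (real \<times> real \<Rightarrow> ennreal) \<Rightarrow> (nat \<Rightarrow> real \<Rightarrow> real) \<Rightarrow> real \<Rightarrow> bool" where
  "support_cost_le n w \<phi> S \<longleftrightarrow>
     0 \<le> S \<and> (\<forall>x. (\<forall>j<n. x j \<in> Iper \<and> \<phi> j (x j) \<noteq> 0) \<longrightarrow> cN n w x \<le> ennreal S)"

lemma sum_sq_disjoint:
  fixes a :: "nat \<Rightarrow> real"
  assumes "\<And>i j. i < n \<Longrightarrow> j < n \<Longrightarrow> i \<noteq> j \<Longrightarrow> a i * a j = 0"
  shows "(\<Sum>i<n. a i)\<^sup>2 = (\<Sum>i<n. (a i)\<^sup>2)"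
proof -
  have "(\<Sum>i<n. a i)\<^sup>2 = (\<Sum>i<n. \<Sum>j<n. a i * a j)" by (simp add: power2_eq_square sum_product)
  also have "\<dots> = (\<Sum>i<n. \<Sum>j<n. if j = i then (a i)\<^sup>2 else 0)"
    using assms by (intro sum.cong refl) (auto simp: power2_eq_square)
  finally show ?thesis by (simp add: sum.delta')
qed

locale orbital_system =
  fixes n :: nat and \<phi> \<phi>' :: "nat \<Rightarrow> real \<Rightarrow> real"
  assumes n_pos: "1 \<le> n" and unit: "\<And>j. j < n \<Longrightarrow> unit_orbital (\<phi> j) (\<phi>' j)" and disjoint: "disjoint_supports n \<phi> \<phi>"
begin

lemma adm_orbital_density: "adm (orbital_density n \<phi>)"
  unfolding adm_def
proof (intro conjI ballI)
  show "0 \<le> orbital_density n \<phi> t" for t by (simp add: orbital_density_def sum_nonneg)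
  have C1: "C1per (\<lambda>t. (1 / sqrt (real n)) * (\<Sum>j<n. \<phi> j t)) (\<lambda>t. (1 / sqrt (real n)) * (\<Sum>j<n. \<phi>' j t))"
    using unit unit_orbitalD(1) by (intro C1per_cmult C1per_sum) auto
  have "(1 / sqrt (real n)) * (\<Sum>j<n. \<phi> j t) = sqrt (orbital_density n \<phi> t)" if t: "t \<in> Iper" for t
  proof -
    have "orbital_density n \<phi> t = (1 / real n) * (\<Sum>j<n. \<phi> j t)\<^sup>2"
      using sum_sq_disjoint[of n "\<lambda>j. \<phi> j t"] disjoint_supportsD[OF disjoint _ _ _ t] by (simp add: orbital_density_def)
    moreover have "(\<Sum>j<n. \<phi> j t) \<ge> 0" using unit_orbitalD(2)[OF unit] by (auto intro: sum_nonneg)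
    ultimately show ?thesis by (simp add: real_sqrt_divide)
  qed
  then have "wderiv1 (\<lambda>t. complex_of_real (sqrt (orbital_density n \<phi> t))) (\<lambda>t. complex_of_real ((1 / sqrt (real n)) * (\<Sum>j<n. \<phi>' j t)))"
    by (intro wderiv1_cong[OF C1per_wderiv1[OF C1]]) (simp_all only:)
  then show "H1per (\<lambda>t. sqrt (orbital_density n \<phi> t))" by (auto simp: H1per_def)
  have "integrable Lper (\<lambda>t. (\<phi> j t)\<^sup>2)" if "j < n" for j
    by (intro integrable_Lper_cont continuous_intros C1per_cont[OF unit_orbitalD(1)[OF unit[OF that]]])
  then show "(\<integral>t. orbital_density n \<phi> t \<partial>Lper) = 1"
    unfolding orbital_density_def using unit_orbitalD(3)[OF unit] n_pos by (simp add: Bochner_Integration.integral_sum)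
qed

definition mass :: "nat \<Rightarrow> real \<Rightarrow> real" where
  "mass j = (SOME s. mass_coordinate (\<phi> j) (\<phi>' j) s)"

definition excited_orbital :: "nat \<Rightarrow> nat \<Rightarrow> real \<Rightarrow> complex" where
  "excited_orbital k j = phase_orbital (\<phi> j) (mass j) k"

definition excited_orbital_deriv :: "nat \<Rightarrow> nat \<Rightarrow> real \<Rightarrow> complex" where
  "excited_orbital_deriv k j = phase_orbital_deriv (\<phi> j) (\<phi>' j) (mass j) k"

definition state :: "nat \<Rightarrow> (nat \<Rightarrow> real) \<Rightarrow> complex" where
  "state k = slater n (\<lambda>i. excited_orbital k)"

definition state_grad :: "nat \<Rightarrow> nat \<Rightarrow> (nat \<Rightarrow> real) \<Rightarrow> complex" where
  "state_grad k = slater_grad n (excited_orbital k) (excited_orbital_deriv k)"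

text \<open>Only the ground state carries weight; the others are present because a mixed state is indexed by an infinite
  orthonormal family.\<close>

definition weight :: "nat \<Rightarrow> real" where "weight k = (if k = 0 then 1 else 0)"

lemma mass_coordinate_mass: "j < n \<Longrightarrow> mass_coordinate (\<phi> j) (\<phi>' j) (mass j)"
  unfolding mass_def by (rule someI_ex[OF exists_mass_coordinate[OF unit]])

lemma excited_orbital_wderiv1: "j < n \<Longrightarrow> wderiv1 (excited_orbital k j) (excited_orbital_deriv k j)"
  unfolding excited_orbital_def excited_orbital_deriv_def
  by (rule mass_coordinate.phase_orbital_wderiv1[OF mass_coordinate_mass])

lemma excited_orbital_L2per:
  assumes "j < n" shows "L2per (excited_orbital k j)" "L2per (excited_orbital_deriv k j)"
  using wderiv1_L2[OF excited_orbital_wderiv1[OF assms]] by auto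

lemma excited_orbital_disjoint: "disjoint_supports n (excited_orbital k) (excited_orbital l)"
  using disjoint by (auto simp: disjoint_supports_def excited_orbital_def phase_orbital_def)

lemma excited_orbital_0 [simp]:
  "excited_orbital 0 j t = complex_of_real (\<phi> j t)" "excited_orbital_deriv 0 j t = complex_of_real (\<phi>' j t)"
  by (auto simp: excited_orbital_def excited_orbital_deriv_def phase_orbital_def phase_orbital_deriv_def)

lemma state_wgradN: "wgradN n (state k) (state_grad k)"
  unfolding state_def state_grad_def by (intro slater_wgradN excited_orbital_wderiv1)

lemma state_inner: "innerN n (state k) (state l) = (if k = l then 1 else 0)"
proof -
  have "innerN n (state k) (state l) = (\<Prod>j<n. \<integral>t. cnj (excited_orbital k j t) * excited_orbital l j t \<partial>Lper)"
    unfolding state_def by (intro slater_inner excited_orbital_L2per excited_orbital_disjoint)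
  also have "\<dots> = (\<Prod>j<n. if k = l then 1 else 0)"
    unfolding excited_orbital_def by (intro prod.cong refl mass_coordinate.phase_orbital_inner[OF mass_coordinate_mass]) auto
  also have "\<dots> = (if k = l then 1 else 0)" using n_pos by (auto simp: power_0_left)
  finally show ?thesis .
qed

lemma state_0_densN:
  assumes t: "t \<in> Iper" shows "densN n (state 0) t = ennreal (real n * orbital_density n \<phi> t)"
proof -
  have "densN n (state 0) t = ennreal (\<Sum>k<n. (cmod (excited_orbital 0 k t))\<^sup>2)"
    unfolding state_def
    by (intro slater_densN n_pos excited_orbital_L2per excited_orbital_disjoint t) (auto simp: unit_orbitalD(3)[OF unit])
  then show ?thesis using n_pos by (simp add: orbital_density_def)
qed

lemma suminf_weight: "(\<Sum>k. ennreal (weight k) * c k) = c 0"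
  by (subst suminf_finite[of "{0}"]) (auto simp: weight_def)

lemma mixed_state: "mixed n (orbital_density n \<phi>) weight state state_grad"
  unfolding mixed_def
proof (intro conjI allI)
  show "0 \<le> weight k" for k by (simp add: weight_def)
  show "weight sums 1" using sums_single[of 0 "\<lambda>_. 1::real"] by (simp add: weight_def[abs_def])
  show "antisymN n (state k)" for k unfolding state_def by (rule slater_antisym)
  show "AE t in Lper. (\<Sum>k. ennreal (weight k) * densN n (state k) t) = ennreal (real n * orbital_density n \<phi> t)"
    by (rule AE_I2) (simp add: suminf_weight state_0_densN)
qed (rule state_wgradN state_inner)+

lemma cN_le_on_state_0_support:
  assumes S: "support_cost_le n w \<phi> S" and x: "x \<in> space (muN n)" "state 0 x \<noteq> 0"
  shows "cN n w x \<le> ennreal S"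
proof -
  obtain p where p: "p permutes {..<n}" "\<And>i. i < n \<Longrightarrow> excited_orbital 0 (p i) (x i) \<noteq> 0"
    using slater_nonzero_imp_permutes x(2) unfolding state_def by blast
  have ip: "inv p permutes {..<n}" by (rule permutes_inv[OF p(1)])
  have "(x \<circ> inv p) j \<in> Iper \<and> \<phi> j ((x \<circ> inv p) j) \<noteq> 0" if j: "j < n" for j
    using x(1) p(2)[OF permutes_less[OF ip j]] permutes_less[OF ip j] permutes_inverses(1)[OF p(1)]
    by (auto simp: space_muN)
  then have "cN n w (x \<circ> inv p) \<le> ennreal S" using S unfolding support_cost_le_def by blast
  then show ?thesis by (simp add: cN_permute[OF ip])
qed

lemma Feps_orbital_density_le:
  assumes S: "support_cost_le n w \<phi> S" and eps: "0 \<le> \<epsilon>"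
  shows "Feps n w \<epsilon> (orbital_density n \<phi>) \<le> ennreal (\<epsilon> * slater_kinetic n \<phi>' + S)"
proof -
  let ?kin = "\<Sum>j<n. \<integral>x. (cmod (state_grad 0 j x))\<^sup>2 \<partial>muN n"
  have "Feps n w \<epsilon> (orbital_density n \<phi>) \<le> (\<Sum>k. ennreal (weight k) * energyN n w \<epsilon> (state k) (state_grad k))"
    unfolding Feps_def by (rule INF_lower2[of "(weight, state, state_grad)"]) (use mixed_state in auto)
  also have "\<dots> = energyN n w \<epsilon> (state 0) (state_grad 0)" by (rule suminf_weight)
  also have "\<dots> \<le> ennreal (\<epsilon> * ?kin + S)"
    using S cN_le_on_state_0_support[OF S]
    by (intro energyN_le state_wgradN eps) (auto simp: state_inner support_cost_le_def)
  also have "\<dots> \<le> ennreal (\<epsilon> * slater_kinetic n \<phi>' + S)"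
  proof -
    have "?kin \<le> fact n * (\<Sum>j<n. \<integral>t. (cmod (excited_orbital_deriv 0 j t))\<^sup>2 \<partial>Lper)"
      unfolding state_grad_def
      by (intro slater_grad_sq_le excited_orbital_L2per) (auto simp: unit_orbitalD(3)[OF unit])
    then have "?kin \<le> slater_kinetic n \<phi>'" by (simp add: slater_kinetic_def)
    then show ?thesis using eps by (intro ennreal_leI add_right_mono mult_left_mono)
  qed
  finally show ?thesis .
qed

end

section \<open>Comparison of the quantum and the classical energy\<close>

abbreviation Bper :: "real measure" where "Bper \<equiv> restrict_space lborel Iper"

lemma nn_integral_Bper: "nn_integral Bper f = nn_integral Lper f"
  by (simp add: nn_integral_restrict_space nn_integral_completion)

lemma space_Bper [simp]: "space Bper = Iper" by (simp add: space_restrict_space)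

lemma Lper_to_Bper: "(\<lambda>x. x) \<in> measurable Lper Bper"
proof (rule measurable_restrict_space3)
  show "(\<lambda>x. x) \<in> measurable lebesgue lborel" by (rule measurable_completion) simp
qed auto

lemma Bper_to_borel: "(\<lambda>x. x) \<in> measurable Bper borel"
  by (rule measurable_restrict_space1) simp

lemma continuous_on_Bper_measurable:
  assumes "continuous_on Iper (f :: real \<Rightarrow> real)" shows "f \<in> borel_measurable Bper"
proof -
  have "f \<in> borel_measurable (restrict_space borel Iper)" by (rule borel_measurable_continuous_on_restrict[OF assms])
  moreover have "sets (restrict_space borel Iper) = sets Bper" by (simp add: sets_restrict_space)
  ultimately show ?thesis using measurable_cong_sets by blast
qed

lemma cN_measurable:
  assumes "assumptionA w"
  shows "cN n w \<in> borel_measurable (Pi\<^sub>M {..<n} (\<lambda>_. Bper))"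
proof -
  have w: "w \<in> borel_measurable (restrict_space borel (Iper \<times> Iper))"
    using assms by (intro borel_measurable_continuous_on_restrict) (simp add: assumptionA_def)
  have "(\<lambda>x. w (x i, x j)) \<in> borel_measurable (Pi\<^sub>M {..<n} (\<lambda>_. Bper))" if ij: "i < n" "j < n" for i j
  proof (rule measurable_compose[OF _ w], rule measurable_restrict_space2)
    show "(\<lambda>x. (x i, x j)) \<in> space (Pi\<^sub>M {..<n} (\<lambda>_. Bper)) \<rightarrow> Iper \<times> Iper"
      using ij by (auto simp: space_PiM)
    have "(\<lambda>x. x k) \<in> borel_measurable (Pi\<^sub>M {..<n} (\<lambda>_. Bper))" if "k < n" for k
      using that by (intro measurable_compose[OF measurable_component_singleton[of k "{..<n}" "\<lambda>_. Bper"] Bper_to_borel]) auto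
    then show "(\<lambda>x. (x i, x j)) \<in> borel_measurable (Pi\<^sub>M {..<n} (\<lambda>_. Bper))"
      using ij by (intro borel_measurable_Pair) auto
  qed
  then show ?thesis unfolding cN_def by (intro borel_measurable_sum) auto
qed

lemma PiM_permutes_measurable:
  assumes s: "\<sigma> permutes I"
  shows "(\<lambda>x. x \<circ> \<sigma>) \<in> measurable (Pi\<^sub>M I (\<lambda>_. M)) (Pi\<^sub>M I (\<lambda>_. M))"
proof -
  have "(\<lambda>x i. x (\<sigma> i)) \<in> measurable (Pi\<^sub>M I (\<lambda>_. M)) (Pi\<^sub>M I (\<lambda>_. M))"
  proof (rule measurable_PiM_single')
    show "(\<lambda>x. x (\<sigma> i)) \<in> measurable (Pi\<^sub>M I (\<lambda>_. M)) M" if "i \<in> I" for i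
      using that permutes_in_image[OF s] by (intro measurable_component_singleton) simp
    show "(\<lambda>x i. x (\<sigma> i)) \<in> space (Pi\<^sub>M I (\<lambda>_. M)) \<rightarrow> (\<Pi>\<^sub>E i\<in>I. space M)"
      using permutes_in_image[OF s] permutes_not_in[OF s] by (auto simp: space_PiM PiE_def Pi_def extensional_def)
  qed
  then show ?thesis by (simp add: o_def)
qed

lemma comp_permutes_in_PiE_iff:
  assumes s: "\<sigma> permutes I"
  shows "x \<circ> \<sigma> \<in> Pi\<^sub>E I A \<longleftrightarrow> x \<in> Pi\<^sub>E I (A \<circ> inv \<sigma>)"
proof -
  have "(\<forall>i\<in>I. x (\<sigma> i) \<in> A i) \<longleftrightarrow> (\<forall>i\<in>I. x i \<in> A (inv \<sigma> i))"
    using permutes_in_image[OF s] permutes_in_image[OF permutes_inv[OF s]] permutes_inverses[OF s] by metis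
  moreover have "(\<forall>i. i \<notin> I \<longrightarrow> x (\<sigma> i) = undefined) \<longleftrightarrow> (\<forall>i. i \<notin> I \<longrightarrow> x i = undefined)"
    using permutes_not_in[OF s] by metis
  ultimately show ?thesis by (auto simp: PiE_def Pi_def extensional_def)
qed

lemma distr_PiM_permutes:
  assumes M: "sigma_finite_measure M" and I: "finite I" and s: "\<sigma> permutes I"
  shows "distr (Pi\<^sub>M I (\<lambda>_. M)) (Pi\<^sub>M I (\<lambda>_. M)) (\<lambda>x. x \<circ> \<sigma>) = Pi\<^sub>M I (\<lambda>_. M)"
proof -
  interpret product_sigma_finite "\<lambda>_. M" using M by (simp add: product_sigma_finite_def)
  let ?M = "Pi\<^sub>M I (\<lambda>_. M)"
  have inv: "inv \<sigma> permutes I" by (rule permutes_inv[OF s])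
  show ?thesis
  proof (rule PiM_eqI[OF I])
    fix A assume A: "\<And>i. i \<in> I \<Longrightarrow> A i \<in> sets M"
    have S: "Pi\<^sub>E I A \<in> sets ?M" "Pi\<^sub>E I (A \<circ> inv \<sigma>) \<in> sets ?M"
      using A permutes_in_image[OF inv] by (auto intro!: sets_PiM_I_finite I)
    have "(\<lambda>x. x \<circ> \<sigma>) -` (Pi\<^sub>E I A) \<inter> space ?M = Pi\<^sub>E I (A \<circ> inv \<sigma>)"
      using sets.sets_into_space[OF S(2)] by (simp only: vimage_def comp_permutes_in_PiE_iff[OF s]) blast
    then have "emeasure (distr ?M ?M (\<lambda>x. x \<circ> \<sigma>)) (Pi\<^sub>E I A) = emeasure ?M (Pi\<^sub>E I (A \<circ> inv \<sigma>))"
      by (simp only: emeasure_distr[OF PiM_permutes_measurable[OF s] S(1)])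
    also have "\<dots> = (\<Prod>i\<in>I. emeasure M ((A \<circ> inv \<sigma>) i))"
      using A permutes_in_image[OF inv] by (intro emeasure_PiM I) auto
    also have "\<dots> = (\<Prod>i\<in>I. emeasure M (A i))"
      using prod.permute[OF inv, of "\<lambda>i. emeasure M (A i)"] by (simp add: o_def)
    finally show "emeasure (distr ?M ?M (\<lambda>x. x \<circ> \<sigma>)) (Pi\<^sub>E I A) = (\<Prod>i\<in>I. emeasure M (A i))" .
  qed simp_all
qed

lemma muN_component_measurable: "i < n \<Longrightarrow> (\<lambda>x. x i) \<in> measurable (muN n) Lper"
  unfolding muN_def by (rule measurable_component_singleton) simp

lemma antisymN_nn_integral_component:
  assumes anti: "antisymN n \<Psi>" and \<Psi> [measurable]: "\<Psi> \<in> borel_measurable (muN n)" and f: "f \<in> borel_measurable Lper"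
    and ij: "i < n" "j < n"
  shows "(\<integral>\<^sup>+x. f (x j) * ennreal ((cmod (\<Psi> x))\<^sup>2) \<partial>muN n) = (\<integral>\<^sup>+x. f (x i) * ennreal ((cmod (\<Psi> x))\<^sup>2) \<partial>muN n)"
proof -
  let ?t = "Transposition.transpose i j"
  have t: "?t permutes {..<n}" using ij by (intro permutes_swap_id) auto
  have m: "(\<lambda>x. x \<circ> ?t) \<in> measurable (muN n) (muN n)" "distr (muN n) (muN n) (\<lambda>x. x \<circ> ?t) = muN n"
    unfolding muN_def
    by (auto intro!: PiM_permutes_measurable distr_PiM_permutes t finite_measure.sigma_finite_measure[OF finite_measure_Lper])
  note [measurable] = measurable_compose[OF muN_component_measurable[OF ij(1)] f]
  have "(\<integral>\<^sup>+x. f (x i) * ennreal ((cmod (\<Psi> x))\<^sup>2) \<partial>muN n) = (\<integral>\<^sup>+x. f (x i) * ennreal ((cmod (\<Psi> x))\<^sup>2) \<partial>distr (muN n) (muN n) (\<lambda>x. x \<circ> ?t))"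
    by (simp only: m)
  also have "\<dots> = (\<integral>\<^sup>+x. f ((x \<circ> ?t) i) * ennreal ((cmod (\<Psi> (x \<circ> ?t)))\<^sup>2) \<partial>muN n)"
    by (intro nn_integral_distr m) measurable
  also have "\<dots> = (\<integral>\<^sup>+x. f (x j) * ennreal ((cmod (\<Psi> x))\<^sup>2) \<partial>muN n)"
  proof (rule nn_integral_cong_AE)
    have "AE x in muN n. \<Psi> (x \<circ> ?t) = of_int (sign ?t) * \<Psi> x" using anti t unfolding antisymN_def by blast
    then show "AE x in muN n. f ((x \<circ> ?t) i) * ennreal ((cmod (\<Psi> (x \<circ> ?t)))\<^sup>2) = f (x j) * ennreal ((cmod (\<Psi> x))\<^sup>2)"
      by (rule AE_mp) (auto intro!: AE_I2 simp: norm_mult sign_def)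
  qed
  finally show ?thesis by simp
qed

lemma nn_integral_densN:
  assumes n: "1 \<le> n" and \<Psi> [measurable]: "\<Psi> \<in> borel_measurable (muN n)" and f [measurable]: "f \<in> borel_measurable Lper"
  shows "densN n \<Psi> \<in> borel_measurable Lper"
    "ennreal (real n) * (\<integral>\<^sup>+x. f (x 0) * ennreal ((cmod (\<Psi> x))\<^sup>2) \<partial>muN n) = (\<integral>\<^sup>+t. densN n \<Psi> t * f t \<partial>Lper)"
proof -
  let ?C = "Pi\<^sub>M {1..<n} (\<lambda>_. Lper)" and ?P = "\<lambda>x. ennreal ((cmod (\<Psi> x))\<^sup>2)"
  have split: "{..<n} = insert 0 {1..<n}" using n by auto
  have "(\<lambda>(t, y). y(0 := t)) \<in> measurable (Lper \<Otimes>\<^sub>M ?C) (muN n)"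
    unfolding muN_def split case_prod_beta' by (rule measurable_fun_upd[where J="{1..<n}"]) auto
  then have "(\<lambda>z. ?P (case z of (t, y) \<Rightarrow> y(0 := t))) \<in> borel_measurable (Lper \<Otimes>\<^sub>M ?C)"
    by (rule measurable_compose) measurable
  then have slice: "(\<lambda>(t, y). ?P (y(0 := t))) \<in> borel_measurable (Lper \<Otimes>\<^sub>M ?C)"
    by (simp add: case_prod_beta')
  interpret C: sigma_finite_measure ?C by (rule Lprod.sigma_finite) simp
  have [measurable]: "(\<lambda>t. \<integral>\<^sup>+y. ?P (y(0 := t)) \<partial>?C) \<in> borel_measurable Lper"
    by (rule C.borel_measurable_nn_integral[OF slice])
  show "densN n \<Psi> \<in> borel_measurable Lper" unfolding densN_def by measurable
  have [measurable]: "(\<lambda>x. f (x 0)) \<in> borel_measurable (muN n)"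
    using n by (intro measurable_compose[OF muN_component_measurable f]) simp
  have "(\<lambda>x. f (x 0) * ?P x) \<in> borel_measurable (muN n)" by measurable
  then have "(\<integral>\<^sup>+x. f (x 0) * ?P x \<partial>muN n) = (\<integral>\<^sup>+t. (\<integral>\<^sup>+y. f t * ?P (y(0 := t)) \<partial>?C) \<partial>Lper)"
    unfolding muN_def split by (subst Lprod.product_nn_integral_insert_rev) auto
  also have "\<dots> = (\<integral>\<^sup>+t. f t * (\<integral>\<^sup>+y. ?P (y(0 := t)) \<partial>?C) \<partial>Lper)"
  proof (rule nn_integral_cong)
    fix t assume "t \<in> space Lper"
    then have "(\<lambda>y. ?P (y(0 := t))) \<in> borel_measurable ?C"
      using measurable_compose[OF measurable_Pair1'[of t Lper ?C] slice] by simp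
    then show "(\<integral>\<^sup>+y. f t * ?P (y(0 := t)) \<partial>?C) = f t * (\<integral>\<^sup>+y. ?P (y(0 := t)) \<partial>?C)" by (rule nn_integral_cmult)
  qed
  finally have "ennreal (real n) * (\<integral>\<^sup>+x. f (x 0) * ?P x \<partial>muN n)
    = (\<integral>\<^sup>+t. ennreal (real n) * (f t * (\<integral>\<^sup>+y. ?P (y(0 := t)) \<partial>?C)) \<partial>Lper)"
    by (simp only:) (rule nn_integral_cmult[symmetric], measurable)
  then show "ennreal (real n) * (\<integral>\<^sup>+x. f (x 0) * ?P x \<partial>muN n) = (\<integral>\<^sup>+t. densN n \<Psi> t * f t \<partial>Lper)"
    by (simp add: densN_def mult_ac)
qed

text \<open>The squared modulus of a mixed state with one-particle density n * rho is a coupling of rho,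
  all marginals agreeing by antisymmetry.\<close>

definition state_coupling :: "nat \<Rightarrow> (nat \<Rightarrow> real) \<Rightarrow> (nat \<Rightarrow> (nat \<Rightarrow> real) \<Rightarrow> complex) \<Rightarrow> (nat \<Rightarrow> real) measure" where
  "state_coupling n lam \<Psi> =
     distr (density (muN n) (\<lambda>x. \<Sum>k. ennreal (lam k) * ennreal ((cmod (\<Psi> k x))\<^sup>2))) (Pi\<^sub>M {..<n} (\<lambda>_. Bper)) (\<lambda>x. x)"

lemma nn_integral_state_coupling:
  assumes \<Psi> [measurable]: "\<And>k. \<Psi> k \<in> borel_measurable (muN n)" and f: "f \<in> borel_measurable (Pi\<^sub>M {..<n} (\<lambda>_. Bper))"
  shows "(\<integral>\<^sup>+x. f x \<partial>state_coupling n lam \<Psi>) = (\<Sum>k. ennreal (lam k) * (\<integral>\<^sup>+x. f x * ennreal ((cmod (\<Psi> k x))\<^sup>2) \<partial>muN n))"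
proof -
  let ?P = "\<lambda>k x. ennreal ((cmod (\<Psi> k x))\<^sup>2)" and ?D = "\<lambda>x. \<Sum>k. ennreal (lam k) * ennreal ((cmod (\<Psi> k x))\<^sup>2)"
  have id: "(\<lambda>x. x) \<in> measurable (muN n) (Pi\<^sub>M {..<n} (\<lambda>_. Bper))"
  proof (rule measurable_PiM_single'[where f="\<lambda>i x. x i"])
    show "(\<lambda>x. x i) \<in> measurable (muN n) Bper" if "i \<in> {..<n}" for i
      unfolding muN_def by (rule measurable_compose[OF measurable_component_singleton[OF that] Lper_to_Bper])
    show "(\<lambda>x i. x i) \<in> space (muN n) \<rightarrow> (\<Pi>\<^sub>E i\<in>{..<n}. space Bper)" by (simp add: space_muN)
  qed
  have fm [measurable]: "f \<in> borel_measurable (muN n)" using measurable_compose[OF id f] by simp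
  have "(\<integral>\<^sup>+x. f x \<partial>state_coupling n lam \<Psi>) = (\<integral>\<^sup>+x. f x \<partial>density (muN n) ?D)"
    unfolding state_coupling_def using id f by (intro nn_integral_distr) simp_all
  also have "\<dots> = (\<integral>\<^sup>+x. ?D x * f x \<partial>muN n)" by (intro nn_integral_density) measurable
  also have "\<dots> = (\<integral>\<^sup>+x. (\<Sum>k. ennreal (lam k) * (f x * ?P k x)) \<partial>muN n)"
    by (intro nn_integral_cong) (simp add: ennreal_suminf_multc[symmetric] mult_ac)
  also have "\<dots> = (\<Sum>k. \<integral>\<^sup>+x. ennreal (lam k) * (f x * ?P k x) \<partial>muN n)"
    by (intro nn_integral_suminf) measurable
  also have "\<dots> = (\<Sum>k. ennreal (lam k) * (\<integral>\<^sup>+x. f x * ?P k x \<partial>muN n))"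
    by (intro suminf_cong nn_integral_cmult) measurable
  finally show ?thesis .
qed

lemma mixedD:
  assumes "mixed n \<rho> lam \<Psi> G"
  shows "0 \<le> lam k" "lam sums 1" "antisymN n (\<Psi> k)" "\<Psi> k \<in> borel_measurable (muN n)"
    "(\<integral>\<^sup>+x. ennreal ((cmod (\<Psi> k x))\<^sup>2) \<partial>muN n) = 1"
    "AE t in Lper. (\<Sum>k. ennreal (lam k) * densN n (\<Psi> k) t) = ennreal (real n * \<rho> t)"
proof -
  show "0 \<le> lam k" "lam sums 1" "antisymN n (\<Psi> k)" "\<Psi> k \<in> borel_measurable (muN n)"
    "AE t in Lper. (\<Sum>k. ennreal (lam k) * densN n (\<Psi> k) t) = ennreal (real n * \<rho> t)"
    using assms by (auto simp: mixed_def wgradN_def)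
  have "integrable (muN n) (\<lambda>x. (cmod (\<Psi> k x))\<^sup>2)" "innerN n (\<Psi> k) (\<Psi> k) = 1"
    using assms by (auto simp: mixed_def wgradN_def)
  then show "(\<integral>\<^sup>+x. ennreal ((cmod (\<Psi> k x))\<^sup>2) \<partial>muN n) = 1"
    unfolding innerN_self of_real_eq_1_iff by (subst nn_integral_eq_integral) auto
qed

lemma nn_integral_state_coupling_component:
  assumes mix: "mixed n \<rho> lam \<Psi> G" and \<rho> [measurable]: "\<rho> \<in> borel_measurable Lper" and f: "f \<in> borel_measurable Bper" and j: "j < n"
  shows "(\<integral>\<^sup>+x. f (x j) \<partial>state_coupling n lam \<Psi>) = (\<integral>\<^sup>+t. ennreal (\<rho> t) * f t \<partial>Lper)"
proof -
  have n: "1 \<le> n" using j by simp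
  note m = mixedD[OF mix]
  have fL [measurable]: "f \<in> borel_measurable Lper" using measurable_compose[OF Lper_to_Bper f] by simp
  note dens = nn_integral_densN[OF n m(4) fL]
  have "(\<lambda>x. f (x j)) \<in> borel_measurable (Pi\<^sub>M {..<n} (\<lambda>_. Bper))"
    using j by (intro measurable_compose[OF _ f] measurable_component_singleton) auto
  then have "(\<integral>\<^sup>+x. f (x j) \<partial>state_coupling n lam \<Psi>) = (\<Sum>k. ennreal (lam k) * (\<integral>\<^sup>+x. f (x 0) * ennreal ((cmod (\<Psi> k x))\<^sup>2) \<partial>muN n))"
    using n by (subst nn_integral_state_coupling[OF m(4)])
      (auto intro!: suminf_cong arg_cong2[where f="(*)"] antisymN_nn_integral_component[OF m(3,4) fL _ j])
  then have "ennreal (real n) * (\<integral>\<^sup>+x. f (x j) \<partial>state_coupling n lam \<Psi>)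
    = (\<Sum>k. ennreal (lam k) * (ennreal (real n) * (\<integral>\<^sup>+x. f (x 0) * ennreal ((cmod (\<Psi> k x))\<^sup>2) \<partial>muN n)))"
    by (simp only: ennreal_suminf_cmult[symmetric] mult.left_commute)
  also have "\<dots> = (\<Sum>k. \<integral>\<^sup>+t. ennreal (lam k) * (densN n (\<Psi> k) t * f t) \<partial>Lper)"
    unfolding dens(2) using dens(1)
    by (intro suminf_cong nn_integral_cmult[symmetric] borel_measurable_times_ennreal fL)
  also have "\<dots> = (\<integral>\<^sup>+t. (\<Sum>k. ennreal (lam k) * (densN n (\<Psi> k) t * f t)) \<partial>Lper)"
    using dens(1) by (intro nn_integral_suminf[symmetric] borel_measurable_times_ennreal fL borel_measurable_const)
  also have "\<dots> = (\<integral>\<^sup>+t. (\<Sum>k. ennreal (lam k) * densN n (\<Psi> k) t) * f t \<partial>Lper)"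
    by (simp only: mult.assoc[symmetric] ennreal_suminf_multc)
  also have "\<dots> = (\<integral>\<^sup>+t. ennreal (real n) * (ennreal (\<rho> t) * f t) \<partial>Lper)"
    by (rule nn_integral_cong_AE, rule AE_mp[OF m(6)]) (auto intro!: AE_I2 simp: ennreal_mult' mult_ac)
  also have "\<dots> = ennreal (real n) * (\<integral>\<^sup>+t. ennreal (\<rho> t) * f t \<partial>Lper)" by (intro nn_integral_cmult) measurable
  finally show ?thesis using n by (simp add: ennreal_mult_cancel_left)
qed

lemma coupling_state_coupling:
  assumes mix: "mixed n \<rho> lam \<Psi> G" and \<rho>: "continuous_on Iper \<rho>"
  shows "coupling n \<rho> (state_coupling n lam \<Psi>)"
  unfolding coupling_def
proof (intro conjI allI impI)
  note m = mixedD[OF mix]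
  have [measurable]: "\<rho> \<in> borel_measurable Bper" by (rule continuous_on_Bper_measurable[OF \<rho>])
  show sets: "sets (state_coupling n lam \<Psi>) = sets (Pi\<^sub>M {..<n} (\<lambda>_. Bper))" by (simp add: state_coupling_def)
  show "prob_space (state_coupling n lam \<Psi>)"
  proof
    have "(\<Sum>k. ennreal (lam k)) = 1"
      using suminf_ennreal2[OF m(1) sums_summable[OF m(2)]] sums_unique[OF m(2)] by simp
    moreover have "(\<integral>\<^sup>+x. 1 \<partial>state_coupling n lam \<Psi>) = (\<Sum>k. ennreal (lam k))"
      by (subst nn_integral_state_coupling[OF m(4)]) (auto simp: m(5))
    ultimately show "emeasure (state_coupling n lam \<Psi>) (space (state_coupling n lam \<Psi>)) = 1" by simp
  qed
  fix j assume j: "j < n"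
  have component: "(\<lambda>x. x j) \<in> measurable (state_coupling n lam \<Psi>) Bper"
    unfolding measurable_cong_sets[OF sets refl] using j by (intro measurable_component_singleton) simp
  show "distr (state_coupling n lam \<Psi>) Bper (\<lambda>x. x j) = density Bper (\<lambda>t. ennreal (\<rho> t))"
  proof (rule measure_eqI)
    fix E assume "E \<in> sets (distr (state_coupling n lam \<Psi>) Bper (\<lambda>x. x j))"
    then have E [measurable]: "E \<in> sets Bper" by simp
    have "emeasure (distr (state_coupling n lam \<Psi>) Bper (\<lambda>x. x j)) E = (\<integral>\<^sup>+t. indicator E t \<partial>distr (state_coupling n lam \<Psi>) Bper (\<lambda>x. x j))"
      by simp
    also have "\<dots> = (\<integral>\<^sup>+x. indicator E (x j) \<partial>state_coupling n lam \<Psi>)"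
      using component by (intro nn_integral_distr) auto
    also have "\<dots> = (\<integral>\<^sup>+t. ennreal (\<rho> t) * indicator E t \<partial>Lper)"
      by (intro nn_integral_state_coupling_component[OF mix _ _ j] measurable_Lper_cont[OF \<rho>]) measurable
    also have "\<dots> = emeasure (density Bper (\<lambda>t. ennreal (\<rho> t))) E"
      by (simp add: emeasure_density nn_integral_Bper)
    finally show "emeasure (distr (state_coupling n lam \<Psi>) Bper (\<lambda>x. x j)) E = emeasure (density Bper (\<lambda>t. ennreal (\<rho> t))) E" .
  qed simp
qed

lemma FOT_le_Feps:
  assumes assumption_A: "assumptionA w" and \<rho>: "continuous_on Iper \<rho>"
  shows "FOT n w \<rho> \<le> Feps n w \<epsilon> \<rho>"
  unfolding Feps_def
proof (rule INF_greatest)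
  fix st assume "st \<in> {(lam, \<Psi>, G). mixed n \<rho> lam \<Psi> G}"
  then obtain lam \<Psi> G where st: "st = (lam, \<Psi>, G)" and mix: "mixed n \<rho> lam \<Psi> G" by auto
  have "FOT n w \<rho> \<le> (\<integral>\<^sup>+x. cN n w x \<partial>state_coupling n lam \<Psi>)"
    unfolding FOT_def using coupling_state_coupling[OF mix \<rho>] by (intro INF_lower) simp
  also have "\<dots> = (\<Sum>k. ennreal (lam k) * (\<integral>\<^sup>+x. cN n w x * ennreal ((cmod (\<Psi> k x))\<^sup>2) \<partial>muN n))"
    by (rule nn_integral_state_coupling[OF mixedD(4)[OF mix] cN_measurable[OF assumption_A]])
  also have "\<dots> \<le> (\<Sum>k. ennreal (lam k) * energyN n w \<epsilon> (\<Psi> k) (G k))"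
    unfolding energyN_def by (intro suminf_le mult_left_mono nn_integral_mono) auto
  finally show "FOT n w \<rho> \<le> (case st of (lam, \<Psi>, G) \<Rightarrow> \<Sum>k. ennreal (lam k) * energyN n w \<epsilon> (\<Psi> k) (G k))" by (simp add: st)
qed

section \<open>The distance on the circle\<close>

lemma distT_le: "distT t \<le> \<bar>t - 2 * pi * real_of_int k\<bar>"
  unfolding distT_def by (rule cInf_lower) (auto intro!: bdd_belowI[of _ 0])

lemma distT_le_abs: "distT t \<le> \<bar>t\<bar>"
  using distT_le[of t 0] by simp

lemma distT_eq:
  assumes s: "\<bar>t - 2 * pi * real_of_int k\<bar> \<le> pi"
  shows "distT t = \<bar>t - 2 * pi * real_of_int k\<bar>"
  unfolding distT_def
proof (rule cInf_eq_minimum)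
  show "\<bar>t - 2 * pi * real_of_int k\<bar> \<in> {\<bar>t - 2 * pi * real_of_int k\<bar> | k. True}" by blast
  fix x assume "x \<in> {\<bar>t - 2 * pi * real_of_int k\<bar> | k. True}"
  then obtain j :: int where x: "x = \<bar>t - 2 * pi * real_of_int j\<bar>" by auto
  show "\<bar>t - 2 * pi * real_of_int k\<bar> \<le> x"
  proof (cases "j = k")
    case True then show ?thesis by (simp add: x)
  next
    case False
    then have "\<bar>real_of_int k - real_of_int j\<bar> \<ge> 1" by linarith
    then have "2 * pi * \<bar>real_of_int k - real_of_int j\<bar> \<ge> 2 * pi * 1" by (intro mult_left_mono) auto
    then have "\<bar>2 * pi * (real_of_int k - real_of_int j)\<bar> \<ge> 2 * pi" by (simp add: abs_mult)
    moreover have "t - 2 * pi * real_of_int j = (t - 2 * pi * real_of_int k) + 2 * pi * (real_of_int k - real_of_int j)"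
      by (simp add: algebra_simps)
    ultimately show ?thesis using s x by linarith
  qed
qed

lemma distT_attained:
  obtains k :: int where "distT t = \<bar>t - 2 * pi * real_of_int k\<bar>" "\<bar>t - 2 * pi * real_of_int k\<bar> \<le> pi"
proof -
  define k where "k = round (t / (2 * pi))"
  have "\<bar>of_int k - t / (2 * pi)\<bar> \<le> 1/2" unfolding k_def by (rule of_int_round_abs_le)
  then have "\<bar>t / (2 * pi) - of_int k\<bar> * (2 * pi) \<le> (1/2) * (2 * pi)" by (intro mult_right_mono) (auto simp: abs_minus_commute)
  moreover have "\<bar>t / (2 * pi) - of_int k\<bar> * (2 * pi) = \<bar>t - 2 * pi * of_int k\<bar>"
    using abs_mult_pos[of "2 * pi" "t / (2 * pi) - of_int k"] by (simp add: field_simps)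
  ultimately have "\<bar>t - 2 * pi * of_int k\<bar> \<le> pi" by simp
  then show ?thesis using that distT_eq by blast
qed

lemma distT_arccos: "distT t = arccos (cos t)"
proof -
  obtain k where k: "distT t = \<bar>t - 2 * pi * real_of_int k\<bar>" "\<bar>t - 2 * pi * real_of_int k\<bar> \<le> pi" by (rule distT_attained)
  have "cos t = cos \<bar>t - 2 * pi * real_of_int k\<bar>" using periodic_int[of cos t "- k"] by simp
  then show ?thesis using arccos_cos[OF abs_ge_zero k(2)] k(1) by (simp del: cos_abs_real)
qed

lemma distT_nonneg: "0 \<le> distT t"
  unfolding distT_arccos by (auto intro: arccos_lbound)

lemma distT_0 [simp]: "distT 0 = 0"
  by (simp add: distT_arccos)

lemma distT_periodic: "distT (t + 2 * pi * of_int k) = distT t"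
  by (rule periodic_int) (simp add: distT_arccos)

lemma distT_commute: "distT (x - y) = distT (y - x)"
  unfolding distT_arccos using cos_minus[of "x - y"] by simp

lemma distT_add_le: "distT (x + y) \<le> distT x + distT y"
proof -
  obtain k l where "distT x = \<bar>x - 2 * pi * real_of_int k\<bar>" "distT y = \<bar>y - 2 * pi * real_of_int l\<bar>"
    using distT_attained by metis
  moreover have "distT (x + y) \<le> \<bar>x + y - 2 * pi * real_of_int (k + l)\<bar>" by (rule distT_le)
  moreover have "x + y - 2 * pi * real_of_int (k + l) = (x - 2 * pi * real_of_int k) + (y - 2 * pi * real_of_int l)"
    by (simp add: algebra_simps)
  ultimately show ?thesis by linarith
qed

lemma distT_triangle: "distT (x - z) \<le> distT (x - y) + distT (y - z)"
  using distT_add_le[of "x - y" "y - z"] by simp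

lemma distT_triangle4: "distT (a - b) \<le> distT (x - a) + distT (x - y) + distT (y - b)"
  using distT_triangle[of a b x] distT_triangle[of x b y] by (simp add: distT_commute[of a x])

lemma distT_perturb:
  assumes "a \<le> distT (x - y)" "\<bar>x' - x\<bar> \<le> a / 4" "\<bar>y' - y\<bar> \<le> a / 4"
  shows "a / 2 \<le> distT (x' - y')"
  using distT_triangle4[of x y x' y'] distT_le_abs[of "x' - x"] distT_le_abs[of "y' - y"] assms by linarith

lemma continuous_on_distT:
  fixes f :: "'a::t2_space \<Rightarrow> real"
  shows "continuous_on A f \<Longrightarrow> continuous_on A (\<lambda>x. distT (f x))"
  unfolding distT_arccos by (intro continuous_intros) (auto simp: abs_le_iff)

lemma distT_less_iff_cos:
  assumes "0 \<le> b" "b \<le> pi" shows "distT t < b \<longleftrightarrow> cos b < cos t"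
  using arccos_less_mono[of "cos t" "cos b"] arccos_cos[of b] assms by (simp add: distT_arccos abs_le_iff)

lemma distT_multiple_ge:
  assumes "0 < m" "real j * m \<le> 2 * pi - m" "j \<ge> 1"
  shows "m \<le> distT (real j * m)"
proof -
  obtain k where k: "distT (real j * m) = \<bar>real j * m - 2 * pi * real_of_int k\<bar>" by (rule distT_attained)
  have jm: "m \<le> real j * m" using assms by simp
  show ?thesis
  proof (cases "k \<le> 0")
    case True
    then have "2 * pi * real_of_int k \<le> 0" by (simp add: mult_le_0_iff)
    then show ?thesis using k jm assms by linarith
  next
    case False
    then have "2 * pi * 1 \<le> 2 * pi * real_of_int k" by (intro mult_left_mono) auto
    then show ?thesis using k assms by linarith
  qed
qed

section \<open>The cost away from coincidences\<close>

lemma compact_continuous_preimage: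
  fixes f :: "'a::t2_space \<Rightarrow> 'b::topological_space"
  assumes "compact K" "continuous_on K f" "closed T"
  shows "compact (K \<inter> f -` T)"
proof -
  have "closed (K \<inter> f -` T)" by (rule continuous_closed_preimage[OF assms(2) compact_imp_closed[OF assms(1)] assms(3)])
  then have "compact (K \<inter> (K \<inter> f -` T))" by (rule compact_Int_closed[OF assms(1)])
  then show ?thesis by simp
qed

definition separated_pairs :: "real \<Rightarrow> (real \<times> real) set" where
  "separated_pairs a = {p \<in> Iper \<times> Iper. a \<le> distT (fst p - snd p)}"

lemma compact_separated_pairs: "compact (separated_pairs a)"
proof -
  have "compact (Iper \<times> Iper \<inter> (\<lambda>p. distT (fst p - snd p)) -` {a..})"
    by (intro compact_continuous_preimage compact_Times compact_Iper continuous_on_distT continuous_intros closed_atLeast)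
  moreover have "separated_pairs a = Iper \<times> Iper \<inter> (\<lambda>p. distT (fst p - snd p)) -` {a..}" by (auto simp: separated_pairs_def)
  ultimately show ?thesis by simp
qed

locale cost =
  fixes n :: nat and w :: "real \<times> real \<Rightarrow> ennreal"
  assumes n_pos: "1 \<le> n" and assumption_A: "assumptionA w"
begin

lemma w_sym: "x \<in> Iper \<Longrightarrow> y \<in> Iper \<Longrightarrow> w (x, y) = w (y, x)"
  using assumption_A by (simp add: assumptionA_def)

lemma w_cont: "continuous_on (Iper \<times> Iper) w"
  using assumption_A by (simp add: assumptionA_def)

lemma w_eq_top_iff:
  assumes "x \<in> Iper" "y \<in> Iper" shows "w (x, y) = top \<longleftrightarrow> distT (x - y) = 0"
proof -
  have "{p \<in> Iper \<times> Iper. w p = \<infinity>} = {(x, y) \<in> Iper \<times> Iper. distT (x - y) = 0}"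
    using assumption_A by (simp add: assumptionA_def)
  then have "(x, y) \<in> {p \<in> Iper \<times> Iper. w p = \<infinity>} \<longleftrightarrow> (x, y) \<in> {(x, y) \<in> Iper \<times> Iper. distT (x - y) = 0}"
    by (simp only:)
  then show ?thesis using assms by (simp add: infinity_ennreal_def)
qed

lemma w_less_top: "x \<in> Iper \<Longrightarrow> y \<in> Iper \<Longrightarrow> 0 < distT (x - y) \<Longrightarrow> w (x, y) < top"
  using w_eq_top_iff[of x y] by (auto simp: less_top)

lemma continuous_on_enn2real_w:
  assumes a: "0 < a" shows "continuous_on (separated_pairs a) (\<lambda>p. enn2real (w p))"
  unfolding continuous_on_def
proof
  fix p assume p: "p \<in> separated_pairs a"
  have "continuous_on (separated_pairs a) w"
    by (rule continuous_on_subset[OF w_cont]) (auto simp: separated_pairs_def)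
  moreover have "w p < top" using w_less_top[of "fst p" "snd p"] p a by (auto simp: separated_pairs_def)
  then have "w p = ennreal (enn2real (w p))" by simp
  ultimately have "(w \<longlongrightarrow> ennreal (enn2real (w p))) (at p within separated_pairs a)"
    using p by (simp add: continuous_on_def)
  then show "((\<lambda>p. enn2real (w p)) \<longlongrightarrow> enn2real (w p)) (at p within separated_pairs a)"
    by (rule tendsto_enn2real) simp
qed

lemma w_bounded_separated:
  assumes a: "0 < a"
  obtains W where "0 \<le> W" "\<And>x y. x \<in> Iper \<Longrightarrow> y \<in> Iper \<Longrightarrow> a \<le> distT (x - y) \<Longrightarrow> w (x, y) \<le> ennreal W"
proof -
  have "bounded ((\<lambda>p. enn2real (w p)) ` separated_pairs a)"
    by (rule compact_imp_bounded[OF compact_continuous_image[OF continuous_on_enn2real_w[OF a] compact_separated_pairs]])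
  then obtain B where B: "\<And>p. p \<in> separated_pairs a \<Longrightarrow> \<bar>enn2real (w p)\<bar> \<le> B" by (auto simp: bounded_iff)
  show ?thesis
  proof (rule that[of "max B 0"])
    fix x y assume xy: "x \<in> Iper" "y \<in> Iper" "a \<le> distT (x - y)"
    have "w (x, y) = ennreal (enn2real (w (x, y)))" using w_less_top[of x y] xy a by simp
    also have "\<dots> \<le> ennreal (max B 0)" using B[of "(x, y)"] xy by (intro ennreal_leI) (auto simp: separated_pairs_def)
    finally show "w (x, y) \<le> ennreal (max B 0)" .
  qed simp
qed

lemma separated_of_w_le:
  obtains a where "0 < a" "\<And>x y. x \<in> Iper \<Longrightarrow> y \<in> Iper \<Longrightarrow> w (x, y) \<le> ennreal C \<Longrightarrow> a \<le> distT (x - y)"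
proof -
  define T where "T = Iper \<times> Iper \<inter> w -` {..ennreal C}"
  have cT: "compact T" unfolding T_def
    by (intro compact_continuous_preimage compact_Times compact_Iper w_cont) simp
  show ?thesis
  proof (cases "T = {}")
    case True
    show ?thesis by (rule that[of 1]) (use True in \<open>auto simp: T_def\<close>)
  next
    case False
    have cd: "continuous_on T (\<lambda>p. distT (fst p - snd p))" by (intro continuous_on_distT continuous_intros)
    obtain p where p: "p \<in> T" "\<And>q. q \<in> T \<Longrightarrow> distT (fst p - snd p) \<le> distT (fst q - snd q)"
      using continuous_attains_inf[OF cT False cd] by blast
    have "w (fst p, snd p) \<noteq> top" using p(1) by (auto simp: T_def top_unique)
    then have "0 < distT (fst p - snd p)"
      using w_eq_top_iff[of "fst p" "snd p"] p(1) distT_nonneg[of "fst p - snd p"] by (auto simp: T_def)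
    then show ?thesis
      by (rule that) (use p(2) in \<open>force simp: T_def\<close>)
  qed
qed

lemma w_le_cN: assumes "i < n" "j < n" "i \<noteq> j" shows "w (x i, x j) \<le> cN n w x"
proof -
  have "w (x i, x j) \<le> (\<Sum>j\<in>{..<n} - {i}. w (x i, x j))"
    using assms by (intro member_le_sum) auto
  also have "\<dots> \<le> cN n w x" unfolding cN_def
    using assms by (intro member_le_sum[where f="\<lambda>i. \<Sum>j\<in>{..<n} - {i}. w (x i, x j)"]) auto
  finally show ?thesis .
qed

definition configs :: "(nat \<Rightarrow> real) set" where
  "configs = {x. \<forall>i<n. x i \<in> Iper}"

definition separated_configs :: "real \<Rightarrow> (nat \<Rightarrow> real) set" where
  "separated_configs a = {x \<in> configs. \<forall>i<n. \<forall>j<n. i \<noteq> j \<longrightarrow> a \<le> distT (x i - x j)}"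

definition distinct_configs :: "(nat \<Rightarrow> real) set" where
  "distinct_configs = {x \<in> configs. \<forall>i<n. \<forall>j<n. i \<noteq> j \<longrightarrow> 0 < distT (x i - x j)}"

definition real_cost :: "(nat \<Rightarrow> real) \<Rightarrow> real" where
  "real_cost x = (\<Sum>i<n. \<Sum>j\<in>{..<n} - {i}. enn2real (w (x i, x j)))"

lemma configsD: "x \<in> configs \<Longrightarrow> i < n \<Longrightarrow> x i \<in> Iper"
  by (simp add: configs_def)

lemma distinct_configsD: "x \<in> distinct_configs \<Longrightarrow> i < n \<Longrightarrow> x i \<in> Iper"
  by (simp add: distinct_configs_def configsD)

lemma distinct_configs_subset: "distinct_configs \<subseteq> configs"
  by (auto simp: distinct_configs_def)

lemma separated_configs_subset: "separated_configs a \<subseteq> configs"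
  by (auto simp: separated_configs_def)

lemma separated_configsD: "x \<in> separated_configs a \<Longrightarrow> i < n \<Longrightarrow> j < n \<Longrightarrow> i \<noteq> j \<Longrightarrow> a \<le> distT (x i - x j)"
  unfolding separated_configs_def by blast

lemma separated_configs_distinct: "0 < a \<Longrightarrow> x \<in> separated_configs a \<Longrightarrow> x \<in> distinct_configs"
  by (fastforce simp: separated_configs_def distinct_configs_def)

lemma distinct_config_separated:
  assumes x: "x \<in> distinct_configs" obtains a where "0 < a" "x \<in> separated_configs a"
proof -
  define D where "D = insert 1 ((\<lambda>p. distT (x (fst p) - x (snd p))) ` {p \<in> {..<n} \<times> {..<n}. fst p \<noteq> snd p})"
  have D: "finite D" "D \<noteq> {}" by (auto simp: D_def)
  show ?thesis
  proof (rule that[of "Min D"])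
    show "0 < Min D" using x D by (auto simp: D_def distinct_configs_def)
    have "distT (x i - x j) \<in> D" if "i < n" "j < n" "i \<noteq> j" for i j
      using that by (force simp: D_def)
    then show "x \<in> separated_configs (Min D)" using x D(1) distinct_configs_subset
      by (auto simp: separated_configs_def intro!: Min_le)
  qed
qed

lemma real_cost_nonneg: "0 \<le> real_cost x"
  unfolding real_cost_def by (intro sum_nonneg) auto

lemma cN_eq_real_cost: assumes x: "x \<in> distinct_configs" shows "cN n w x = ennreal (real_cost x)"
proof -
  have "cN n w x = (\<Sum>i<n. \<Sum>j\<in>{..<n} - {i}. ennreal (enn2real (w (x i, x j))))"
    unfolding cN_def using x w_less_top by (intro sum.cong refl) (auto simp: distinct_configs_def configs_def)
  also have "\<dots> = ennreal (real_cost x)" unfolding real_cost_def by (simp add: sum_ennreal sum_nonneg)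
  finally show ?thesis .
qed

lemma cN_eq_top: assumes x: "x \<in> configs" "x \<notin> distinct_configs" shows "cN n w x = top"
proof -
  obtain i j where ij: "i < n" "j < n" "i \<noteq> j" "\<not> 0 < distT (x i - x j)" using x by (auto simp: distinct_configs_def)
  then have "w (x i, x j) = top"
    using distT_nonneg[of "x i - x j"] w_eq_top_iff configsD[OF x(1)] by auto
  then show ?thesis using w_le_cN[OF ij(1,2,3), of x] by (simp add: top_unique)
qed

lemma cN_bounded_separated:
  assumes a: "0 < a"
  obtains S where "0 \<le> S" "\<And>x. x \<in> separated_configs a \<Longrightarrow> cN n w x \<le> ennreal S"
proof -
  obtain W where W: "0 \<le> W" "\<And>x y. x \<in> Iper \<Longrightarrow> y \<in> Iper \<Longrightarrow> a \<le> distT (x - y) \<Longrightarrow> w (x, y) \<le> ennreal W"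
    using w_bounded_separated[OF a] by metis
  show ?thesis
  proof (rule that[of "real n * (real n * W)"])
    fix x assume x: "x \<in> separated_configs a"
    have "cN n w x \<le> (\<Sum>i<n. \<Sum>j\<in>{..<n} - {i}. ennreal W)"
      unfolding cN_def using x by (intro sum_mono W) (auto simp: separated_configs_def configs_def)
    also have "\<dots> \<le> (\<Sum>i<n. \<Sum>j<n. ennreal W)" by (intro sum_mono sum_mono2) auto
    also have "\<dots> = ennreal (real n * (real n * W))" using W(1) by (simp add: ennreal_mult ennreal_of_nat_eq_real_of_nat)
    finally show "cN n w x \<le> ennreal (real n * (real n * W))" .
  qed (use W in simp)
qed

lemma separated_of_real_cost_le:
  obtains a where "0 < a" "\<And>x. x \<in> distinct_configs \<Longrightarrow> real_cost x \<le> C \<Longrightarrow> x \<in> separated_configs a"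
proof -
  obtain a where a: "0 < a" "\<And>x y. x \<in> Iper \<Longrightarrow> y \<in> Iper \<Longrightarrow> w (x, y) \<le> ennreal C \<Longrightarrow> a \<le> distT (x - y)"
    using separated_of_w_le by metis
  show ?thesis
  proof (rule that[OF a(1)])
    fix x assume x: "x \<in> distinct_configs" "real_cost x \<le> C"
    have "w (x i, x j) \<le> ennreal C" if "i < n" "j < n" "i \<noteq> j" for i j
      using w_le_cN[OF that, of x] ennreal_leI[OF x(2)] by (simp add: cN_eq_real_cost[OF x(1)])
    then show "x \<in> separated_configs a"
      using a(2) x(1) distinct_configsD[OF x(1)] by (auto simp: separated_configs_def distinct_configs_def)
  qed
qed

lemma w_uniformly_continuous:
  assumes a: "0 < a" and e: "0 < e"
  obtains d where "0 < d" "d \<le> a / 4" "\<And>x x' y y'. x \<in> Iper \<Longrightarrow> x' \<in> Iper \<Longrightarrow> y \<in> Iper \<Longrightarrow> y' \<in> Iper \<Longrightarrow> a \<le> distT (x - y) \<Longrightarrow>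
    \<bar>x' - x\<bar> < d \<Longrightarrow> \<bar>y' - y\<bar> < d \<Longrightarrow> \<bar>enn2real (w (x', y')) - enn2real (w (x, y))\<bar> < e"
proof -
  have "uniformly_continuous_on (separated_pairs (a/2)) (\<lambda>p. enn2real (w p))"
    by (rule compact_uniformly_continuous[OF continuous_on_enn2real_w compact_separated_pairs]) (use a in simp)
  then obtain d where d: "0 < d" "\<And>p q. p \<in> separated_pairs (a/2) \<Longrightarrow> q \<in> separated_pairs (a/2) \<Longrightarrow> dist q p < d \<Longrightarrow> dist (enn2real (w q)) (enn2real (w p)) < e"
    using e unfolding uniformly_continuous_on_def by metis
  show ?thesis
  proof (rule that[of "min (d/2) (a/4)"])
    fix x x' y y'
    assume h: "x \<in> Iper" "x' \<in> Iper" "y \<in> Iper" "y' \<in> Iper" "a \<le> distT (x - y)"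
      "\<bar>x' - x\<bar> < min (d/2) (a/4)" "\<bar>y' - y\<bar> < min (d/2) (a/4)"
    have "a / 2 \<le> distT (x' - y')" by (rule distT_perturb[OF h(5)]) (use h in auto)
    moreover have "dist (x', y') (x, y) < d"
    proof -
      have "dist (x', y') (x, y) \<le> dist x' x + dist y' y"
        unfolding dist_Pair_Pair by (rule sqrt_sum_squares_le_sum) auto
      then show ?thesis using h by (simp add: dist_real_def)
    qed
    ultimately have "dist (enn2real (w (x', y'))) (enn2real (w (x, y))) < e"
      using h a by (intro d) (auto simp: separated_pairs_def)
    then show "\<bar>enn2real (w (x', y')) - enn2real (w (x, y))\<bar> < e" by (simp add: dist_real_def)
  qed (use d a in auto)
qed

lemma real_cost_uniformly_continuous:
  assumes a: "0 < a" and e: "0 < e"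
  obtains d where "0 < d" "\<And>x y. x \<in> separated_configs a \<Longrightarrow> y \<in> configs \<Longrightarrow> (\<And>i. i < n \<Longrightarrow> \<bar>y i - x i\<bar> < d) \<Longrightarrow>
     y \<in> separated_configs (a / 2) \<and> \<bar>real_cost y - real_cost x\<bar> < e"
proof -
  define e' where "e' = e / (real n * real n + 1)"
  have e': "0 < e'" using e by (simp add: e'_def add_nonneg_pos)
  obtain d where d: "0 < d" "d \<le> a / 4" "\<And>x x' y y'. x \<in> Iper \<Longrightarrow> x' \<in> Iper \<Longrightarrow> y \<in> Iper \<Longrightarrow> y' \<in> Iper \<Longrightarrow> a \<le> distT (x - y) \<Longrightarrow>
    \<bar>x' - x\<bar> < d \<Longrightarrow> \<bar>y' - y\<bar> < d \<Longrightarrow> \<bar>enn2real (w (x', y')) - enn2real (w (x, y))\<bar> < e'"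
    using w_uniformly_continuous[OF a e'] by metis
  show ?thesis
  proof (rule that[OF d(1)])
    fix x y assume x: "x \<in> separated_configs a" and y: "y \<in> configs" and xy: "\<And>i. i < n \<Longrightarrow> \<bar>y i - x i\<bar> < d"
    note I = configsD[OF subsetD[OF separated_configs_subset x]] configsD[OF y]
    have sep: "y \<in> separated_configs (a / 2)"
      unfolding separated_configs_def
    proof (intro CollectI conjI y allI impI)
      fix i j assume ij: "i < n" "j < n" "i \<noteq> j"
      show "a / 2 \<le> distT (y i - y j)"
        using xy[OF ij(1)] xy[OF ij(2)] d(2) by (intro distT_perturb[OF separated_configsD[OF x ij]]) linarith+
    qed
    have "\<bar>real_cost y - real_cost x\<bar> \<le> (\<Sum>i<n. \<Sum>j\<in>{..<n} - {i}. \<bar>enn2real (w (y i, y j)) - enn2real (w (x i, x j))\<bar>)"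
      unfolding real_cost_def sum_subtractf[symmetric] by (intro order_trans[OF sum_abs] sum_mono) (auto intro: sum_abs)
    also have "\<dots> \<le> (\<Sum>i<n. \<Sum>j\<in>{..<n} - {i}. e')"
      using I xy separated_configsD[OF x] by (intro sum_mono less_imp_le[OF d(3)]) auto
    also have "\<dots> \<le> (\<Sum>i<n. \<Sum>j<n. e')" using e' by (intro sum_mono sum_mono2) auto
    also have "\<dots> = real n * real n * e'" by simp
    also have "\<dots> < (real n * real n + 1) * e'" using e' by simp
    also have "\<dots> = e" unfolding e'_def by (simp add: add_nonneg_eq_0_iff)
    finally show "y \<in> separated_configs (a / 2) \<and> \<bar>real_cost y - real_cost x\<bar> < e" using sep by blast
  qed
qed

definition separated_supports :: "real \<Rightarrow> (nat \<Rightarrow> real \<Rightarrow> real) \<Rightarrow> bool" where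
  "separated_supports a \<phi> \<longleftrightarrow>
     (\<forall>i<n. \<forall>j<n. i \<noteq> j \<longrightarrow> (\<forall>x\<in>Iper. \<forall>y\<in>Iper. \<phi> i x \<noteq> 0 \<longrightarrow> \<phi> j y \<noteq> 0 \<longrightarrow> a \<le> distT (x - y)))"

lemma orbital_system_separated:
  assumes "0 < a" "separated_supports a \<phi>" "\<And>j. j < n \<Longrightarrow> unit_orbital (\<phi> j) (\<phi>' j)"
  shows "orbital_system n \<phi> \<phi>'"
proof
  show "disjoint_supports n \<phi> \<phi>"
    using assms(1,2) unfolding disjoint_supports_def separated_supports_def
    by (metis diff_self distT_0 mult_eq_0_iff not_le)
qed (use n_pos assms(3) in auto)

lemma support_cost_le_separated:
  assumes "separated_supports a \<phi>" "0 \<le> S" "\<And>x. x \<in> separated_configs a \<Longrightarrow> cN n w x \<le> ennreal S"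
  shows "support_cost_le n w \<phi> S"
  unfolding support_cost_le_def
proof (intro conjI allI impI)
  fix x assume "\<forall>j<n. x j \<in> Iper \<and> \<phi> j (x j) \<noteq> 0"
  then have "x \<in> separated_configs a"
    using assms(1) unfolding separated_configs_def configs_def separated_supports_def by blast
  then show "cN n w x \<le> ennreal S" by (rule assms(3))
qed (rule assms(2))

text \<open>The only consequence of minimality that is used: it makes sense for \<open>\<epsilon> = 0\<close>, hence for limits of potentials.\<close>

definition slater_bound :: "real \<Rightarrow> ((real \<Rightarrow> real) \<Rightarrow> real) \<Rightarrow> bool" where
  "slater_bound \<epsilon> V \<longleftrightarrow> (\<forall>\<phi> \<phi>' S. orbital_system n \<phi> \<phi>' \<longrightarrow> support_cost_le n w \<phi> S \<longrightarrow>
     (\<Sum>j<n. V (\<lambda>t. (\<phi> j t)\<^sup>2)) \<le> \<epsilon> * slater_kinetic n \<phi>' + S)"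

lemma slater_boundD:
  "slater_bound \<epsilon> V \<Longrightarrow> orbital_system n \<phi> \<phi>' \<Longrightarrow> support_cost_le n w \<phi> S \<Longrightarrow>
     (\<Sum>j<n. V (\<lambda>t. (\<phi> j t)\<^sup>2)) \<le> \<epsilon> * slater_kinetic n \<phi>' + S"
  unfolding slater_bound_def by blast

end

section \<open>Partitions of unity on the circle\<close>

lemma integral_mass_coordinate:
  assumes G: "\<And>t. (G has_real_derivative g t) (at t)" and cg: "continuous_on UNIV g"
    and G0: "G 0 = 0" and G1: "G (2 * pi) = 1"
    and P: "continuous_on UNIV P" "\<And>t. P (t + 2 * pi) = P t"
  shows "(\<integral>t. g t * P (2 * pi * G t - a) \<partial>Lper) = 1 / (2 * pi) * (\<integral>t. P t \<partial>Lper)"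
proof -
  obtain Q where Q: "\<And>t. (Q has_real_derivative P t) (at t)" using continuous_antiderivative[OF P(1)] by metis
  have cG: "continuous_on UNIV G" using G by (meson DERIV_isCont continuous_at_imp_continuous_on)
  have d: "((\<lambda>t. 1 / (2 * pi) * Q (2 * pi * G t - a)) has_real_derivative g t * P (2 * pi * G t - a)) (at t)" for t
  proof -
    have "((\<lambda>t. Q (2 * pi * G t - a)) has_real_derivative P (2 * pi * G t - a) * (2 * pi * g t)) (at t)"
      by (rule DERIV_chain2[OF Q]) (auto intro!: derivative_eq_intros G)
    from DERIV_cmult[OF this, of "1 / (2 * pi)"] show ?thesis by (simp add: mult_ac)
  qed
  have "(\<integral>t. g t * P (2 * pi * G t - a) \<partial>Lper) = 1 / (2 * pi) * Q (2 * pi * G (2 * pi) - a) - 1 / (2 * pi) * Q (2 * pi * G 0 - a)"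
    by (rule integral_Lper_FTC)
      (use d in \<open>auto simp: has_real_derivative_iff_has_vector_derivative[symmetric] intro!: continuous_intros cg cG continuous_on_compose2[OF P(1)]\<close>)
  also have "\<dots> = 1 / (2 * pi) * (Q (- a + 2 * pi) - Q (- a))" by (simp only: G0 G1) (simp add: algebra_simps)
  also have "Q (- a + 2 * pi) - Q (- a) = (\<integral>t. P t \<partial>Lper)" using antiderivative_periodic[OF Q P(2) P(1), of "- a"] by simp
  finally show ?thesis .
qed

lemma integral_Lper_shift:
  assumes P: "continuous_on UNIV P" "\<And>t. P (t + 2 * pi) = P t"
  shows "(\<integral>t. P (t - a) \<partial>Lper) = (\<integral>t. P t \<partial>Lper :: real)"
proof -
  have "(\<integral>t. (1 / (2 * pi)) * P (2 * pi * (t / (2 * pi)) - a) \<partial>Lper) = 1 / (2 * pi) * (\<integral>t. P t \<partial>Lper)"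
    by (rule integral_mass_coordinate[OF _ _ _ _ P]) (auto intro!: derivative_eq_intros continuous_intros)
  then show ?thesis by simp
qed

definition cos_bump :: "real \<Rightarrow> real \<Rightarrow> real" where
  "cos_bump b t = (max 0 (cos t - cos b))\<^sup>2"

definition cos_bump_deriv :: "real \<Rightarrow> real \<Rightarrow> real" where
  "cos_bump_deriv b t = 2 * max 0 (cos t - cos b) * (- sin t)"

lemma DERIV_pos_part_sq: "((\<lambda>y. (max 0 y)\<^sup>2) has_real_derivative 2 * max 0 y) (at (y::real))"
proof (cases y "0::real" rule: linorder_cases)
  case less
  have "((\<lambda>y. 0) has_real_derivative 2 * max 0 y) (at y)" using less by simp
  then show ?thesis
    by (rule has_field_derivative_transform_within_open[where S="{..<0}"]) (use less in auto)
next
  case greater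
  have "((\<lambda>y. y\<^sup>2) has_real_derivative 2 * max 0 y) (at y)" using greater by (auto intro!: derivative_eq_intros)
  then show ?thesis
    by (rule has_field_derivative_transform_within_open[where S="{0<..}"]) (use greater in auto)
next
  case equal
  have "((\<lambda>h. ((max 0 (0 + h))\<^sup>2 - (max 0 0)\<^sup>2) / h) \<longlongrightarrow> 0) (at (0::real))"
  proof (rule Lim_null_comparison[where g="\<lambda>h. \<bar>h\<bar>"])
    show "\<forall>\<^sub>F h in at (0::real). norm (((max 0 (0 + h))\<^sup>2 - (max 0 0)\<^sup>2) / h) \<le> \<bar>h\<bar>"
      by (rule always_eventually) (auto simp: max_def power2_eq_square)
    show "((\<lambda>h. \<bar>h\<bar>) \<longlongrightarrow> 0) (at (0::real))" by (rule tendsto_eq_intros | simp)+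
  qed
  then show ?thesis unfolding equal DERIV_def by simp
qed

lemma cos_bump_C1per: "C1per (cos_bump b) (cos_bump_deriv b)"
  unfolding C1per_def
proof (intro conjI allI)
  fix t
  have "((\<lambda>t. (max 0 (cos t - cos b))\<^sup>2) has_real_derivative 2 * max 0 (cos t - cos b) * (- sin t)) (at t)"
    by (rule DERIV_chain2[OF DERIV_pos_part_sq]) (auto intro!: derivative_eq_intros)
  then show "(cos_bump b has_real_derivative cos_bump_deriv b t) (at t)" unfolding cos_bump_def cos_bump_deriv_def .
  show "continuous_on UNIV (cos_bump_deriv b)" unfolding cos_bump_deriv_def by (intro continuous_intros)
  show "cos_bump b (t + 2 * pi) = cos_bump b t" by (simp add: cos_bump_def)
qed

lemma cos_bump_nonneg: "0 \<le> cos_bump b t"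
  by (simp add: cos_bump_def)

lemma cos_bump_nonzero_iff: "0 \<le> b \<Longrightarrow> b \<le> pi \<Longrightarrow> cos_bump b t \<noteq> 0 \<longleftrightarrow> distT t < b"
  by (auto simp: distT_less_iff_cos cos_bump_def)

definition grid_angle :: "nat \<Rightarrow> nat \<Rightarrow> real" where
  "grid_angle N i = 2 * pi * real i / real N"

definition window_radius :: "nat \<Rightarrow> real" where
  "window_radius N = 4 * pi / (3 * real N)"

definition bump_sq_sum :: "nat \<Rightarrow> real \<Rightarrow> real" where
  "bump_sq_sum N t = (\<Sum>i<N. (cos_bump (window_radius N) (t - grid_angle N i))\<^sup>2)"

definition window :: "nat \<Rightarrow> nat \<Rightarrow> real \<Rightarrow> real" where
  "window N i t = cos_bump (window_radius N) (t - grid_angle N i) / sqrt (bump_sq_sum N t)"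

lemma grid_angle_0 [simp]: "grid_angle N 0 = 0"
  by (simp add: grid_angle_def)

lemma window_radius_bounds: assumes "2 \<le> N" shows "0 < window_radius N" "window_radius N \<le> pi"
proof -
  have N: "real N \<ge> 2" using assms by simp
  then have "4 * pi \<le> pi * (3 * real N)" using pi_gt_zero by simp
  then show "0 < window_radius N" "window_radius N \<le> pi" using N by (auto simp: window_radius_def divide_le_eq)
qed

lemma exists_near_grid_angle:
  assumes N: "1 \<le> N" obtains i where "i < N" "distT (t - grid_angle N i) \<le> pi / real N"
proof -
  have N0: "real N > 0" using N by simp
  define j where "j = round (t * real N / (2 * pi))"
  define i where "i = nat (j mod int N)"
  define q where "q = j div int N"
  have jm: "0 \<le> j mod int N" "j mod int N < int N" using N by auto
  then have i: "i < N" by (simp add: i_def nat_less_iff)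
  have "j = int i + int N * q" using jm by (simp add: i_def q_def)
  then have j: "real_of_int j = real i + real N * real_of_int q" by simp
  have "\<bar>of_int j - t * real N / (2 * pi)\<bar> \<le> 1/2" unfolding j_def by (rule of_int_round_abs_le)
  then have "\<bar>of_int j - t * real N / (2 * pi)\<bar> * (2 * pi / real N) \<le> 1/2 * (2 * pi / real N)"
    using N0 by (intro mult_right_mono) auto
  then have "\<bar>(of_int j - t * real N / (2 * pi)) * (2 * pi / real N)\<bar> \<le> pi / real N"
    using N0 by (simp only: abs_mult) simp
  moreover have "(of_int j - t * real N / (2 * pi)) * (2 * pi / real N) = - ((t - grid_angle N i) - 2 * pi * of_int q)"
    using N0 by (simp add: j grid_angle_def field_simps)
  ultimately have "\<bar>(t - grid_angle N i) - 2 * pi * of_int q\<bar> \<le> pi / real N" by (simp only: abs_minus_cancel)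
  then show ?thesis using that[OF i] distT_le[of "t - grid_angle N i" q] by linarith
qed

lemma bump_sq_sum_pos: assumes N: "2 \<le> N" shows "0 < bump_sq_sum N t"
proof -
  obtain i where i: "i < N" "distT (t - grid_angle N i) \<le> pi / real N" using exists_near_grid_angle[of N t] N by auto
  have "pi / real N < window_radius N" using N by (simp add: window_radius_def field_simps)
  then have "cos_bump (window_radius N) (t - grid_angle N i) \<noteq> 0"
    using window_radius_bounds[OF N] i(2) by (subst cos_bump_nonzero_iff) auto
  then have "0 < (cos_bump (window_radius N) (t - grid_angle N i))\<^sup>2" by simp
  also have "\<dots> \<le> bump_sq_sum N t" unfolding bump_sq_sum_def using i(1) by (intro member_le_sum) auto
  finally show ?thesis .
qed

lemma bump_sq_sum_C1per: "\<exists>Z'. C1per (bump_sq_sum N) Z'"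
  unfolding bump_sq_sum_def[abs_def]
  by (rule exI, rule C1per_sum, simp, rule C1per_sq[OF C1per_shift[OF cos_bump_C1per]])

lemma window_C1per: assumes N: "2 \<le> N" shows "\<exists>f'. C1per (window N i) f'"
proof -
  obtain Z' where Z': "C1per (bump_sq_sum N) Z'" using bump_sq_sum_C1per by blast
  have "sqrt (bump_sq_sum N t) \<noteq> 0" for t using bump_sq_sum_pos[OF N, of t] by simp
  from C1per_mult[OF C1per_shift[OF cos_bump_C1per] C1per_inverse[OF C1per_sqrt[OF Z' bump_sq_sum_pos[OF N]] this]]
  show ?thesis unfolding window_def[abs_def] divide_inverse by blast
qed

lemma window_cont: "2 \<le> N \<Longrightarrow> continuous_on A (window N i)"
  using window_C1per C1per_cont(1) by blast

lemma window_nonneg: "2 \<le> N \<Longrightarrow> 0 \<le> window N i t"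
  using bump_sq_sum_pos[of N t] by (simp add: window_def cos_bump_nonneg less_imp_le)

lemma window_nonzero_iff: "2 \<le> N \<Longrightarrow> window N i t \<noteq> 0 \<longleftrightarrow> distT (t - grid_angle N i) < window_radius N"
  using window_radius_bounds[of N] bump_sq_sum_pos[of N t]
  by (simp add: window_def cos_bump_nonzero_iff[symmetric] less_imp_le)

lemma window_sq_sum: assumes N: "2 \<le> N" shows "(\<Sum>i<N. (window N i t)\<^sup>2) = 1"
proof -
  have "(\<Sum>i<N. (window N i t)\<^sup>2) = (\<Sum>i<N. (cos_bump (window_radius N) (t - grid_angle N i))\<^sup>2 / bump_sq_sum N t)"
    using bump_sq_sum_pos[OF N, of t] by (simp add: window_def power_divide)
  also have "\<dots> = bump_sq_sum N t / bump_sq_sum N t" unfolding sum_divide_distrib[symmetric] bump_sq_sum_def[of N t, symmetric] ..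
  finally show ?thesis using bump_sq_sum_pos[OF N, of t] by simp
qed

lemma window_sq_le_one: assumes "2 \<le> N" "i < N" shows "(window N i t)\<^sup>2 \<le> 1"
  using member_le_sum[of i "{..<N}" "\<lambda>i. (window N i t)\<^sup>2"] window_sq_sum[OF assms(1)] assms(2) by simp

lemma bump_sq_sum_shift: assumes N: "1 \<le> N" shows "bump_sq_sum N (t - grid_angle N i) = bump_sq_sum N t"
proof (induction i)
  case (Suc i)
  let ?b = "\<lambda>s j. (cos_bump (window_radius N) (s - grid_angle N j))\<^sup>2"
  have wrap: "?b s N = ?b s 0" for s
    using C1per_periodic[OF cos_bump_C1per, of "window_radius N" "s - 2 * pi"] N by (simp add: grid_angle_def)
  have "bump_sq_sum N (t - grid_angle N (Suc i)) = (\<Sum>j<N. ?b (t - grid_angle N i) (Suc j))"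
    unfolding bump_sq_sum_def using N by (simp add: grid_angle_def field_simps)
  also have "\<dots> = (\<Sum>j<Suc N. ?b (t - grid_angle N i) j) - ?b (t - grid_angle N i) 0"
    by (simp only: sum.lessThan_Suc_shift add_diff_cancel_left')
  also have "\<dots> = bump_sq_sum N (t - grid_angle N i)"
    unfolding bump_sq_sum_def by (simp add: wrap del: grid_angle_0)
  finally show ?case using Suc by simp
qed simp

lemma window_shift: "2 \<le> N \<Longrightarrow> window N i t = window N 0 (t - grid_angle N i)"
  by (simp add: window_def bump_sq_sum_shift)

lemma integral_window_sq:
  assumes N: "2 \<le> N" shows "(\<integral>t. (window N 0 t)\<^sup>2 \<partial>Lper) = 2 * pi / real N"
proof -
  have c: "continuous_on B (\<lambda>t. (window N i t)\<^sup>2)" for i B by (intro continuous_intros window_cont N)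
  obtain W' where "C1per (window N 0) W'" using window_C1per[OF N] by blast
  then have "(window N 0 (t + 2 * pi))\<^sup>2 = (window N 0 t)\<^sup>2" for t by (simp add: C1per_def)
  then have "(\<integral>t. (window N i t)\<^sup>2 \<partial>Lper) = (\<integral>t. (window N 0 t)\<^sup>2 \<partial>Lper)" for i
    unfolding window_shift[OF N, of i] by (rule integral_Lper_shift[OF c])
  then have "(\<Sum>i<N. \<integral>t. (window N i t)\<^sup>2 \<partial>Lper) = (\<Sum>i<N. \<integral>t. (window N 0 t)\<^sup>2 \<partial>Lper)"
    by (intro sum.cong refl)
  then have "real N * (\<integral>t. (window N 0 t)\<^sup>2 \<partial>Lper) = (\<Sum>i<N. \<integral>t. (window N i t)\<^sup>2 \<partial>Lper)" by simp
  also have "\<dots> = (\<integral>t. (\<Sum>i<N. (window N i t)\<^sup>2) \<partial>Lper)"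
    by (rule Bochner_Integration.integral_sum[symmetric]) (intro integrable_Lper_cont c)
  also have "\<dots> = 2 * pi" by (simp add: window_sq_sum[OF N] measure_Lper)
  finally show ?thesis using N by (simp add: field_simps)
qed

section \<open>Energy bound for densities bounded above and below\<close>

definition H1_linear :: "((real \<Rightarrow> real) \<Rightarrow> real) \<Rightarrow> bool" where
  "H1_linear V \<longleftrightarrow> (\<forall>f h a b. H1per f \<longrightarrow> H1per h \<longrightarrow> V (\<lambda>t. a * f t + b * h t) = a * V f + b * V h)"

lemma H1_linearD: "H1_linear V \<Longrightarrow> H1per f \<Longrightarrow> H1per h \<Longrightarrow> V (\<lambda>t. a * f t + b * h t) = a * V f + b * V h"
  unfolding H1_linear_def by blast

lemma H1_linear_cmult: "H1_linear V \<Longrightarrow> H1per f \<Longrightarrow> V (\<lambda>t. c * f t) = c * V f"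
  using H1_linearD[of V f f c 0] by simp

lemma H1_linear_diff: "H1_linear V \<Longrightarrow> H1per f \<Longrightarrow> H1per h \<Longrightarrow> V (\<lambda>t. f t - h t) = V f - V h"
  using H1_linearD[of V f h 1 "-1"] by simp

lemma H1_linear_sum:
  assumes V: "H1_linear V" and "finite A" and f: "\<And>i. i \<in> A \<Longrightarrow> H1per (f i)"
  shows "H1per (\<lambda>t. \<Sum>i\<in>A. c i * f i t) \<and> V (\<lambda>t. \<Sum>i\<in>A. c i * f i t) = (\<Sum>i\<in>A. c i * V (f i))"
  using assms(2) f
proof (induction rule: finite_induct)
  case empty
  show ?case using H1_linear_cmult[OF V H1per_const, of 0 0] by (simp add: H1per_const)
next
  case (insert x F)
  then have IH: "H1per (\<lambda>t. \<Sum>i\<in>F. c i * f i t)" "V (\<lambda>t. \<Sum>i\<in>F. c i * f i t) = (\<Sum>i\<in>F. c i * V (f i))" and fx: "H1per (f x)"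
    by auto
  show ?case using H1per_lin[OF fx IH(1), of "c x" 1] H1_linearD[OF V fx IH(1), of "c x" 1] IH(2) insert by simp
qed

lemma grid_angle_parity_class_separated:
  assumes n: "1 \<le> n" and jk: "j < n" "k < n" "j \<noteq> k"
  shows "2 * pi / real n \<le> distT (grid_angle (2 * n) (2 * j + r) - grid_angle (2 * n) (2 * k + r))"
proof -
  have n0: "real n > 0" using n by simp
  have "2 * pi / real n \<le> distT (grid_angle (2 * n) (2 * j + r) - grid_angle (2 * n) (2 * k + r))" if "j < n" "k < j" for j k
  proof -
    have "grid_angle (2 * n) (2 * j + r) - grid_angle (2 * n) (2 * k + r) = real (j - k) * (2 * pi / real n)"
      using that n0 by (simp add: grid_angle_def of_nat_diff field_simps)
    moreover have "(real (j - k) + 1) * (2 * pi / real n) \<le> real n * (2 * pi / real n)"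
      using n0 that by (intro mult_right_mono) (auto simp: of_nat_diff)
    then have "real (j - k) * (2 * pi / real n) \<le> 2 * pi - 2 * pi / real n" using n0 by (simp add: algebra_simps add_divide_distrib)
    ultimately show ?thesis using n0 that by (simp only:) (intro distT_multiple_ge, auto)
  qed
  then show ?thesis using jk distT_commute by (metis nat_neq_iff)
qed

text \<open>The density is cut into 2n windows of equal mass, equally spaced in the mass coordinate \<open>2 * pi * G\<close>;
  the n windows of equal parity are separated, and each such class is the density of one Slater determinant.\<close>

locale density_windows = cost +
  fixes g g' G W' :: "real \<Rightarrow> real" and m M \<Lambda> :: real
  assumes g_C1per: "C1per g g'" and G_deriv: "\<And>t. (G has_real_derivative g t) (at t)" and G_0: "G 0 = 0"
    and integral_g: "(\<integral>t. g t \<partial>Lper) = 1" and m_pos: "0 < m" and g_bounds: "\<And>t. m \<le> g t" "\<And>t. g t \<le> M"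
    and W'_C1per: "C1per (window (2 * n) 0) W'" and W'_bound: "\<And>t. \<bar>W' t\<bar> \<le> \<Lambda>"
begin

lemma two_le_2n: "2 \<le> 2 * n"
  using n_pos by simp

lemma g_pos: "0 < g t"
  using g_bounds(1)[of t] m_pos by linarith

lemma M_pos: "0 < M"
  using g_bounds(2)[of 0] g_pos[of 0] by linarith

lemma G_cont: "continuous_on A G"
  using G_deriv by (meson DERIV_isCont continuous_at_imp_continuous_on)

lemma G_periodic: "G (t + 2 * pi) = G t + 1"
  using antiderivative_periodic[OF G_deriv C1per_periodic[OF g_C1per] C1per_cont(1)[OF g_C1per]] integral_g by simp

lemma G_periodic_int: "G (t + 2 * pi * of_int k) = G t + of_int k"
  using periodic_int[of "\<lambda>t. G t - t / (2 * pi)" t k] by (simp add: G_periodic add_divide_distrib)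

lemma G_lipschitz: "\<bar>G a - G b\<bar> \<le> M * \<bar>a - b\<bar>"
  using field_differentiable_bound[of UNIV G g M a b] G_deriv g_bounds(2) g_pos by (auto intro: less_imp_le simp: abs_of_pos)

lemma mass_coordinate_lipschitz_circle: "distT (2 * pi * G x - 2 * pi * G y) \<le> 2 * pi * M * distT (x - y)"
proof -
  obtain k where k: "distT (x - y) = \<bar>x - y - 2 * pi * real_of_int k\<bar>" by (rule distT_attained)
  have "distT (2 * pi * G x - 2 * pi * G y) \<le> \<bar>2 * pi * G x - 2 * pi * G y - 2 * pi * of_int k\<bar>" by (rule distT_le)
  also have "\<dots> = \<bar>2 * pi * (G x - G (y + 2 * pi * of_int k))\<bar>"
    unfolding G_periodic_int by (simp add: algebra_simps)
  also have "\<dots> \<le> 2 * pi * (M * \<bar>x - (y + 2 * pi * of_int k)\<bar>)"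
    using G_lipschitz[of x "y + 2 * pi * of_int k"] by (simp add: abs_mult)
  also have "\<dots> = 2 * pi * M * distT (x - y)" by (simp add: k diff_diff_eq)
  finally show ?thesis .
qed

definition mass_window :: "nat \<Rightarrow> real \<Rightarrow> real" where
  "mass_window i t = window (2 * n) 0 (2 * pi * G t - grid_angle (2 * n) i)"

definition mass_window_deriv :: "nat \<Rightarrow> real \<Rightarrow> real" where
  "mass_window_deriv i t = W' (2 * pi * G t - grid_angle (2 * n) i) * (2 * pi * g t)"

definition piece :: "nat \<Rightarrow> real \<Rightarrow> real" where
  "piece i t = sqrt (real (2 * n)) * (sqrt (g t) * mass_window i t)"

definition piece_deriv :: "nat \<Rightarrow> real \<Rightarrow> real" where
  "piece_deriv i t = sqrt (real (2 * n)) * ((inverse (sqrt (g t)) / 2 * g' t) * mass_window i t + sqrt (g t) * mass_window_deriv i t)"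

lemma mass_window_eq: "mass_window i t = window (2 * n) i (2 * pi * G t)"
  by (simp add: mass_window_def window_shift[OF two_le_2n, of i])

lemma mass_window_C1per: "C1per (mass_window i) (mass_window_deriv i)"
  unfolding C1per_def
proof (intro conjI allI)
  fix t
  show "(mass_window i has_real_derivative mass_window_deriv i t) (at t)" unfolding mass_window_def mass_window_deriv_def
    by (rule DERIV_chain2[where f="window (2 * n) 0"]) (use W'_C1per in \<open>auto simp: C1per_def intro!: derivative_eq_intros G_deriv\<close>)
  show "continuous_on UNIV (mass_window_deriv i)" unfolding mass_window_deriv_def
    by (intro continuous_intros continuous_on_compose2[OF C1per_cont(2)[OF W'_C1per, of UNIV]] C1per_cont[OF g_C1per] G_cont) auto
  have "2 * pi * G (t + 2 * pi) - grid_angle (2 * n) i = 2 * pi * G t - grid_angle (2 * n) i + 2 * pi"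
    by (simp only: G_periodic) (simp add: algebra_simps)
  then show "mass_window i (t + 2 * pi) = mass_window i t" by (simp only: mass_window_def C1per_periodic[OF W'_C1per])
qed

lemma piece_C1per: "C1per (piece i) (piece_deriv i)"
  unfolding piece_def piece_deriv_def by (intro C1per_cmult C1per_mult C1per_sqrt g_C1per g_pos mass_window_C1per)

lemma piece_sq: "(piece i t)\<^sup>2 = real (2 * n) * (g t * (mass_window i t)\<^sup>2)"
  using g_pos[of t] by (simp add: piece_def power_mult_distrib less_imp_le)

lemma piece_unit_orbital: "unit_orbital (piece i) (piece_deriv i)"
  unfolding unit_orbital_def
proof (intro conjI allI)
  show "0 \<le> piece i t" for t
    unfolding piece_def mass_window_eq using window_nonneg[OF two_le_2n] g_pos[of t] by (simp add: less_imp_le)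
  have "(\<integral>t. g t * (window (2 * n) 0 (2 * pi * G t - grid_angle (2 * n) i))\<^sup>2 \<partial>Lper) = 1 / (2 * pi) * (\<integral>t. (window (2 * n) 0 t)\<^sup>2 \<partial>Lper)"
    by (rule integral_mass_coordinate[OF G_deriv C1per_cont(1)[OF g_C1per] G_0, of "\<lambda>t. (window (2 * n) 0 t)\<^sup>2"])
      (use G_periodic[of 0] G_0 C1per_periodic[OF W'_C1per] C1per_cont[OF W'_C1per] in \<open>auto intro!: continuous_intros\<close>)
  then show "(\<integral>t. (piece i t)\<^sup>2 \<partial>Lper) = 1"
    unfolding piece_sq mass_window_def using n_pos by (simp add: integral_window_sq[OF two_le_2n])
qed (rule piece_C1per)

lemma piece_parity_class_separated: "separated_supports (1 / (3 * real n * M)) (\<lambda>j. piece (2 * j + r))"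
  unfolding separated_supports_def
proof (intro allI impI ballI)
  fix j k x y assume jk: "j < n" "k < n" "j \<noteq> k" and x: "piece (2 * j + r) x \<noteq> 0" and y: "piece (2 * k + r) y \<noteq> 0"
  have n0: "real n > 0" using n_pos by simp
  let ?X = "2 * pi * G x" and ?Y = "2 * pi * G y"
  let ?a = "grid_angle (2 * n) (2 * j + r)" and ?b = "grid_angle (2 * n) (2 * k + r)"
  have "distT (?X - ?a) < window_radius (2 * n)" "distT (?Y - ?b) < window_radius (2 * n)"
    using x y by (auto simp: piece_def mass_window_eq window_nonzero_iff[OF two_le_2n, symmetric])
  moreover have "distT (?a - ?b) \<le> distT (?X - ?a) + distT (?X - ?Y) + distT (?Y - ?b)" by (rule distT_triangle4)
  moreover have "2 * pi / real n \<le> distT (?a - ?b)" by (rule grid_angle_parity_class_separated[OF n_pos jk])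
  moreover have "2 * pi / real n - 2 * window_radius (2 * n) = 2 * pi / (3 * real n)"
    using n0 by (simp add: window_radius_def field_simps)
  ultimately have "2 * pi / (3 * real n) \<le> 2 * pi * M * distT (x - y)" using mass_coordinate_lipschitz_circle[of x y] by linarith
  then show "1 / (3 * real n * M) \<le> distT (x - y)" using n0 M_pos by (simp add: field_simps)
qed

lemma piece_deriv_sq_le:
  assumes i: "i < 2 * n"
  shows "(piece_deriv i t)\<^sup>2 \<le> 2 * real (2 * n) * (1 / (4 * m) * (g' t)\<^sup>2 + M * (2 * pi * M * \<Lambda>)\<^sup>2)"
proof -
  let ?a = "(inverse (sqrt (g t)) / 2 * g' t) * mass_window i t" and ?b = "sqrt (g t) * mass_window_deriv i t"
  have a: "?a\<^sup>2 \<le> 1 / (4 * m) * (g' t)\<^sup>2"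
  proof -
    have "(inverse (sqrt (g t)) / 2)\<^sup>2 \<le> 1 / (4 * m)"
      using g_bounds(1)[of t] m_pos g_pos[of t] by (simp add: power_divide power_inverse less_imp_le field_simps)
    then have "(inverse (sqrt (g t)) / 2)\<^sup>2 * (mass_window i t)\<^sup>2 \<le> 1 / (4 * m) * 1"
      unfolding mass_window_eq using m_pos by (intro mult_mono window_sq_le_one two_le_2n i) auto
    then have "(inverse (sqrt (g t)) / 2)\<^sup>2 * (mass_window i t)\<^sup>2 * (g' t)\<^sup>2 \<le> 1 / (4 * m) * (g' t)\<^sup>2" by (intro mult_right_mono) auto
    then show ?thesis by (simp only: power_mult_distrib mult_ac)
  qed
  have b: "?b\<^sup>2 \<le> M * (2 * pi * M * \<Lambda>)\<^sup>2"
  proof -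
    have "\<bar>mass_window_deriv i t\<bar> \<le> \<Lambda> * (2 * pi * M)"
      unfolding mass_window_deriv_def abs_mult using g_bounds(2)[of t] g_pos[of t] W'_bound order_trans[OF abs_ge_zero W'_bound]
      by (intro mult_mono) auto
    then have "\<bar>mass_window_deriv i t\<bar>\<^sup>2 \<le> (\<Lambda> * (2 * pi * M))\<^sup>2" by (intro power_mono) auto
    then have "(mass_window_deriv i t)\<^sup>2 \<le> (2 * pi * M * \<Lambda>)\<^sup>2" by (simp add: mult_ac)
    then have "g t * (mass_window_deriv i t)\<^sup>2 \<le> M * (2 * pi * M * \<Lambda>)\<^sup>2" using g_bounds(2)[of t] M_pos by (intro mult_mono) auto
    then show ?thesis using g_pos[of t] by (simp add: power_mult_distrib less_imp_le)
  qed
  have "(?a + ?b)\<^sup>2 \<le> 2 * ?a\<^sup>2 + 2 * ?b\<^sup>2" using sum_squares_bound[of ?a ?b] by (simp add: power2_sum)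
  also have "\<dots> \<le> 2 * (1 / (4 * m) * (g' t)\<^sup>2 + M * (2 * pi * M * \<Lambda>)\<^sup>2)"
    unfolding distrib_left[symmetric] by (intro mult_left_mono add_mono a b) simp
  finally have "real (2 * n) * (?a + ?b)\<^sup>2 \<le> real (2 * n) * (2 * (1 / (4 * m) * (g' t)\<^sup>2 + M * (2 * pi * M * \<Lambda>)\<^sup>2))"
    by (intro mult_left_mono) auto
  then show ?thesis unfolding piece_deriv_def by (simp add: power_mult_distrib mult_ac)
qed

definition kinetic_constant :: real where
  "kinetic_constant = 2 * real (2 * n) * (1 / (4 * m) + 2 * pi * (M * (2 * pi * M * \<Lambda>)\<^sup>2))"

lemma integral_piece_deriv_sq_le:
  assumes i: "i < 2 * n"
  shows "(\<integral>t. (piece_deriv i t)\<^sup>2 \<partial>Lper) \<le> kinetic_constant * (1 + (\<integral>t. (g' t)\<^sup>2 \<partial>Lper))"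
proof -
  let ?C = "M * (2 * pi * M * \<Lambda>)\<^sup>2" and ?E = "\<integral>t. (g' t)\<^sup>2 \<partial>Lper"
  have ig: "integrable Lper (\<lambda>t. (g' t)\<^sup>2)" by (intro integrable_Lper_cont continuous_intros C1per_cont[OF g_C1per])
  have "(\<integral>t. (piece_deriv i t)\<^sup>2 \<partial>Lper) \<le> (\<integral>t. 2 * real (2 * n) * (1 / (4 * m) * (g' t)\<^sup>2 + ?C) \<partial>Lper)"
    by (intro integral_mono piece_deriv_sq_le[OF i] integrable_Lper_cont continuous_intros C1per_cont[OF piece_C1per] C1per_cont[OF g_C1per])
  also have "\<dots> = 2 * real (2 * n) * (1 / (4 * m) * ?E + 2 * pi * ?C)"
    using ig integrable_Lper_const[of ?C] by (simp add: measure_Lper)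
  also have "\<dots> \<le> 2 * real (2 * n) * ((1 / (4 * m) + 2 * pi * ?C) * (1 + ?E))"
  proof (rule mult_left_mono)
    have "0 \<le> 1 / (4 * m)" "0 \<le> 2 * pi * ?C * ?E" using m_pos M_pos by auto
    then show "1 / (4 * m) * ?E + 2 * pi * ?C \<le> (1 / (4 * m) + 2 * pi * ?C) * (1 + ?E)" by (simp add: distrib_left distrib_right)
  qed simp
  finally show ?thesis by (simp only: kinetic_constant_def mult.assoc)
qed

lemma parity_class_bound:
  assumes V: "slater_bound \<epsilon> V" and eps: "0 \<le> \<epsilon>" and r: "r < 2"
    and S: "0 \<le> S" "\<And>x. x \<in> separated_configs (1 / (3 * real n * M)) \<Longrightarrow> cN n w x \<le> ennreal S"
  shows "(\<Sum>j<n. V (\<lambda>t. (piece (2 * j + r) t)\<^sup>2))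
    \<le> \<epsilon> * (fact n * (real n * kinetic_constant) * (1 + (\<integral>t. (g' t)\<^sup>2 \<partial>Lper))) + S"
proof -
  let ?E = "\<integral>t. (g' t)\<^sup>2 \<partial>Lper"
  note sep = piece_parity_class_separated[of r]
  have "slater_kinetic n (\<lambda>j. piece_deriv (2 * j + r)) \<le> fact n * (\<Sum>j<n. kinetic_constant * (1 + ?E))"
    unfolding slater_kinetic_def using r by (intro mult_left_mono sum_mono integral_piece_deriv_sq_le) auto
  then have kinetic: "slater_kinetic n (\<lambda>j. piece_deriv (2 * j + r)) \<le> fact n * (real n * kinetic_constant) * (1 + ?E)"
    by (simp add: mult_ac)
  have "(\<Sum>j<n. V (\<lambda>t. (piece (2 * j + r) t)\<^sup>2)) \<le> \<epsilon> * slater_kinetic n (\<lambda>j. piece_deriv (2 * j + r)) + S"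
    by (rule slater_boundD[OF V orbital_system_separated[OF _ sep piece_unit_orbital] support_cost_le_separated[OF sep S]])
      (use n_pos M_pos in simp)
  also have "\<dots> \<le> \<epsilon> * (fact n * (real n * kinetic_constant) * (1 + ?E)) + S"
    by (intro add_right_mono mult_left_mono kinetic eps)
  finally show ?thesis .
qed

lemma density_eq_sum_pieces: "g t = (\<Sum>i<2 * n. (1 / real (2 * n)) * (piece i t)\<^sup>2)"
proof -
  have "(\<Sum>i<2 * n. (1 / real (2 * n)) * (piece i t)\<^sup>2) = g t * (\<Sum>i<2 * n. (window (2 * n) i (2 * pi * G t))\<^sup>2)"
    using n_pos by (simp add: piece_sq mass_window_eq sum_distrib_left)
  then show ?thesis by (simp add: window_sq_sum[OF two_le_2n])
qed

lemma potential_density_le: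
  assumes lin: "H1_linear V" and V: "slater_bound \<epsilon> V" and eps: "0 \<le> \<epsilon>"
    and S: "0 \<le> S" "\<And>x. x \<in> separated_configs (1 / (3 * real n * M)) \<Longrightarrow> cN n w x \<le> ennreal S"
  shows "real n * V g \<le> \<epsilon> * (fact n * (real n * kinetic_constant) * (1 + (\<integral>t. (g' t)\<^sup>2 \<partial>Lper))) + S"
proof -
  let ?v = "\<lambda>i. V (\<lambda>t. (piece i t)\<^sup>2)"
  have "g = (\<lambda>t. \<Sum>i<2 * n. (1 / real (2 * n)) * (piece i t)\<^sup>2)" using density_eq_sum_pieces by auto
  then have "V g = (\<Sum>i<2 * n. (1 / real (2 * n)) * ?v i)"
    using H1_linear_sum[OF lin, of "{..<2 * n}" "\<lambda>i t. (piece i t)\<^sup>2" "\<lambda>_. 1 / real (2 * n)"] C1per_H1per[OF C1per_sq[OF piece_C1per]] by simp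
  then have "2 * (real n * V g) = (\<Sum>i<2 * n. if even i then ?v i else ?v i)"
    using n_pos by (simp add: sum_divide_distrib[symmetric])
  also have "\<dots> = (\<Sum>j<n. ?v (2 * j + 0)) + (\<Sum>j<n. ?v (2 * j + 1))"
    by (subst sum_split_even_odd) simp
  finally show ?thesis using parity_class_bound[OF V eps _ S, of 0] parity_class_bound[OF V eps _ S, of 1] by simp
qed

end

lemma (in cost) potential_bound_bounded_densities:
  assumes m: "0 < m" and M: "0 < M"
  obtains K S where "0 \<le> K" "0 \<le> S"
    "\<And>\<epsilon> V g g'. 0 \<le> \<epsilon> \<Longrightarrow> H1_linear V \<Longrightarrow> slater_bound \<epsilon> V \<Longrightarrow> C1per g g' \<Longrightarrow> (\<And>t. m \<le> g t) \<Longrightarrow> (\<And>t. g t \<le> M) \<Longrightarrow>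
       (\<integral>t. g t \<partial>Lper) = 1 \<Longrightarrow> real n * V g \<le> \<epsilon> * (K * (1 + (\<integral>t. (g' t)\<^sup>2 \<partial>Lper))) + S"
proof -
  obtain W' where W': "C1per (window (2 * n) 0) W'" using window_C1per[of "2 * n"] n_pos by auto
  obtain \<Lambda> where \<Lambda>: "\<And>t. \<bar>W' t\<bar> \<le> \<Lambda>" using C1per_bounded[OF W'] by metis
  obtain S where S: "0 \<le> S" "\<And>x. x \<in> separated_configs (1 / (3 * real n * M)) \<Longrightarrow> cN n w x \<le> ennreal S"
    using cN_bounded_separated[of "1 / (3 * real n * M)"] n_pos M by auto
  define K where "K = fact n * (real n * (2 * real (2 * n) * (1 / (4 * m) + 2 * pi * (M * (2 * pi * M * \<Lambda>)\<^sup>2))))"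
  show ?thesis
  proof (rule that[of K S])
    show "0 \<le> K" using m M by (simp add: K_def)
    show "0 \<le> S" by (rule S(1))
    fix \<epsilon> V g g' assume eps: "0 \<le> \<epsilon>" and V: "H1_linear V" "slater_bound \<epsilon> V" and g: "C1per g g'"
      and gb: "\<And>t. m \<le> g t" "\<And>t. g t \<le> M" and g1: "(\<integral>t. g t \<partial>Lper) = 1"
    obtain G where "\<And>t. (G has_real_derivative g t) (at t)" "G 0 = 0"
      using continuous_antiderivative[OF C1per_cont(1)[OF g]] by metis
    then interpret density_windows n w g g' G W' m M \<Lambda>
      by unfold_locales (use g g1 m gb W' \<Lambda> in auto)
    show "real n * V g \<le> \<epsilon> * (K * (1 + (\<integral>t. (g' t)\<^sup>2 \<partial>Lper))) + S"
      using potential_density_le[OF V eps S] by (simp only: K_def kinetic_constant_def)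
  qed
qed

section \<open>Bounded functionals on periodic H1\<close>

lemma Hminus_H1_linear: "Hminus V \<Longrightarrow> H1_linear V"
  by (simp add: Hminus_def H1_linear_def)

lemma Hminus_bounded:
  assumes "Hminus V"
  obtains B where "\<And>f g. wderiv1 (\<lambda>t. complex_of_real (f t)) (\<lambda>t. complex_of_real (g t)) \<Longrightarrow> \<bar>V f\<bar> \<le> B * sqrt (h1_sqnorm f g)"
proof -
  obtain B where B: "\<And>f g. wderiv1 (\<lambda>t. complex_of_real (f t)) g \<Longrightarrow>
      \<bar>V f\<bar> \<le> B * sqrt ((\<integral>t. (f t)\<^sup>2 \<partial>Lper) + (\<integral>t. (cmod (g t))\<^sup>2 \<partial>Lper))"
    using assms unfolding Hminus_def by blast
  show ?thesis
    by (rule that[of B]) (use B in \<open>fastforce simp: h1_sqnorm_def\<close>)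
qed

lemma Hminus_add_integral:
  assumes "Hminus v" shows "Hminus (\<lambda>f. v f + c * (\<integral>t. f t \<partial>Lper))"
  unfolding Hminus_def
proof (intro conjI allI impI)
  fix f h a b assume fh: "H1per f" "H1per h"
  have "(\<integral>t. a * f t + b * h t \<partial>Lper) = a * (\<integral>t. f t \<partial>Lper) + b * (\<integral>t. h t \<partial>Lper)"
    using fh H1per_integrable by simp
  moreover have "v (\<lambda>t. a * f t + b * h t) = a * v f + b * v h" by (rule H1_linearD[OF Hminus_H1_linear[OF assms] fh])
  ultimately show "v (\<lambda>t. a * f t + b * h t) + c * (\<integral>t. a * f t + b * h t \<partial>Lper) =
    a * (v f + c * (\<integral>t. f t \<partial>Lper)) + b * (v h + c * (\<integral>t. h t \<partial>Lper))"
    by (simp only:) (simp add: algebra_simps)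
next
  let ?q = "\<lambda>f g. sqrt ((\<integral>t. (f t)\<^sup>2 \<partial>Lper) + (\<integral>t. (cmod (g t))\<^sup>2 \<partial>Lper))"
  obtain B where B: "\<And>f g. wderiv1 (\<lambda>t. complex_of_real (f t)) g \<Longrightarrow> \<bar>v f\<bar> \<le> B * ?q f g"
    using assms unfolding Hminus_def by blast
  show "\<exists>B. \<forall>f g. wderiv1 (\<lambda>t. complex_of_real (f t)) g \<longrightarrow> \<bar>v f + c * (\<integral>t. f t \<partial>Lper)\<bar> \<le> B * ?q f g"
  proof (intro exI[of _ "B + \<bar>c\<bar> * sqrt (2 * pi)"] allI impI)
    fix f g assume fg: "wderiv1 (\<lambda>t. complex_of_real (f t)) g"
    note L = wderiv1_L2(1)[OF fg]
    have "integrable Lper (\<lambda>t. (f t)\<^sup>2)" using square_integrableD(2)[OF L] by simp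
    then have "\<bar>\<integral>t. f t \<partial>Lper\<bar> \<le> sqrt (2 * pi * (\<integral>t. (f t)\<^sup>2 \<partial>Lper))"
      using finite_measure.abs_integral_le_sqrt_integral_sq[OF finite_measure_Lper L2per_of_real_integrable[OF L]]
      by (simp add: measure_Lper)
    also have "\<dots> \<le> sqrt (2 * pi) * ?q f g" unfolding real_sqrt_mult by (intro mult_left_mono real_sqrt_le_mono) auto
    finally have "\<bar>c * (\<integral>t. f t \<partial>Lper)\<bar> \<le> \<bar>c\<bar> * (sqrt (2 * pi) * ?q f g)" unfolding abs_mult by (intro mult_left_mono) auto
    then show "\<bar>v f + c * (\<integral>t. f t \<partial>Lper)\<bar> \<le> (B + \<bar>c\<bar> * sqrt (2 * pi)) * ?q f g"
      using B[OF fg] by (simp only: distrib_right mult.assoc)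
  qed
qed

definition H1_continuous :: "((real \<Rightarrow> real) \<Rightarrow> real) \<Rightarrow> bool" where
  "H1_continuous V \<longleftrightarrow> (\<forall>f g T T'. H1_approximation f g T T' \<longrightarrow> (\<lambda>k. V (T k)) \<longlonglongrightarrow> V f)"

lemma H1_continuousD: "H1_continuous V \<Longrightarrow> H1_approximation f g T T' \<Longrightarrow> (\<lambda>k. V (T k)) \<longlonglongrightarrow> V f"
  unfolding H1_continuous_def by blast

lemma H1_continuousI:
  assumes "\<And>f g T T' k. H1_approximation f g T T' \<Longrightarrow> \<bar>V f - V (T k)\<bar> \<le> C * sqrt (h1_sqnorm (\<lambda>t. f t - T k t) (\<lambda>t. g t - T' k t))"
  shows "H1_continuous V"
  unfolding H1_continuous_def
proof (intro allI impI)
  fix f g T T' assume approx: "H1_approximation f g T T'"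
  let ?err = "\<lambda>k. C * sqrt (h1_sqnorm (\<lambda>t. f t - T k t) (\<lambda>t. g t - T' k t))"
  have "?err \<longlonglongrightarrow> C * sqrt 0" by (intro tendsto_intros H1_approximationD(3)[OF approx])
  then have err: "?err \<longlonglongrightarrow> 0" by simp
  have bound: "norm (V (T k) - V f) \<le> ?err k" for k
    using assms[OF approx, of k] by (simp add: abs_minus_commute)
  have "(\<lambda>k. V (T k) - V f) \<longlonglongrightarrow> 0"
    by (rule Lim_null_comparison[OF always_eventually[OF allI[OF bound]] err])
  then show "(\<lambda>k. V (T k)) \<longlonglongrightarrow> V f" by (rule LIM_zero_cancel)
qed

lemma Hminus_H1_continuous:
  assumes V: "Hminus V" shows "H1_continuous V"
proof -
  obtain B where B: "\<And>f g. wderiv1 (\<lambda>t. complex_of_real (f t)) (\<lambda>t. complex_of_real (g t)) \<Longrightarrow> \<bar>V f\<bar> \<le> B * sqrt (h1_sqnorm f g)"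
    using Hminus_bounded[OF V] by metis
  show ?thesis
  proof (rule H1_continuousI[where C=B])
    fix f g T T' k assume approx: "H1_approximation f g T T'"
    note f = H1_approximationD(1)[OF approx] and T = H1_approximationD(2)[OF approx]
    have "wderiv1 (\<lambda>t. complex_of_real (f t - T k t)) (\<lambda>t. complex_of_real (g t - T' k t))"
      using wderiv1_lin[OF f C1per_wderiv1[OF T[of k]], of 1 "-1"] by simp
    then show "\<bar>V f - V (T k)\<bar> \<le> B * sqrt (h1_sqnorm (\<lambda>t. f t - T k t) (\<lambda>t. g t - T' k t))"
      using B[of "\<lambda>t. f t - T k t"] H1_linear_diff[OF Hminus_H1_linear[OF V] H1_approximation_H1per[OF approx] C1per_H1per[OF T]] by simp
  qed
qed

definition H1_functional :: "real \<Rightarrow> ((real \<Rightarrow> real) \<Rightarrow> real) \<Rightarrow> bool" where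
  "H1_functional C V \<longleftrightarrow> 0 \<le> C \<and> H1_linear V \<and> H1_continuous V \<and> (\<forall>f f'. C1per f f' \<longrightarrow> \<bar>V f\<bar> \<le> C * sqrt (h1_sqnorm f f'))"

lemma H1_functionalD:
  assumes "H1_functional C V"
  shows "0 \<le> C" "H1_linear V" "H1_continuous V" "C1per f f' \<Longrightarrow> \<bar>V f\<bar> \<le> C * sqrt (h1_sqnorm f f')"
  using assms unfolding H1_functional_def by auto

lemma H1_functional_of_unit_ball:
  assumes V: "H1_linear V" "H1_continuous V" and C: "0 \<le> C"
    and unit: "\<And>h h'. C1per h h' \<Longrightarrow> h1_sqnorm h h' \<le> 1 \<Longrightarrow> V h \<le> C"
  shows "H1_functional C V"
  unfolding H1_functional_def
proof (intro conjI V C allI impI)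
  fix f f' assume f: "C1per f f'"
  let ?q = "sqrt (h1_sqnorm f f')"
  have "\<bar>V f\<bar> \<le> C * s" if s: "?q < s" for s
  proof -
    have s0: "0 < s" using s h1_sqnorm_nonneg[of f f'] by (meson le_less_trans real_sqrt_ge_zero)
    have scaled: "c * V f \<le> C" if c: "\<bar>c\<bar> = 1 / s" for c
    proof -
      have "h1_sqnorm (\<lambda>t. c * f t) (\<lambda>t. c * f' t) = (1 / s)\<^sup>2 * ?q\<^sup>2"
        using h1_sqnorm_nonneg[of f f'] by (simp add: h1_sqnorm_cmult c[symmetric])
      also have "\<dots> = (?q / s)\<^sup>2" by (simp add: power_divide)
      also have "\<dots> \<le> 1\<^sup>2" using s s0 h1_sqnorm_nonneg[of f f'] by (intro power_mono) auto
      finally have "V (\<lambda>t. c * f t) \<le> C" by (intro unit[OF C1per_cmult[OF f]]) simp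
      then show ?thesis by (simp add: H1_linear_cmult[OF V(1) C1per_H1per[OF f]])
    qed
    show ?thesis using scaled[of "1 / s"] scaled[of "- 1 / s"] s0 by (simp add: abs_le_iff field_simps)
  qed
  then have "\<forall>\<^sub>F s in at_right ?q. \<bar>V f\<bar> \<le> C * s" by (auto simp: eventually_at_filter)
  moreover have "((\<lambda>s. C * s) \<longlongrightarrow> C * ?q) (at_right ?q)" by (intro tendsto_intros)
  ultimately show "\<bar>V f\<bar> \<le> C * ?q" by (intro tendsto_lowerbound[of "\<lambda>s. C * s" _ "at_right ?q"]) simp_all
qed

lemma H1_functional_approximation_error:
  assumes V: "H1_functional C V" and approx: "H1_approximation f g T T'"
  shows "\<bar>V f - V (T k)\<bar> \<le> C * sqrt 2 * sqrt (h1_sqnorm (\<lambda>t. f t - T k t) (\<lambda>t. g t - T' k t))"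
proof -
  let ?d = "\<lambda>k. h1_sqnorm (\<lambda>t. f t - T k t) (\<lambda>t. g t - T' k t)"
  note T = H1_approximationD(2)[OF approx]
  have bound: "\<bar>V (T i) - V (T k)\<bar> \<le> C * sqrt (2 * ?d i + 2 * ?d k)" for i
  proof -
    have "\<bar>V (T i) - V (T k)\<bar> = \<bar>V (\<lambda>t. T i t - T k t)\<bar>"
      by (simp add: H1_linear_diff[OF H1_functionalD(2)[OF V] C1per_H1per[OF T] C1per_H1per[OF T]])
    also have "\<dots> \<le> C * sqrt (h1_sqnorm (\<lambda>t. T i t - T k t) (\<lambda>t. T' i t - T' k t))"
      by (rule H1_functionalD(4)[OF V C1per_diff[OF T T]])
    also have "\<dots> \<le> C * sqrt (2 * ?d i + 2 * ?d k)"
      by (intro mult_left_mono real_sqrt_le_mono h1_sqnorm_diff_le[OF approx] H1_functionalD(1)[OF V])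
    finally show ?thesis .
  qed
  have "(\<lambda>i. \<bar>V (T i) - V (T k)\<bar>) \<longlonglongrightarrow> \<bar>V f - V (T k)\<bar>"
    by (intro tendsto_intros H1_continuousD[OF H1_functionalD(3)[OF V] approx])
  moreover have "(\<lambda>i. C * sqrt (2 * ?d i + 2 * ?d k)) \<longlonglongrightarrow> C * sqrt (2 * 0 + 2 * ?d k)"
    by (intro tendsto_intros H1_approximationD(3)[OF approx])
  ultimately show ?thesis using LIMSEQ_le bound by (fastforce simp: real_sqrt_mult)
qed

section \<open>Compactness of the potentials\<close>

lemma C1per_abs_le_2:
  assumes f: "C1per f f'" and "h1_sqnorm f f' \<le> 1"
  shows "\<bar>f t\<bar> \<le> 2"
proof (rule periodic_all_of_Iper[of f "\<lambda>y. \<bar>y\<bar> \<le> 2"])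
  fix t assume "t \<in> Iper"
  then have "(f t)\<^sup>2 \<le> 2\<^sup>2" using C1per_sq_le_h1_sqnorm[OF f, of t] assms(2) by simp
  then show "\<bar>f t\<bar> \<le> 2" using abs_le_square_iff[of "f t" 2] by simp
qed (rule C1per_periodic[OF f])

lemma integral_sq_add_cmult_le:
  fixes f g :: "real \<Rightarrow> real"
  assumes "continuous_on Iper f" "continuous_on Iper g"
  shows "(\<integral>t. (f t + c * g t)\<^sup>2 \<partial>Lper) \<le> 2 * (\<integral>t. (f t)\<^sup>2 \<partial>Lper) + 2 * c\<^sup>2 * (\<integral>t. (g t)\<^sup>2 \<partial>Lper)"
proof -
  have "(\<integral>t. (f t - - (c * g t))\<^sup>2 \<partial>Lper) \<le> 2 * (\<integral>t. (f t - 0)\<^sup>2 \<partial>Lper) + 2 * (\<integral>t. (0 - - (c * g t))\<^sup>2 \<partial>Lper)"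
    by (intro integral_sq_triangle L2per_cont continuous_intros assms)
  then show ?thesis by (simp add: power_mult_distrib)
qed

lemma normalise_bounded_function:
  assumes ab: "0 < a" "0 < b" and h: "C1per h h'" and bounds: "\<And>t. a \<le> h t" "\<And>t. h t \<le> b"
  obtains c where "2 * pi * a \<le> c" "c \<le> 2 * pi * b" "(\<integral>t. 1 / c * h t \<partial>Lper) = 1"
    "\<And>t. a / (2 * pi * b) \<le> 1 / c * h t" "\<And>t. 1 / c * h t \<le> b / (2 * pi * a)"
proof -
  define c where "c = (\<integral>t. h t \<partial>Lper)"
  have "(\<integral>t. a \<partial>Lper) \<le> c" "c \<le> (\<integral>t. b \<partial>Lper)"
    unfolding c_def by (intro integral_mono integrable_Lper_const integrable_Lper_cont C1per_cont[OF h] bounds)+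
  then have c: "2 * pi * a \<le> c" "c \<le> 2 * pi * b" by (simp_all add: measure_Lper)
  moreover have "0 < 2 * pi * a" using ab by simp
  ultimately have c_pos: "0 < c" by linarith
  show ?thesis
  proof (rule that[OF c])
    show "(\<integral>t. 1 / c * h t \<partial>Lper) = 1" using c_pos by (simp add: c_def[symmetric])
    show "a / (2 * pi * b) \<le> 1 / c * h t" "1 / c * h t \<le> b / (2 * pi * a)" for t
      using bounds[of t] c c_pos ab frac_le[of "h t" a c "2 * pi * b"] frac_le[of b "h t" "2 * pi * a" c] by simp_all
  qed
qed

lemma (in cost) potential_bound_bounded_functions:
  assumes a: "0 < a" and b: "0 < b"
  obtains K S where "0 \<le> K" "0 \<le> S"
    "\<And>\<epsilon> V h h'. 0 \<le> \<epsilon> \<Longrightarrow> H1_linear V \<Longrightarrow> slater_bound \<epsilon> V \<Longrightarrow> C1per h h' \<Longrightarrow> (\<And>t. a \<le> h t) \<Longrightarrow> (\<And>t. h t \<le> b) \<Longrightarrow>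
       V h \<le> \<epsilon> * (K * (1 + (\<integral>t. (h' t)\<^sup>2 \<partial>Lper))) + S"
proof -
  let ?a = "2 * pi * a" and ?b = "2 * pi * b"
  have ab: "0 < a / ?b" "0 < b / ?a" using a b by simp_all
  obtain K S where KS: "0 \<le> K" "0 \<le> S"
    "\<And>\<epsilon> V g g'. 0 \<le> \<epsilon> \<Longrightarrow> H1_linear V \<Longrightarrow> slater_bound \<epsilon> V \<Longrightarrow> C1per g g' \<Longrightarrow> (\<And>t. a / ?b \<le> g t) \<Longrightarrow> (\<And>t. g t \<le> b / ?a) \<Longrightarrow>
       (\<integral>t. g t \<partial>Lper) = 1 \<Longrightarrow> real n * V g \<le> \<epsilon> * (K * (1 + (\<integral>t. (g' t)\<^sup>2 \<partial>Lper))) + S"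
    using potential_bound_bounded_densities[OF ab] by blast
  show ?thesis
  proof (rule that[of "?b * (K * (1 + 1 / ?a\<^sup>2))" "?b * S"])
    fix \<epsilon> V h h' assume eps: "0 \<le> \<epsilon>" and V: "H1_linear V" "slater_bound \<epsilon> V" and h: "C1per h h'"
      and bounds: "\<And>t. a \<le> h t" "\<And>t. h t \<le> b"
    let ?E = "\<integral>t. (h' t)\<^sup>2 \<partial>Lper"
    let ?R = "\<epsilon> * (K * (1 + 1 / ?a\<^sup>2) * (1 + ?E)) + S"
    obtain c where c: "?a \<le> c" "c \<le> ?b" and g: "(\<integral>t. 1 / c * h t \<partial>Lper) = 1" "\<And>t. a / ?b \<le> 1 / c * h t" "\<And>t. 1 / c * h t \<le> b / ?a"
      using normalise_bounded_function[OF a b h bounds] by metis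
    have "0 < ?a" using a by simp
    then have c_pos: "0 < c" using c by linarith
    have "1 / c\<^sup>2 \<le> 1 / ?a\<^sup>2" using c c_pos a by (intro divide_left_mono power_mono) auto
    then have "(1 / c\<^sup>2) * ?E \<le> (1 / ?a\<^sup>2) * ?E" by (intro mult_right_mono) auto
    then have "1 + (\<integral>t. ((1 / c) * h' t)\<^sup>2 \<partial>Lper) \<le> (1 + 1 / ?a\<^sup>2) * (1 + ?E)"
      by (simp add: power_mult_distrib power_divide distrib_left distrib_right add_increasing)
    then have "\<epsilon> * (K * (1 + (\<integral>t. ((1 / c) * h' t)\<^sup>2 \<partial>Lper))) + S \<le> ?R"
      unfolding mult.assoc[of K] by (intro add_right_mono mult_left_mono eps KS(1))
    with KS(3)[OF eps V C1per_cmult[OF h] g(2,3,1)] have nV: "real n * V (\<lambda>t. (1 / c) * h t) \<le> ?R" by linarith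
    have R: "0 \<le> ?R" using eps KS by (intro add_nonneg_nonneg mult_nonneg_nonneg) auto
    have "V (\<lambda>t. (1 / c) * h t) \<le> ?R / real n" using nV n_pos by (simp add: pos_le_divide_eq mult.commute)
    also have "\<dots> \<le> ?R" using R n_pos by (simp add: divide_le_eq mult_le_cancel_left1)
    finally have "c * V (\<lambda>t. (1 / c) * h t) \<le> c * ?R" using c_pos by (simp only: mult_le_cancel_left_pos)
    then have "V h \<le> c * ?R" unfolding H1_linear_cmult[OF V(1) C1per_H1per[OF h]] using c_pos by simp
    also have "\<dots> \<le> ?b * ?R" by (intro mult_right_mono c(2) R)
    finally show "V h \<le> \<epsilon> * (?b * (K * (1 + 1 / ?a\<^sup>2)) * (1 + ?E)) + ?b * S"
      unfolding distrib_left[of ?b] by (simp only: mult_ac)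
  qed (use KS b in auto)
qed

lemma Dper_approximation:
  assumes \<rho>: "Dper \<rho>"
  obtains m M R g T T' where "0 < m" "0 < M" "H1_approximation \<rho> g T T'"
    "\<forall>\<^sub>F k in sequentially. (\<forall>t. m \<le> T k t \<and> T k t \<le> M) \<and> (\<integral>t. (T' k t)\<^sup>2 \<partial>Lper) \<le> R"
proof -
  have cont: "continuous_on Iper \<rho>" and pos: "\<And>x. x \<in> Iper \<Longrightarrow> 0 < \<rho> x" using \<rho> by (auto simp: Dper_def)
  obtain g T T' where approx: "H1_approximation \<rho> g T T'" using exists_trig_H1_approximation \<rho> unfolding Dper_def by metis
  note T = H1_approximationD(2)[OF approx] and L = H1_approximation_L2per[OF approx]
  obtain x where x: "x \<in> Iper" "\<And>y. y \<in> Iper \<Longrightarrow> \<rho> x \<le> \<rho> y"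
    using continuous_attains_inf[OF compact_Iper Iper_nonempty cont] by auto
  obtain B where B: "\<And>y. y \<in> Iper \<Longrightarrow> \<bar>\<rho> y\<bar> \<le> B" using continuous_on_Iper_bounded[OF cont] by metis
  let ?m = "\<rho> x / 2" and ?M = "B + \<rho> x / 2" and ?R = "2 + 2 * (\<integral>t. (g t)\<^sup>2 \<partial>Lper)"
  have "\<forall>\<^sub>F k in sequentially. \<forall>t\<in>Iper. dist (T k t) (\<rho> t) < ?m"
    using uniform_limitD[OF H1_approximation_uniform_limit[OF approx cont], of ?m] pos[OF x(1)] by simp
  moreover have "\<forall>\<^sub>F k in sequentially. h1_sqnorm (\<lambda>t. \<rho> t - T k t) (\<lambda>t. g t - T' k t) < 1"
    by (rule order_tendstoD(2)[OF H1_approximationD(3)[OF approx]]) simp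
  ultimately have "\<forall>\<^sub>F k in sequentially. (\<forall>t. ?m \<le> T k t \<and> T k t \<le> ?M) \<and> (\<integral>t. (T' k t)\<^sup>2 \<partial>Lper) \<le> ?R"
  proof eventually_elim
    case (elim k)
    have "?m \<le> T k t \<and> T k t \<le> ?M" for t
    proof (rule periodic_all_of_Iper[of "T k" "\<lambda>y. ?m \<le> y \<and> y \<le> ?M"])
      fix t assume t: "t \<in> Iper"
      then have "\<bar>T k t - \<rho> t\<bar> < ?m" using elim(1) by (simp add: dist_real_def)
      then show "?m \<le> T k t \<and> T k t \<le> ?M" using x(2)[OF t] B[OF t] by (simp only: abs_less_iff abs_le_iff) linarith
    qed (rule C1per_periodic[OF T])
    moreover have "(\<integral>t. (T' k t - 0)\<^sup>2 \<partial>Lper) \<le> 2 * (\<integral>t. (T' k t - g t)\<^sup>2 \<partial>Lper) + 2 * (\<integral>t. (g t - 0)\<^sup>2 \<partial>Lper)"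
      by (intro integral_sq_triangle L L2per_cont continuous_intros)
    moreover have "(\<integral>t. (T' k t - g t)\<^sup>2 \<partial>Lper) \<le> 1"
      using L2_le_h1_sqnorm(2)[where f="\<lambda>t. \<rho> t - T k t" and g="\<lambda>t. g t - T' k t"] elim(2)
      by (simp add: power2_commute[of "T' k _" "g _"])
    ultimately show ?case by simp
  qed
  then show ?thesis by (rule that[OF _ _ approx, rotated 2]) (use pos[OF x(1)] B[OF x(1)] in auto)
qed

context cost
begin

lemma potential_C1per_perturbation_bound:
  assumes mM: "0 < m" "0 < M"
  obtains B where "0 \<le> B"
    "\<And>\<epsilon> V T T' f f'. 0 \<le> \<epsilon> \<Longrightarrow> \<epsilon> \<le> 1 \<Longrightarrow> H1_linear V \<Longrightarrow> slater_bound \<epsilon> V \<Longrightarrow> C1per T T' \<Longrightarrow> \<forall>t. m \<le> T t \<and> T t \<le> M \<Longrightarrow>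
       (\<integral>t. (T' t)\<^sup>2 \<partial>Lper) \<le> R \<Longrightarrow> C1per f f' \<Longrightarrow> h1_sqnorm f f' \<le> 1 \<Longrightarrow> V T + m / 4 * V f \<le> B"
proof -
  have half: "0 < m / 2" "0 < M + m / 2" using mM by auto
  obtain K S where KS: "0 \<le> K" "0 \<le> S"
    "\<And>\<epsilon> V h h'. 0 \<le> \<epsilon> \<Longrightarrow> H1_linear V \<Longrightarrow> slater_bound \<epsilon> V \<Longrightarrow> C1per h h' \<Longrightarrow> (\<And>t. m / 2 \<le> h t) \<Longrightarrow> (\<And>t. h t \<le> M + m / 2) \<Longrightarrow>
       V h \<le> \<epsilon> * (K * (1 + (\<integral>t. (h' t)\<^sup>2 \<partial>Lper))) + S"
    using potential_bound_bounded_functions[OF half] by blast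
  define D where "D = 2 * \<bar>R\<bar> + 2 * (m / 4)\<^sup>2"
  show ?thesis
  proof (rule that[of "K * (1 + D) + S"])
    fix \<epsilon> V T T' f f' assume eps: "0 \<le> \<epsilon>" "\<epsilon> \<le> 1" and V: "H1_linear V" "slater_bound \<epsilon> V"
      and T: "C1per T T'" "\<forall>t. m \<le> T t \<and> T t \<le> M" "(\<integral>t. (T' t)\<^sup>2 \<partial>Lper) \<le> R" and f: "C1per f f'" "h1_sqnorm f f' \<le> 1"
    let ?h = "\<lambda>t. T t + m / 4 * f t" and ?h' = "\<lambda>t. T' t + m / 4 * f' t"
    have h: "C1per ?h ?h'" by (intro C1per_add C1per_cmult T f)
    have bounds: "m / 2 \<le> ?h t" "?h t \<le> M + m / 2" for t
    proof -
      have "\<bar>m / 4 * f t\<bar> \<le> m / 4 * 2" unfolding abs_mult using C1per_abs_le_2[OF f, of t] mM by (intro mult_mono) auto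
      then have "- (m / 2) \<le> m / 4 * f t" "m / 4 * f t \<le> m / 2" unfolding abs_le_iff by simp_all
      moreover have "m \<le> T t" "T t \<le> M" using T(2) by auto
      ultimately show "m / 2 \<le> ?h t" "?h t \<le> M + m / 2" by linarith+
    qed
    have "(\<integral>t. (?h' t)\<^sup>2 \<partial>Lper) \<le> 2 * (\<integral>t. (T' t)\<^sup>2 \<partial>Lper) + 2 * (m / 4)\<^sup>2 * (\<integral>t. (f' t)\<^sup>2 \<partial>Lper)"
      by (intro integral_sq_add_cmult_le C1per_cont[OF T(1)] C1per_cont[OF f(1)])
    also have "\<dots> \<le> 2 * \<bar>R\<bar> + 2 * (m / 4)\<^sup>2 * 1"
      using T(3) f(2) L2_le_h1_sqnorm(2)[where f=f and g=f'] by (intro add_mono mult_left_mono) auto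
    finally have E: "(\<integral>t. (?h' t)\<^sup>2 \<partial>Lper) \<le> D" by (simp add: D_def)
    have "V T + m / 4 * V f = V ?h"
      using H1_linearD[OF V(1) C1per_H1per[OF T(1)] C1per_H1per[OF f(1)], of 1 "m / 4"] by simp
    also have "\<dots> \<le> \<epsilon> * (K * (1 + (\<integral>t. (?h' t)\<^sup>2 \<partial>Lper))) + S" using KS(3)[OF eps(1) V h bounds] .
    also have "\<dots> \<le> 1 * (K * (1 + D)) + S"
      using E KS(1) eps by (intro add_right_mono mult_mono mult_left_mono mult_nonneg_nonneg add_nonneg_nonneg) auto
    finally show "V T + m / 4 * V f \<le> K * (1 + D) + S" by simp
  qed (use KS in \<open>auto simp: D_def\<close>)
qed

lemma potential_perturbation_bound:
  assumes \<rho>: "Dper \<rho>"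
  obtains \<delta> B where "0 < \<delta>" "0 \<le> B"
    "\<And>\<epsilon> V f f'. 0 \<le> \<epsilon> \<Longrightarrow> \<epsilon> \<le> 1 \<Longrightarrow> H1_linear V \<Longrightarrow> H1_continuous V \<Longrightarrow> slater_bound \<epsilon> V \<Longrightarrow>
       C1per f f' \<Longrightarrow> h1_sqnorm f f' \<le> 1 \<Longrightarrow> V \<rho> + \<delta> * V f \<le> B"
proof -
  obtain m M R g T T' where mM: "0 < m" "0 < M" and approx: "H1_approximation \<rho> g T T'"
    and T: "\<forall>\<^sub>F k in sequentially. (\<forall>t. m \<le> T k t \<and> T k t \<le> M) \<and> (\<integral>t. (T' k t)\<^sup>2 \<partial>Lper) \<le> R"
    by (rule Dper_approximation[OF \<rho>])
  obtain B where B: "0 \<le> B"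
    "\<And>\<epsilon> V T T' f f'. 0 \<le> \<epsilon> \<Longrightarrow> \<epsilon> \<le> 1 \<Longrightarrow> H1_linear V \<Longrightarrow> slater_bound \<epsilon> V \<Longrightarrow> C1per T T' \<Longrightarrow> \<forall>t. m \<le> T t \<and> T t \<le> M \<Longrightarrow>
       (\<integral>t. (T' t)\<^sup>2 \<partial>Lper) \<le> R \<Longrightarrow> C1per f f' \<Longrightarrow> h1_sqnorm f f' \<le> 1 \<Longrightarrow> V T + m / 4 * V f \<le> B"
    using potential_C1per_perturbation_bound[OF mM] by blast
  show ?thesis
  proof (rule that[OF _ B(1)])
    show "0 < m / 4" using mM by simp
    fix \<epsilon> V f f' assume eps: "0 \<le> \<epsilon>" "\<epsilon> \<le> 1" and V: "H1_linear V" "H1_continuous V" "slater_bound \<epsilon> V"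
      and f: "C1per f f'" "h1_sqnorm f f' \<le> 1"
    have "\<forall>\<^sub>F k in sequentially. V (T k) + m / 4 * V f \<le> B"
      using T by (rule eventually_mono) (use B(2)[OF eps V(1,3) H1_approximationD(2)[OF approx] _ _ f] in blast)
    moreover have "(\<lambda>k. V (T k) + m / 4 * V f) \<longlonglongrightarrow> V \<rho> + m / 4 * V f"
      by (intro tendsto_intros H1_continuousD[OF V(2) approx])
    ultimately show "V \<rho> + m / 4 * V f \<le> B" by (intro tendsto_upperbound) auto
  qed
qed

lemma uniform_H1_bound:
  assumes \<rho>: "Dper \<rho>"
  obtains C where "\<And>\<epsilon> V. 0 \<le> \<epsilon> \<Longrightarrow> \<epsilon> \<le> 1 \<Longrightarrow> H1_linear V \<Longrightarrow> H1_continuous V \<Longrightarrow> slater_bound \<epsilon> V \<Longrightarrow> 0 \<le> V \<rho> \<Longrightarrow>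
     H1_functional C V"
proof -
  obtain \<delta> B where \<delta>B: "0 < \<delta>" "0 \<le> B"
    "\<And>\<epsilon> V f f'. 0 \<le> \<epsilon> \<Longrightarrow> \<epsilon> \<le> 1 \<Longrightarrow> H1_linear V \<Longrightarrow> H1_continuous V \<Longrightarrow> slater_bound \<epsilon> V \<Longrightarrow>
       C1per f f' \<Longrightarrow> h1_sqnorm f f' \<le> 1 \<Longrightarrow> V \<rho> + \<delta> * V f \<le> B"
    using potential_perturbation_bound[OF \<rho>] by blast
  show ?thesis
  proof (rule that[of "B / \<delta>"], rule H1_functional_of_unit_ball)
    fix \<epsilon> V h h' assume V: "0 \<le> \<epsilon>" "\<epsilon> \<le> 1" "H1_linear V" "H1_continuous V" "slater_bound \<epsilon> V" and "0 \<le> V \<rho>"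
      and h: "C1per h h'" "h1_sqnorm h h' \<le> 1"
    have "\<delta> * V h \<le> B" using \<delta>B(3)[OF V h] \<open>0 \<le> V \<rho>\<close> by simp
    then show "V h \<le> B / \<delta>" using \<delta>B(1) by (simp add: field_simps)
  qed (use \<delta>B in auto)
qed

end

lemma pointwise_bounded_convergent_subsequence:
  fixes F :: "nat \<Rightarrow> 'a \<Rightarrow> 'b::{real_normed_vector, heine_borel}"
  assumes "countable S" and bdd: "\<And>x. x \<in> S \<Longrightarrow> bounded (range (\<lambda>j. F j x))"
  obtains r :: "nat \<Rightarrow> nat" where "strict_mono r" "\<And>x. x \<in> S \<Longrightarrow> convergent (\<lambda>j. F (r j) x)"
proof -
  have "\<exists>B>0. \<forall>j. norm (F j x) \<le> B" if "x \<in> S" for x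
    using bdd[OF that] unfolding bounded_pos by auto
  then obtain B where B: "\<And>x. x \<in> S \<Longrightarrow> 0 < B x" "\<And>x j. x \<in> S \<Longrightarrow> norm (F j x) \<le> B x" by metis
  have "norm (F j x /\<^sub>R B x) \<le> 1" if "x \<in> S" for j x using B[OF that] by (simp add: divide_le_eq flip: divide_inverse_commute)
  then obtain r where r: "strict_mono r" "\<And>x. x \<in> S \<Longrightarrow> \<exists>l. (\<lambda>j. F (r j) x /\<^sub>R B x) \<longlonglongrightarrow> l"
    using function_convergent_subsequence[OF assms(1), of "\<lambda>j x. F j x /\<^sub>R B x" 1] by metis
  have "convergent (\<lambda>j. F (r j) x)" if x: "x \<in> S" for x
  proof -
    obtain l where "(\<lambda>j. F (r j) x /\<^sub>R B x) \<longlonglongrightarrow> l" using r(2)[OF x] by blast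
    then have "(\<lambda>j. B x *\<^sub>R (F (r j) x /\<^sub>R B x)) \<longlonglongrightarrow> B x *\<^sub>R l" by (intro tendsto_intros)
    then show ?thesis using B(1)[OF x] by (auto simp: convergent_def)
  qed
  then show ?thesis using that r(1) by blast
qed

lemma convergent_of_uniform_approximation:
  fixes X :: "nat \<Rightarrow> 'a::complete_space"
  assumes "\<And>e. 0 < e \<Longrightarrow> \<exists>Y. convergent Y \<and> (\<forall>j. dist (X j) (Y j) < e)"
  shows "convergent X"
  unfolding Cauchy_convergent_iff[symmetric]
proof (rule metric_CauchyI)
  fix e :: real assume "0 < e"
  then obtain Y where Y: "Cauchy Y" "\<And>j. dist (X j) (Y j) < e / 3"
    using assms[of "e / 3"] by (auto simp: Cauchy_convergent_iff)
  obtain M where M: "\<And>i j. i \<ge> M \<Longrightarrow> j \<ge> M \<Longrightarrow> dist (Y i) (Y j) < e / 3"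
    using metric_CauchyD[OF Y(1), of "e / 3"] \<open>0 < e\<close> by auto
  have "dist (X i) (X j) < e" if "M \<le> i" "M \<le> j" for i j
    using Y(2)[of i] Y(2)[of j] M[OF that] dist_triangle[of "X i" "X j" "Y i"] dist_triangle[of "Y i" "X j" "Y j"]
      dist_commute[of "Y j" "X j"] by linarith
  then show "\<exists>M. \<forall>i\<ge>M. \<forall>j\<ge>M. dist (X i) (X j) < e" by blast
qed

lemma convergent_on_H1per:
  assumes V: "\<And>j. H1_functional C (V j)"
    and conv: "\<And>m::int. convergent (\<lambda>j. V j (\<lambda>t. cos (real_of_int m * t)))"
      "\<And>m::int. convergent (\<lambda>j. V j (\<lambda>t. sin (real_of_int m * t)))"
    and f: "H1per f"
  shows "convergent (\<lambda>j. V j f)"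
proof (rule convergent_of_uniform_approximation)
  fix e :: real assume e: "0 < e"
  have trig: "convergent (\<lambda>j. V j p)" if "real_trig_polynomial p" for p
    using that
  proof induction
    case (lin p q a b)
    have "(\<lambda>j. V j (\<lambda>t. a * p t + b * q t)) = (\<lambda>j. a * V j p + b * V j q)"
      using real_trig_polynomial_C1per[OF lin.hyps(1)] real_trig_polynomial_C1per[OF lin.hyps(2)]
      by (auto intro!: H1_linearD[OF H1_functionalD(2)[OF V]] C1per_H1per)
    then show ?case using lin.IH by (auto intro!: convergent_add convergent_mult convergent_const)
  qed (rule conv)+
  obtain g T T' where approx: "H1_approximation f g T T'" and T: "\<And>k. real_trig_polynomial (T k)"
    using exists_trig_H1_approximation[OF f] by metis
  let ?err = "\<lambda>k. C * sqrt 2 * sqrt (h1_sqnorm (\<lambda>t. f t - T k t) (\<lambda>t. g t - T' k t))"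
  have "?err \<longlonglongrightarrow> C * sqrt 2 * sqrt 0" by (intro tendsto_intros H1_approximationD(3)[OF approx])
  then have "\<forall>\<^sub>F k in sequentially. ?err k < e" using e by (intro order_tendstoD) auto
  then obtain k where "?err k < e" by (auto simp: eventually_sequentially)
  then have "\<forall>j. dist (V j f) (V j (T k)) < e"
    using H1_functional_approximation_error[OF V approx, of _ k] unfolding dist_real_def by (meson le_less_trans)
  then show "\<exists>Y. convergent Y \<and> (\<forall>j. dist (V j f) (Y j) < e)" using trig[OF T] by blast
qed

lemma H1_functional_limit:
  assumes V: "\<And>j. H1_functional C (V j)" and lim: "\<And>f. H1per f \<Longrightarrow> (\<lambda>j. V j f) \<longlonglongrightarrow> V0 f"
  shows "H1_functional C V0"
  unfolding H1_functional_def H1_linear_def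
proof (intro conjI allI impI)
  show "0 \<le> C" by (rule H1_functionalD(1)[OF V])
  fix f h a c assume fh: "H1per f" "H1per h"
  have "(\<lambda>j. a * V j f + c * V j h) \<longlonglongrightarrow> V0 (\<lambda>t. a * f t + c * h t)"
    using lim[OF H1per_lin[OF fh, of a c]] by (simp add: H1_linearD[OF H1_functionalD(2)[OF V] fh])
  moreover have "(\<lambda>j. a * V j f + c * V j h) \<longlonglongrightarrow> a * V0 f + c * V0 h" by (intro tendsto_intros lim fh)
  ultimately show "V0 (\<lambda>t. a * f t + c * h t) = a * V0 f + c * V0 h" by (rule LIMSEQ_unique)
next
  show "H1_continuous V0"
  proof (rule H1_continuousI[where C="C * sqrt 2"])
    fix f g T T' k assume approx: "H1_approximation f g T T'"
    have "(\<lambda>j. \<bar>V j f - V j (T k)\<bar>) \<longlonglongrightarrow> \<bar>V0 f - V0 (T k)\<bar>"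
      by (intro tendsto_intros lim H1_approximation_H1per[OF approx] C1per_H1per[OF H1_approximationD(2)[OF approx]])
    then show "\<bar>V0 f - V0 (T k)\<bar> \<le> C * sqrt 2 * sqrt (h1_sqnorm (\<lambda>t. f t - T k t) (\<lambda>t. g t - T' k t))"
      by (rule LIMSEQ_le_const2) (use H1_functional_approximation_error[OF V approx] in blast)
  qed
next
  fix f f' assume f: "C1per f f'"
  have "(\<lambda>j. \<bar>V j f\<bar>) \<longlonglongrightarrow> \<bar>V0 f\<bar>" by (intro tendsto_intros lim C1per_H1per[OF f])
  then show "\<bar>V0 f\<bar> \<le> C * sqrt (h1_sqnorm f f')"
    by (rule LIMSEQ_le_const2) (use H1_functionalD(4)[OF V f] in blast)
qed

lemma H1_functional_convergent_subsequence:
  assumes V: "\<And>j. H1_functional C (V j)"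
  obtains r V0 where "strict_mono (r :: nat \<Rightarrow> nat)" "\<And>f. H1per f \<Longrightarrow> (\<lambda>j. V (r j) f) \<longlonglongrightarrow> V0 f" "H1_functional C V0"
proof -
  let ?S = "range (\<lambda>(m::int) t. cos (real_of_int m * t)) \<union> range (\<lambda>(m::int) t. sin (real_of_int m * t))"
  have "bounded (range (\<lambda>j. V j p))" if "p \<in> ?S" for p
  proof -
    have "real_trig_polynomial p" using that by (auto intro: real_trig_polynomial.intros)
    then obtain p' where "C1per p p'" using real_trig_polynomial_C1per by blast
    then show ?thesis using H1_functionalD(4)[OF V] unfolding bounded_iff by auto
  qed
  then obtain r where r: "strict_mono (r :: nat \<Rightarrow> nat)" "\<And>p. p \<in> ?S \<Longrightarrow> convergent (\<lambda>j. V (r j) p)"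
    using pointwise_bounded_convergent_subsequence[of ?S V] by auto
  have "convergent (\<lambda>j. V (r j) f)" if "H1per f" for f
    by (rule convergent_on_H1per[OF V _ _ that]) (auto intro: r(2))
  then have lim: "(\<lambda>j. V (r j) f) \<longlonglongrightarrow> lim (\<lambda>j. V (r j) f)" if "H1per f" for f
    using that by (simp add: convergent_LIMSEQ_iff)
  show ?thesis by (rule that[OF r(1) lim H1_functional_limit[OF V lim]])
qed

context cost
begin

lemma slater_bound_limit:
  assumes V: "\<And>j. slater_bound (e j) (V j)" and e: "e \<longlonglongrightarrow> e0" and lim: "\<And>f. H1per f \<Longrightarrow> (\<lambda>j. V j f) \<longlonglongrightarrow> V0 f"
  shows "slater_bound e0 V0"
  unfolding slater_bound_def
proof (intro allI impI)
  fix \<phi> \<phi>' S assume \<phi>: "orbital_system n \<phi> \<phi>'" and S: "support_cost_le n w \<phi> S"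
  have "H1per (\<lambda>t. (\<phi> j t)\<^sup>2)" if "j < n" for j
    using C1per_H1per[OF C1per_sq[OF unit_orbitalD(1)[OF orbital_system.unit[OF \<phi> that]]]] .
  then have "(\<lambda>i. \<Sum>j<n. V i (\<lambda>t. (\<phi> j t)\<^sup>2)) \<longlonglongrightarrow> (\<Sum>j<n. V0 (\<lambda>t. (\<phi> j t)\<^sup>2))" by (intro tendsto_sum lim) auto
  moreover have "(\<lambda>i. e i * slater_kinetic n \<phi>' + S) \<longlonglongrightarrow> e0 * slater_kinetic n \<phi>' + S" by (intro tendsto_intros e)
  ultimately show "(\<Sum>j<n. V0 (\<lambda>t. (\<phi> j t)\<^sup>2)) \<le> e0 * slater_kinetic n \<phi>' + S"
    by (rule LIMSEQ_le) (use slater_boundD[OF V \<phi> S] in blast)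
qed

lemma potentials_convergent_subsequence:
  assumes \<rho>: "Dper \<rho>" and e: "\<And>j. 0 < e j" "\<And>j. e j \<le> 1" "e \<longlonglongrightarrow> 0"
    and V: "\<And>j. Hminus (V j)" "\<And>j. slater_bound (e j) (V j)" "\<And>j. 0 \<le> V j \<rho>"
  obtains r V0 C where "strict_mono (r :: nat \<Rightarrow> nat)" "\<And>f. H1per f \<Longrightarrow> (\<lambda>j. V (r j) f) \<longlonglongrightarrow> V0 f"
    "H1_functional C V0" "slater_bound 0 V0"
proof -
  obtain C where C: "\<And>\<epsilon> V. 0 \<le> \<epsilon> \<Longrightarrow> \<epsilon> \<le> 1 \<Longrightarrow> H1_linear V \<Longrightarrow> H1_continuous V \<Longrightarrow> slater_bound \<epsilon> V \<Longrightarrow> 0 \<le> V \<rho> \<Longrightarrow> H1_functional C V"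
    using uniform_H1_bound[OF \<rho>] by metis
  have "H1_functional C (V j)" for j
    by (rule C[OF less_imp_le[OF e(1)] e(2) Hminus_H1_linear[OF V(1)] Hminus_H1_continuous[OF V(1)] V(2,3)])
  then obtain r V0 where r: "strict_mono (r :: nat \<Rightarrow> nat)" and lim: "\<And>f. H1per f \<Longrightarrow> (\<lambda>j. V (r j) f) \<longlonglongrightarrow> V0 f"
    and V0: "H1_functional C V0"
    using H1_functional_convergent_subsequence[of C V] by metis
  have "(\<lambda>j. e (r j)) \<longlonglongrightarrow> 0" using LIMSEQ_subseq_LIMSEQ[OF e(3) r] by (simp add: o_def)
  then show ?thesis using that[OF r lim V0] slater_bound_limit[OF V(2) _ lim] by metis
qed

end

section \<open>Improving feasible potentials to continuous ones\<close>

lemma sum_comp_fun_upd: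
  fixes u :: "'b \<Rightarrow> 'c::ab_group_add"
  assumes "finite A" "i \<in> A"
  shows "(\<Sum>j\<in>A. u ((x(i := s)) j)) = (\<Sum>j\<in>A. u (x j)) - u (x i) + u s"
proof -
  have "(\<Sum>j\<in>A - {i}. u ((x(i := s)) j)) = (\<Sum>j\<in>A - {i}. u (x j))" by (rule sum.cong) auto
  then show ?thesis using assms by (simp add: sum.remove)
qed

context cost
begin

definition dual_feasible :: "(real \<Rightarrow> real) \<Rightarrow> bool" where
  "dual_feasible u \<longleftrightarrow> (\<forall>x\<in>distinct_configs. (\<Sum>i<n. u (x i)) \<le> real_cost x)"

lemma dual_feasibleD: "dual_feasible u \<Longrightarrow> x \<in> distinct_configs \<Longrightarrow> (\<Sum>i<n. u (x i)) \<le> real_cost x"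
  unfolding dual_feasible_def by blast

lemma exists_spread_config:
  assumes t: "t \<in> Iper"
  obtains x where "x 0 = t" "x \<in> separated_configs (2 * pi / real n)"
proof -
  let ?a = "\<lambda>i. grid_angle (2 * n) (2 * i)"
  have "\<exists>y. y \<in> Iper \<and> (\<exists>k::int. y = t + ?a i + 2 * pi * of_int k) \<and> (i = 0 \<longrightarrow> y = t)" for i
  proof (cases "i = 0")
    case True
    then show ?thesis using t by (intro exI[of _ t]) (auto intro: exI[of _ 0])
  next
    case False
    then show ?thesis using translate_into_Iper[of "t + ?a i"] by auto
  qed
  then obtain x where x: "\<And>i. x i \<in> Iper" "\<And>i. \<exists>k::int. x i = t + ?a i + 2 * pi * of_int k" "x 0 = t"
    by metis
  have "2 * pi / real n \<le> distT (x i - x j)" if ij: "i < n" "j < n" "i \<noteq> j" for i j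
  proof -
    obtain k l where "x i = t + ?a i + 2 * pi * of_int k" "x j = t + ?a j + 2 * pi * of_int l"
      using x(2) by metis
    then have "x i - x j = (?a i - ?a j) + 2 * pi * of_int (k - l)" by (simp add: algebra_simps)
    then have "distT (x i - x j) = distT (?a i - ?a j)" by (simp only: distT_periodic)
    then show ?thesis using grid_angle_parity_class_separated[OF n_pos ij, of 0] by simp
  qed
  then show ?thesis using that[of x] x(1,3) by (simp add: separated_configs_def configs_def)
qed

lemma feasible_upper_bound:
  obtains S where "\<And>u M t. dual_feasible u \<Longrightarrow> (\<And>s. s \<in> Iper \<Longrightarrow> - M \<le> u s) \<Longrightarrow> 0 \<le> M \<Longrightarrow> t \<in> Iper \<Longrightarrow> u t \<le> S + real n * M"
proof -
  have a: "0 < 2 * pi / real n" using n_pos by simp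
  obtain S where S: "0 \<le> S" "\<And>x. x \<in> separated_configs (2 * pi / real n) \<Longrightarrow> cN n w x \<le> ennreal S"
    using cN_bounded_separated[OF a] by metis
  show ?thesis
  proof (rule that[of S])
    fix u M t assume u: "dual_feasible u" "\<And>s. s \<in> Iper \<Longrightarrow> - M \<le> u s" "0 \<le> M" and t: "t \<in> Iper"
    obtain x where x: "x 0 = t" "x \<in> separated_configs (2 * pi / real n)" using exists_spread_config[OF t] by metis
    note x_distinct = separated_configs_distinct[OF a x(2)]
    have "real_cost x \<le> S" using S(2)[OF x(2)] S(1) cN_eq_real_cost[OF x_distinct] by (simp add: ennreal_le_iff)
    then have "(\<Sum>i<n. u (x i)) \<le> S" using dual_feasibleD[OF u(1) x_distinct] by linarith
    moreover have "(\<Sum>i<n. u (x i)) = u t + (\<Sum>i\<in>{..<n} - {0}. u (x i))"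
      using n_pos x(1) by (subst sum.remove[of _ 0]) auto
    moreover have "(\<Sum>i\<in>{..<n} - {0}. - M) \<le> (\<Sum>i\<in>{..<n} - {0}. u (x i))"
      using u(2) distinct_configsD[OF x_distinct] by (intro sum_mono) auto
    moreover have "(\<Sum>i\<in>{..<n} - {0}. - M) = - (real n * M) + M" using n_pos by (simp add: of_nat_diff algebra_simps)
    ultimately show "u t \<le> S + real n * M" using u(3) by linarith
  qed
qed

text \<open>A configuration nearly active at \<open>u\<close> contains \<open>t\<close> only once, because the cost is infinite on the diagonal.
  Moving this single point turns the modulus of continuity of the cost into one for \<open>u\<close>.\<close>

definition c_conjugate :: "(real \<Rightarrow> real) \<Rightarrow> bool" where
  "c_conjugate u \<longleftrightarrow> (\<forall>t\<in>Iper. \<forall>e>0. \<exists>x\<in>distinct_configs. \<exists>i<n. x i = t \<and> real_cost x < (\<Sum>j<n. u (x j)) + e)"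

lemma c_conjugate_continuous:
  assumes u: "dual_feasible u" "c_conjugate u" and B: "\<And>t. t \<in> Iper \<Longrightarrow> u t \<le> B"
  shows "continuous_on Iper u"
  unfolding continuous_on_iff
proof (intro ballI allI impI)
  fix t0 e0 :: real assume t0: "t0 \<in> Iper" and e0: "0 < e0"
  define e where "e = min 1 (e0 / 3)"
  have e: "0 < e" "e \<le> 1" "2 * e < e0" using e0 by (auto simp: e_def)
  obtain a where a: "0 < a" "\<And>x. x \<in> distinct_configs \<Longrightarrow> real_cost x \<le> real n * B + 1 \<Longrightarrow> x \<in> separated_configs a"
    using separated_of_real_cost_le by metis
  obtain d where d: "0 < d" "\<And>x y. x \<in> separated_configs a \<Longrightarrow> y \<in> configs \<Longrightarrow> (\<And>i. i < n \<Longrightarrow> \<bar>y i - x i\<bar> < d) \<Longrightarrow>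
     y \<in> separated_configs (a / 2) \<and> \<bar>real_cost y - real_cost x\<bar> < e"
    using real_cost_uniformly_continuous[OF a(1) e(1)] by metis
  have increment: "u s - u t < 2 * e" if t: "t \<in> Iper" and s: "s \<in> Iper" and st: "\<bar>s - t\<bar> < d" for s t
  proof -
    obtain x i where x: "x \<in> distinct_configs" "i < n" "x i = t" "real_cost x < (\<Sum>j<n. u (x j)) + e"
      using u(2) t e(1) unfolding c_conjugate_def by metis
    have "(\<Sum>j<n. u (x j)) \<le> (\<Sum>j<n. B)" using B distinct_configsD[OF x(1)] by (intro sum_mono) auto
    then have "real_cost x \<le> real n * B + 1" using x(4) e(2) by simp
    then have "x \<in> separated_configs a" by (rule a(2)[OF x(1)])
    moreover have "x(i := s) \<in> configs" using configsD[OF subsetD[OF distinct_configs_subset x(1)]] s by (simp add: configs_def)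
    ultimately have "x(i := s) \<in> separated_configs (a / 2) \<and> \<bar>real_cost (x(i := s)) - real_cost x\<bar> < e"
      by (rule d(2)) (use st d(1) x(3) in auto)
    moreover from this have "(\<Sum>j<n. u ((x(i := s)) j)) \<le> real_cost (x(i := s))"
      using a(1) dual_feasibleD[OF u(1) separated_configs_distinct[of "a / 2" "x(i := s)"]] by (simp only: half_gt_zero)
    moreover have "(\<Sum>j<n. u ((x(i := s)) j)) = (\<Sum>j<n. u (x j)) - u t + u s"
      using sum_comp_fun_upd[of "{..<n}" i u x s] x(2,3) by simp
    ultimately show ?thesis using x(4) by linarith
  qed
  have "dist (u s) (u t0) < e0" if "s \<in> Iper" "dist s t0 < d" for s
    using increment[OF t0 that(1)] increment[OF that(1) t0] that(2) e(3) by (auto simp: dist_real_def abs_minus_commute)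
  then show "\<exists>d>0. \<forall>x'\<in>Iper. dist x' t0 < d \<longrightarrow> dist (u x') (u t0) < e0" using d(1) by blast
qed

definition conjugate_values :: "(real \<Rightarrow> real) \<Rightarrow> real \<Rightarrow> real set" where
  "conjugate_values u t = {real_cost x - (\<Sum>j\<in>{..<n} - {i}. u (x j)) | x i. x \<in> distinct_configs \<and> i < n \<and> x i = t}"

definition averaged_conjugate :: "(real \<Rightarrow> real) \<Rightarrow> real \<Rightarrow> real" where
  "averaged_conjugate u t = u t + (Inf (conjugate_values u t) - u t) / real n"

lemma conjugate_values_nonempty: assumes "t \<in> Iper" shows "conjugate_values u t \<noteq> {}"
proof -
  obtain x where x: "x 0 = t" "x \<in> separated_configs (2 * pi / real n)" using exists_spread_config[OF assms] by metis
  then have "x \<in> distinct_configs" using n_pos by (intro separated_configs_distinct) auto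
  then show ?thesis using x(1) n_pos unfolding conjugate_values_def by fastforce
qed

lemma le_conjugate_values:
  assumes u: "dual_feasible u" and y: "y \<in> conjugate_values u t" shows "u t \<le> y"
proof -
  obtain x i where x: "y = real_cost x - (\<Sum>j\<in>{..<n} - {i}. u (x j))" "x \<in> distinct_configs" "i < n" "x i = t"
    using y unfolding conjugate_values_def by auto
  then show ?thesis using dual_feasibleD[OF u x(2)] by (simp add: sum.remove[of "{..<n}" i])
qed

lemma Inf_conjugate_values_le:
  assumes u: "dual_feasible u" and x: "x \<in> distinct_configs" "i < n"
  shows "Inf (conjugate_values u (x i)) + (\<Sum>j\<in>{..<n} - {i}. u (x j)) \<le> real_cost x"
proof -
  have "bdd_below (conjugate_values u (x i))" using le_conjugate_values[OF u] by (rule bdd_belowI)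
  moreover have "real_cost x - (\<Sum>j\<in>{..<n} - {i}. u (x j)) \<in> conjugate_values u (x i)"
    using x unfolding conjugate_values_def by blast
  ultimately show ?thesis using cInf_lower by fastforce
qed

lemma averaged_conjugate_ge:
  assumes u: "dual_feasible u" and t: "t \<in> Iper" shows "u t \<le> averaged_conjugate u t"
  using cInf_greatest[OF conjugate_values_nonempty[OF t] le_conjugate_values[OF u]] by (simp add: averaged_conjugate_def)

lemma averaged_conjugate_feasible:
  assumes u: "dual_feasible u" shows "dual_feasible (averaged_conjugate u)"
  unfolding dual_feasible_def
proof
  fix x assume x: "x \<in> distinct_configs"
  let ?U = "\<Sum>i<n. u (x i)" and ?I = "\<lambda>i. Inf (conjugate_values u (x i))"
  have "(\<Sum>i<n. ?I i + ?U - u (x i)) \<le> (\<Sum>i<n. real_cost x)"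
    using Inf_conjugate_values_le[OF u x] by (intro sum_mono) (simp add: sum.remove add.assoc)
  then have "real n * ?U + (\<Sum>i<n. ?I i - u (x i)) \<le> real n * real_cost x"
    by (simp add: sum.distrib sum_subtractf)
  then have "?U + (\<Sum>i<n. ?I i - u (x i)) / real n \<le> real_cost x" using n_pos by (simp add: field_simps)
  then show "(\<Sum>i<n. averaged_conjugate u (x i)) \<le> real_cost x"
    by (simp add: averaged_conjugate_def sum.distrib sum_divide_distrib)
qed

lemma averaged_conjugate_funpow_feasible: "dual_feasible v \<Longrightarrow> dual_feasible ((averaged_conjugate ^^ k) v)"
  by (induction k) (auto intro: averaged_conjugate_feasible)

lemma averaged_conjugate_funpow_incseq:
  assumes "dual_feasible v" "t \<in> Iper" shows "incseq (\<lambda>k. (averaged_conjugate ^^ k) v t)"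
  using averaged_conjugate_ge[OF averaged_conjugate_funpow_feasible[OF assms(1)] assms(2)] by (intro incseq_SucI) simp

lemma averaged_conjugate_funpow_convergent:
  assumes v: "dual_feasible v" "\<And>t. t \<in> Iper \<Longrightarrow> - M \<le> v t" "0 \<le> M" and t: "t \<in> Iper"
  shows "convergent (\<lambda>k. (averaged_conjugate ^^ k) v t)"
proof -
  let ?w = "\<lambda>k. (averaged_conjugate ^^ k) v"
  obtain S where S: "\<And>u M t. dual_feasible u \<Longrightarrow> (\<And>s. s \<in> Iper \<Longrightarrow> - M \<le> u s) \<Longrightarrow> 0 \<le> M \<Longrightarrow> t \<in> Iper \<Longrightarrow> u t \<le> S + real n * M"
    using feasible_upper_bound by blast
  have "v s \<le> ?w k s" if "s \<in> Iper" for k s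
    using incseqD[OF averaged_conjugate_funpow_incseq[OF v(1) that], of 0 k] by simp
  then have "- M \<le> ?w k s" if "s \<in> Iper" for k s using order_trans[OF v(2)[OF that]] that by blast
  then have "\<forall>k. ?w k t \<le> S + real n * M"
    by (intro allI S averaged_conjugate_funpow_feasible v(1,3) t)
  then show ?thesis
    using incseq_convergent[OF averaged_conjugate_funpow_incseq[OF v(1) t]] unfolding convergent_def by blast
qed

lemma averaged_conjugate_limit_c_conjugate:
  assumes feasible: "\<And>k. dual_feasible (z k)" and step: "\<And>k. z (Suc k) = averaged_conjugate (z k)"
    and lim: "\<And>t. t \<in> Iper \<Longrightarrow> (\<lambda>k. z k t) \<longlonglongrightarrow> u t" and below: "\<And>k t. t \<in> Iper \<Longrightarrow> z k t \<le> u t"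
  shows "c_conjugate u"
  unfolding c_conjugate_def
proof (intro ballI allI impI)
  fix t e :: real assume t: "t \<in> Iper" and e: "0 < e"
  have "(\<lambda>k. z k t + real n * (z (Suc k) t - z k t)) \<longlonglongrightarrow> u t + real n * (u t - u t)"
    by (intro tendsto_intros lim[OF t] LIMSEQ_Suc)
  then have "(\<lambda>k. Inf (conjugate_values (z k) t)) \<longlonglongrightarrow> u t"
    using n_pos by (simp add: step averaged_conjugate_def)
  then have "\<forall>\<^sub>F k in sequentially. Inf (conjugate_values (z k) t) < u t + e" using e by (intro order_tendstoD) auto
  then obtain k where "Inf (conjugate_values (z k) t) < u t + e" by (auto simp: eventually_sequentially)
  then obtain x i where x: "x \<in> distinct_configs" "i < n" "x i = t" "real_cost x - (\<Sum>j\<in>{..<n} - {i}. z k (x j)) < u t + e"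
    using cInf_lessD[OF conjugate_values_nonempty[OF t]] unfolding conjugate_values_def by blast
  have "(\<Sum>j\<in>{..<n} - {i}. z k (x j)) \<le> (\<Sum>j\<in>{..<n} - {i}. u (x j))"
    using distinct_configsD[OF x(1)] by (intro sum_mono below) auto
  then have "real_cost x < (\<Sum>j<n. u (x j)) + e" using x by (simp add: sum.remove[of "{..<n}" i])
  then show "\<exists>x\<in>distinct_configs. \<exists>i<n. x i = t \<and> real_cost x < (\<Sum>j<n. u (x j)) + e" using x by blast
qed

lemma exists_continuous_feasible_above:
  assumes v: "dual_feasible v" "\<And>t. t \<in> Iper \<Longrightarrow> - M \<le> v t" "0 \<le> M"
  obtains u where "dual_feasible u" "\<And>t. t \<in> Iper \<Longrightarrow> v t \<le> u t" "continuous_on Iper u"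
proof -
  let ?w = "\<lambda>k. (averaged_conjugate ^^ k) v"
  define u where "u t = lim (\<lambda>k. ?w k t)" for t
  have lim: "(\<lambda>k. ?w k t) \<longlonglongrightarrow> u t" if "t \<in> Iper" for t
    using averaged_conjugate_funpow_convergent[OF v that] by (simp add: u_def convergent_LIMSEQ_iff)
  have below: "?w k t \<le> u t" if "t \<in> Iper" for k t
    by (rule incseq_le[OF averaged_conjugate_funpow_incseq[OF v(1) that] lim[OF that]])
  have u: "dual_feasible u"
    unfolding dual_feasible_def
  proof
    fix x assume x: "x \<in> distinct_configs"
    then have "(\<lambda>k. \<Sum>i<n. ?w k (x i)) \<longlonglongrightarrow> (\<Sum>i<n. u (x i))"
      using distinct_configsD by (intro tendsto_sum lim) auto
    then show "(\<Sum>i<n. u (x i)) \<le> real_cost x"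
      by (rule LIMSEQ_le_const2) (use dual_feasibleD[OF averaged_conjugate_funpow_feasible[OF v(1)] x] in blast)
  qed
  have above: "v t \<le> u t" if "t \<in> Iper" for t using below[OF that, of 0] by simp
  obtain S where S: "\<And>u M t. dual_feasible u \<Longrightarrow> (\<And>s. s \<in> Iper \<Longrightarrow> - M \<le> u s) \<Longrightarrow> 0 \<le> M \<Longrightarrow> t \<in> Iper \<Longrightarrow> u t \<le> S + real n * M"
    using feasible_upper_bound by blast
  have "- M \<le> u t" if "t \<in> Iper" for t using order_trans[OF v(2) above] that by blast
  then have "u t \<le> S + real n * M" if "t \<in> Iper" for t using that by (intro S u v(3))
  moreover have "c_conjugate u"
    by (rule averaged_conjugate_limit_c_conjugate[OF averaged_conjugate_funpow_feasible[OF v(1)] _ lim below]) simp_all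
  ultimately show ?thesis using that u above c_conjugate_continuous by blast
qed

end

section \<open>Localised orbitals\<close>

lemma h1_sqnorm_shift:
  assumes "C1per f f'" shows "h1_sqnorm (\<lambda>t. f (t - a)) (\<lambda>t. f' (t - a)) = h1_sqnorm f f'"
proof -
  have "continuous_on UNIV (\<lambda>t. (f t)\<^sup>2)" "continuous_on UNIV (\<lambda>t. (f' t)\<^sup>2)"
    using C1per_cont[OF assms] by (auto intro!: continuous_intros)
  moreover have "(f (t + 2 * pi))\<^sup>2 = (f t)\<^sup>2" "(f' (t + 2 * pi))\<^sup>2 = (f' t)\<^sup>2" for t
    by (simp_all only: C1per_periodic[OF assms] C1per_deriv_periodic[OF assms])
  ultimately show ?thesis unfolding h1_sqnorm_def
    using integral_Lper_shift[of "\<lambda>t. (f t)\<^sup>2" a] integral_Lper_shift[of "\<lambda>t. (f' t)\<^sup>2" a] by simp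
qed

lemma H1_functional_shift_bound:
  assumes "H1_functional C V" "C1per f f'"
  shows "\<bar>V (\<lambda>t. f (t - a))\<bar> \<le> C * sqrt (h1_sqnorm f f')"
  using H1_functionalD(4)[OF assms(1) C1per_shift[OF assms(2)], of a] by (simp add: h1_sqnorm_shift[OF assms(2)])

lemma unit_orbital_shift:
  assumes "unit_orbital \<phi> \<phi>'" shows "unit_orbital (\<lambda>t. \<phi> (t - a)) (\<lambda>t. \<phi>' (t - a))"
proof -
  note \<phi> = unit_orbitalD[OF assms]
  have "(\<integral>t. (\<phi> (t - a))\<^sup>2 \<partial>Lper) = (\<integral>t. (\<phi> t)\<^sup>2 \<partial>Lper)"
    by (rule integral_Lper_shift[of "\<lambda>t. (\<phi> t)\<^sup>2"]) (intro continuous_intros C1per_cont[OF \<phi>(1)], simp only: C1per_periodic[OF \<phi>(1)])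
  then show ?thesis unfolding unit_orbital_def using C1per_shift[OF \<phi>(1)] \<phi>(2,3) by simp
qed

lemma unit_orbital_normalise:
  assumes \<phi>: "C1per \<phi> \<phi>'" "\<And>t. 0 \<le> \<phi> t" and mass: "0 < (\<integral>t. (\<phi> t)\<^sup>2 \<partial>Lper)"
  defines "c \<equiv> 1 / sqrt (\<integral>t. (\<phi> t)\<^sup>2 \<partial>Lper)"
  shows "unit_orbital (\<lambda>t. c * \<phi> t) (\<lambda>t. c * \<phi>' t)"
proof -
  have "c\<^sup>2 * (\<integral>t. (\<phi> t)\<^sup>2 \<partial>Lper) = 1" using mass by (simp add: c_def power_divide)
  moreover have "0 \<le> c" using mass by (simp add: c_def)
  ultimately show ?thesis unfolding unit_orbital_def using C1per_cmult[OF \<phi>(1)] \<phi>(2) by (simp add: power_mult_distrib)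
qed

lemma exists_unit_bump:
  assumes b: "0 < b" "b \<le> pi"
  obtains \<beta> \<beta>' where "unit_orbital \<beta> \<beta>'" "\<And>t. \<beta> t \<noteq> 0 \<Longrightarrow> distT t < b"
proof -
  have "0 < (\<integral>t. (cos_bump b t)\<^sup>2 \<partial>Lper)"
  proof (rule integral_Lper_pos[of _ 0])
    show "continuous_on Iper (\<lambda>t. (cos_bump b t)\<^sup>2)" by (intro continuous_intros C1per_cont[OF cos_bump_C1per])
    show "0 < (cos_bump b 0)\<^sup>2" using cos_bump_nonzero_iff[of b 0] b by simp
  qed (auto simp: Iper_def)
  from unit_orbital_normalise[OF cos_bump_C1per cos_bump_nonneg this] show ?thesis
    by (rule that) (use cos_bump_nonzero_iff[of b] b in auto)
qed

lemma distT_less_imp_abs_less: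
  assumes "distT t < r" "\<bar>t\<bar> \<le> 2 * pi - r" shows "\<bar>t\<bar> < r"
proof -
  obtain k where k: "distT t = \<bar>t - 2 * pi * real_of_int k\<bar>" by (rule distT_attained)
  have "k = 0"
  proof (rule ccontr)
    assume "k \<noteq> 0"
    then have "2 * pi * 1 \<le> 2 * pi * \<bar>real_of_int k\<bar>" by (intro mult_left_mono) auto
    then have "2 * pi \<le> \<bar>2 * pi * real_of_int k\<bar>" by (simp add: abs_mult)
    then show False using assms k by linarith
  qed
  then show ?thesis using assms(1) k by simp
qed

lemma grid_angle_bounds:
  assumes "0 < i" "i < N"
  shows "2 * pi / real N \<le> grid_angle N i" "grid_angle N i \<le> 2 * pi - 2 * pi / real N"
proof -
  have N: "0 < real N" using assms by simp
  have "2 * pi * 1 \<le> 2 * pi * real i" using assms by (intro mult_left_mono) auto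
  then show "2 * pi / real N \<le> grid_angle N i" using N by (simp add: grid_angle_def divide_right_mono)
  have "real i \<le> real N - 1" using assms by linarith
  then have "2 * pi * real i \<le> 2 * pi * (real N - 1)" by (intro mult_left_mono) auto
  then have "grid_angle N i \<le> 2 * pi * (real N - 1) / real N" unfolding grid_angle_def by (intro divide_right_mono) auto
  also have "\<dots> = 2 * pi - 2 * pi / real N" using N by (simp add: field_simps)
  finally show "grid_angle N i \<le> 2 * pi - 2 * pi / real N" .
qed

lemma grid_angle_in_Iper: "i < N \<Longrightarrow> grid_angle N i \<in> Iper"
  using pi_gt_zero by (simp add: grid_angle_def Iper_def divide_le_eq)

lemma window_support_near:
  assumes N: "2 \<le> N" and i: "0 < i" "i < N" and t: "t \<in> Iper" "window N i t \<noteq> 0"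
  shows "\<bar>t - grid_angle N i\<bar> < window_radius N"
proof (rule distT_less_imp_abs_less)
  show "distT (t - grid_angle N i) < window_radius N" using t(2) window_nonzero_iff[OF N] by blast
  have "window_radius N \<le> 2 * pi / real N" using N by (simp add: window_radius_def field_simps)
  then show "\<bar>t - grid_angle N i\<bar> \<le> 2 * pi - window_radius N"
    using grid_angle_bounds[OF i] t(1) by (auto simp: Iper_def abs_le_iff)
qed

context cost
begin

definition arc_radius :: real where "arc_radius = 2 * pi / (3 * real n)"

lemma arc_radius_pos: "0 < arc_radius"
  using n_pos by (simp add: arc_radius_def)

lemma arc_radius_le_pi: "arc_radius \<le> pi"
proof -
  have "2 * pi \<le> pi * (3 * real n)" using n_pos pi_gt_zero by simp
  then show ?thesis using n_pos by (simp add: arc_radius_def divide_le_eq)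
qed

lemma separated_supports_arcs:
  assumes supp: "\<And>j t. j < n \<Longrightarrow> t \<in> Iper \<Longrightarrow> \<phi> j t \<noteq> 0 \<Longrightarrow> distT (t - (a + grid_angle (2 * n) (2 * j))) < arc_radius"
  shows "separated_supports arc_radius \<phi>"
  unfolding separated_supports_def
proof (intro allI impI ballI)
  fix j k x y assume jk: "j < n" "k < n" "j \<noteq> k" and x: "x \<in> Iper" "\<phi> j x \<noteq> 0" and y: "y \<in> Iper" "\<phi> k y \<noteq> 0"
  let ?a = "a + grid_angle (2 * n) (2 * j)" and ?b = "a + grid_angle (2 * n) (2 * k)"
  have "2 * pi / real n \<le> distT (?a - ?b)" using grid_angle_parity_class_separated[OF n_pos jk, of 0] by simp
  moreover have "distT (?a - ?b) \<le> distT (x - ?a) + distT (x - y) + distT (y - ?b)" by (rule distT_triangle4)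
  moreover have "distT (x - ?a) < arc_radius" "distT (y - ?b) < arc_radius" using supp jk x y by auto
  moreover have "2 * pi / real n - 2 * arc_radius = arc_radius" using n_pos by (simp add: arc_radius_def field_simps)
  ultimately show "arc_radius \<le> distT (x - y)" by linarith
qed

lemma exists_density_Feps_finite: "\<exists>\<zeta>. adm \<zeta> \<and> (\<forall>\<epsilon>>0. Feps n w \<epsilon> \<zeta> < top)"
proof -
  obtain \<beta> \<beta>' where \<beta>: "unit_orbital \<beta> \<beta>'" "\<And>t. \<beta> t \<noteq> 0 \<Longrightarrow> distT t < arc_radius"
    using exists_unit_bump[OF arc_radius_pos arc_radius_le_pi] by metis
  obtain S where S: "0 \<le> S" "\<And>x. x \<in> separated_configs arc_radius \<Longrightarrow> cN n w x \<le> ennreal S"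
    using cN_bounded_separated[OF arc_radius_pos] by metis
  let ?\<phi> = "\<lambda>j t. \<beta> (t - (0 + grid_angle (2 * n) (2 * j)))" and ?\<phi>' = "\<lambda>j t. \<beta>' (t - (0 + grid_angle (2 * n) (2 * j)))"
  have sep: "separated_supports arc_radius ?\<phi>"
    by (rule separated_supports_arcs[where a=0]) (use \<beta>(2) in auto)
  interpret orbital_system n ?\<phi> ?\<phi>'
    by (rule orbital_system_separated[OF arc_radius_pos sep unit_orbital_shift[OF \<beta>(1)]])
  have "Feps n w \<epsilon> (orbital_density n ?\<phi>) < top" if "0 < \<epsilon>" for \<epsilon>
    by (rule le_less_trans[OF Feps_orbital_density_le[OF support_cost_le_separated[OF sep S]]]) (use that in auto)
  then show ?thesis using adm_orbital_density by blast
qed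

end

section \<open>The envelope of a limit potential\<close>

locale limit_potential = cost +
  fixes V :: "(real \<Rightarrow> real) \<Rightarrow> real" and C :: real
  assumes V_functional: "H1_functional C V" and V_slater: "slater_bound 0 V"
begin

lemmas V_linear = H1_functionalD(2)[OF V_functional]

text \<open>An orbital localised on an arc is completed to n separated ones by translates of a fixed bump; the values
  of V at these are bounded below, which bounds the value at the given orbital from above.\<close>

lemma localised_density_bounded:
  obtains B where "\<And>\<phi> \<phi>' a. unit_orbital \<phi> \<phi>' \<Longrightarrow> (\<And>t. t \<in> Iper \<Longrightarrow> \<phi> t \<noteq> 0 \<Longrightarrow> distT (t - a) < arc_radius) \<Longrightarrow>
     V (\<lambda>t. (\<phi> t)\<^sup>2) \<le> B"
proof -
  obtain S where S: "0 \<le> S" "\<And>x. x \<in> separated_configs arc_radius \<Longrightarrow> cN n w x \<le> ennreal S"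
    using cN_bounded_separated[OF arc_radius_pos] by metis
  obtain \<beta> \<beta>' where \<beta>: "unit_orbital \<beta> \<beta>'" "\<And>t. \<beta> t \<noteq> 0 \<Longrightarrow> distT t < arc_radius"
    using exists_unit_bump[OF arc_radius_pos arc_radius_le_pi] by metis
  define q where "q = C * sqrt (h1_sqnorm (\<lambda>t. (\<beta> t)\<^sup>2) (\<lambda>t. 2 * \<beta> t * \<beta>' t))"
  have q: "\<bar>V (\<lambda>t. (\<beta> (t - c))\<^sup>2)\<bar> \<le> q" for c
    unfolding q_def by (rule H1_functional_shift_bound[OF V_functional C1per_sq[OF unit_orbitalD(1)[OF \<beta>(1)]]])
  show ?thesis
  proof (rule that[of "S + real n * q"])
    fix \<phi> \<phi>' a assume \<phi>: "unit_orbital \<phi> \<phi>'" and supp: "\<And>t. t \<in> Iper \<Longrightarrow> \<phi> t \<noteq> 0 \<Longrightarrow> distT (t - a) < arc_radius"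
    let ?c = "\<lambda>j. a + grid_angle (2 * n) (2 * j)"
    let ?\<Phi> = "\<lambda>j. if j = 0 then \<phi> else (\<lambda>t. \<beta> (t - ?c j))" and ?\<Phi>' = "\<lambda>j. if j = 0 then \<phi>' else (\<lambda>t. \<beta>' (t - ?c j))"
    have sep: "separated_supports arc_radius ?\<Phi>"
      by (rule separated_supports_arcs[where a=a]) (use supp \<beta>(2) in \<open>auto split: if_splits\<close>)
    have unit: "unit_orbital (?\<Phi> j) (?\<Phi>' j)" for j using \<phi> unit_orbital_shift[OF \<beta>(1)] by simp
    have "(\<Sum>j<n. V (\<lambda>t. (?\<Phi> j t)\<^sup>2)) \<le> S"
      using slater_boundD[OF V_slater orbital_system_separated[OF arc_radius_pos sep unit] support_cost_le_separated[OF sep S]] by simp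
    moreover have "(\<Sum>j<n. V (\<lambda>t. (?\<Phi> j t)\<^sup>2)) = V (\<lambda>t. (\<phi> t)\<^sup>2) + (\<Sum>j\<in>{..<n} - {0}. V (\<lambda>t. (?\<Phi> j t)\<^sup>2))"
      using n_pos by (subst sum.remove[of _ 0]) auto
    moreover have "(\<Sum>j\<in>{..<n} - {0}. - q) \<le> (\<Sum>j\<in>{..<n} - {0}. V (\<lambda>t. (?\<Phi> j t)\<^sup>2))"
      using q by (intro sum_mono) (auto simp: abs_le_iff minus_le_iff)
    moreover have "(\<Sum>j\<in>{..<n} - {0}. - q) = - (real n * q) + q" using n_pos by (simp add: of_nat_diff algebra_simps)
    moreover have "0 \<le> q" using q[of 0] by linarith
    ultimately show "V (\<lambda>t. (\<phi> t)\<^sup>2) \<le> S + real n * q" by linarith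
  qed
qed

definition localised_bound :: real where
  "localised_bound = Sup (insert 0 {V (\<lambda>t. (\<phi> t)\<^sup>2) | \<phi> \<phi>' a. unit_orbital \<phi> \<phi>' \<and> (\<forall>t\<in>Iper. \<phi> t \<noteq> 0 \<longrightarrow> distT (t - a) < arc_radius)})"

lemma localised_values_bdd:
  "bdd_above (insert 0 {V (\<lambda>t. (\<phi> t)\<^sup>2) | \<phi> \<phi>' a. unit_orbital \<phi> \<phi>' \<and> (\<forall>t\<in>Iper. \<phi> t \<noteq> 0 \<longrightarrow> distT (t - a) < arc_radius)})"
proof -
  obtain B where "\<And>\<phi> \<phi>' a. unit_orbital \<phi> \<phi>' \<Longrightarrow> (\<And>t. t \<in> Iper \<Longrightarrow> \<phi> t \<noteq> 0 \<Longrightarrow> distT (t - a) < arc_radius) \<Longrightarrow> V (\<lambda>t. (\<phi> t)\<^sup>2) \<le> B"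
    using localised_density_bounded by blast
  then show ?thesis unfolding bdd_above_insert by (intro bdd_aboveI[of _ B]) blast
qed

lemma localised_bound_nonneg: "0 \<le> localised_bound"
  unfolding localised_bound_def by (intro cSup_upper localised_values_bdd) simp

lemma V_sq_le_localised_bound:
  "unit_orbital \<phi> \<phi>' \<Longrightarrow> (\<And>t. t \<in> Iper \<Longrightarrow> \<phi> t \<noteq> 0 \<Longrightarrow> distT (t - a) < arc_radius) \<Longrightarrow> V (\<lambda>t. (\<phi> t)\<^sup>2) \<le> localised_bound"
  unfolding localised_bound_def by (intro cSup_upper localised_values_bdd) blast

definition localised_orbitals :: "real \<Rightarrow> real \<Rightarrow> (real \<Rightarrow> real) set" where
  "localised_orbitals x d = {\<phi>. (\<exists>\<phi>'. unit_orbital \<phi> \<phi>') \<and> (\<forall>t\<in>Iper. \<phi> t \<noteq> 0 \<longrightarrow> \<bar>t - x\<bar> < d)}"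

lemma localised_orbitals_mono: "d \<le> d' \<Longrightarrow> localised_orbitals x d \<subseteq> localised_orbitals x d'"
  by (fastforce simp: localised_orbitals_def)

lemma localised_orbital_le_bound:
  assumes "d \<le> arc_radius" "\<phi> \<in> localised_orbitals x d" shows "V (\<lambda>t. (\<phi> t)\<^sup>2) \<le> localised_bound"
proof -
  obtain \<phi>' where "unit_orbital \<phi> \<phi>'" using assms(2) by (auto simp: localised_orbitals_def)
  then show ?thesis
  proof (rule V_sq_le_localised_bound[where a=x])
    fix t assume "t \<in> Iper" "\<phi> t \<noteq> 0"
    then have "\<bar>t - x\<bar> < d" using assms(2) by (auto simp: localised_orbitals_def)
    then show "distT (t - x) < arc_radius" using distT_le_abs[of "t - x"] assms(1) by linarith
  qed
qed

text \<open>Periodicity leaves no orbital localised at an end point of \<open>Iper\<close>, hence the additional finite value.\<close>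

definition localised_values :: "real \<Rightarrow> nat \<Rightarrow> real set" where
  "localised_values x k = insert (- (real n * localised_bound))
     ((\<lambda>\<phi>. V (\<lambda>t. (\<phi> t)\<^sup>2)) ` localised_orbitals x (arc_radius / real (Suc k)))"

definition envelope :: "real \<Rightarrow> real" where
  "envelope x = (INF k. Sup (localised_values x k))"

definition local_majorant :: "(real \<Rightarrow> real) \<Rightarrow> bool" where
  "local_majorant u \<longleftrightarrow> (\<forall>t\<in>Iper. \<forall>e>0. \<exists>d>0. \<forall>\<phi>\<in>localised_orbitals t d. V (\<lambda>t. (\<phi> t)\<^sup>2) \<le> u t + e)"

lemma local_majorant_mono: "local_majorant v \<Longrightarrow> (\<And>t. t \<in> Iper \<Longrightarrow> v t \<le> u t) \<Longrightarrow> local_majorant u"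
  unfolding local_majorant_def by (meson add_right_mono order_trans)

lemma arc_radius_div_Suc: "0 < arc_radius / real (Suc k)" "arc_radius / real (Suc k) \<le> arc_radius"
  using arc_radius_pos by (simp_all add: divide_le_eq mult_le_cancel_left1)

lemma localised_values_le: "s \<in> localised_values x k \<Longrightarrow> s \<le> localised_bound"
  using localised_orbital_le_bound[OF arc_radius_div_Suc(2)] localised_bound_nonneg
  by (auto simp: localised_values_def minus_le_iff intro: order_trans[of _ 0])

lemma bdd_above_localised_values: "bdd_above (localised_values x k)"
  using localised_values_le by (rule bdd_aboveI)

lemma le_Sup_localised_values: "- (real n * localised_bound) \<le> Sup (localised_values x k)"
  by (rule cSup_upper[OF _ bdd_above_localised_values]) (simp add: localised_values_def)

lemma envelope_ge: "- (real n * localised_bound) \<le> envelope x"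
  unfolding envelope_def by (rule cINF_greatest) (auto simp: le_Sup_localised_values)

lemma envelope_le_Sup: "envelope x \<le> Sup (localised_values x k)"
  unfolding envelope_def by (rule cINF_lower) (auto intro: bdd_belowI2 le_Sup_localised_values)

lemma local_majorant_envelope: "local_majorant envelope"
  unfolding local_majorant_def
proof (intro ballI allI impI)
  fix t e :: real assume "0 < e"
  then have "Inf (range (\<lambda>k. Sup (localised_values t k))) < envelope t + e" by (simp add: envelope_def)
  then obtain k where k: "Sup (localised_values t k) < envelope t + e"
    using cInf_lessD[of "range (\<lambda>k. Sup (localised_values t k))"] by auto
  have "V (\<lambda>t. (\<phi> t)\<^sup>2) \<le> Sup (localised_values t k)" if "\<phi> \<in> localised_orbitals t (arc_radius / real (Suc k))" for \<phi>
    using that by (intro cSup_upper[OF _ bdd_above_localised_values]) (auto simp: localised_values_def)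
  then show "\<exists>d>0. \<forall>\<phi>\<in>localised_orbitals t d. V (\<lambda>t. (\<phi> t)\<^sup>2) \<le> envelope t + e"
    using k arc_radius_div_Suc(1) by (meson less_imp_le order_trans)
qed

lemma localised_orbitals_sum_le:
  assumes x: "x \<in> separated_configs a" and a: "0 < a" and e: "0 < e"
  obtains d where "0 < d" "\<And>\<phi>. (\<And>i. i < n \<Longrightarrow> \<phi> i \<in> localised_orbitals (x i) d) \<Longrightarrow> (\<Sum>i<n. V (\<lambda>t. (\<phi> i t)\<^sup>2)) \<le> real_cost x + e"
proof -
  obtain d where d: "0 < d" "\<And>x y. x \<in> separated_configs a \<Longrightarrow> y \<in> configs \<Longrightarrow> (\<And>i. i < n \<Longrightarrow> \<bar>y i - x i\<bar> < d) \<Longrightarrow>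
     y \<in> separated_configs (a / 2) \<and> \<bar>real_cost y - real_cost x\<bar> < e"
    using real_cost_uniformly_continuous[OF a e] by blast
  show ?thesis
  proof (rule that[of "min d (a / 4)"])
    show "0 < min d (a / 4)" using d(1) a by simp
    fix \<phi> assume \<phi>: "\<And>i. i < n \<Longrightarrow> \<phi> i \<in> localised_orbitals (x i) (min d (a / 4))"
    then obtain \<phi>' where \<phi>': "\<And>i. i < n \<Longrightarrow> unit_orbital (\<phi> i) (\<phi>' i)" unfolding localised_orbitals_def by simp metis
    have near: "\<bar>t - x i\<bar> < min d (a / 4)" if "i < n" "t \<in> Iper" "\<phi> i t \<noteq> 0" for i t
      using \<phi>[OF that(1)] that(2,3) unfolding localised_orbitals_def by blast
    have "separated_supports (a / 2) \<phi>"
      unfolding separated_supports_def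
    proof (intro allI impI ballI)
      fix i j s t assume ij: "i < n" "j < n" "i \<noteq> j" and st: "s \<in> Iper" "t \<in> Iper" "\<phi> i s \<noteq> 0" "\<phi> j t \<noteq> 0"
      show "a / 2 \<le> distT (s - t)"
        using near[OF ij(1) st(1,3)] near[OF ij(2) st(2,4)] by (intro distT_perturb[OF separated_configsD[OF x ij]]) linarith+
    qed
    then have system: "orbital_system n \<phi> \<phi>'" using a \<phi>' by (intro orbital_system_separated[of "a / 2"]) auto
    have "support_cost_le n w \<phi> (real_cost x + e)"
      unfolding support_cost_le_def
    proof (intro conjI allI impI)
      show "0 \<le> real_cost x + e" using real_cost_nonneg[of x] e by simp
      fix y assume y: "\<forall>j<n. y j \<in> Iper \<and> \<phi> j (y j) \<noteq> 0"
      then have "y \<in> configs" "\<And>i. i < n \<Longrightarrow> \<bar>y i - x i\<bar> < d" using near by (auto simp: configs_def)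
      then have dy: "y \<in> separated_configs (a / 2) \<and> \<bar>real_cost y - real_cost x\<bar> < e" by (rule d(2)[OF x])
      then have "cN n w y = ennreal (real_cost y)" using a by (intro cN_eq_real_cost separated_configs_distinct[of "a / 2"]) auto
      also have "\<dots> \<le> ennreal (real_cost x + e)" using dy by (intro ennreal_leI) linarith
      finally show "cN n w y \<le> ennreal (real_cost x + e)" .
    qed
    from slater_boundD[OF V_slater system this] show "(\<Sum>i<n. V (\<lambda>t. (\<phi> i t)\<^sup>2)) \<le> real_cost x + e" by simp
  qed
qed

lemma localised_values_sum_le:
  assumes s: "\<And>i. i < n \<Longrightarrow> s i \<in> localised_values (x i) k"
    and orbitals: "\<And>\<phi>. (\<And>i. i < n \<Longrightarrow> \<phi> i \<in> localised_orbitals (x i) (arc_radius / real (Suc k))) \<Longrightarrow> (\<Sum>i<n. V (\<lambda>t. (\<phi> i t)\<^sup>2)) \<le> c"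
    and c: "0 \<le> c"
  shows "(\<Sum>i<n. s i) \<le> c"
proof (cases "\<exists>i<n. s i = - (real n * localised_bound)")
  case True
  then obtain i where i: "i < n" "s i = - (real n * localised_bound)" by blast
  have "(\<Sum>j<n. s j) = s i + (\<Sum>j\<in>{..<n} - {i}. s j)" using i(1) by (subst sum.remove[of _ i]) auto
  also have "(\<Sum>j\<in>{..<n} - {i}. s j) \<le> (\<Sum>j\<in>{..<n} - {i}. localised_bound)"
    using localised_values_le s by (intro sum_mono) auto
  also have "\<dots> = real n * localised_bound - localised_bound" using i(1) by (simp add: of_nat_diff algebra_simps)
  finally show ?thesis using i(2) localised_bound_nonneg c by linarith
next
  case False
  then have "\<exists>\<phi>\<in>localised_orbitals (x i) (arc_radius / real (Suc k)). s i = V (\<lambda>t. (\<phi> t)\<^sup>2)" if "i < n" for i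
    using s[OF that] that by (auto simp: localised_values_def)
  then obtain \<phi> where \<phi>: "\<And>i. i < n \<Longrightarrow> \<phi> i \<in> localised_orbitals (x i) (arc_radius / real (Suc k))"
    "\<And>i. i < n \<Longrightarrow> s i = V (\<lambda>t. (\<phi> i t)\<^sup>2)" by metis
  show ?thesis using orbitals[OF \<phi>(1)] \<phi>(2) by simp
qed

lemma envelope_feasible: "dual_feasible envelope"
  unfolding dual_feasible_def
proof (rule ballI, rule field_le_epsilon)
  fix x e assume x: "x \<in> distinct_configs" and e: "(0::real) < e"
  obtain a where a: "0 < a" "x \<in> separated_configs a" using distinct_config_separated[OF x] by metis
  obtain d where d: "0 < d" "\<And>\<phi>. (\<And>i. i < n \<Longrightarrow> \<phi> i \<in> localised_orbitals (x i) d) \<Longrightarrow> (\<Sum>i<n. V (\<lambda>t. (\<phi> i t)\<^sup>2)) \<le> real_cost x + e / 2"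
    using localised_orbitals_sum_le[OF a(2,1), of "e / 2"] e by auto
  have "(\<lambda>k. arc_radius / real (Suc k)) \<longlonglongrightarrow> 0" by (rule LIMSEQ_Suc[OF lim_const_over_n])
  then have "\<forall>\<^sub>F k in sequentially. arc_radius / real (Suc k) < d" using d(1) by (rule order_tendstoD)
  then obtain k where k: "arc_radius / real (Suc k) \<le> d" by (auto simp: eventually_sequentially intro: less_imp_le)
  have "\<exists>s\<in>localised_values (x i) k. envelope (x i) < s + e / 2 / real n" for i
  proof -
    have "0 < e / 2 / real n" using e n_pos by simp
    then have "envelope (x i) - e / 2 / real n < Sup (localised_values (x i) k)" using envelope_le_Sup[of "x i" k] by linarith
    then obtain s where "s \<in> localised_values (x i) k" "envelope (x i) - e / 2 / real n < s"
      by (rule less_cSupE) (auto simp: localised_values_def)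
    then show ?thesis by (auto simp only: diff_less_eq)
  qed
  then obtain s where s: "\<And>i. s i \<in> localised_values (x i) k" "\<And>i. envelope (x i) < s i + e / 2 / real n" by metis
  have "(\<Sum>i<n. envelope (x i)) \<le> (\<Sum>i<n. s i + e / 2 / real n)" using s(2) by (intro sum_mono less_imp_le) auto
  also have "\<dots> = (\<Sum>i<n. s i) + e / 2" using n_pos by (simp add: sum.distrib)
  also have "(\<Sum>i<n. s i) \<le> real_cost x + e / 2"
  proof (rule localised_values_sum_le)
    show "s i \<in> localised_values (x i) k" for i by (rule s(1))
    show "0 \<le> real_cost x + e / 2" using real_cost_nonneg[of x] e by simp
  qed (use d(2) localised_orbitals_mono[OF k] in blast)
  finally show "(\<Sum>i<n. envelope (x i)) \<le> real_cost x + e" by simp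
qed

section \<open>Domination of a limit potential by an integral\<close>

lemma V_sq_le_mass_mult:
  assumes \<phi>: "C1per \<phi> \<phi>'" "\<And>t. 0 \<le> \<phi> t" and mass: "0 < (\<integral>t. (\<phi> t)\<^sup>2 \<partial>Lper)"
    and bound: "\<And>c. unit_orbital (\<lambda>t. c * \<phi> t) (\<lambda>t. c * \<phi>' t) \<Longrightarrow> V (\<lambda>t. (c * \<phi> t)\<^sup>2) \<le> B"
  shows "V (\<lambda>t. (\<phi> t)\<^sup>2) \<le> B * (\<integral>t. (\<phi> t)\<^sup>2 \<partial>Lper)"
proof -
  let ?m = "\<integral>t. (\<phi> t)\<^sup>2 \<partial>Lper"
  have "(\<lambda>t. (1 / sqrt ?m * \<phi> t)\<^sup>2) = (\<lambda>t. (1 / ?m) * (\<phi> t)\<^sup>2)"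
    using mass by (simp add: power_mult_distrib power_divide)
  then have "V (\<lambda>t. (1 / sqrt ?m * \<phi> t)\<^sup>2) = (1 / ?m) * V (\<lambda>t. (\<phi> t)\<^sup>2)"
    using H1_linear_cmult[OF V_linear C1per_H1per[OF C1per_sq[OF \<phi>(1)]], of "1 / ?m"] by (simp only:)
  moreover have "V (\<lambda>t. (1 / sqrt ?m * \<phi> t)\<^sup>2) \<le> B" by (rule bound[OF unit_orbital_normalise[OF \<phi> mass]])
  ultimately have "(1 / ?m) * V (\<lambda>t. (\<phi> t)\<^sup>2) \<le> B" by (simp only:)
  then show ?thesis using mass by (simp add: field_simps)
qed

lemma local_majorant_Lebesgue_number:
  assumes u: "local_majorant u" "continuous_on Iper u" and e: "0 < e"
  obtains \<eta> where "0 < \<eta>" "\<And>c. c \<in> Iper \<Longrightarrow> \<exists>x\<in>Iper. \<exists>d. (\<forall>t. \<bar>t - c\<bar> < \<eta> \<longrightarrow> \<bar>t - x\<bar> < d) \<and>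
     (\<forall>\<phi>\<in>localised_orbitals x d. V (\<lambda>t. (\<phi> t)\<^sup>2) \<le> u x + e) \<and> (\<forall>t\<in>Iper. \<bar>t - x\<bar> < d \<longrightarrow> u x - e \<le> u t)"
proof -
  have "\<exists>d>0. (\<forall>\<phi>\<in>localised_orbitals x d. V (\<lambda>t. (\<phi> t)\<^sup>2) \<le> u x + e) \<and> (\<forall>t\<in>Iper. \<bar>t - x\<bar> < d \<longrightarrow> u x - e \<le> u t)"
    if x: "x \<in> Iper" for x
  proof -
    obtain d where d: "0 < d" "\<forall>\<phi>\<in>localised_orbitals x d. V (\<lambda>t. (\<phi> t)\<^sup>2) \<le> u x + e"
      using u(1) x e unfolding local_majorant_def by blast
    obtain d' where d': "0 < d'" "\<And>t. t \<in> Iper \<Longrightarrow> dist t x < d' \<Longrightarrow> dist (u t) (u x) < e"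
      using u(2) x e unfolding continuous_on_iff by blast
    have "u x - e \<le> u t" if "t \<in> Iper" "\<bar>t - x\<bar> < min d d'" for t
      using d'(2)[OF that(1)] that(2) by (simp add: dist_real_def abs_less_iff)
    then show ?thesis using d d'(1) localised_orbitals_mono[of "min d d'" d x] by (intro exI[of _ "min d d'"]) auto
  qed
  then obtain d where d: "\<And>x. x \<in> Iper \<Longrightarrow> 0 < d x"
    "\<And>x. x \<in> Iper \<Longrightarrow> (\<forall>\<phi>\<in>localised_orbitals x (d x). V (\<lambda>t. (\<phi> t)\<^sup>2) \<le> u x + e) \<and> (\<forall>t\<in>Iper. \<bar>t - x\<bar> < d x \<longrightarrow> u x - e \<le> u t)"
    by metis
  have "Iper \<subseteq> \<Union>((\<lambda>x. ball x (d x)) ` Iper)" using d(1) by force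
  then obtain \<eta> where \<eta>: "0 < \<eta>" "\<And>c. c \<in> Iper \<Longrightarrow> \<exists>G\<in>(\<lambda>x. ball x (d x)) ` Iper. ball c \<eta> \<subseteq> G"
    by (rule Heine_Borel_lemma[OF compact_Iper]) auto
  show ?thesis
  proof (rule that[OF \<eta>(1)])
    fix c assume "c \<in> Iper"
    then obtain x where x: "x \<in> Iper" "ball c \<eta> \<subseteq> ball x (d x)" using \<eta>(2) by blast
    then have "\<bar>t - c\<bar> < \<eta> \<longrightarrow> \<bar>t - x\<bar> < d x" for t
      by (auto simp: subset_iff dist_real_def abs_minus_commute)
    then show "\<exists>x\<in>Iper. \<exists>d. (\<forall>t. \<bar>t - c\<bar> < \<eta> \<longrightarrow> \<bar>t - x\<bar> < d) \<and>
     (\<forall>\<phi>\<in>localised_orbitals x d. V (\<lambda>t. (\<phi> t)\<^sup>2) \<le> u x + e) \<and> (\<forall>t\<in>Iper. \<bar>t - x\<bar> < d \<longrightarrow> u x - e \<le> u t)"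
      using d(2)[OF x(1)] x(1) by blast
  qed
qed

lemma V_narrow_sq_le:
  assumes u: "local_majorant u" "continuous_on Iper u" and e: "0 < e"
  obtains \<eta> where "0 < \<eta>" "\<And>\<phi> \<phi>' c. c \<in> Iper \<Longrightarrow> C1per \<phi> \<phi>' \<Longrightarrow> (\<And>t. 0 \<le> \<phi> t) \<Longrightarrow> 0 < (\<integral>t. (\<phi> t)\<^sup>2 \<partial>Lper) \<Longrightarrow>
     (\<And>t. t \<in> Iper \<Longrightarrow> \<phi> t \<noteq> 0 \<Longrightarrow> \<bar>t - c\<bar> < \<eta>) \<Longrightarrow> V (\<lambda>t. (\<phi> t)\<^sup>2) \<le> (\<integral>t. u t * (\<phi> t)\<^sup>2 \<partial>Lper) + 2 * e * (\<integral>t. (\<phi> t)\<^sup>2 \<partial>Lper)"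
proof -
  obtain \<eta> where \<eta>: "0 < \<eta>" "\<And>c. c \<in> Iper \<Longrightarrow> \<exists>x\<in>Iper. \<exists>d. (\<forall>t. \<bar>t - c\<bar> < \<eta> \<longrightarrow> \<bar>t - x\<bar> < d) \<and>
     (\<forall>\<phi>\<in>localised_orbitals x d. V (\<lambda>t. (\<phi> t)\<^sup>2) \<le> u x + e) \<and> (\<forall>t\<in>Iper. \<bar>t - x\<bar> < d \<longrightarrow> u x - e \<le> u t)"
    using local_majorant_Lebesgue_number[OF u e] by blast
  show ?thesis
  proof (rule that[OF \<eta>(1)])
    fix \<phi> \<phi>' c assume c: "c \<in> Iper" and \<phi>: "C1per \<phi> \<phi>'" "\<And>t. 0 \<le> \<phi> t" and mass: "0 < (\<integral>t. (\<phi> t)\<^sup>2 \<partial>Lper)"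
      and supp: "\<And>t. t \<in> Iper \<Longrightarrow> \<phi> t \<noteq> 0 \<Longrightarrow> \<bar>t - c\<bar> < \<eta>"
    let ?m = "\<integral>t. (\<phi> t)\<^sup>2 \<partial>Lper"
    obtain x d where near: "\<And>t. \<bar>t - c\<bar> < \<eta> \<Longrightarrow> \<bar>t - x\<bar> < d"
      and V_le: "\<And>\<psi>. \<psi> \<in> localised_orbitals x d \<Longrightarrow> V (\<lambda>t. (\<psi> t)\<^sup>2) \<le> u x + e"
      and u_ge: "\<And>t. t \<in> Iper \<Longrightarrow> \<bar>t - x\<bar> < d \<Longrightarrow> u x - e \<le> u t"
      using \<eta>(2)[OF c] by blast
    have "V (\<lambda>t. (\<phi> t)\<^sup>2) \<le> (u x + e) * ?m"
    proof (rule V_sq_le_mass_mult[OF \<phi> mass])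
      fix r assume "unit_orbital (\<lambda>t. r * \<phi> t) (\<lambda>t. r * \<phi>' t)"
      then show "V (\<lambda>t. (r * \<phi> t)\<^sup>2) \<le> u x + e"
        using supp near by (intro V_le) (auto simp: localised_orbitals_def)
    qed
    moreover have "(\<integral>t. (u x - e) * (\<phi> t)\<^sup>2 \<partial>Lper) \<le> (\<integral>t. u t * (\<phi> t)\<^sup>2 \<partial>Lper)"
    proof (rule integral_mono)
      show "integrable Lper (\<lambda>t. (u x - e) * (\<phi> t)\<^sup>2)" "integrable Lper (\<lambda>t. u t * (\<phi> t)\<^sup>2)"
        by (intro integrable_Lper_cont continuous_intros u(2) C1per_cont[OF \<phi>(1)])+
      show "(u x - e) * (\<phi> t)\<^sup>2 \<le> u t * (\<phi> t)\<^sup>2" if "t \<in> space Lper" for t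
        using u_ge[OF _ near[OF supp], of t] that by (cases "\<phi> t = 0") (auto intro: mult_right_mono)
    qed
    then have "(u x - e) * ?m \<le> (\<integral>t. u t * (\<phi> t)\<^sup>2 \<partial>Lper)" unfolding integral_mult_right_zero .
    ultimately show "V (\<lambda>t. (\<phi> t)\<^sup>2) \<le> (\<integral>t. u t * (\<phi> t)\<^sup>2 \<partial>Lper) + 2 * e * ?m"
      by (simp add: distrib_right left_diff_distrib)
  qed
qed

end

lemma exists_fine_grid:
  assumes "0 < \<eta>" "0 < r" "0 < e"
  obtains N where "2 \<le> N" "window_radius N < \<eta>" "window_radius N < r" "B * (2 * pi / real N) < e"
proof -
  have radius: "window_radius \<longlonglongrightarrow> 0"
    using lim_const_over_n[of "4 * pi / 3 :: real"] by (simp add: window_radius_def[abs_def])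
  have "(\<lambda>N. B * (2 * pi / real N)) \<longlonglongrightarrow> B * 0" by (intro tendsto_intros lim_const_over_n)
  then have "\<forall>\<^sub>F N in sequentially. B * (2 * pi / real N) < e" using assms(3) by (intro order_tendstoD) auto
  then have "\<forall>\<^sub>F N in sequentially. 2 \<le> N \<and> window_radius N < \<eta> \<and> window_radius N < r \<and> B * (2 * pi / real N) < e"
    using assms by (intro eventually_conj eventually_ge_at_top order_tendstoD(2)[OF radius])
  then show ?thesis using that by (auto simp: eventually_sequentially)
qed

lemma window_piece:
  assumes N: "2 \<le> N" and f: "C1per f f'" "\<And>t. 0 < f t"
  defines "\<phi> \<equiv> \<lambda>i t. sqrt (f t) * window N i t"
  shows "\<exists>\<phi>'. C1per (\<phi> i) \<phi>'" "0 \<le> \<phi> i t" "f t = (\<Sum>i<N. (\<phi> i t)\<^sup>2)" "i < N \<Longrightarrow> 0 < (\<integral>t. (\<phi> i t)\<^sup>2 \<partial>Lper)"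
proof -
  obtain W' where W': "C1per (window N i) W'" using window_C1per[OF N] by blast
  show "\<exists>\<phi>'. C1per (\<phi> i) \<phi>'" unfolding \<phi>_def using C1per_mult[OF C1per_sqrt[OF f] W'] by blast
  show "0 \<le> \<phi> i t" for t using window_nonneg[OF N, of i t] f(2)[of t] by (simp add: \<phi>_def)
  show "f t = (\<Sum>i<N. (\<phi> i t)\<^sup>2)"
    using f(2)[of t] by (simp add: \<phi>_def power_mult_distrib window_sq_sum[OF N] flip: sum_distrib_left)
  assume i: "i < N"
  show "0 < (\<integral>t. (\<phi> i t)\<^sup>2 \<partial>Lper)"
  proof (rule integral_Lper_pos[OF _ _ grid_angle_in_Iper[OF i]])
    show "continuous_on Iper (\<lambda>t. (\<phi> i t)\<^sup>2)"
      unfolding \<phi>_def by (intro continuous_intros window_cont N C1per_cont[OF f(1)])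
    have "window N i (grid_angle N i) \<noteq> 0" using window_nonzero_iff[OF N] window_radius_bounds[OF N] by simp
    then show "0 < (\<phi> i (grid_angle N i))\<^sup>2" using f(2)[of "grid_angle N i"] by (simp add: \<phi>_def)
  qed simp
qed

lemma integral_mult_sq_ge:
  fixes u \<phi> :: "real \<Rightarrow> real"
  assumes u: "continuous_on Iper u" "\<And>t. t \<in> Iper \<Longrightarrow> \<bar>u t\<bar> \<le> U" and \<phi>: "continuous_on Iper \<phi>"
  shows "- (U * (\<integral>t. (\<phi> t)\<^sup>2 \<partial>Lper)) \<le> (\<integral>t. u t * (\<phi> t)\<^sup>2 \<partial>Lper)"
proof -
  have "(\<integral>t. - U * (\<phi> t)\<^sup>2 \<partial>Lper) \<le> (\<integral>t. u t * (\<phi> t)\<^sup>2 \<partial>Lper)"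
  proof (rule integral_mono)
    show "integrable Lper (\<lambda>t. - U * (\<phi> t)\<^sup>2)" "integrable Lper (\<lambda>t. u t * (\<phi> t)\<^sup>2)"
      by (intro integrable_Lper_cont continuous_intros u(1) \<phi>)+
    show "- U * (\<phi> t)\<^sup>2 \<le> u t * (\<phi> t)\<^sup>2" if "t \<in> space Lper" for t
      using u(2)[of t] that by (intro mult_right_mono) (auto simp: abs_le_iff)
  qed
  then show ?thesis by simp
qed

context limit_potential
begin

text \<open>The window around the end points of \<open>Iper\<close> is not localised, but its mass is small.\<close>

lemma V_central_piece_le:
  assumes u: "continuous_on Iper u" "\<And>t. t \<in> Iper \<Longrightarrow> \<bar>u t\<bar> \<le> U" "0 \<le> U"
    and f: "C1per f f'" "\<And>t. 0 < f t" "\<And>t. \<bar>f t\<bar> \<le> F" and N: "2 \<le> N" "window_radius N < arc_radius"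
  defines "\<phi> \<equiv> \<lambda>t. sqrt (f t) * window N 0 t"
  shows "V (\<lambda>t. (\<phi> t)\<^sup>2) \<le> (\<integral>t. u t * (\<phi> t)\<^sup>2 \<partial>Lper) + (localised_bound + U) * F * (2 * pi / real N)"
proof -
  let ?m = "\<integral>t. (\<phi> t)\<^sup>2 \<partial>Lper"
  note piece = window_piece(1,2,4)[OF N(1) f(1,2), where i=0]
  obtain \<phi>' where \<phi>': "C1per \<phi> \<phi>'" using piece(1) unfolding \<phi>_def by blast
  have "V (\<lambda>t. (\<phi> t)\<^sup>2) \<le> localised_bound * ?m"
  proof (rule V_sq_le_mass_mult[OF \<phi>'])
    show "0 \<le> \<phi> t" for t using piece(2) by (simp add: \<phi>_def)
    show "0 < ?m" using piece(3) N(1) by (simp add: \<phi>_def)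
    fix r assume "unit_orbital (\<lambda>t. r * \<phi> t) (\<lambda>t. r * \<phi>' t)"
    then show "V (\<lambda>t. (r * \<phi> t)\<^sup>2) \<le> localised_bound"
    proof (rule V_sq_le_localised_bound[where a=0])
      fix t assume "r * \<phi> t \<noteq> 0"
      then show "distT (t - 0) < arc_radius" using window_nonzero_iff[OF N(1), of 0 t] N(2) by (simp add: \<phi>_def)
    qed
  qed
  moreover have "- (U * ?m) \<le> (\<integral>t. u t * (\<phi> t)\<^sup>2 \<partial>Lper)" by (rule integral_mult_sq_ge[OF u(1,2) C1per_cont(1)[OF \<phi>']])
  moreover have "?m \<le> (\<integral>t. F * (window N 0 t)\<^sup>2 \<partial>Lper)"
  proof (rule integral_mono)
    show "integrable Lper (\<lambda>t. (\<phi> t)\<^sup>2)" "integrable Lper (\<lambda>t. F * (window N 0 t)\<^sup>2)"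
      by (intro integrable_Lper_cont continuous_intros C1per_cont[OF \<phi>'] window_cont N(1))+
    show "(\<phi> t)\<^sup>2 \<le> F * (window N 0 t)\<^sup>2" for t
      using f(2)[of t] f(3)[of t] by (simp add: \<phi>_def power_mult_distrib mult_right_mono)
  qed
  then have "(localised_bound + U) * ?m \<le> (localised_bound + U) * (F * (2 * pi / real N))"
    using localised_bound_nonneg u(3) by (intro mult_left_mono) (auto simp: integral_window_sq[OF N(1)])
  ultimately show ?thesis by (simp only: distrib_right[of localised_bound U ?m] mult.assoc)
qed

lemma V_le_integral_approx:
  assumes u: "local_majorant u" "continuous_on Iper u" and f: "C1per f f'" "\<And>t. 0 < f t" and e: "0 < e"
  shows "V f \<le> (\<integral>t. u t * f t \<partial>Lper) + 2 * e * (\<integral>t. f t \<partial>Lper) + e"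
proof -
  obtain U where U: "0 \<le> U" "\<And>t. t \<in> Iper \<Longrightarrow> \<bar>u t\<bar> \<le> U" using continuous_on_Iper_bounded[OF u(2)] by blast
  obtain F where F: "0 \<le> F" "\<And>t. \<bar>f t\<bar> \<le> F" using C1per_bounded[OF f(1)] by metis
  obtain \<eta> where \<eta>: "0 < \<eta>" "\<And>\<phi> \<phi>' c. c \<in> Iper \<Longrightarrow> C1per \<phi> \<phi>' \<Longrightarrow> (\<And>t. 0 \<le> \<phi> t) \<Longrightarrow> 0 < (\<integral>t. (\<phi> t)\<^sup>2 \<partial>Lper) \<Longrightarrow>
     (\<And>t. t \<in> Iper \<Longrightarrow> \<phi> t \<noteq> 0 \<Longrightarrow> \<bar>t - c\<bar> < \<eta>) \<Longrightarrow> V (\<lambda>t. (\<phi> t)\<^sup>2) \<le> (\<integral>t. u t * (\<phi> t)\<^sup>2 \<partial>Lper) + 2 * e * (\<integral>t. (\<phi> t)\<^sup>2 \<partial>Lper)"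
    using V_narrow_sq_le[OF u e] by blast
  obtain N where N: "2 \<le> N" "window_radius N < \<eta>" "window_radius N < arc_radius" "(localised_bound + U) * F * (2 * pi / real N) < e"
    using exists_fine_grid[OF \<eta>(1) arc_radius_pos e] by metis
  let ?\<phi> = "\<lambda>i t. sqrt (f t) * window N i t" and ?m = "\<lambda>i. \<integral>t. (sqrt (f t) * window N i t)\<^sup>2 \<partial>Lper"
  note piece = window_piece[OF N(1) f]
  have V_piece: "V (\<lambda>t. (?\<phi> i t)\<^sup>2) \<le> (\<integral>t. u t * (?\<phi> i t)\<^sup>2 \<partial>Lper) + 2 * e * ?m i + (if i = 0 then e else 0)" if i: "i < N" for i
  proof (cases "i = 0")
    case True
    have "0 \<le> 2 * e * ?m 0" using e piece(4)[of 0] N(1) by simp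
    then show ?thesis using V_central_piece_le[OF u(2) U(2,1) f F(2) N(1,3)] N(4) True by simp
  next
    case False
    obtain \<phi>' where \<phi>': "C1per (?\<phi> i) \<phi>'" using piece(1) by blast
    have "\<bar>t - grid_angle N i\<bar> < \<eta>" if "t \<in> Iper" "?\<phi> i t \<noteq> 0" for t
      using window_support_near[OF N(1) _ i that(1)] that(2) False N(2) by simp
    from \<eta>(2)[OF grid_angle_in_Iper[OF i] \<phi>' piece(2) piece(4)[OF i] this] False show ?thesis by simp
  qed
  have "H1per (\<lambda>t. (?\<phi> i t)\<^sup>2)" for i using piece(1)[of i] C1per_H1per[OF C1per_sq] by blast
  then have "V f = (\<Sum>i<N. V (\<lambda>t. (?\<phi> i t)\<^sup>2))"
    using H1_linear_sum[OF V_linear, of "{..<N}" "\<lambda>i t. (?\<phi> i t)\<^sup>2" "\<lambda>_. 1"] by (simp flip: piece(3))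
  also have "\<dots> \<le> (\<Sum>i<N. (\<integral>t. u t * (?\<phi> i t)\<^sup>2 \<partial>Lper) + 2 * e * ?m i + (if i = 0 then e else 0))"
    using V_piece by (intro sum_mono) auto
  also have "\<dots> = (\<Sum>i<N. \<integral>t. u t * (?\<phi> i t)\<^sup>2 \<partial>Lper) + 2 * e * (\<Sum>i<N. ?m i) + e"
    using N(1) by (simp add: sum.distrib sum_distrib_left)
  also have "(\<Sum>i<N. \<integral>t. u t * (?\<phi> i t)\<^sup>2 \<partial>Lper) = (\<integral>t. (\<Sum>i<N. u t * (?\<phi> i t)\<^sup>2) \<partial>Lper)"
    by (rule Bochner_Integration.integral_sum[symmetric])
      (intro integrable_Lper_cont continuous_intros u(2) window_cont N(1) C1per_cont[OF f(1)])
  also have "(\<Sum>i<N. ?m i) = (\<integral>t. (\<Sum>i<N. (?\<phi> i t)\<^sup>2) \<partial>Lper)"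
    by (rule Bochner_Integration.integral_sum[symmetric])
      (intro integrable_Lper_cont continuous_intros window_cont N(1) C1per_cont[OF f(1)])
  finally show ?thesis by (simp only: sum_distrib_left[symmetric] piece(3)[symmetric])
qed

lemma V_le_integral:
  assumes "local_majorant u" "continuous_on Iper u" "C1per f f'" "\<And>t. 0 < f t"
  shows "V f \<le> (\<integral>t. u t * f t \<partial>Lper)"
proof (rule tendsto_lowerbound)
  show "((\<lambda>e. (\<integral>t. u t * f t \<partial>Lper) + 2 * e * (\<integral>t. f t \<partial>Lper) + e) \<longlongrightarrow> (\<integral>t. u t * f t \<partial>Lper)) (at_right 0)"
    by (rule tendsto_eq_intros | simp)+
  show "\<forall>\<^sub>F e in at_right 0. V f \<le> (\<integral>t. u t * f t \<partial>Lper) + 2 * e * (\<integral>t. f t \<partial>Lper) + e"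
    unfolding eventually_at_filter using V_le_integral_approx[OF assms] by auto
qed simp

definition integral_majorant :: "(real \<Rightarrow> real) \<Rightarrow> bool" where
  "integral_majorant u \<longleftrightarrow> continuous_on Iper u \<and> (\<forall>f f'. C1per f f' \<longrightarrow> (\<forall>t. 0 < f t) \<longrightarrow> V f \<le> (\<integral>t. u t * f t \<partial>Lper))"

lemma exists_integral_majorant:
  obtains u where "dual_feasible u" "integral_majorant u"
proof -
  obtain u where u: "dual_feasible u" "\<And>t. t \<in> Iper \<Longrightarrow> envelope t \<le> u t" "continuous_on Iper u"
    using exists_continuous_feasible_above[OF envelope_feasible envelope_ge] localised_bound_nonneg by auto
  have "local_majorant u" by (rule local_majorant_mono[OF local_majorant_envelope u(2)])
  then have "integral_majorant u" unfolding integral_majorant_def using V_le_integral u(3) by blast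
  then show ?thesis using that u(1) by blast
qed

end

section \<open>Weak duality\<close>

lemma integral_Bper:
  fixes f :: "real \<Rightarrow> real"
  assumes "f \<in> borel_measurable Bper"
  shows "(\<integral>t. f t \<partial>Bper) = (\<integral>t. f t \<partial>Lper)"
proof -
  have "(\<lambda>t. indicator Iper t *\<^sub>R f t) \<in> borel_measurable lborel"
    using assms by (subst (asm) borel_measurable_restrict_space_iff) auto
  then show ?thesis by (simp add: integral_restrict_space integral_completion)
qed

lemma coupling_component:
  assumes "coupling n \<rho> \<gamma>" "i < n" shows "(\<lambda>x. x i) \<in> measurable \<gamma> Bper"
proof -
  have "sets \<gamma> = sets (Pi\<^sub>M {..<n} (\<lambda>_. Bper))" using assms(1) by (simp add: coupling_def)
  then have "measurable \<gamma> Bper = measurable (Pi\<^sub>M {..<n} (\<lambda>_. Bper)) Bper" by (rule measurable_cong_sets[OF _ refl])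
  moreover have "(\<lambda>x. x i) \<in> measurable (Pi\<^sub>M {..<n} (\<lambda>_. Bper)) Bper"
    by (rule measurable_component_singleton) (simp add: assms(2))
  ultimately show ?thesis by simp
qed

lemma space_coupling: assumes "coupling n \<rho> \<gamma>" shows "space \<gamma> = PiE {..<n} (\<lambda>_. Iper)"
proof -
  have "sets \<gamma> = sets (Pi\<^sub>M {..<n} (\<lambda>_. Bper))" using assms by (simp add: coupling_def)
  then show ?thesis by (subst sets_eq_imp_space_eq) (auto simp: space_PiM)
qed

lemma coupling_marginal:
  assumes \<gamma>: "coupling n \<rho> \<gamma>" and \<rho>: "continuous_on Iper \<rho>" "\<And>t. t \<in> Iper \<Longrightarrow> 0 \<le> \<rho> t"
    and h: "continuous_on Iper (h :: real \<Rightarrow> real)" and i: "i < n"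
  shows "integrable \<gamma> (\<lambda>x. h (x i))" "(\<integral>x. h (x i) \<partial>\<gamma>) = (\<integral>t. \<rho> t * h t \<partial>Lper)"
proof -
  note component = coupling_component[OF \<gamma> i]
  have m: "h \<in> borel_measurable Bper" "\<rho> \<in> borel_measurable Bper" "(\<lambda>t. \<rho> t * h t) \<in> borel_measurable Bper"
    by (intro continuous_on_Bper_measurable continuous_intros \<rho>(1) h)+
  obtain B where B: "\<And>t. t \<in> Iper \<Longrightarrow> \<bar>h t\<bar> \<le> B" using continuous_on_Iper_bounded[OF h] by metis
  interpret prob_space \<gamma> using \<gamma> by (simp add: coupling_def)
  show "integrable \<gamma> (\<lambda>x. h (x i))"
    by (rule integrable_const_bound[where B=B])
      (use B i space_coupling[OF \<gamma>] measurable_compose[OF component m(1)] in \<open>auto intro!: AE_I2\<close>)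
  have "(\<integral>x. h (x i) \<partial>\<gamma>) = (\<integral>t. h t \<partial>distr \<gamma> Bper (\<lambda>x. x i))"
    by (rule integral_distr[OF component m(1), symmetric])
  also have "\<dots> = (\<integral>t. h t \<partial>density Bper (\<lambda>t. ennreal (\<rho> t)))" using \<gamma> i by (simp add: coupling_def)
  also have "\<dots> = (\<integral>t. \<rho> t * h t \<partial>Bper)" using integral_density[OF m(1,2) AE_I2] \<rho>(2) by simp
  finally show "(\<integral>x. h (x i) \<partial>\<gamma>) = (\<integral>t. \<rho> t * h t \<partial>Lper)" by (simp add: integral_Bper[OF m(3)])
qed

lemma ennreal_integral_le_nn_integral:
  assumes "integrable M f" shows "ennreal (\<integral>x. f x \<partial>M) \<le> (\<integral>\<^sup>+x. ennreal (f x) \<partial>M)"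
proof -
  have "(\<integral>x. f x \<partial>M) \<le> enn2real (\<integral>\<^sup>+x. ennreal (f x) \<partial>M)"
    by (simp add: real_lebesgue_integral_def[OF assms])
  then have "ennreal (\<integral>x. f x \<partial>M) \<le> ennreal (enn2real (\<integral>\<^sup>+x. ennreal (f x) \<partial>M))" by (rule ennreal_leI)
  also have "\<dots> \<le> (\<integral>\<^sup>+x. ennreal (f x) \<partial>M)" by (simp add: ennreal_enn2real_if)
  finally show ?thesis .
qed

lemma DperD:
  assumes "Dper \<rho>"
  shows "H1per \<rho>" "continuous_on Iper \<rho>" "t \<in> Iper \<Longrightarrow> 0 < \<rho> t" "t \<in> Iper \<Longrightarrow> 0 \<le> \<rho> t" "(\<integral>t. \<rho> t \<partial>Lper) = 1"
  using assms by (auto simp: Dper_def less_imp_le)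

context cost
begin

lemma weak_duality:
  assumes u: "\<And>i. i < n \<Longrightarrow> continuous_on Iper (u i)" "\<And>x. x \<in> distinct_configs \<Longrightarrow> (\<Sum>i<n. u i (x i)) \<le> real_cost x"
    and \<rho>: "Dper \<rho>"
  shows "ennreal (\<Sum>i<n. \<integral>t. \<rho> t * u i t \<partial>Lper) \<le> FOT n w \<rho>"
  unfolding FOT_def
proof (rule INF_greatest)
  fix \<gamma> assume "\<gamma> \<in> {\<gamma>. coupling n \<rho> \<gamma>}"
  then have \<gamma>: "coupling n \<rho> \<gamma>" by simp
  note marginal = coupling_marginal[OF \<gamma> DperD(2,4)[OF \<rho>] u(1)]
  have "ennreal (\<Sum>i<n. \<integral>t. \<rho> t * u i t \<partial>Lper) = ennreal (\<integral>x. (\<Sum>i<n. u i (x i)) \<partial>\<gamma>)"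
    using marginal by (simp add: Bochner_Integration.integral_sum)
  also have "\<dots> \<le> (\<integral>\<^sup>+x. ennreal (\<Sum>i<n. u i (x i)) \<partial>\<gamma>)"
    using marginal(1) by (intro ennreal_integral_le_nn_integral Bochner_Integration.integrable_sum) simp
  also have "\<dots> \<le> (\<integral>\<^sup>+x. cN n w x \<partial>\<gamma>)"
  proof (rule nn_integral_mono)
    fix x assume "x \<in> space \<gamma>"
    then have "x \<in> configs" using space_coupling[OF \<gamma>] by (auto simp: configs_def)
    then show "ennreal (\<Sum>i<n. u i (x i)) \<le> cN n w x"
      using u(2)[of x] cN_eq_real_cost[of x] cN_eq_top[of x] by (cases "x \<in> distinct_configs") (auto intro: ennreal_leI)
  qed
  finally show "ennreal (\<Sum>i<n. \<integral>t. \<rho> t * u i t \<partial>Lper) \<le> (\<integral>\<^sup>+x. cN n w x \<partial>\<gamma>)" .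
qed

lemma cN_cong: "(\<And>i. i < n \<Longrightarrow> x i = y i) \<Longrightarrow> cN n w x = cN n w y"
  unfolding cN_def by (intro sum.cong) auto

lemma dual_feasible_iff:
  "dual_feasible u \<longleftrightarrow> (\<forall>x\<in>PiE {..<n} (\<lambda>_. Iper). 0 \<le> enn2ereal (cN n w x) - ereal (\<Sum>j<n. u (x j)))" (is "_ \<longleftrightarrow> ?R")
proof
  assume u: "dual_feasible u"
  show ?R
  proof
    fix x assume "x \<in> PiE {..<n} (\<lambda>_. Iper)"
    then have "x \<in> configs" by (auto simp: configs_def)
    then show "0 \<le> enn2ereal (cN n w x) - ereal (\<Sum>j<n. u (x j))"
      using dual_feasibleD[OF u, of x] cN_eq_real_cost[of x] cN_eq_top[of x] real_cost_nonneg[of x]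
      by (cases "x \<in> distinct_configs") (auto simp: enn2ereal_ennreal)
  qed
next
  assume R: ?R
  show "dual_feasible u" unfolding dual_feasible_def
  proof
    fix x assume x: "x \<in> distinct_configs"
    let ?y = "restrict x {..<n}"
    have "?y \<in> PiE {..<n} (\<lambda>_. Iper)" using distinct_configsD[OF x] by auto
    then have "0 \<le> enn2ereal (cN n w ?y) - ereal (\<Sum>j<n. u (?y j))" using R by blast
    moreover have "cN n w ?y = ennreal (real_cost x)" using cN_cong[of ?y x] cN_eq_real_cost[OF x] by simp
    ultimately show "(\<Sum>i<n. u (x i)) \<le> real_cost x" using real_cost_nonneg[of x] by (simp add: enn2ereal_ennreal)
  qed
qed

lemma kantorovich_pot_iff:
  assumes \<rho>: "Dper \<rho>" and u: "continuous_on Iper u"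
  shows "kantorovich_pot n w \<rho> u \<longleftrightarrow>
    dual_feasible u \<and> 0 \<le> (\<integral>t. \<rho> t * u t \<partial>Lper) \<and> FOT n w \<rho> = ennreal (real n * (\<integral>t. \<rho> t * u t \<partial>Lper))"
proof -
  let ?r = "real n * (\<integral>t. \<rho> t * u t \<partial>Lper)"
  have "integrable Lper (\<lambda>t. \<rho> t * u t)" by (intro integrable_Lper_cont continuous_intros DperD(2)[OF \<rho>] u)
  moreover have "enn2ereal (FOT n w \<rho>) = ereal ?r \<longleftrightarrow> 0 \<le> ?r \<and> FOT n w \<rho> = ennreal ?r"
  proof (cases "FOT n w \<rho>")
    case (real F)
    then show ?thesis by (auto simp: enn2ereal_ennreal)
  next
    case top
    then show ?thesis by simp
  qed
  moreover have "0 \<le> ?r \<longleftrightarrow> 0 \<le> (\<integral>t. \<rho> t * u t \<partial>Lper)" using n_pos by (simp add: zero_le_mult_iff)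
  ultimately show ?thesis unfolding kantorovich_pot_def dual_feasible_iff by blast
qed

end

section \<open>The limit potential is a Kantorovich potential\<close>

lemma integrable_Lper_cont_mult:
  fixes u h :: "real \<Rightarrow> real"
  assumes u: "continuous_on Iper u" and h: "integrable Lper h" shows "integrable Lper (\<lambda>t. u t * h t)"
proof -
  obtain U where "\<And>t. t \<in> Iper \<Longrightarrow> \<bar>u t\<bar> \<le> U" "0 \<le> U" using continuous_on_Iper_bounded[OF u] by metis
  then have "AE t in Lper. norm (u t * h t) \<le> norm (U * h t)"
    by (intro AE_I2) (auto simp: abs_mult intro!: mult_right_mono)
  then show ?thesis
    by (rule Bochner_Integration.integrable_bound[OF integrable_mult_right[OF h, of U], rotated])
      (intro borel_measurable_times measurable_Lper_cont[OF u] borel_measurable_integrable[OF h])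
qed

lemma abs_integral_mult_le:
  fixes u h :: "real \<Rightarrow> real"
  assumes u: "continuous_on Iper u" "\<And>t. t \<in> Iper \<Longrightarrow> \<bar>u t\<bar> \<le> U" "0 \<le> U" and h: "L2per (\<lambda>t. complex_of_real (h t))"
  shows "\<bar>\<integral>t. u t * h t \<partial>Lper\<bar> \<le> U * sqrt (2 * pi * (\<integral>t. (h t)\<^sup>2 \<partial>Lper))"
proof -
  have hi: "integrable Lper h" by (rule L2per_of_real_integrable[OF h])
  have h2: "integrable Lper (\<lambda>t. \<bar>h t\<bar>\<^sup>2)" using square_integrableD(2)[OF h] by simp
  have "\<bar>\<integral>t. u t * h t \<partial>Lper\<bar> \<le> (\<integral>t. \<bar>u t * h t\<bar> \<partial>Lper)" by (rule integral_abs_bound)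
  also have "\<dots> \<le> (\<integral>t. U * \<bar>h t\<bar> \<partial>Lper)"
    using u(2) by (intro integral_mono integrable_abs integrable_Lper_cont_mult[OF u(1) hi] integrable_mult_right hi)
      (auto simp: abs_mult intro!: mult_right_mono)
  also have "\<dots> = U * (\<integral>t. \<bar>h t\<bar> \<partial>Lper)" by simp
  also have "(\<integral>t. \<bar>h t\<bar> \<partial>Lper) \<le> sqrt (2 * pi * (\<integral>t. \<bar>h t\<bar>\<^sup>2 \<partial>Lper))"
    using finite_measure.abs_integral_le_sqrt_integral_sq[OF finite_measure_Lper integrable_abs[OF hi] h2]
    by (simp add: measure_Lper)
  finally show ?thesis using u(3) by (simp add: mult_left_mono)
qed

lemma H1_continuous_integral_mult:
  assumes u: "continuous_on Iper u" shows "H1_continuous (\<lambda>f. \<integral>t. u t * f t \<partial>Lper)"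
proof -
  obtain U where U: "\<And>t. t \<in> Iper \<Longrightarrow> \<bar>u t\<bar> \<le> U" "0 \<le> U" using continuous_on_Iper_bounded[OF u] by metis
  show ?thesis
  proof (rule H1_continuousI[where C="U * sqrt (2 * pi)"])
    fix f g T T' k assume approx: "H1_approximation f g T T'"
    note L = H1_approximation_L2per[OF approx]
    have "L2per (\<lambda>t. complex_of_real (f t - T k t))" using square_integrable_diff[OF L(1) L(3)] by simp
    from abs_integral_mult_le[OF u U this]
    have "\<bar>(\<integral>t. u t * f t \<partial>Lper) - (\<integral>t. u t * T k t \<partial>Lper)\<bar> \<le> U * sqrt (2 * pi * (\<integral>t. (f t - T k t)\<^sup>2 \<partial>Lper))"
      using L2per_of_real_integrable[OF L(1)] L2per_of_real_integrable[OF L(3)]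
      by (simp add: right_diff_distrib integrable_Lper_cont_mult[OF u])
    also have "\<dots> \<le> U * sqrt (2 * pi) * sqrt (h1_sqnorm (\<lambda>t. f t - T k t) (\<lambda>t. g t - T' k t))"
      unfolding real_sqrt_mult mult.assoc by (intro mult_left_mono real_sqrt_le_mono L2_le_h1_sqnorm U(2)) auto
    finally show "\<bar>(\<integral>t. u t * f t \<partial>Lper) - (\<integral>t. u t * T k t \<partial>Lper)\<bar>
      \<le> U * sqrt (2 * pi) * sqrt (h1_sqnorm (\<lambda>t. f t - T k t) (\<lambda>t. g t - T' k t))" .
  qed
qed

lemma H1_continuous_eqI:
  assumes "H1_continuous V" "H1_continuous W" "\<And>f f'. C1per f f' \<Longrightarrow> V f = W f" "H1per f"
  shows "V f = W f"
proof -
  obtain g T T' where approx: "H1_approximation f g T T'" using exists_trig_H1_approximation[OF assms(4)] by metis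
  then have "(\<lambda>k. V (T k)) \<longlonglongrightarrow> W f"
    using H1_continuousD[OF assms(2) approx] assms(3)[OF H1_approximationD(2)[OF approx]] by simp
  then show ?thesis using H1_continuousD[OF assms(1) approx] LIMSEQ_unique by blast
qed

context limit_potential
begin

lemma V_perturbed_density_le:
  assumes u: "integral_majorant u" and \<rho>: "Dper \<rho>"
  obtains m where "0 < m" "\<And>h h'. C1per h h' \<Longrightarrow> \<forall>t. \<bar>h t\<bar> < m \<Longrightarrow>
    V \<rho> + V h \<le> (\<integral>t. \<rho> t * u t \<partial>Lper) + (\<integral>t. u t * h t \<partial>Lper)"
proof -
  obtain m M R g T T' where m: "0 < m" and approx: "H1_approximation \<rho> g T T'"
    and T: "\<forall>\<^sub>F k in sequentially. (\<forall>t. m \<le> T k t \<and> T k t \<le> M) \<and> (\<integral>t. (T' k t)\<^sup>2 \<partial>Lper) \<le> R"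
    by (rule Dper_approximation[OF \<rho>])
  note C1T = H1_approximationD(2)[OF approx]
  have cont: "continuous_on Iper u" using u by (simp add: integral_majorant_def)
  show ?thesis
  proof (rule that[OF m])
    fix h h' assume h: "C1per h h'" "\<forall>t. \<bar>h t\<bar> < m"
    have "\<forall>\<^sub>F k in sequentially. V (T k) + V h \<le> (\<integral>t. u t * T k t \<partial>Lper) + (\<integral>t. u t * h t \<partial>Lper)"
      using T
    proof eventually_elim
      case (elim k)
      have "0 < T k t + h t" for t using elim h(2) by (auto simp: abs_less_iff dest!: spec[of _ t])
      then have "V (\<lambda>t. T k t + h t) \<le> (\<integral>t. u t * (T k t + h t) \<partial>Lper)"
        using u C1per_add[OF C1T h(1)] unfolding integral_majorant_def by blast
      also have "\<dots> = (\<integral>t. u t * T k t \<partial>Lper) + (\<integral>t. u t * h t \<partial>Lper)"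
        unfolding distrib_left
        by (intro Bochner_Integration.integral_add integrable_Lper_cont continuous_intros cont C1per_cont[OF C1T] C1per_cont[OF h(1)])
      finally show ?case using H1_linearD[OF V_linear C1per_H1per[OF C1T] C1per_H1per[OF h(1)], of 1 k 1] by simp
    qed
    moreover have "(\<lambda>k. V (T k) + V h) \<longlonglongrightarrow> V \<rho> + V h"
      by (intro tendsto_intros H1_continuousD[OF H1_functionalD(3)[OF V_functional] approx])
    moreover have "(\<lambda>k. (\<integral>t. u t * T k t \<partial>Lper) + (\<integral>t. u t * h t \<partial>Lper)) \<longlonglongrightarrow> (\<integral>t. u t * \<rho> t \<partial>Lper) + (\<integral>t. u t * h t \<partial>Lper)"
      by (intro tendsto_intros H1_continuousD[OF H1_continuous_integral_mult[OF cont] approx])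
    ultimately have "V \<rho> + V h \<le> (\<integral>t. u t * \<rho> t \<partial>Lper) + (\<integral>t. u t * h t \<partial>Lper)"
      by (intro tendsto_le[OF sequentially_bot]) auto
    then show "V \<rho> + V h \<le> (\<integral>t. \<rho> t * u t \<partial>Lper) + (\<integral>t. u t * h t \<partial>Lper)" by (simp add: mult.commute)
  qed
qed

text \<open>Equality at the interior point \<open>\<rho>\<close> of the cone of positive densities forces equality of the linear functionals.\<close>

lemma V_eq_integral:
  assumes u: "integral_majorant u"
    and \<rho>: "Dper \<rho>" "V \<rho> = (\<integral>t. \<rho> t * u t \<partial>Lper)" and f: "H1per f"
  shows "V f = (\<integral>t. u t * f t \<partial>Lper)"
proof (rule H1_continuous_eqI[OF H1_functionalD(3)[OF V_functional] H1_continuous_integral_mult _ f])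
  show "continuous_on Iper u" using u by (simp add: integral_majorant_def)
  fix h h' assume h: "C1per h h'"
  obtain m where m: "0 < m" "\<And>h h'. C1per h h' \<Longrightarrow> \<forall>t. \<bar>h t\<bar> < m \<Longrightarrow>
    V \<rho> + V h \<le> (\<integral>t. \<rho> t * u t \<partial>Lper) + (\<integral>t. u t * h t \<partial>Lper)"
    using V_perturbed_density_le[OF u \<rho>(1)] by blast
  obtain B where B: "0 \<le> B" "\<And>t. \<bar>h t\<bar> \<le> B" using C1per_bounded[OF h] by metis
  define \<tau> where "\<tau> = m / (B + 1)"
  have \<tau>: "0 < \<tau>" "\<tau> * (B + 1) = m" using m(1) B(1) by (auto simp: \<tau>_def)
  have scaled: "c * V h \<le> c * (\<integral>t. u t * h t \<partial>Lper)" if c: "\<bar>c\<bar> = \<tau>" for c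
  proof -
    have "\<forall>t. \<bar>c * h t\<bar> < m"
    proof
      fix t
      have "\<bar>c * h t\<bar> \<le> \<tau> * B" unfolding abs_mult c using \<tau>(1) B(2) by (intro mult_left_mono) auto
      also have "\<dots> < m" using \<tau> by (simp add: distrib_left)
      finally show "\<bar>c * h t\<bar> < m" .
    qed
    from m(2)[OF C1per_cmult[OF h] this] show ?thesis
      by (simp add: \<rho>(2) H1_linear_cmult[OF V_linear C1per_H1per[OF h]] mult.left_commute)
  qed
  show "V h = (\<integral>t. u t * h t \<partial>Lper)" using scaled[of \<tau>] scaled[of "- \<tau>"] \<tau>(1) by simp
qed

lemma exists_kantorovich_pot:
  assumes \<rho>: "Dper \<rho>" and "FOT n w \<rho> \<le> ennreal (real n * V \<rho>)" "0 \<le> V \<rho>"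
  obtains u where "regular_kantorovich_pot n w \<rho> u" "\<And>f. H1per f \<Longrightarrow> V f = (\<integral>t. u t * f t \<partial>Lper)"
proof -
  obtain u where feasible: "dual_feasible u" and u: "integral_majorant u" by (rule exists_integral_majorant)
  then have cont: "continuous_on Iper u" by (simp add: integral_majorant_def)
  let ?r = "\<integral>t. \<rho> t * u t \<partial>Lper"
  obtain m where m: "0 < m" "\<And>h h'. C1per h h' \<Longrightarrow> \<forall>t. \<bar>h t\<bar> < m \<Longrightarrow> V \<rho> + V h \<le> ?r + (\<integral>t. u t * h t \<partial>Lper)"
    using V_perturbed_density_le[OF u \<rho>] by blast
  have "V \<rho> \<le> ?r"
    using m(2)[OF C1per_const[of 0]] m(1) H1_linear_cmult[OF V_linear H1per_const, of 0 0] by simp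
  moreover have dual: "ennreal (real n * ?r) \<le> FOT n w \<rho>"
    using weak_duality[of "\<lambda>_. u" \<rho>] dual_feasibleD[OF feasible] cont \<rho> by simp
  then have "real n * ?r \<le> real n * V \<rho>"
    using order_trans[OF dual assms(2)] assms(3) by (simp add: ennreal_le_iff)
  then have "?r \<le> V \<rho>" using n_pos by simp
  ultimately have eq: "V \<rho> = ?r" by simp
  then have "FOT n w \<rho> = ennreal (real n * ?r)" using dual assms(2) by simp
  then have "regular_kantorovich_pot n w \<rho> u"
    using feasible eq assms(3) cont by (simp add: regular_kantorovich_pot_def kantorovich_pot_iff[OF \<rho>])
  then show ?thesis using that V_eq_integral[OF u \<rho> eq] by blast
qed

end

section \<open>Contact configurations\<close>

context cost
begin

lemma kantorovich_potD:
  assumes "Dper \<rho>" "continuous_on Iper u" "kantorovich_pot n w \<rho> u"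
  shows "dual_feasible u" "0 \<le> (\<integral>t. \<rho> t * u t \<partial>Lper)" "FOT n w \<rho> = ennreal (real n * (\<integral>t. \<rho> t * u t \<partial>Lper))"
  using assms kantorovich_pot_iff by auto

lemma kantorovich_pot_integral_eq:
  assumes \<rho>: "Dper \<rho>" and u: "continuous_on Iper u" "kantorovich_pot n w \<rho> u" and v: "continuous_on Iper v" "kantorovich_pot n w \<rho> v"
  shows "(\<integral>t. \<rho> t * u t \<partial>Lper) = (\<integral>t. \<rho> t * v t \<partial>Lper)"
proof -
  have "ennreal (real n * (\<integral>t. \<rho> t * u t \<partial>Lper)) = ennreal (real n * (\<integral>t. \<rho> t * v t \<partial>Lper))"
    using kantorovich_potD(3)[OF \<rho> u] kantorovich_potD(3)[OF \<rho> v] by simp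
  then show ?thesis using kantorovich_potD(2)[OF \<rho> u] kantorovich_potD(2)[OF \<rho> v] n_pos by (simp add: ennreal_inj)
qed

lemma kantorovich_pot_average:
  assumes \<rho>: "Dper \<rho>" and u: "continuous_on Iper u" "kantorovich_pot n w \<rho> u" and v: "continuous_on Iper v" "kantorovich_pot n w \<rho> v"
  shows "kantorovich_pot n w \<rho> (\<lambda>t. (u t + v t) / 2)"
proof -
  have "integrable Lper (\<lambda>t. \<rho> t * u t)" "integrable Lper (\<lambda>t. \<rho> t * v t)"
    by (intro integrable_Lper_cont continuous_intros DperD(2)[OF \<rho>] u(1) v(1))+
  then have "(\<integral>t. \<rho> t * ((u t + v t) / 2) \<partial>Lper) = (\<integral>t. \<rho> t * u t \<partial>Lper)"
    using kantorovich_pot_integral_eq[OF \<rho> u v] by (simp add: distrib_left add_divide_distrib)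
  moreover have "dual_feasible (\<lambda>t. (u t + v t) / 2)"
    using kantorovich_potD(1)[OF \<rho> u] kantorovich_potD(1)[OF \<rho> v]
    by (force simp: dual_feasible_def sum.distrib simp flip: sum_divide_distrib)
  moreover have "continuous_on Iper (\<lambda>t. (u t + v t) / 2)" by (intro continuous_intros u(1) v(1)) simp
  ultimately show ?thesis using kantorovich_potD(2,3)[OF \<rho> u] by (simp add: kantorovich_pot_iff[OF \<rho>])
qed

text \<open>Otherwise the first potential could be raised near \<open>t\<close>, contradicting weak duality.\<close>

lemma exists_near_contact:
  assumes \<rho>: "Dper \<rho>" and u: "continuous_on Iper u" "kantorovich_pot n w \<rho> u" and t: "t \<in> Iper" and d: "0 < d"
  obtains x where "x \<in> distinct_configs" "\<bar>x 0 - t\<bar> < d" "real_cost x < (\<Sum>i<n. u (x i)) + d"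
proof (rule ccontr)
  note contact = that
  assume "\<not> thesis"
  then have far: "(\<Sum>i<n. u (x i)) + d \<le> real_cost x" if "x \<in> distinct_configs" "\<bar>x 0 - t\<bar> < d" for x
    using contact[OF that] by linarith
  define h where "h s = max 0 (d - \<bar>s - t\<bar>)" for s
  have h_cont: "continuous_on Iper h" unfolding h_def by (intro continuous_intros)
  let ?u = "\<lambda>i s. u s + (if i = 0 then h s else 0)"
  have raised: "(\<Sum>i<n. ?u i (x i)) \<le> real_cost x" if x: "x \<in> distinct_configs" for x
  proof -
    have "(\<Sum>i<n. ?u i (x i)) = (\<Sum>i<n. u (x i)) + h (x 0)" using n_pos by (simp add: sum.distrib)
    also have "\<dots> \<le> real_cost x"
      using far[OF x] dual_feasibleD[OF kantorovich_potD(1)[OF \<rho> u] x] by (cases "\<bar>x 0 - t\<bar> < d") (auto simp: h_def)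
    finally show ?thesis .
  qed
  have "integrable Lper (\<lambda>s. \<rho> s * u s)" "integrable Lper (\<lambda>s. \<rho> s * h s)"
    by (intro integrable_Lper_cont continuous_intros DperD(2)[OF \<rho>] u(1) h_cont)+
  then have marginal: "(\<integral>s. \<rho> s * ?u i s \<partial>Lper) = (\<integral>s. \<rho> s * u s \<partial>Lper) + (if i = 0 then \<integral>s. \<rho> s * h s \<partial>Lper else 0)" for i
    by (simp add: distrib_left)
  have "(\<Sum>i<n. \<integral>s. \<rho> s * ?u i s \<partial>Lper) = real n * (\<integral>s. \<rho> s * u s \<partial>Lper) + (\<integral>s. \<rho> s * h s \<partial>Lper)"
    unfolding marginal sum.distrib using n_pos by simp
  moreover have "continuous_on Iper (?u i)" for i by (cases "i = 0") (auto intro!: continuous_intros u(1) h_cont)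
  then have "ennreal (\<Sum>i<n. \<integral>s. \<rho> s * ?u i s \<partial>Lper) \<le> ennreal (real n * (\<integral>s. \<rho> s * u s \<partial>Lper))"
    unfolding kantorovich_potD(3)[OF \<rho> u, symmetric] by (intro weak_duality raised \<rho>)
  moreover have "0 < (\<integral>s. \<rho> s * h s \<partial>Lper)"
    by (rule integral_Lper_pos[OF _ _ t]) (use DperD[OF \<rho>] h_cont t d in \<open>auto intro!: continuous_intros simp: h_def\<close>)
  ultimately show False using kantorovich_potD(2)[OF \<rho> u] by (simp add: ennreal_le_iff)
qed

lemma configs_convergent_subsequence:
  assumes y: "\<And>k. y k \<in> configs"
  obtains r x where "strict_mono (r :: nat \<Rightarrow> nat)" "x \<in> configs" "\<And>i. i < n \<Longrightarrow> (\<lambda>k. y (r k) i) \<longlonglongrightarrow> x i"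
proof -
  have "bounded (range (\<lambda>k. y k i))" if "i \<in> {..<n}" for i
    by (rule bounded_subset[OF compact_imp_bounded[OF compact_Iper]]) (use configsD[OF y] that in auto)
  then obtain r where r: "strict_mono (r :: nat \<Rightarrow> nat)" "\<And>i. i \<in> {..<n} \<Longrightarrow> convergent (\<lambda>k. y (r k) i)"
    using pointwise_bounded_convergent_subsequence[of "{..<n}" y] by (metis countable_finite finite_lessThan)
  then obtain x where x: "\<And>i. i < n \<Longrightarrow> (\<lambda>k. y (r k) i) \<longlonglongrightarrow> x i" unfolding convergent_def lessThan_iff by metis
  have "x i \<in> Iper" if "i < n" for i
    using closed_sequentially[OF compact_imp_closed[OF compact_Iper] _ x[OF that]] configsD[OF y that] by blast
  then show ?thesis using that[OF r(1) _ x] by (simp add: configs_def)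
qed

lemma separated_configs_limit:
  assumes y: "\<And>k. y k \<in> separated_configs a" and x: "x \<in> configs" and lim: "\<And>i. i < n \<Longrightarrow> (\<lambda>k. y k i) \<longlonglongrightarrow> x i"
  shows "x \<in> separated_configs a"
proof -
  have "isCont distT z" for z
    using continuous_on_distT[OF continuous_on_id, of UNIV] by (simp add: continuous_on_eq_continuous_at)
  then have dist_lim: "(\<lambda>k. distT (y k i - y k j)) \<longlonglongrightarrow> distT (x i - x j)" if "i < n" "j < n" for i j
    by (rule isCont_tendsto_compose) (intro tendsto_intros lim that)
  have "a \<le> distT (x i - x j)" if "i < n" "j < n" "i \<noteq> j" for i j
    by (rule LIMSEQ_le_const[OF dist_lim[OF that(1,2)]]) (use separated_configsD[OF y that] in blast)
  then show ?thesis using x by (simp add: separated_configs_def)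
qed

lemma real_cost_tendsto:
  assumes x: "x \<in> separated_configs a" "0 < a" and y: "\<And>k. y k \<in> configs" and lim: "\<And>i. i < n \<Longrightarrow> (\<lambda>k. y k i) \<longlonglongrightarrow> x i"
  shows "(\<lambda>k. real_cost (y k)) \<longlonglongrightarrow> real_cost x"
proof (rule tendstoI)
  fix e :: real assume e: "0 < e"
  obtain d where d: "0 < d" "\<And>x y. x \<in> separated_configs a \<Longrightarrow> y \<in> configs \<Longrightarrow> (\<And>i. i < n \<Longrightarrow> \<bar>y i - x i\<bar> < d) \<Longrightarrow>
     y \<in> separated_configs (a / 2) \<and> \<bar>real_cost y - real_cost x\<bar> < e"
    using real_cost_uniformly_continuous[OF x(2) e] by blast
  have "\<forall>\<^sub>F k in sequentially. \<forall>i\<in>{..<n}. dist (y k i) (x i) < d"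
    using lim d(1) by (intro eventually_ball_finite) (auto simp: tendsto_iff)
  then show "\<forall>\<^sub>F k in sequentially. dist (real_cost (y k)) (real_cost x) < e"
    by (rule eventually_mono) (use d(2)[OF x(1) y] in \<open>auto simp: dist_real_def\<close>)
qed

lemma exists_contact:
  assumes \<rho>: "Dper \<rho>" and u: "continuous_on Iper u" "kantorovich_pot n w \<rho> u" and t: "t \<in> Iper"
  obtains x where "x \<in> distinct_configs" "x 0 = t" "(\<Sum>i<n. u (x i)) = real_cost x"
proof -
  let ?d = "\<lambda>k. inverse (real (Suc k))"
  have "\<exists>x\<in>distinct_configs. \<bar>x 0 - t\<bar> < ?d k \<and> real_cost x < (\<Sum>i<n. u (x i)) + ?d k" for k
    by (rule exists_near_contact[OF \<rho> u t, of "?d k"]) auto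
  then obtain y where y: "\<And>k. y k \<in> distinct_configs" "\<And>k. \<bar>y k 0 - t\<bar> < ?d k"
    "\<And>k. real_cost (y k) < (\<Sum>i<n. u (y k i)) + ?d k" by metis
  have y_configs: "y k \<in> configs" for k using y(1) distinct_configs_subset by blast
  obtain r x where r: "strict_mono (r :: nat \<Rightarrow> nat)" and x: "x \<in> configs" and lim: "\<And>i. i < n \<Longrightarrow> (\<lambda>k. y (r k) i) \<longlonglongrightarrow> x i"
    using configs_convergent_subsequence[of y, OF y_configs] by blast
  have d0: "(\<lambda>k. ?d (r k)) \<longlonglongrightarrow> 0" using LIMSEQ_subseq_LIMSEQ[OF LIMSEQ_inverse_real_of_nat r] by (simp add: o_def)
  obtain U where U: "\<And>t. t \<in> Iper \<Longrightarrow> \<bar>u t\<bar> \<le> U" using continuous_on_Iper_bounded[OF u(1)] by metis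
  obtain a where a: "0 < a" "\<And>x. x \<in> distinct_configs \<Longrightarrow> real_cost x \<le> real n * U + 1 \<Longrightarrow> x \<in> separated_configs a"
    using separated_of_real_cost_le by metis
  have "real_cost (y k) \<le> real n * U + 1" for k
  proof -
    have "(\<Sum>i<n. u (y k i)) \<le> (\<Sum>i<n. U)" using U[OF distinct_configsD[OF y(1)]] by (intro sum_mono) (auto simp: abs_le_iff)
    moreover have "?d k \<le> 1" by (simp add: inverse_le_1_iff)
    ultimately show ?thesis using y(3)[of k] by simp
  qed
  then have "x \<in> separated_configs a" by (intro separated_configs_limit[OF a(2)[OF y(1)] x lim])
  then have x_distinct: "x \<in> distinct_configs" and cost_lim: "(\<lambda>k. real_cost (y (r k))) \<longlonglongrightarrow> real_cost x"
    using separated_configs_distinct[OF a(1)] real_cost_tendsto[OF _ a(1) y_configs lim] by auto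
  have "(\<lambda>k. \<bar>y (r k) 0 - t\<bar>) \<longlonglongrightarrow> \<bar>x 0 - t\<bar>" using n_pos by (intro tendsto_intros lim) simp
  then have "\<bar>x 0 - t\<bar> \<le> 0" by (rule LIMSEQ_le[OF _ d0]) (use y(2) less_imp_le in blast)
  moreover have "(\<lambda>k. (\<Sum>i<n. u (y (r k) i)) + ?d (r k)) \<longlonglongrightarrow> (\<Sum>i<n. u (x i)) + 0"
    using configsD[OF x] configsD[OF y_configs]
    by (intro tendsto_add tendsto_sum d0 continuous_on_tendsto_compose[OF u(1) lim]) auto
  then have "real_cost x \<le> (\<Sum>i<n. u (x i)) + 0" by (rule LIMSEQ_le[OF cost_lim]) (use y(3) less_imp_le in blast)
  ultimately show ?thesis
    using that[OF x_distinct] dual_feasibleD[OF kantorovich_potD(1)[OF \<rho> u] x_distinct] by simp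
qed

lemma exists_common_contact:
  assumes \<rho>: "Dper \<rho>" and u: "continuous_on Iper u" "kantorovich_pot n w \<rho> u" and v: "continuous_on Iper v" "kantorovich_pot n w \<rho> v"
    and t: "t \<in> Iper"
  obtains x where "x \<in> distinct_configs" "x 0 = t" "(\<Sum>i<n. u (x i)) = real_cost x" "(\<Sum>i<n. v (x i)) = real_cost x"
proof -
  have "continuous_on Iper (\<lambda>t. (u t + v t) / 2)" by (intro continuous_intros u(1) v(1)) simp
  then obtain x where x: "x \<in> distinct_configs" "x 0 = t" "(\<Sum>i<n. (u (x i) + v (x i)) / 2) = real_cost x"
    using exists_contact[OF \<rho> _ kantorovich_pot_average[OF \<rho> u v] t] by metis
  then have "(\<Sum>i<n. u (x i)) + (\<Sum>i<n. v (x i)) = 2 * real_cost x"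
    by (simp add: sum.distrib flip: sum_divide_distrib)
  then show ?thesis
    using that[OF x(1,2)] dual_feasibleD[OF kantorovich_potD(1)[OF \<rho> u] x(1)] dual_feasibleD[OF kantorovich_potD(1)[OF \<rho> v] x(1)]
    by linarith
qed

end

section \<open>Common supergradients\<close>

definition supergradient_on :: "real set \<Rightarrow> (real \<Rightarrow> real) \<Rightarrow> (real \<Rightarrow> real) \<Rightarrow> bool" where
  "supergradient_on S p f \<longleftrightarrow>
     (\<forall>e>0. \<exists>d>0. \<forall>s\<in>S. \<forall>t\<in>S. \<bar>s - t\<bar> < d \<longrightarrow> f s - f t \<le> p t * (s - t) + e * \<bar>s - t\<bar>)"

lemma supergradient_on_subset: "supergradient_on T p f \<Longrightarrow> S \<subseteq> T \<Longrightarrow> supergradient_on S p f"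
  unfolding supergradient_on_def by (meson subsetD)

lemma difference_increment_le:
  assumes f: "supergradient_on {a..b} p f" and g: "supergradient_on {a..b} p g" and ab: "a \<le> b" and e: "0 < e"
  shows "\<forall>\<^sub>F N in sequentially. (f b - g b) - (f a - g a) \<le> (p a - p b) * ((b - a) / real N) + 2 * e * (b - a)"
proof -
  obtain d where d: "0 < d" "\<forall>s\<in>{a..b}. \<forall>t\<in>{a..b}. \<bar>s - t\<bar> < d \<longrightarrow> f s - f t \<le> p t * (s - t) + e * \<bar>s - t\<bar>"
    using f e unfolding supergradient_on_def by meson
  obtain d' where d': "0 < d'" "\<forall>s\<in>{a..b}. \<forall>t\<in>{a..b}. \<bar>s - t\<bar> < d' \<longrightarrow> g s - g t \<le> p t * (s - t) + e * \<bar>s - t\<bar>"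
    using g e unfolding supergradient_on_def by meson
  have "\<forall>\<^sub>F N in sequentially. (b - a) / real N < min d d'"
    using d(1) d'(1) by (intro order_tendstoD[OF lim_const_over_n]) simp
  then show ?thesis using eventually_gt_at_top[of 0]
  proof eventually_elim
    case (elim N)
    define \<delta> where "\<delta> = (b - a) / real N"
    have \<delta>: "0 \<le> \<delta>" "\<delta> < d" "\<delta> < d'" "real N * \<delta> = b - a" using elim ab by (auto simp: \<delta>_def)
    let ?x = "\<lambda>i::nat. a + real i * \<delta>"
    have x: "?x i \<in> {a..b}" if "i \<le> N" for i
      using mult_right_mono[of "real i" "real N" \<delta>] that \<delta> by auto
    have step: "(f (?x (Suc i)) - g (?x (Suc i))) - (f (?x i) - g (?x i)) \<le> (p (?x i) - p (?x (Suc i))) * \<delta> + 2 * e * \<delta>"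
      if i: "i < N" for i
    proof -
      have diff: "?x (Suc i) - ?x i = \<delta>" "?x i - ?x (Suc i) = - \<delta>" by (simp_all add: algebra_simps)
      have xi: "?x i \<in> {a..b}" "?x (Suc i) \<in> {a..b}" using x[of i] x[of "Suc i"] i by auto
      have "f (?x (Suc i)) - f (?x i) \<le> p (?x i) * \<delta> + e * \<delta>"
        using d(2)[rule_format, OF xi(2,1)] \<delta> unfolding diff by simp
      moreover have "g (?x i) - g (?x (Suc i)) \<le> p (?x (Suc i)) * (- \<delta>) + e * \<delta>"
        using d'(2)[rule_format, OF xi] \<delta> unfolding diff by simp
      ultimately show ?thesis by (simp add: left_diff_distrib)
    qed
    have "(f b - g b) - (f a - g a) = (\<Sum>i<N. (f (?x (Suc i)) - g (?x (Suc i))) - (f (?x i) - g (?x i)))"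
      unfolding sum_lessThan_telescope[of "\<lambda>i. f (?x i) - g (?x i)"] using \<delta>(4) by simp
    also have "\<dots> \<le> (\<Sum>i<N. (p (?x i) - p (?x (Suc i))) * \<delta> + 2 * e * \<delta>)" using step by (intro sum_mono) auto
    also have "\<dots> = (p (?x 0) - p (?x N)) * \<delta> + 2 * e * (real N * \<delta>)"
      unfolding sum.distrib sum_distrib_right[symmetric] sum_lessThan_telescope'[of "\<lambda>i. p (?x i)"] by simp
    finally show ?case using \<delta>(4) by (simp add: \<delta>_def)
  qed
qed

lemma difference_le_of_common_supergradient:
  assumes f: "supergradient_on {a..b} p f" and g: "supergradient_on {a..b} p g" and ab: "a \<le> b"
  shows "f b - g b \<le> f a - g a"
proof -
  let ?h = "(f b - g b) - (f a - g a)"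
  have "?h \<le> 2 * e * (b - a)" if e: "0 < e" for e
  proof (rule tendsto_lowerbound[OF _ difference_increment_le[OF f g ab e]])
    have "(\<lambda>N. (p a - p b) * ((b - a) / real N) + 2 * e * (b - a)) \<longlonglongrightarrow> (p a - p b) * 0 + 2 * e * (b - a)"
      by (intro tendsto_intros lim_const_over_n)
    then show "(\<lambda>N. (p a - p b) * ((b - a) / real N) + 2 * e * (b - a)) \<longlonglongrightarrow> 2 * e * (b - a)" by simp
  qed simp
  then have "\<forall>\<^sub>F e in at_right 0. ?h \<le> 2 * e * (b - a)" by (simp add: eventually_at_filter)
  moreover have "((\<lambda>e. 2 * e * (b - a)) \<longlongrightarrow> 0) (at_right 0)" by (rule tendsto_eq_intros | simp)+
  ultimately have "?h \<le> 0" by (intro tendsto_lowerbound[of "\<lambda>e. 2 * e * (b - a)" 0 "at_right 0"]) simp_all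
  then show ?thesis by simp
qed

lemma has_field_derivative_slice:
  fixes f :: "real \<times> real \<Rightarrow> real"
  assumes f: "(f has_derivative f') (at (x, z) within S)" and J: "(\<lambda>x. (x, z)) ` J \<subseteq> S"
  shows "((\<lambda>x. f (x, z)) has_field_derivative f' (1, 0)) (at x within J)"
proof -
  have "((\<lambda>x. (x, z)) has_derivative (\<lambda>h. (h, 0))) (at x within J)" by (auto intro!: derivative_eq_intros)
  from diff_chain_within[OF this has_derivative_subset[OF f J]]
  have "((\<lambda>x. f (x, z)) has_derivative (\<lambda>h. f' (h, 0))) (at x within J)" by (simp add: o_def)
  moreover have "(\<lambda>h. f' (h, 0)) = (*) (f' (1, 0))"
  proof
    fix h show "f' (h, 0) = f' (1, 0) * h"
      using linear_cmul[OF has_derivative_linear[OF f], of h "(1, 0)"] by simp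
  qed
  ultimately show ?thesis by (simp only: has_field_derivative_def)
qed

lemma slice_increment_le:
  fixes f :: "real \<times> real \<Rightarrow> real" and D :: "real \<times> real \<Rightarrow> (real \<times> real) \<Rightarrow>\<^sub>L real"
  assumes D: "\<And>p. p \<in> S \<Longrightarrow> (f has_derivative blinfun_apply (D p)) (at p within S)"
    and segment: "\<And>x. x \<in> closed_segment t s \<Longrightarrow> (x, z) \<in> S"
    and near: "\<And>x. x \<in> closed_segment t s \<Longrightarrow> norm (D (x, z) - D (t, z)) \<le> e"
  shows "\<bar>f (s, z) - f (t, z) - D (t, z) (1, 0) * (s - t)\<bar> \<le> e * \<bar>s - t\<bar>"
proof -
  let ?J = "closed_segment t s" and ?h = "\<lambda>x. f (x, z) - D (t, z) (1, 0) * x"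
  have "(?h has_field_derivative D (x, z) (1, 0) - D (t, z) (1, 0)) (at x within ?J)" if x: "x \<in> ?J" for x
  proof -
    have "((\<lambda>x. f (x, z)) has_field_derivative D (x, z) (1, 0)) (at x within ?J)"
      using segment by (intro has_field_derivative_slice[OF D[OF segment[OF x]]]) blast
    then show ?thesis by (auto intro!: derivative_eq_intros)
  qed
  moreover have "norm (D (x, z) (1, 0) - D (t, z) (1, 0)) \<le> e" if "x \<in> ?J" for x
    using norm_blinfun[of "D (x, z) - D (t, z)" "(1, 0)"] near[OF that] by (simp add: blinfun.diff_left norm_Pair)
  ultimately have "norm (?h s - ?h t) \<le> e * norm (s - t)"
    by (rule field_differentiable_bound[OF convex_closed_segment]) auto
  then show ?thesis by (simp add: algebra_simps)
qed

context cost
begin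

definition uniform_partial_derivative :: "real \<Rightarrow> (real \<times> real \<Rightarrow> real) \<Rightarrow> bool" where
  "uniform_partial_derivative a g \<longleftrightarrow> (\<forall>e>0. \<exists>d>0. \<forall>s\<in>Iper. \<forall>t\<in>Iper. \<forall>z\<in>Iper. a \<le> distT (t - z) \<longrightarrow> \<bar>s - t\<bar> < d \<longrightarrow>
     \<bar>enn2real (w (s, z)) - enn2real (w (t, z)) - g (t, z) * (s - t)\<bar> \<le> e * \<bar>s - t\<bar>)"

lemma separated_pairs_offdiag: "0 < a \<Longrightarrow> separated_pairs a \<subseteq> offdiag"
  by (auto simp: separated_pairs_def offdiag_def)

lemma separated_pair_near:
  assumes "s \<in> Iper" "z \<in> Iper" "a \<le> distT (t - z)" "\<bar>s - t\<bar> \<le> a / 2"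
  shows "(s, z) \<in> separated_pairs (a / 2)"
  using distT_triangle[of t z s] distT_le_abs[of "t - s"] assms by (simp add: separated_pairs_def abs_minus_commute)

lemma exists_uniform_partial_derivative:
  assumes C1: "C1_offdiag w" and a: "0 < a"
  obtains g where "uniform_partial_derivative a g"
proof -
  obtain D :: "real \<times> real \<Rightarrow> ((real \<times> real) \<Rightarrow>\<^sub>L real)" where D_cont: "continuous_on offdiag D"
    and D: "\<And>p. p \<in> offdiag \<Longrightarrow> ((\<lambda>q. enn2real (w q)) has_derivative blinfun_apply (D p)) (at p within offdiag)"
    using C1 unfolding C1_offdiag_def by blast
  define g where "g p = blinfun_apply (D p) (1, 0)" for p
  let ?K = "separated_pairs (a / 2)"
  have K: "?K \<subseteq> offdiag" by (rule separated_pairs_offdiag) (use a in simp)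
  have "uniformly_continuous_on ?K D"
    by (rule compact_uniformly_continuous[OF continuous_on_subset[OF D_cont K] compact_separated_pairs])
  note unif = this[unfolded uniformly_continuous_on_def, rule_format]
  have "uniform_partial_derivative a g"
    unfolding uniform_partial_derivative_def
  proof (intro allI impI)
    fix e :: real assume e: "0 < e"
    obtain d where d: "0 < d" "\<And>p q. p \<in> ?K \<Longrightarrow> q \<in> ?K \<Longrightarrow> dist q p < d \<Longrightarrow> dist (D q) (D p) < e"
      using unif[OF e] by blast
    have "\<bar>enn2real (w (s, z)) - enn2real (w (t, z)) - g (t, z) * (s - t)\<bar> \<le> e * \<bar>s - t\<bar>"
      if st: "s \<in> Iper" "t \<in> Iper" "z \<in> Iper" "a \<le> distT (t - z)" "\<bar>s - t\<bar> < min d (a / 2)" for s t z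
    proof -
      have J: "x \<in> Iper" "\<bar>x - t\<bar> \<le> \<bar>s - t\<bar>" if "x \<in> closed_segment t s" for x
        using that st(1,2) by (auto simp: closed_segment_eq_real_ivl Iper_def split: if_splits)
      then have JK: "(x, z) \<in> ?K" if "x \<in> closed_segment t s" for x
        using that st by (intro separated_pair_near[of _ _ _ t]) force+
      show ?thesis
        unfolding g_def
      proof (rule slice_increment_le[OF D])
        fix x assume x: "x \<in> closed_segment t s"
        show "(x, z) \<in> offdiag" using JK[OF x] K by blast
        have "dist (x, z) (t, z) < d" using J(2)[OF x] st(5) by (simp add: dist_Pair_Pair dist_real_def)
        then show "norm (D (x, z) - D (t, z)) \<le> e" using d(2)[OF JK JK[OF x], of t] by (simp add: dist_norm)
      qed
    qed
    then show "\<exists>d>0. \<forall>s\<in>Iper. \<forall>t\<in>Iper. \<forall>z\<in>Iper. a \<le> distT (t - z) \<longrightarrow> \<bar>s - t\<bar> < d \<longrightarrow>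
     \<bar>enn2real (w (s, z)) - enn2real (w (t, z)) - g (t, z) * (s - t)\<bar> \<le> e * \<bar>s - t\<bar>"
      using d(1) a by (intro exI[of _ "min d (a / 2)"]) auto
  qed
  then show ?thesis by (rule that)
qed

lemma real_cost_split:
  assumes x: "x \<in> configs" and i: "i < n"
  shows "real_cost x = (\<Sum>j\<in>{..<n} - {i}. 2 * enn2real (w (x i, x j))) +
    (\<Sum>k\<in>{..<n} - {i}. \<Sum>j\<in>{..<n} - {k} - {i}. enn2real (w (x k, x j)))"
proof -
  let ?w = "\<lambda>k j. enn2real (w (x k, x j))"
  have "real_cost x = (\<Sum>j\<in>{..<n} - {i}. ?w i j) + (\<Sum>k\<in>{..<n} - {i}. \<Sum>j\<in>{..<n} - {k}. ?w k j)"
    unfolding real_cost_def using i by (intro sum.remove) auto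
  also have "(\<Sum>k\<in>{..<n} - {i}. \<Sum>j\<in>{..<n} - {k}. ?w k j) = (\<Sum>k\<in>{..<n} - {i}. ?w k i + (\<Sum>j\<in>{..<n} - {k} - {i}. ?w k j))"
    using i by (intro sum.cong refl sum.remove) auto
  also have "\<dots> = (\<Sum>k\<in>{..<n} - {i}. ?w i k) + (\<Sum>k\<in>{..<n} - {i}. \<Sum>j\<in>{..<n} - {k} - {i}. ?w k j)"
    unfolding sum.distrib using w_sym configsD[OF x] i by (intro arg_cong2[of _ _ _ _ "(+)"] sum.cong) auto
  finally show ?thesis by (simp add: sum_distrib_left[symmetric])
qed

lemma real_cost_fun_upd:
  assumes x: "x \<in> configs" and s: "s \<in> Iper" and i: "i < n"
  shows "real_cost (x(i := s)) - real_cost x = (\<Sum>j\<in>{..<n} - {i}. 2 * (enn2real (w (s, x j)) - enn2real (w (x i, x j))))"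
proof -
  let ?y = "x(i := s)"
  have "?y \<in> configs" using configsD[OF x] s by (simp add: configs_def)
  moreover have "(\<Sum>j\<in>{..<n} - {i}. 2 * enn2real (w (?y i, ?y j))) = (\<Sum>j\<in>{..<n} - {i}. 2 * enn2real (w (s, x j)))"
    by (rule sum.cong) auto
  moreover have "(\<Sum>k\<in>{..<n} - {i}. \<Sum>j\<in>{..<n} - {k} - {i}. enn2real (w (?y k, ?y j))) =
      (\<Sum>k\<in>{..<n} - {i}. \<Sum>j\<in>{..<n} - {k} - {i}. enn2real (w (x k, x j)))"
    by (intro sum.cong) auto
  ultimately show ?thesis
    using real_cost_split[OF x i] real_cost_split[of ?y, OF _ i] by (simp add: right_diff_distrib sum_subtractf)
qed

lemma real_cost_increment_le:
  assumes x: "x \<in> separated_configs a" and s: "s \<in> Iper" and i: "i < n" and e: "0 \<le> e"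
    and g: "\<And>z. z \<in> Iper \<Longrightarrow> a \<le> distT (x i - z) \<Longrightarrow>
      \<bar>enn2real (w (s, z)) - enn2real (w (x i, z)) - g (x i, z) * (s - x i)\<bar> \<le> e * \<bar>s - x i\<bar>"
  shows "real_cost (x(i := s)) - real_cost x \<le> (\<Sum>j\<in>{..<n} - {i}. 2 * g (x i, x j)) * (s - x i) + 2 * real n * e * \<bar>s - x i\<bar>"
proof -
  have x_configs: "x \<in> configs" using x separated_configs_subset by blast
  have "real_cost (x(i := s)) - real_cost x \<le> (\<Sum>j\<in>{..<n} - {i}. 2 * g (x i, x j) * (s - x i) + 2 * (e * \<bar>s - x i\<bar>))"
    unfolding real_cost_fun_upd[OF x_configs s i]
  proof (rule sum_mono)
    fix j assume j: "j \<in> {..<n} - {i}"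
    have "\<bar>enn2real (w (s, x j)) - enn2real (w (x i, x j)) - g (x i, x j) * (s - x i)\<bar> \<le> e * \<bar>s - x i\<bar>"
      using j by (intro g configsD[OF x_configs] separated_configsD[OF x i]) auto
    then show "2 * (enn2real (w (s, x j)) - enn2real (w (x i, x j))) \<le> 2 * g (x i, x j) * (s - x i) + 2 * (e * \<bar>s - x i\<bar>)"
      by (simp add: abs_le_iff)
  qed
  also have "\<dots> = (\<Sum>j\<in>{..<n} - {i}. 2 * g (x i, x j)) * (s - x i) + real (n - 1) * (2 * (e * \<bar>s - x i\<bar>))"
    using i by (simp add: sum.distrib sum_distrib_right)
  also have "real (n - 1) * (2 * (e * \<bar>s - x i\<bar>)) \<le> real n * (2 * (e * \<bar>s - x i\<bar>))"
    using e by (intro mult_right_mono) auto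
  finally show ?thesis by (simp add: mult_ac)
qed

lemma contact_supergradient:
  assumes a: "0 < a" and g: "uniform_partial_derivative a g" and u: "dual_feasible u"
    and X: "\<And>t. t \<in> Iper \<Longrightarrow> X t \<in> separated_configs a" "\<And>t. t \<in> Iper \<Longrightarrow> X t 0 = t"
    and contact: "\<And>t. t \<in> Iper \<Longrightarrow> (\<Sum>i<n. u (X t i)) = real_cost (X t)"
  shows "supergradient_on Iper (\<lambda>t. \<Sum>j\<in>{..<n} - {0}. 2 * g (t, X t j)) u"
  unfolding supergradient_on_def
proof (intro allI impI)
  fix e :: real assume e: "0 < e"
  define e' where "e' = e / (2 * real n)"
  have e': "0 < e'" "2 * real n * e' = e" using e n_pos by (auto simp: e'_def)
  obtain d where d: "0 < d" "\<forall>s\<in>Iper. \<forall>t\<in>Iper. \<forall>z\<in>Iper. a \<le> distT (t - z) \<longrightarrow> \<bar>s - t\<bar> < d \<longrightarrow>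
     \<bar>enn2real (w (s, z)) - enn2real (w (t, z)) - g (t, z) * (s - t)\<bar> \<le> e' * \<bar>s - t\<bar>"
    using g e'(1) unfolding uniform_partial_derivative_def by blast
  obtain d' where d': "0 < d'" "\<And>x y. x \<in> separated_configs a \<Longrightarrow> y \<in> configs \<Longrightarrow> (\<And>i. i < n \<Longrightarrow> \<bar>y i - x i\<bar> < d') \<Longrightarrow>
     y \<in> separated_configs (a / 2) \<and> \<bar>real_cost y - real_cost x\<bar> < 1"
    using real_cost_uniformly_continuous[OF a zero_less_one] by blast
  have "u s - u t \<le> (\<Sum>j\<in>{..<n} - {0}. 2 * g (t, X t j)) * (s - t) + e * \<bar>s - t\<bar>"
    if s: "s \<in> Iper" and t: "t \<in> Iper" and st: "\<bar>s - t\<bar> < min d d'" for s t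
  proof -
    have n0: "0 < n" using n_pos by simp
    have "(X t)(0 := s) \<in> configs"
      using configsD[OF subsetD[OF separated_configs_subset X(1)[OF t]]] s by (simp add: configs_def)
    then have "(X t)(0 := s) \<in> separated_configs (a / 2)"
      using d'(2)[OF X(1)[OF t], of "(X t)(0 := s)"] st d'(1) X(2)[OF t] by simp
    then have "(X t)(0 := s) \<in> distinct_configs" using a by (intro separated_configs_distinct[of "a / 2"]) simp_all
    then have "(\<Sum>j<n. u (((X t)(0 := s)) j)) \<le> real_cost ((X t)(0 := s))" by (rule dual_feasibleD[OF u])
    moreover have "(\<Sum>j<n. u (((X t)(0 := s)) j)) = (\<Sum>j<n. u (X t j)) - u t + u s"
      using sum_comp_fun_upd[of "{..<n}" 0 u "X t" s] n0 X(2)[OF t] by simp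
    moreover have "real_cost ((X t)(0 := s)) - real_cost (X t)
      \<le> (\<Sum>j\<in>{..<n} - {0}. 2 * g (X t 0, X t j)) * (s - X t 0) + 2 * real n * e' * \<bar>s - X t 0\<bar>"
      by (rule real_cost_increment_le[OF X(1)[OF t] s n0 less_imp_le[OF e'(1)]]) (use d(2) s t st X(2)[OF t] in auto)
    ultimately show ?thesis using contact[OF t] e'(2) X(2)[OF t] by simp
  qed
  then show "\<exists>d>0. \<forall>s\<in>Iper. \<forall>t\<in>Iper. \<bar>s - t\<bar> < d \<longrightarrow> u s - u t \<le> (\<Sum>j\<in>{..<n} - {0}. 2 * g (t, X t j)) * (s - t) + e * \<bar>s - t\<bar>"
    using d(1) d'(1) by (intro exI[of _ "min d d'"]) auto
qed

lemma exists_common_supergradient: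
  assumes \<rho>: "Dper \<rho>" and C1: "C1_offdiag w"
    and u: "continuous_on Iper u" "kantorovich_pot n w \<rho> u" and v: "continuous_on Iper v" "kantorovich_pot n w \<rho> v"
  obtains p where "supergradient_on Iper p u" "supergradient_on Iper p v"
proof -
  have "\<exists>x. x \<in> distinct_configs \<and> x 0 = t \<and> (\<Sum>i<n. u (x i)) = real_cost x \<and> (\<Sum>i<n. v (x i)) = real_cost x" if "t \<in> Iper" for t
    using exists_common_contact[OF \<rho> u v that] by metis
  then obtain X where X: "\<And>t. t \<in> Iper \<Longrightarrow> X t \<in> distinct_configs" "\<And>t. t \<in> Iper \<Longrightarrow> X t 0 = t"
    and contact: "\<And>t. t \<in> Iper \<Longrightarrow> (\<Sum>i<n. u (X t i)) = real_cost (X t)" "\<And>t. t \<in> Iper \<Longrightarrow> (\<Sum>i<n. v (X t i)) = real_cost (X t)"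
    by metis
  obtain U where U: "\<And>t. t \<in> Iper \<Longrightarrow> \<bar>u t\<bar> \<le> U" using continuous_on_Iper_bounded[OF u(1)] by metis
  obtain a where a: "0 < a" "\<And>x. x \<in> distinct_configs \<Longrightarrow> real_cost x \<le> real n * U \<Longrightarrow> x \<in> separated_configs a"
    using separated_of_real_cost_le by metis
  have separated: "X t \<in> separated_configs a" if t: "t \<in> Iper" for t
  proof (rule a(2)[OF X(1)[OF t]])
    have "(\<Sum>i<n. u (X t i)) \<le> (\<Sum>i<n. U)"
      using U[OF distinct_configsD[OF X(1)[OF t]]] by (intro sum_mono) (auto simp: abs_le_iff)
    then show "real_cost (X t) \<le> real n * U" using contact(1)[OF t] by simp
  qed
  obtain g where g: "uniform_partial_derivative a g" using exists_uniform_partial_derivative[OF C1 a(1)] by metis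
  show ?thesis
    using that contact_supergradient[OF a(1) g kantorovich_potD(1)[OF \<rho> u] separated X(2) contact(1)]
      contact_supergradient[OF a(1) g kantorovich_potD(1)[OF \<rho> v] separated X(2) contact(2)] by blast
qed

lemma regular_potential_unique:
  assumes \<rho>: "Dper \<rho>" and C1: "C1_offdiag w"
    and u: "regular_kantorovich_pot n w \<rho> u" and v: "regular_kantorovich_pot n w \<rho> v" and x: "x \<in> Iper"
  shows "u x = v x"
proof -
  have u: "continuous_on Iper u" "kantorovich_pot n w \<rho> u" and v: "continuous_on Iper v" "kantorovich_pot n w \<rho> v"
    using u v by (auto simp: regular_kantorovich_pot_def)
  obtain p where p: "supergradient_on Iper p u" "supergradient_on Iper p v"
    using exists_common_supergradient[OF \<rho> C1 u v] by metis
  have const: "u a - v a = u b - v b" if "a \<in> Iper" "b \<in> Iper" "a \<le> b" for a b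
  proof -
    have "{a..b} \<subseteq> Iper" using that by (auto simp: Iper_def)
    note sub = supergradient_on_subset[OF p(1) this] supergradient_on_subset[OF p(2) this]
    show ?thesis
      using difference_le_of_common_supergradient[OF sub that(3)] difference_le_of_common_supergradient[OF sub(2,1) that(3)] by linarith
  qed
  have diff: "u s = v s + (u x - v x)" if "s \<in> Iper" for s
  proof (cases "s \<le> x")
    case True
    then show ?thesis using const[OF that x] by simp
  next
    case False
    then show ?thesis using const[OF x that] by simp
  qed
  have i: "integrable Lper (\<lambda>t. \<rho> t * v t)" "integrable Lper \<rho>"
    by (intro integrable_Lper_cont continuous_intros DperD(2)[OF \<rho>] v(1))+
  have "(\<integral>t. \<rho> t * v t \<partial>Lper) = (\<integral>t. \<rho> t * u t \<partial>Lper)" by (rule kantorovich_pot_integral_eq[OF \<rho> v u])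
  also have "\<dots> = (\<integral>t. \<rho> t * v t + (u x - v x) * \<rho> t \<partial>Lper)"
  proof (rule Bochner_Integration.integral_cong[OF refl])
    show "\<rho> t * u t = \<rho> t * v t + (u x - v x) * \<rho> t" if "t \<in> space Lper" for t
      using diff[of t] that by (simp add: distrib_left mult.commute)
  qed
  also have "\<dots> = (\<integral>t. \<rho> t * v t \<partial>Lper) + (u x - v x)" using i DperD(5)[OF \<rho>] by simp
  finally show ?thesis by simp
qed

end

section \<open>Convergence of the normalised potentials\<close>

context cost
begin

definition minimising_potential :: "real \<Rightarrow> (real \<Rightarrow> real) \<Rightarrow> ((real \<Rightarrow> real) \<Rightarrow> real) \<Rightarrow> bool" where
  "minimising_potential \<epsilon> \<rho> v \<longleftrightarrow> Hminus v \<and> (\<forall>\<zeta>. adm \<zeta> \<longrightarrow>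
     enn2ereal (Feps n w \<epsilon> \<rho>) - ereal (real n * v \<rho>) \<le> enn2ereal (Feps n w \<epsilon> \<zeta>) - ereal (real n * v \<zeta>))"

lemma Feps_finite:
  assumes e: "0 < \<epsilon>" and v: "minimising_potential \<epsilon> \<rho> v" shows "Feps n w \<epsilon> \<rho> < top"
proof -
  obtain \<zeta> where \<zeta>: "adm \<zeta>" "Feps n w \<epsilon> \<zeta> < top" using exists_density_Feps_finite e by blast
  obtain q where "Feps n w \<epsilon> \<zeta> = ennreal q" "0 \<le> q" using \<zeta>(2) by (cases "Feps n w \<epsilon> \<zeta>") auto
  then have "enn2ereal (Feps n w \<epsilon> \<rho>) \<noteq> \<infinity>" using v \<zeta>(1) unfolding minimising_potential_def by force
  then show ?thesis by (cases "Feps n w \<epsilon> \<rho>") auto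
qed

text \<open>The additive constant makes \<open>n V(\<rho>)\<close> the energy of \<open>\<rho>\<close>; then \<open>n V\<close> lies below the energy of every
  admissible density.\<close>

definition energy_shift :: "real \<Rightarrow> (real \<Rightarrow> real) \<Rightarrow> ((real \<Rightarrow> real) \<Rightarrow> real) \<Rightarrow> real" where
  "energy_shift \<epsilon> \<rho> v = enn2real (Feps n w \<epsilon> \<rho>) / real n - v \<rho>"

definition normalised_potential :: "real \<Rightarrow> (real \<Rightarrow> real) \<Rightarrow> ((real \<Rightarrow> real) \<Rightarrow> real) \<Rightarrow> (real \<Rightarrow> real) \<Rightarrow> real" where
  "normalised_potential \<epsilon> \<rho> v f = v f + energy_shift \<epsilon> \<rho> v * (\<integral>t. f t \<partial>Lper)"

lemma Hminus_normalised_potential: "minimising_potential \<epsilon> \<rho> v \<Longrightarrow> Hminus (normalised_potential \<epsilon> \<rho> v)"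
  unfolding normalised_potential_def by (rule Hminus_add_integral) (simp add: minimising_potential_def)

lemma normalised_potential_at_density:
  "Dper \<rho> \<Longrightarrow> real n * normalised_potential \<epsilon> \<rho> v \<rho> = enn2real (Feps n w \<epsilon> \<rho>)"
  using DperD(5)[of \<rho>] n_pos by (simp add: normalised_potential_def energy_shift_def)

lemma normalised_potential_nonneg: "Dper \<rho> \<Longrightarrow> 0 \<le> normalised_potential \<epsilon> \<rho> v \<rho>"
  using normalised_potential_at_density[of \<rho> \<epsilon> v] n_pos by (metis enn2real_nonneg zero_le_mult_iff of_nat_0_less_iff less_le_trans zero_less_one not_le)

lemma FOT_le_normalised_potential:
  assumes "0 < \<epsilon>" "minimising_potential \<epsilon> \<rho> v" and \<rho>: "Dper \<rho>"
  shows "FOT n w \<rho> \<le> ennreal (real n * normalised_potential \<epsilon> \<rho> v \<rho>)"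
  using FOT_le_Feps[OF assumption_A DperD(2)[OF \<rho>]] Feps_finite[OF assms(1,2)]
  by (simp add: normalised_potential_at_density[OF \<rho>])

lemma normalised_potential_le:
  assumes e: "0 < \<epsilon>" and v: "minimising_potential \<epsilon> \<rho> v" and \<zeta>: "adm \<zeta>" "Feps n w \<epsilon> \<zeta> \<le> ennreal B" and B: "0 \<le> B"
  shows "real n * normalised_potential \<epsilon> \<rho> v \<zeta> \<le> B"
proof -
  obtain q where q: "Feps n w \<epsilon> \<zeta> = ennreal q" "0 \<le> q" "q \<le> B"
    using \<zeta>(2) B by (cases "Feps n w \<epsilon> \<zeta>") (auto simp: top_unique)
  obtain F where F: "Feps n w \<epsilon> \<rho> = ennreal F" "0 \<le> F"
    using Feps_finite[OF e v] by (cases "Feps n w \<epsilon> \<rho>") auto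
  have "enn2ereal (ennreal F) - ereal (real n * v \<rho>) \<le> enn2ereal (ennreal q) - ereal (real n * v \<zeta>)"
    using v \<zeta>(1) unfolding minimising_potential_def F(1)[symmetric] q(1)[symmetric] by blast
  then have "F - real n * v \<rho> \<le> q - real n * v \<zeta>" using F(2) q(2) by (simp add: enn2ereal_ennreal)
  moreover have "real n * normalised_potential \<epsilon> \<rho> v \<zeta> = real n * v \<zeta> + (F - real n * v \<rho>)"
    using \<zeta>(1) F n_pos by (simp add: adm_def normalised_potential_def energy_shift_def algebra_simps)
  ultimately show ?thesis using q(3) by linarith
qed

lemma slater_bound_normalised_potential:
  assumes e: "0 < \<epsilon>" and v: "minimising_potential \<epsilon> \<rho> v"
  shows "slater_bound \<epsilon> (normalised_potential \<epsilon> \<rho> v)"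
  unfolding slater_bound_def
proof (intro allI impI)
  fix \<phi> \<phi>' S assume system: "orbital_system n \<phi> \<phi>'" and S: "support_cost_le n w \<phi> S"
  interpret orbital_system n \<phi> \<phi>' by (rule system)
  let ?V = "normalised_potential \<epsilon> \<rho> v"
  have "0 \<le> \<epsilon> * slater_kinetic n \<phi>' + S" using e S slater_kinetic_nonneg by (simp add: support_cost_le_def)
  then have "real n * ?V (orbital_density n \<phi>) \<le> \<epsilon> * slater_kinetic n \<phi>' + S"
    using e by (intro normalised_potential_le[OF e v adm_orbital_density Feps_orbital_density_le[OF S]]) auto
  moreover have "H1per (\<lambda>t. (\<phi> j t)\<^sup>2)" if "j < n" for j using C1per_H1per[OF C1per_sq[OF unit_orbitalD(1)[OF unit[OF that]]]] .
  then have "?V (\<lambda>t. \<Sum>j<n. 1 / real n * (\<phi> j t)\<^sup>2) = (\<Sum>j<n. 1 / real n * ?V (\<lambda>t. (\<phi> j t)\<^sup>2))"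
    using H1_linear_sum[OF Hminus_H1_linear[OF Hminus_normalised_potential[OF v]], of "{..<n}" "\<lambda>j t. (\<phi> j t)\<^sup>2" "\<lambda>_. 1 / real n"] by simp
  then have "real n * ?V (orbital_density n \<phi>) = (\<Sum>j<n. ?V (\<lambda>t. (\<phi> j t)\<^sup>2))"
    using n_pos by (simp add: orbital_density_def[abs_def] sum_divide_distrib[symmetric])
  ultimately show "(\<Sum>j<n. ?V (\<lambda>t. (\<phi> j t)\<^sup>2)) \<le> \<epsilon> * slater_kinetic n \<phi>' + S" by simp
qed

lemma normalised_potentials_convergent_subsequence:
  assumes \<rho>: "Dper \<rho>" and e: "\<And>j. 0 < e j" "\<And>j. e j \<le> 1" "e \<longlonglongrightarrow> 0" and v: "\<And>\<epsilon>. 0 < \<epsilon> \<Longrightarrow> minimising_potential \<epsilon> \<rho> (v \<epsilon>)"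
  obtains r u where "strict_mono (r :: nat \<Rightarrow> nat)" "regular_kantorovich_pot n w \<rho> u"
    "\<And>f. H1per f \<Longrightarrow> (\<lambda>j. normalised_potential (e (r j)) \<rho> (v (e (r j))) f) \<longlonglongrightarrow> (\<integral>t. u t * f t \<partial>Lper)"
proof -
  let ?V = "\<lambda>j. normalised_potential (e j) \<rho> (v (e j))"
  note v = v[OF e(1)]
  have admissible: "Hminus (?V j)" "slater_bound (e j) (?V j)" "0 \<le> ?V j \<rho>" for j
    by (rule Hminus_normalised_potential[OF v] slater_bound_normalised_potential[OF e(1) v] normalised_potential_nonneg[OF \<rho>])+
  obtain r V C where r: "strict_mono (r :: nat \<Rightarrow> nat)" and lim: "\<And>f. H1per f \<Longrightarrow> (\<lambda>j. ?V (r j) f) \<longlonglongrightarrow> V f"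
    and V: "H1_functional C V" "slater_bound 0 V"
    using potentials_convergent_subsequence[OF \<rho> e, of ?V, OF admissible] by blast
  interpret limit_potential n w V C by unfold_locales (rule V)+
  note lim_\<rho> = lim[OF DperD(1)[OF \<rho>]]
  have "0 \<le> V \<rho>" by (rule LIMSEQ_le_const[OF lim_\<rho>]) (use normalised_potential_nonneg[OF \<rho>] in blast)
  moreover have "(\<lambda>j. ennreal (real n * ?V (r j) \<rho>)) \<longlonglongrightarrow> ennreal (real n * V \<rho>)"
    by (intro tendsto_ennrealI tendsto_intros lim_\<rho>)
  then have "FOT n w \<rho> \<le> ennreal (real n * V \<rho>)"
    by (rule LIMSEQ_le_const) (use FOT_le_normalised_potential[OF e(1) v \<rho>] in blast)
  ultimately obtain u where u: "regular_kantorovich_pot n w \<rho> u" "\<And>f. H1per f \<Longrightarrow> V f = (\<integral>t. u t * f t \<partial>Lper)"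
    using exists_kantorovich_pot[OF \<rho>] by metis
  then show ?thesis using that[OF r u(1)] lim by simp
qed

end

lemma tendsto_at_right_0_subsequences:
  fixes F :: "real \<Rightarrow> 'a::metric_space"
  assumes sub: "\<And>e::nat \<Rightarrow> real. (\<And>j. 0 < e j) \<Longrightarrow> (\<And>j. e j \<le> 1) \<Longrightarrow> e \<longlonglongrightarrow> 0 \<Longrightarrow>
    \<exists>r. strict_mono (r :: nat \<Rightarrow> nat) \<and> (\<lambda>j. F (e (r j))) \<longlonglongrightarrow> L"
  shows "(F \<longlongrightarrow> L) (at_right 0)"
proof (rule ccontr)
  assume "\<not> ?thesis"
  then obtain d where d: "0 < d" "\<not> (\<forall>\<^sub>F x in at_right 0. dist (F x) L < d)" by (auto simp: tendsto_iff)
  have "\<exists>x. 0 < x \<and> x < inverse (real (Suc k)) \<and> d \<le> dist (F x) L" for k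
    using d(2) unfolding eventually_at_right_field by (metis inverse_positive_iff_positive not_le of_nat_0_less_iff zero_less_Suc)
  then obtain e where e: "\<And>k. 0 < e k" "\<And>k. e k < inverse (real (Suc k))" "\<And>k. d \<le> dist (F (e k)) L" by metis
  have le_1: "e k \<le> 1" for k using less_imp_le[OF e(2)[of k]] inverse_le_1_iff[of "real (Suc k)"] by simp
  have "e \<longlonglongrightarrow> 0"
    by (rule tendsto_sandwich[OF _ _ tendsto_const LIMSEQ_inverse_real_of_nat]) (use e(1,2) in \<open>auto intro!: always_eventually less_imp_le simp del: of_nat_Suc\<close>)
  then obtain r where "(\<lambda>j. F (e (r j))) \<longlonglongrightarrow> L" using sub[of e, OF e(1) le_1] by blast
  then have "\<forall>\<^sub>F j in sequentially. dist (F (e (r j))) L < d" using d(1) by (rule tendstoD)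
  then show False using e(3) by (auto simp: eventually_sequentially not_less[symmetric])
qed

context cost
begin

lemma normalised_potentials_convergent_decreasing:
  assumes \<rho>: "Dper \<rho>" and v: "\<And>\<epsilon>. 0 < \<epsilon> \<Longrightarrow> minimising_potential \<epsilon> \<rho> (v \<epsilon>)"
  obtains e u where "\<And>k. 0 < e k" "\<And>k. e (Suc k) < e k" "e \<longlonglongrightarrow> 0" "regular_kantorovich_pot n w \<rho> u"
    "\<And>f. H1per f \<Longrightarrow> (\<lambda>k. normalised_potential (e k) \<rho> (v (e k)) f) \<longlonglongrightarrow> (\<integral>t. u t * f t \<partial>Lper)"
proof -
  let ?e = "\<lambda>k. inverse (real (Suc k))"
  have "?e k \<le> 1" for k by (simp add: inverse_le_1_iff)
  then obtain r u where r: "strict_mono (r :: nat \<Rightarrow> nat)" and u: "regular_kantorovich_pot n w \<rho> u"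
    "\<And>f. H1per f \<Longrightarrow> (\<lambda>k. normalised_potential (?e (r k)) \<rho> (v (?e (r k))) f) \<longlonglongrightarrow> (\<integral>t. u t * f t \<partial>Lper)"
    using normalised_potentials_convergent_subsequence[OF \<rho> _ _ LIMSEQ_inverse_real_of_nat v] by auto
  show ?thesis
  proof (rule that[of "\<lambda>k. ?e (r k)" u])
    show "?e (r (Suc k)) < ?e (r k)" for k using strict_monoD[OF r, of k "Suc k"] by simp
    show "(\<lambda>k. ?e (r k)) \<longlonglongrightarrow> 0" using LIMSEQ_subseq_LIMSEQ[OF LIMSEQ_inverse_real_of_nat r] by (simp add: o_def)
  qed (use u in auto)
qed

lemma normalised_potentials_tendsto:
  assumes \<rho>: "Dper \<rho>" and C1: "C1_offdiag w" and v: "\<And>\<epsilon>. 0 < \<epsilon> \<Longrightarrow> minimising_potential \<epsilon> \<rho> (v \<epsilon>)"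
    and u: "regular_kantorovich_pot n w \<rho> u" and f: "H1per f"
  shows "((\<lambda>\<epsilon>. normalised_potential \<epsilon> \<rho> (v \<epsilon>) f) \<longlongrightarrow> (\<integral>t. u t * f t \<partial>Lper)) (at_right 0)"
proof (rule tendsto_at_right_0_subsequences)
  fix e :: "nat \<Rightarrow> real" assume e: "\<And>j. 0 < e j" "\<And>j. e j \<le> 1" "e \<longlonglongrightarrow> 0"
  obtain r u' where r: "strict_mono (r :: nat \<Rightarrow> nat)" and u': "regular_kantorovich_pot n w \<rho> u'"
    "\<And>f. H1per f \<Longrightarrow> (\<lambda>j. normalised_potential (e (r j)) \<rho> (v (e (r j))) f) \<longlonglongrightarrow> (\<integral>t. u' t * f t \<partial>Lper)"
    using normalised_potentials_convergent_subsequence[OF \<rho> e v] by blast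
  have "(\<integral>t. u' t * f t \<partial>Lper) = (\<integral>t. u t * f t \<partial>Lper)"
    using regular_potential_unique[OF \<rho> C1 u'(1) u] by (intro Bochner_Integration.integral_cong) auto
  then show "\<exists>r. strict_mono (r :: nat \<Rightarrow> nat) \<and> (\<lambda>j. normalised_potential (e (r j)) \<rho> (v (e (r j))) f) \<longlonglongrightarrow> (\<integral>t. u t * f t \<partial>Lper)"
    using r u'(2)[OF f] by auto
qed

end

theorem theorem2p4:
  fixes n :: nat and w :: "real \<times> real \<Rightarrow> ennreal" and \<rho> :: "real \<Rightarrow> real"
    and v :: "real \<Rightarrow> (real \<Rightarrow> real) \<Rightarrow> real"
  assumes "1 \<le> n"
    and "assumptionA w"
    and "Dper \<rho>"
    and "\<forall>\<epsilon>>0. Hminus (v \<epsilon>) \<and>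
           (\<forall>\<zeta>. adm \<zeta> \<longrightarrow>
              enn2ereal (Feps n w \<epsilon> \<rho>) - ereal (real n * v \<epsilon> \<rho>)
                \<le> enn2ereal (Feps n w \<epsilon> \<zeta>) - ereal (real n * v \<epsilon> \<zeta>))"
  shows "\<exists>(C :: real \<Rightarrow> real) (u :: real \<Rightarrow> real).
           regular_kantorovich_pot n w \<rho> u \<and>
           (\<exists>\<epsilon>s :: nat \<Rightarrow> real. (\<forall>k. 0 < \<epsilon>s k) \<and> (\<forall>k. \<epsilon>s (Suc k) < \<epsilon>s k) \<and> \<epsilon>s \<longlonglongrightarrow> 0 \<and>
              (\<forall>f. H1per f \<longrightarrow>
                 (\<lambda>k. v (\<epsilon>s k) f + C (\<epsilon>s k) * (\<integral>t. f t \<partial>lebesgue_on Iper))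
                   \<longlonglongrightarrow> (\<integral>t. u t * f t \<partial>lebesgue_on Iper))) \<and>
           (C1_offdiag w \<longrightarrow>
              (\<forall>u'. regular_kantorovich_pot n w \<rho> u' \<longrightarrow> (\<forall>x\<in>Iper. u' x = u x)) \<and>
              (\<forall>f. H1per f \<longrightarrow>
                 ((\<lambda>\<epsilon>. v \<epsilon> f + C \<epsilon> * (\<integral>t. f t \<partial>lebesgue_on Iper))
                   \<longlongrightarrow> (\<integral>t. u t * f t \<partial>lebesgue_on Iper)) (at_right 0)))"
proof -
  interpret cost n w by unfold_locales (fact assms)+
  have v: "minimising_potential \<epsilon> \<rho> (v \<epsilon>)" if "0 < \<epsilon>" for \<epsilon>
    using assms(4) that unfolding minimising_potential_def by blast
  obtain \<epsilon>s u where \<epsilon>s: "\<And>k. 0 < \<epsilon>s k" "\<And>k. \<epsilon>s (Suc k) < \<epsilon>s k" "\<epsilon>s \<longlonglongrightarrow> 0"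
    and u: "regular_kantorovich_pot n w \<rho> u"
    and lim: "\<And>f. H1per f \<Longrightarrow> (\<lambda>k. normalised_potential (\<epsilon>s k) \<rho> (v (\<epsilon>s k)) f) \<longlonglongrightarrow> (\<integral>t. u t * f t \<partial>Lper)"
    using normalised_potentials_convergent_decreasing[OF assms(3) v] by blast
  have unique: "\<forall>x\<in>Iper. u' x = u x" if "C1_offdiag w" "regular_kantorovich_pot n w \<rho> u'" for u'
    using regular_potential_unique[OF assms(3) that u] by blast
  have full: "((\<lambda>\<epsilon>. normalised_potential \<epsilon> \<rho> (v \<epsilon>) f) \<longlongrightarrow> (\<integral>t. u t * f t \<partial>Lper)) (at_right 0)"
    if "C1_offdiag w" "H1per f" for f
    using normalised_potentials_tendsto[where v=v, OF assms(3) that(1) v u that(2)] by blast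
  show ?thesis
    by (rule exI[of _ "\<lambda>\<epsilon>. energy_shift \<epsilon> \<rho> (v \<epsilon>)"], rule exI[of _ u])
      (use \<epsilon>s u lim unique full in \<open>unfold normalised_potential_def, blast\<close>)
qed

end
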